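(* Assume Selberg's conjectures (A), (B), (C) stated in the context. Let $F\in\mathcal{S}$. If $F(s)$ has a pole of order $m$ at $s=1$, then $\zeta(s)^m$ divides $F$ in $\mathcal{S}$, i.e. there is $G\in\mathcal{S}$ with $F(s)=\zeta(s)^mG(s)$.
   Context: Write $\sigma=\Re s$, and for a function $\Phi$ put $\overline{\Phi}(s)=\overline{\Phi(\overline{s})}$. $\zeta$ is the Riemann zeta-function. The Selberg class $\mathcal{S}$ is the set of Dirichlet series $F(s)=\sum_{n=1}^{\infty} a_n n^{-s}$ satisfying: (1) Analyticity: $(s-1)^mF(s)$ is (continues to) an entire function of finite order for some non-negative integer $m$. (2) Ramanujan hypothesis: $a_n\ll_\epsilon n^{\epsilon}$ for any fixed $\epsilon>0$. (3) Functional equation: there is a function $\gamma_F(s)=\epsilon Q^s\prod_{i=1}^{k}\Gamma(w_is+\mu_i)$ with $|\epsilon|=1$, $Q>0$, $w_i>0$, $\Re\mu_i\ge 0$ (the product of gamma functions may be empty) such that $\Phi(s)=\gamma_F(s)F(s)$ satisfies $\Phi(s)=\overline{\Phi}(1-s)$. (4) Euler product: $a_1=1$ and $\log F(s)=\sum_{n=1}^{\infty} b_n n^{-s}$ (for $\sigma>1$), where $b_n=0$ unless $n$ is a positive power of a prime, and $b_n\ll n^{\theta}$ for some $\theta<1/2$. $F\in\mathcal{S}$, $F\ne 1$, is primitive if $F=F_1F_2$ with $F_1,F_2\in\mathcal{S}$ implies $F_1=1$ or $F_2=1$. For a primitive Dirichlet character $\chi$, $F^\chi(s)=\sum_{n\ge1}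 a_n\chi(n)n^{-s}$. Sums over $p$ are over primes. Selberg's conjectures: (A) Regularity of distribution: for each $F\in\mathcal{S}$ with coefficients $a_n$ there is an integer $n_F$ such that $\sum_{p\le x}|a_p|^2/p=n_F\log\log x+O(1)$. (B) Orthonormality: if $F$ and $F'$ (with coefficients $a_n$ and $a'_n$) are distinct and primitive, then $n_F=1$ and $\sum_{p\le x}a_p\overline{a'_p}/p=O(1)$. (C) $GL(1)$ twists: if $\chi$ is a primitive Dirichlet character, $F$ and $F^\chi$ are in $\mathcal{S}$, and $F=\prod_{i=1}^kF_i$ with the $F_i$ primitive, then $F^\chi=\prod_{i=1}^kF_i^\chi$ and the $F_i^\chi$ are also primitive elements of $\mathcal{S}$. *)

theory Defs
  imports
    "HOL-Complex_Analysis.Complex_Analysis"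
    "HOL-Number_Theory.Prime_Powers"
    "HOL-Library.Landau_Symbols"
begin

text \<open>
  A Dirichlet series $\sum_{n\ge 1} a_n n^{-s}$ is represented by its coefficient sequence
  \<open>a :: nat \<Rightarrow> complex\<close>.  The index 0 never contributes to the sum
  (because \<open>0 powr _ = 0\<close>); elements of the Selberg class are normalised by \<open>a 0 = 0\<close>, so that
  equality of sequences is equality of Dirichlet series.
\<close>

definition dirichlet_series :: "(nat \<Rightarrow> complex) \<Rightarrow> complex \<Rightarrow> complex" where
  "dirichlet_series a s = (\<Sum>n. a n * of_nat n powr (-s))"

text \<open>
  The meromorphic continuation to the whole plane of the sum of the series on \<open>Re s > 1\<close>.
  It is only meaningful when such a continuation exists; it is then unique, since
  \<open>nicely_meromorphic_on\<close> also fixes the values at poles (to be 0) and at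
  removable singularities.
\<close>

definition Dfun :: "(nat \<Rightarrow> complex) \<Rightarrow> complex \<Rightarrow> complex" where
  "Dfun a = (THE f. f nicely_meromorphic_on UNIV \<and>
                    (\<forall>s. Re s > 1 \<longrightarrow> f s = dirichlet_series a s))"

lemma nicely_meromorphic_unique:
  assumes f: "f nicely_meromorphic_on UNIV" and g: "g nicely_meromorphic_on UNIV"
    and eq: "\<And>s. Re s > 1 \<Longrightarrow> f s = g s"
  shows "f = g"
proof
  fix z
  define h where "h = remove_sings (\<lambda>s. f s - g s)"
  have mero: "(\<lambda>s. f s - g s) meromorphic_on UNIV"
    using f g by (intro meromorphic_intros) (auto simp: nicely_meromorphic_on_def)
  have h: "h nicely_meromorphic_on UNIV"
    unfolding h_def using mero by (rule remove_sings_nicely_meromorphic)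
  have half: "h s = 0" if "Re s > 1" for s
  proof -
    have "eventually (\<lambda>w. w \<in> {w. Re w > 1}) (nhds s)"
      using that by (intro eventually_nhds_in_open) (auto simp: open_halfspace_Re_gt)
    then have "eventually (\<lambda>w. f w - g w = 0) (at s)"
      unfolding eventually_at_filter by eventually_elim (auto simp: eq)
    then have "h s = remove_sings (\<lambda>_. 0) s"
      unfolding h_def by (rule remove_sings_cong) simp
    then show ?thesis by simp
  qed
  have "eventually (\<lambda>w. w \<in> {w. Re w > 1}) (at 2)"
    by (intro eventually_at_in_open') (auto simp: open_halfspace_Re_gt)
  then have "eventually (\<lambda>w. h w = 0) (at 2)"
    by eventually_elim (auto simp: half)
  then have "frequently (\<lambda>w. h w = 0) (at 2)"
    by (rule eventually_frequently[rotated]) simp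
  then have h0: "h w = 0" for w
    by (rule frequently_eq_meromorphic_imp_constant[OF _ h]) auto
  have "eventually (\<lambda>w. h w = f w - g w) (at z)"
    unfolding h_def
    using mero
    by (intro eventually_remove_sings_eq_at meromorphic_on_isolated_singularity)
       (rule meromorphic_on_subset, auto)
  then have ev: "eventually (\<lambda>w. f w = g w) (at z)"
    by eventually_elim (auto simp: h0)
  then have pole: "is_pole f z \<longleftrightarrow> is_pole g z"
    by (intro is_pole_cong) auto
  show "f z = g z"
  proof (cases "is_pole f z")
    case True
    with pole have "\<not> f \<midarrow>z\<rightarrow> f z" "\<not> g \<midarrow>z\<rightarrow> g z"
      by (metis at_neq_bot is_pole_def not_tendsto_and_filterlim_at_infinity)+
    then show ?thesis
      using f g unfolding nicely_meromorphic_on_def by (metis UNIV_I)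
  next
    case False
    then have "f \<midarrow>z\<rightarrow> f z" "g \<midarrow>z\<rightarrow> g z"
      using f g pole unfolding nicely_meromorphic_on_def by auto
    then show ?thesis
      using tendsto_cong[OF ev] by (metis at_neq_bot tendsto_unique)
  qed
qed

lemma Dfun_eqI:
  assumes "f nicely_meromorphic_on UNIV" "\<And>s. Re s > 1 \<Longrightarrow> f s = dirichlet_series a s"
  shows "Dfun a = f"
  unfolding Dfun_def
  by (rule the_equality) (use assms in \<open>auto intro: nicely_meromorphic_unique\<close>)

definition one_series :: "nat \<Rightarrow> complex" where
  "one_series n = (if n = 1 then 1 else 0)"

definition zeta_series :: "nat \<Rightarrow> complex" where
  "zeta_series n = (if n = 0 then 0 else 1)"

definition zeta :: "complex \<Rightarrow> complex" where
  "zeta = Dfun zeta_series"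


section \<open>The Selberg class\<close>

definition finite_order :: "(complex \<Rightarrow> complex) \<Rightarrow> bool" where
  "finite_order g \<longleftrightarrow>
     (\<exists>r::real. (\<lambda>s. norm (g s)) \<in> O[at_infinity](\<lambda>s. exp (norm s powr r)))"

definition selberg_analytic :: "(nat \<Rightarrow> complex) \<Rightarrow> bool" where
  "selberg_analytic a \<longleftrightarrow>
     (\<exists>(m::nat) g. g holomorphic_on UNIV \<and> finite_order g \<and>
        (\<forall>s. Re s > 1 \<longrightarrow> g s = (s - 1) ^ m * dirichlet_series a s))"

definition ramanujan :: "(nat \<Rightarrow> complex) \<Rightarrow> bool" where
  "ramanujan a \<longleftrightarrow> (\<forall>\<epsilon>>0. (\<lambda>n. norm (a n)) \<in> O(\<lambda>n. real n powr \<epsilon>))"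

definition cnj_fun :: "(complex \<Rightarrow> complex) \<Rightarrow> complex \<Rightarrow> complex" where
  "cnj_fun \<Phi> s = cnj (\<Phi> (cnj s))"

definition gamma_factor ::
  "complex \<Rightarrow> real \<Rightarrow> nat \<Rightarrow> (nat \<Rightarrow> real) \<Rightarrow> (nat \<Rightarrow> complex) \<Rightarrow> complex \<Rightarrow> complex" where
  "gamma_factor \<epsilon> Q k w \<mu> s =
     \<epsilon> * of_real Q powr s * (\<Prod>i<k. Gamma (of_real (w i) * s + \<mu> i))"

text \<open>
  The functional equation is an identity of meromorphic functions, hence is required off a
  set without accumulation points: at poles, HOL assigns the conventional value 0 to \<open>Gamma\<close>
  and \<open>Dfun a\<close>.
\<close>

definition functional_equation :: "(nat \<Rightarrow> complex) \<Rightarrow> bool" where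
  "functional_equation a \<longleftrightarrow>
     (\<exists>\<epsilon> Q k w \<mu>. norm \<epsilon> = 1 \<and> Q > 0 \<and> (\<forall>i<k. w i > 0 \<and> Re (\<mu> i) \<ge> 0) \<and>
        (let \<Phi> = (\<lambda>s. gamma_factor \<epsilon> Q k w \<mu> s * Dfun a s)
         in \<forall>\<^sub>\<approx>s\<in>UNIV. \<Phi> s = cnj_fun \<Phi> (1 - s)))"

text \<open>
  $\log F$ is the branch on \<open>Re s > 1\<close> tending to 0 as \<open>Re s\<close> tends to infinity
  (recall \<open>a 1 = 1\<close>), not the principal logarithm of the value.  Since \<open>b 1 = 0\<close>, the
  series over \<open>b\<close> is that branch precisely when its exponential is the series over \<open>a\<close>.
\<close>

definition euler_product :: "(nat \<Rightarrow> complex) \<Rightarrow> bool" where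
  "euler_product a \<longleftrightarrow> a 1 = 1 \<and>
     (\<exists>b \<theta>. \<theta> < 1/2 \<and>
        (\<forall>n. \<not> primepow n \<longrightarrow> b n = 0) \<and>
        (\<lambda>n. norm (b n)) \<in> O(\<lambda>n. real n powr \<theta>) \<and>
        (\<forall>s. Re s > 1 \<longrightarrow> summable (\<lambda>n. b n * of_nat n powr (-s)) \<and>
                          exp (dirichlet_series b s) = dirichlet_series a s))"

definition selberg_class :: "(nat \<Rightarrow> complex) set" where
  "selberg_class = {a. a 0 = 0 \<and> selberg_analytic a \<and> ramanujan a \<and>
                       functional_equation a \<and> euler_product a}"

definition primitive_elem :: "(nat \<Rightarrow> complex) \<Rightarrow> bool" where
  "primitive_elem a \<longleftrightarrow> a \<in> selberg_class \<and> a \<noteq> one_series \<and>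
     (\<forall>b\<in>selberg_class. \<forall>c\<in>selberg_class.
        (\<forall>s. Re s > 1 \<longrightarrow> dirichlet_series a s = dirichlet_series b s * dirichlet_series c s) \<longrightarrow>
        b = one_series \<or> c = one_series)"


section \<open>Dirichlet characters\<close>

definition dirichlet_character :: "nat \<Rightarrow> (nat \<Rightarrow> complex) \<Rightarrow> bool" where
  "dirichlet_character q \<xi> \<longleftrightarrow> q > 0 \<and> \<xi> 1 = 1 \<and>
     (\<forall>m n. \<xi> (m * n) = \<xi> m * \<xi> n) \<and>
     (\<forall>n. \<xi> (n + q) = \<xi> n) \<and>
     (\<forall>n. \<xi> n = 0 \<longleftrightarrow> \<not> coprime n q)"

text \<open>Primitive: not induced by a character of a smaller modulus dividing \<open>q\<close>.\<close>

definition primitive_character :: "nat \<Rightarrow> (nat \<Rightarrow> complex) \<Rightarrow> bool" where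
  "primitive_character q \<xi> \<longleftrightarrow> dirichlet_character q \<xi> \<and>
     \<not> (\<exists>d \<psi>. d dvd q \<and> d < q \<and> dirichlet_character d \<psi> \<and>
              (\<forall>n. coprime n q \<longrightarrow> \<xi> n = \<psi> n))"

definition twist :: "(nat \<Rightarrow> complex) \<Rightarrow> (nat \<Rightarrow> complex) \<Rightarrow> nat \<Rightarrow> complex" where
  "twist a \<xi> n = a n * \<xi> n"


section \<open>Selberg's conjectures\<close>

text \<open>
  \<open>selberg_number a n\<close> says that $n_F = n$ for the series $F$ with coefficients \<open>a\<close>; such an \<open>n\<close>
  is unique as $\log\log x$ is unbounded.
\<close>

definition selberg_number :: "(nat \<Rightarrow> complex) \<Rightarrow> int \<Rightarrow> bool" where
  "selberg_number a n \<longleftrightarrow>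
     (\<lambda>x::real. (\<Sum>p | prime p \<and> real p \<le> x. (norm (a p))\<^sup>2 / real p) - of_int n * ln (ln x))
       \<in> O[at_top](\<lambda>_. 1)"

definition selberg_conjecture_A :: bool where
  "selberg_conjecture_A \<longleftrightarrow> (\<forall>a\<in>selberg_class. \<exists>n. selberg_number a n)"

definition selberg_conjecture_B :: bool where
  "selberg_conjecture_B \<longleftrightarrow>
     (\<forall>a a'. primitive_elem a \<and> primitive_elem a' \<and> a \<noteq> a' \<longrightarrow>
        selberg_number a 1 \<and>
        (\<lambda>x::real. \<Sum>p | prime p \<and> real p \<le> x. a p * cnj (a' p) / of_nat p)
          \<in> O[at_top](\<lambda>_. 1))"

definition selberg_conjecture_C :: bool where
  "selberg_conjecture_C \<longleftrightarrow>
     (\<forall>q \<xi> a (k::nat) f.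
        primitive_character q \<xi> \<and> a \<in> selberg_class \<and> twist a \<xi> \<in> selberg_class \<and>
        (\<forall>i<k. primitive_elem (f i)) \<and>
        (\<forall>s. Re s > 1 \<longrightarrow> dirichlet_series a s = (\<Prod>i<k. dirichlet_series (f i) s)) \<longrightarrow>
        (\<forall>s. Re s > 1 \<longrightarrow>
           dirichlet_series (twist a \<xi>) s = (\<Prod>i<k. dirichlet_series (twist (f i) \<xi>) s)) \<and>
        (\<forall>i<k. primitive_elem (twist (f i) \<xi>)))"

end

theory Submission
  imports Defs "HOL-Real_Asymp.Real_Asymp"
begin

text \<open>
  Let \<open>W = (\<Sum>i<k. w i)\<close> be half the degree. By Stirling it can be read off from the growth of
  \<open>F\<close> on \<open>Re s = -1\<close>, so it is additive, and it vanishes or is at least \<open>1/7\<close>: otherwise the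
  integral of \<open>F\<close> over a suitable piece of the line \<open>Re s = -1\<close>, estimated through the functional
  equation by partial integration, would be smaller than the mean value \<open>1\<close> of \<open>F\<close> on \<open>Re s = 2\<close>
  permits. As \<open>W = 0\<close> forces \<open>F = 1\<close>, every \<open>F\<close> is a finite product of primitive elements.

  By the Euler product, \<open>ln |F \<sigma>|\<close> differs from the real part of the sum of
  \<open>a p * p powr -\<sigma>\<close> over the primes by a bounded amount as \<open>\<sigma>\<close> tends to \<open>1\<close> from the right, so
  this sum determines the order of \<open>F\<close> at \<open>1\<close>. Conjectures A and B for the primitive factors of
  \<open>\<zeta>\<close> imply that all of them have a pole if there are two different ones, which the simple pole
  of \<open>\<zeta>\<close> excludes; hence \<open>\<zeta>\<close> is primitive. By B, every other primitive factor of \<open>F\<close>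
  then has order \<open>0\<close> at \<open>1\<close>, and the pole of \<open>F\<close> comes from factors \<open>\<zeta>\<close>.
\<close>

section \<open>Dirichlet series\<close>

text \<open>The quotient of F by a power of \<zeta> is not visibly holomorphic, as \<zeta> has
  zeros, nor visibly subject to the Ramanujan bound, so it cannot be placed in the class directly.
  This is why a factorization is sought: the cofactor is the product of the remaining primitive
  factors and lies in the class by closure under products.

  The constant 1/7 balances powers of T: the bound T powr (5 * W) falls below H, of order T powr (1
  - 2 * W), exactly if W < 1/7. Any positive lower bound makes the factorization stop. The lines Re
  s = -1 and Re s = 2 are exchanged by the functional equation, and on the second one the series of
  F and of log F converge absolutely.

  The conjectures speak of sums over p \<le> x, the order at 1 of sums for \<sigma> near 1. The term
  ln (ln x) is never carried over: an integral combination with the coefficients of \<zeta> cancels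
  it, and only bounded sums pass through partial summation.

  All this presupposes that \<zeta> is in the class. Its continuation, functional equation and
  finite order come from two evaluations of one Mellin integral.\<close>

definition abs_conv :: "(nat \<Rightarrow> complex) \<Rightarrow> real \<Rightarrow> bool" where
  "abs_conv a \<sigma> \<longleftrightarrow> summable (\<lambda>n. norm (a n) * real n powr (-\<sigma>))"

text \<open>At index 0 every number is a divisor and the divisor sum has no meaning; the value 0 is
  the normalisation of \<open>selberg_class\<close>.\<close>

definition dconv :: "(nat \<Rightarrow> complex) \<Rightarrow> (nat \<Rightarrow> complex) \<Rightarrow> nat \<Rightarrow> complex" where
  "dconv a b n = (if n = 0 then 0 else \<Sum>d | d dvd n. a d * b (n div d))"

lemma norm_dirichlet_term:
  "norm (a n * of_nat n powr (-s)) = norm (a n) * real n powr (- Re s)"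
  by (cases "n = 0") (auto simp: norm_mult norm_powr_real_powr)

lemma abs_conv_mono:
  assumes "abs_conv a \<sigma>" "\<sigma> \<le> \<sigma>'"
  shows "abs_conv a \<sigma>'"
  unfolding abs_conv_def
proof (rule summable_comparison_test'[where N=1])
  show "summable (\<lambda>n. norm (a n) * real n powr (-\<sigma>))"
    using assms by (simp add: abs_conv_def)
  fix n :: nat assume "n \<ge> 1"
  then have "real n powr (-\<sigma>') \<le> real n powr (-\<sigma>)"
    using assms by (intro powr_mono) auto
  then show "norm (norm (a n) * real n powr (-\<sigma>')) \<le> norm (a n) * real n powr (-\<sigma>)"
    by (simp add: mult_left_mono)
qed

lemma abs_conv_norm_summable:
  assumes "abs_conv a \<sigma>" "\<sigma> \<le> Re s"
  shows "summable (\<lambda>n. norm (a n * of_nat n powr (-s)))"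
  using abs_conv_mono[OF assms] by (simp only: norm_dirichlet_term abs_conv_def)

lemma abs_conv_sums:
  assumes "abs_conv a \<sigma>" "\<sigma> \<le> Re s"
  shows "(\<lambda>n. a n * of_nat n powr (-s)) sums dirichlet_series a s"
  unfolding dirichlet_series_def
  by (intro summable_sums summable_norm_cancel[OF abs_conv_norm_summable[OF assms]])

lemma abs_conv_bigo:
  assumes "(\<lambda>n. norm (a n)) \<in> O(\<lambda>n. real n powr \<theta>)" "\<sigma> > 1 + \<theta>"
  shows "abs_conv a \<sigma>"
  unfolding abs_conv_def
proof (rule summable_comparison_test_bigo)
  show "summable (\<lambda>n. norm (real n powr (\<theta> - \<sigma>)))"
    using assms by (simp add: summable_real_powr_iff)
  have "(\<lambda>n. norm (a n) * real n powr (-\<sigma>)) \<in> O(\<lambda>n. real n powr \<theta> * real n powr (-\<sigma>))"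
    by (intro landau_o.big.mult assms) auto
  then show "(\<lambda>n. norm (a n) * real n powr (-\<sigma>)) \<in> O(\<lambda>n. real n powr (\<theta> - \<sigma>))"
    by (simp add: powr_add[symmetric])
qed

lemma ramanujan_abs_conv:
  assumes "ramanujan a" "\<sigma> > 1"
  shows "abs_conv a \<sigma>"
  using assms by (intro abs_conv_bigo[where \<theta> = "(\<sigma> - 1)/2"]) (auto simp: ramanujan_def field_simps)

lemma norm_dirichlet_series_le:
  assumes "abs_conv a \<sigma>" "\<sigma> \<le> Re s"
  shows "norm (dirichlet_series a s) \<le> (\<Sum>n. norm (a n) * real n powr (-\<sigma>))"
proof -
  have "norm (dirichlet_series a s) \<le> (\<Sum>n. norm (a n * of_nat n powr (-s)))"
    unfolding dirichlet_series_def by (rule summable_norm[OF abs_conv_norm_summable[OF assms]])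
  also have "\<dots> \<le> (\<Sum>n. norm (a n) * real n powr (-\<sigma>))"
  proof (rule suminf_le)
    fix n
    have "real n powr (- Re s) \<le> real n powr (-\<sigma>)"
      using assms by (cases "n = 0") (auto intro: powr_mono)
    then show "norm (a n * of_nat n powr (-s)) \<le> norm (a n) * real n powr (-\<sigma>)"
      by (simp only: norm_dirichlet_term mult_left_mono norm_ge_zero)
  qed (use assms abs_conv_norm_summable[OF assms] in \<open>auto simp: abs_conv_def\<close>)
  finally show ?thesis .
qed

lemma dirichlet_series_has_field_derivative:
  assumes "abs_conv a \<sigma>" "\<sigma> < Re s"
  shows "(dirichlet_series a has_field_derivative dirichlet_series (\<lambda>n. - a n * of_real (ln (real n))) s) (at s)"
proof -
  let ?S = "{s. \<sigma> < Re s}"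
  have der: "((\<lambda>s. a n * of_nat n powr (-s)) has_field_derivative
      - a n * of_real (ln (real n)) * of_nat n powr (-x)) (at x)" for n x
    by (cases "n = 0") (auto simp: powr_def Ln_of_nat intro!: derivative_eq_intros)
  obtain g g' where g: "\<forall>x\<in>?S. ((\<lambda>n. a n * of_nat n powr (-x)) sums g x) \<and>
      ((\<lambda>n. - a n * of_real (ln (real n)) * of_nat n powr (-x)) sums g' x) \<and>
      (g has_field_derivative g' x) (at x)"
  proof (rule series_and_derivative_comparison[of ?S "\<lambda>n. norm (a n) * real n powr (-\<sigma>)"
        "\<lambda>n s. a n * of_nat n powr (-s)"])
    show "\<forall>\<^sub>F n in sequentially. \<forall>x\<in>?S. norm (a n * of_nat n powr (-x)) \<le> norm (a n) * real n powr (-\<sigma>)"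
      using eventually_gt_at_top[of 0]
      by eventually_elim (auto simp: norm_dirichlet_term simp del: norm_mult intro!: mult_left_mono powr_mono)
  qed (use assms der in \<open>auto simp: abs_conv_def open_halfspace_Re_gt\<close>)
  have eq: "g x = dirichlet_series a x" "g' x = dirichlet_series (\<lambda>n. - a n * of_real (ln (real n))) x"
    if "x \<in> ?S" for x
    using g that by (auto simp: dirichlet_series_def sums_iff)
  have "(g has_field_derivative dirichlet_series (\<lambda>n. - a n * of_real (ln (real n))) s) (at s)"
    using g eq assms by auto
  then show ?thesis
    using assms eq by (elim has_field_derivative_transform_within_open[of _ _ _ ?S])
      (auto simp: open_halfspace_Re_gt)
qed

lemma dirichlet_series_holomorphic:
  assumes "abs_conv a \<sigma>"
  shows "dirichlet_series a holomorphic_on {s. Re s > \<sigma>}"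
  unfolding holomorphic_on_def field_differentiable_def
  using dirichlet_series_has_field_derivative[OF assms] has_field_derivative_at_within by blast

text \<open>With \<delta> = \<sigma>' - \<sigma> one has \<delta> * ln n \<le> n powr \<delta>, so
  the gap between the abscissas pays for the logarithm.\<close>

lemma abs_conv_mult_ln:
  assumes "abs_conv a \<sigma>" "\<sigma> < \<sigma>'"
  shows "abs_conv (\<lambda>n. a n * of_real (ln (real n))) \<sigma>'"
  unfolding abs_conv_def
proof (rule summable_comparison_test')
  show "summable (\<lambda>n. (1 / (\<sigma>' - \<sigma>)) * (norm (a n) * real n powr (-\<sigma>)))"
    using assms by (intro summable_mult) (simp add: abs_conv_def)
  fix n :: nat assume "n \<ge> 1"
  then have "(\<sigma>' - \<sigma>) * ln (real n) \<le> real n powr (\<sigma>' - \<sigma>)"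
    using ln_le_minus_one[of "real n powr (\<sigma>' - \<sigma>)"] by (simp add: ln_powr)
  then have "ln (real n) \<le> 1 / (\<sigma>' - \<sigma>) * real n powr (\<sigma>' - \<sigma>)"
    using assms by (simp add: field_simps)
  then have "norm (a n) * ln (real n) * real n powr (-\<sigma>') \<le>
      norm (a n) * (1 / (\<sigma>' - \<sigma>) * real n powr (\<sigma>' - \<sigma>)) * real n powr (-\<sigma>')"
    by (intro mult_right_mono mult_left_mono) auto
  also have "\<dots> = (1 / (\<sigma>' - \<sigma>)) * (norm (a n) * real n powr (-\<sigma>))"
    by (simp add: powr_diff powr_minus field_simps)
  finally show "norm (norm (a n * of_real (ln (real n))) * real n powr (-\<sigma>')) \<le>
      (1 / (\<sigma>' - \<sigma>)) * (norm (a n) * real n powr (-\<sigma>))"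
    using \<open>n \<ge> 1\<close> by (simp add: norm_mult)
qed

text \<open>Both claims come from the absolutely convergent double family of products, regrouped by
  the product n of the two indices; each group is the finite divisor sum at n.\<close>

lemma dirichlet_series_product:
  assumes a: "abs_conv a (Re s)" and b: "abs_conv b (Re s)"
  shows "dirichlet_series a s * dirichlet_series b s = dirichlet_series (dconv a b) s"
    and "abs_conv (dconv a b) (Re s)"
proof -
  define f where "f n = a n * of_nat n powr (-s)" for n
  define g where "g n = b n * of_nat n powr (-s)" for n
  have f0: "f 0 = 0" "g 0 = 0" by (auto simp: f_def g_def)
  have fs: "(\<lambda>n. norm (f n)) summable_on UNIV" "(\<lambda>n. norm (g n)) summable_on UNIV"
    using abs_conv_norm_summable[OF a order.refl] abs_conv_norm_summable[OF b order.refl]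
    by (auto simp: f_def g_def summable_on_UNIV_nonneg_real_iff simp del: norm_mult)
  have "(\<lambda>p. norm (f (fst p)) * norm (g (snd p))) summable_on (UNIV \<times> UNIV)"
    by (rule summable_on_SigmaI[where g = "\<lambda>x. norm (f x) * infsum (\<lambda>y. norm (g y)) UNIV"])
       (auto intro!: has_sum_cmult_right summable_on_cmult_left fs has_sum_infsum)
  then have abs: "(\<lambda>p. norm (f (fst p) * g (snd p))) summable_on (UNIV \<times> UNIV)"
    by (simp add: norm_mult)
  then have prod: "(\<lambda>p. f (fst p) * g (snd p)) summable_on (UNIV \<times> UNIV)"
    by (rule abs_summable_summable)
  \<comment> \<open>Pairs (d, e) of positive integers are recoded as (d * e, d). The reindexing
    \<open>bij\<close> is stated for arbitrary normed values because it serves the complex terms and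
    their norms.\<close>
  define D where "D = (SIGMA n:{0::nat<..}. {d. d dvd n})"
  have bij: "((\<lambda>q. h (snd q) (fst q div snd q)) has_sum S) D \<longleftrightarrow>
      ((\<lambda>p. h (fst p) (snd p)) has_sum S) ({0<..} \<times> {0<..})" for h :: "nat \<Rightarrow> nat \<Rightarrow> 'b::real_normed_vector" and S
    by (rule has_sum_reindex_bij_witness[where i = "\<lambda>p. (fst p * snd p, fst p)" and j = "\<lambda>q. (snd q,
        fst q div snd q)"])
       (auto simp: D_def elim!: dvdE)
  have sumf: "(f has_sum dirichlet_series a s) UNIV" and sumg: "(g has_sum dirichlet_series b s) UNIV"
    unfolding f_def g_def
    by (intro norm_summable_imp_has_sum abs_conv_norm_summable[OF a order.refl] abs_conv_sums[OF a order.refl]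
         abs_conv_norm_summable[OF b order.refl] abs_conv_sums[OF b order.refl])+
  have tot: "((\<lambda>p. f (fst p) * g (snd p)) has_sum (dirichlet_series a s * dirichlet_series b s)) (UNIV \<times> UNIV)"
    by (rule has_sum_SigmaI[where g = "\<lambda>x. f x * dirichlet_series b s"])
       (use prod in \<open>auto intro!: has_sum_cmult_right has_sum_cmult_left sumf sumg\<close>)
  then have "((\<lambda>p. f (fst p) * g (snd p)) has_sum (dirichlet_series a s * dirichlet_series b s)) ({0<..} \<times> {0<..})"
    by (rule has_sum_cong_neutral[THEN iffD1, rotated -1]) (auto simp: f0 intro!: gr0I)
  then have totD: "((\<lambda>q. f (snd q) * g (fst q div snd q)) has_sum (dirichlet_series a s * dirichlet_series b s)) D"
    by (subst bij[of "\<lambda>x y. f x * g y"])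
  have inner: "(\<Sum>d | d dvd n. f d * g (n div d)) = dconv a b n * of_nat n powr (-s)" if "n > 0" for n
  proof -
    have "f d * g (n div d) = a d * b (n div d) * of_nat n powr (-s)" if "d dvd n" for d
    proof -
      from that obtain e where e: "n = d * e" by auto
      have "of_nat d powr (-s) * of_nat e powr (-s) = (of_nat n powr (-s) :: complex)"
        unfolding e of_nat_mult by (subst powr_times_real) auto
      then show ?thesis using e \<open>n > 0\<close> by (auto simp: f_def g_def)
    qed
    then show ?thesis using that by (simp add: dconv_def sum_distrib_right)
  qed
  have "((\<lambda>n. \<Sum>d | d dvd n. f d * g (n div d)) has_sum (dirichlet_series a s * dirichlet_series b s)) {0<..}"
    using totD unfolding D_def by (rule has_sum_SigmaD) (auto intro!: has_sum_finite)
  then have "((\<lambda>n. dconv a b n * of_nat n powr (-s)) has_sum (dirichlet_series a s * dirichlet_series b s)) {0<..}"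
    by (rule has_sum_cong[THEN iffD1, rotated]) (use inner in auto)
  then have "((\<lambda>n. dconv a b n * of_nat n powr (-s)) has_sum (dirichlet_series a s * dirichlet_series b s)) UNIV"
    by (rule has_sum_cong_neutral[THEN iffD1, rotated -1]) (auto simp: dconv_def)
  from has_sum_imp_sums[OF this] show "dirichlet_series a s * dirichlet_series b s =
      dirichlet_series (dconv a b) s"
    by (simp add: dirichlet_series_def sums_iff)
  have "(\<lambda>p. norm (f (fst p) * g (snd p))) summable_on ({0<..} \<times> {0<..})"
    using abs by (rule summable_on_subset_banach) auto
  then have "(\<lambda>p. norm (f (fst p)) * norm (g (snd p))) summable_on ({0<..} \<times> {0<..})"
    by (simp only: norm_mult)
  then obtain S where "((\<lambda>q. norm (f (snd q)) * norm (g (fst q div snd q))) has_sum S) D"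
    using bij[of "\<lambda>x y. norm (f x) * norm (g y)"] by (auto simp: summable_on_def)
  then have "((\<lambda>n. \<Sum>d | d dvd n. norm (f d) * norm (g (n div d))) has_sum S) {0<..}"
    unfolding D_def by (rule has_sum_SigmaD) (auto intro!: has_sum_finite)
  then have "(\<lambda>n. \<Sum>d | d dvd n. norm (f d) * norm (g (n div d))) summable_on {0<..}"
    by (rule has_sum_imp_summable)
  then have "(\<lambda>n. norm (dconv a b n * of_nat n powr (-s))) summable_on {0<..}"
  proof (rule summable_on_comparison_test)
    fix n :: nat assume "n \<in> {0<..}"
    then show "norm (dconv a b n * of_nat n powr (-s)) \<le> (\<Sum>d | d dvd n. norm (f d) * norm (g (n div d)))"
      by (subst inner[symmetric]) (auto intro!: sum_norm_le simp: norm_mult)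
  qed auto
  then have "(\<lambda>n. norm (dconv a b n * of_nat n powr (-s))) summable_on UNIV"
    by (rule summable_on_cong_neutral[THEN iffD1, rotated -1]) (auto simp: dconv_def)
  then show "abs_conv (dconv a b) (Re s)"
    unfolding abs_conv_def norm_dirichlet_term by (rule summable_on_imp_summable)
qed

text \<open>By induction all earlier coefficients vanish, so the term at m equals minus the tail. At
  \<sigma> = \<alpha> + k the tail is at most a constant times (m + 1) powr (-k); multiplying by m
  powr \<sigma> leaves a factor (m / (m + 1)) ^ k, which tends to 0.\<close>

lemma dirichlet_series_eq_0_imp:
  assumes abs: "abs_conv a \<alpha>" and zero: "\<And>\<sigma>. \<sigma> \<ge> \<alpha> \<Longrightarrow> dirichlet_series a (of_real \<sigma>) = 0"
    and "n > 0"
  shows "a n = 0"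
  using \<open>n > 0\<close>
proof (induction n rule: less_induct)
  case (less m)
  define C where "C = (\<Sum>n. norm (a n) * real n powr (-\<alpha>))"
  define q where "q = real m / real (Suc m)"
  have q: "0 < q" "q < 1" using less.prems by (auto simp: q_def)
  have bound: "norm (a m) \<le> real m powr \<alpha> * C * q ^ k" for k
  proof -
    define \<sigma> where "\<sigma> = \<alpha> + real k"
    define u where "u n = a n * of_nat n powr (- of_real \<sigma>)" for n
    have abs': "abs_conv a (Re (of_real \<sigma>))"
      using abs_conv_mono[OF abs, of \<sigma>] by (simp add: \<sigma>_def)
    have su: "summable (\<lambda>n. norm (u n))"
      unfolding u_def by (rule abs_conv_norm_summable[OF abs']) simp
    have nu: "norm (u n) = norm (a n) * real n powr (-\<sigma>)" for n
      unfolding u_def norm_dirichlet_term by simp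
    have "u sums 0"
      using abs_conv_sums[OF abs' order.refl] zero[of \<sigma>] unfolding u_def by (simp add: \<sigma>_def)
    moreover have "(\<Sum>n<Suc m. u n) = u m"
    proof -
      have "(\<Sum>n<m. u n) = 0"
      proof (rule sum.neutral, safe)
        fix n assume "n < m"
        then show "u n = 0" using less.IH[of n] by (cases "n = 0") (auto simp: u_def)
      qed
      then show ?thesis by simp
    qed
    ultimately have "(\<lambda>n. u (n + Suc m)) sums (- u m)"
      using sums_split_initial_segment[of u 0 "Suc m"] by simp
    then have "norm (u m) = norm (\<Sum>n. u (n + Suc m))" by (simp add: sums_iff)
    also have "\<dots> \<le> (\<Sum>n. norm (u (n + Suc m)))"
      by (intro summable_norm summable_ignore_initial_segment[OF su])
    also have "\<dots> \<le> (\<Sum>n. real (Suc m) powr (- real k) * (norm (a (n + Suc m)) * real (n + Suc m) powr (-\<alpha>)))"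
    proof (rule suminf_le)
      fix n
      have "real (n + Suc m) powr (-\<sigma>) = real (n + Suc m) powr (-\<alpha>) * real (n + Suc m) powr (- real k)"
        by (simp add: \<sigma>_def powr_add[symmetric])
      also have "\<dots> \<le> real (n + Suc m) powr (-\<alpha>) * real (Suc m) powr (- real k)"
        by (intro mult_left_mono powr_mono2') auto
      finally show "norm (u (n + Suc m)) \<le> real (Suc m) powr (- real k) * (norm (a (n + Suc m)) * real (n +
          Suc m) powr (-\<alpha>))"
        unfolding nu by (simp add: mult_left_mono mult_ac)
    next
      show "summable (\<lambda>n. norm (u (n + Suc m)))"
        by (rule summable_ignore_initial_segment[OF su])
      show "summable (\<lambda>n. real (Suc m) powr (- real k) * (norm (a (n + Suc m)) * real (n + Suc m) powr (-\<alpha>)))"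
        using abs unfolding abs_conv_def by (intro summable_mult summable_ignore_initial_segment)
    qed
    also have "\<dots> = real (Suc m) powr (- real k) * (\<Sum>n. norm (a (n + Suc m)) * real (n + Suc m) powr (-\<alpha>))"
      using abs unfolding abs_conv_def by (intro suminf_mult summable_ignore_initial_segment)
    also have "\<dots> \<le> real (Suc m) powr (- real k) * C"
    proof (rule mult_left_mono)
      have "(\<Sum>n. norm (a (n + Suc m)) * real (n + Suc m) powr (-\<alpha>)) =
          C - (\<Sum>n<Suc m. norm (a n) * real n powr (-\<alpha>))"
        unfolding C_def using abs unfolding abs_conv_def by (rule suminf_minus_initial_segment)
      also have "\<dots> \<le> C" by (simp add: sum_nonneg del: sum.lessThan_Suc)
      finally show "(\<Sum>n. norm (a (n + Suc m)) * real (n + Suc m) powr (-\<alpha>)) \<le> C" .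
    qed auto
    finally have "norm (a m) * real m powr (-\<sigma>) \<le> real (Suc m) powr (- real k) * C"
      by (simp add: nu)
    then have "norm (a m) * real m powr (-\<sigma>) * real m powr \<sigma> \<le> real (Suc m) powr (- real k) * C * real m powr \<sigma>"
      by (rule mult_right_mono) auto
    then have "norm (a m) \<le> real (Suc m) powr (- real k) * C * real m powr \<sigma>"
      using less.prems by (simp add: powr_minus field_simps)
    moreover have "real m powr \<sigma> = real m powr \<alpha> * real m ^ k"
      using less.prems by (simp add: \<sigma>_def powr_add powr_realpow)
    moreover have "real (Suc m) powr (- real k) = 1 / real (Suc m) ^ k"
      by (simp add: powr_minus powr_realpow field_simps del: of_nat_Suc)
    ultimately show ?thesis
      by (simp add: q_def power_divide mult_ac del: of_nat_Suc)
  qed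
  have "(\<lambda>k. real m powr \<alpha> * C * q ^ k) \<longlonglongrightarrow> real m powr \<alpha> * C * 0"
    using q by (intro tendsto_intros LIMSEQ_power_zero) auto
  then have "norm (a m) \<le> real m powr \<alpha> * C * 0"
    by (rule Lim_bounded2[where N=0]) (use bound in auto)
  then show ?case by simp
qed

lemma dirichlet_series_unique:
  assumes "abs_conv a \<alpha>" "abs_conv b \<alpha>"
    "\<And>\<sigma>. \<sigma> \<ge> \<alpha> \<Longrightarrow> dirichlet_series a (of_real \<sigma>) = dirichlet_series b (of_real \<sigma>)" "n > 0"
  shows "a n = b n"
proof -
  have ab: "abs_conv (\<lambda>n. a n - b n) \<alpha>"
    unfolding abs_conv_def
  proof (rule summable_comparison_test'[where N=0])
    show "summable (\<lambda>n. norm (a n) * real n powr (-\<alpha>) + norm (b n) * real n powr (-\<alpha>))"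
      using assms by (intro summable_add) (auto simp: abs_conv_def)
    show "norm (norm (a n - b n) * real n powr (-\<alpha>)) \<le> norm (a n) * real n powr (-\<alpha>) + norm (b n) * real n
        powr (-\<alpha>)" for n
      by (simp add: distrib_right[symmetric] mult_right_mono norm_triangle_ineq4)
  qed
  have "a n - b n = 0"
  proof (rule dirichlet_series_eq_0_imp[OF ab])
    fix \<sigma> assume s: "\<sigma> \<ge> \<alpha>"
    have "(\<lambda>n. (a n - b n) * of_nat n powr (- of_real \<sigma>)) sums
        (dirichlet_series a (of_real \<sigma>) - dirichlet_series b (of_real \<sigma>))"
      unfolding left_diff_distrib
      by (intro sums_diff abs_conv_sums[OF assms(1)] abs_conv_sums[OF assms(2)]) (use s in auto)
    then show "dirichlet_series (\<lambda>n. a n - b n) (of_real \<sigma>) = 0"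
      using assms(3)[OF s] by (simp add: dirichlet_series_def sums_iff)
  qed fact
  then show ?thesis by simp
qed

section \<open>The divisor bound and the Ramanujan hypothesis for convolutions\<close>

lemma card_divisors_prime_power_mult:
  fixes p k m :: nat
  assumes p: "prime p" and "m > 0"
  shows "card {d. d dvd p ^ k * m} \<le> Suc k * card {d. d dvd m}"
proof -
  have "{d. d dvd p ^ k * m} \<subseteq> (\<lambda>(i, e). p ^ i * e) ` ({..k} \<times> {d. d dvd m})"
  proof safe
    fix d assume "d dvd p ^ k * m"
    then obtain b c where bc: "d = b * c" "b dvd p ^ k" "c dvd m"
      using division_decomp by blast
    then obtain i where "i \<le> k" "b = p ^ i"
      using divides_primepow_nat[OF p] by blast
    then show "d \<in> (\<lambda>(i, e). p ^ i * e) ` ({..k} \<times> {d. d dvd m})"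
      using bc by (intro image_eqI[of _ _ "(i, c)"]) auto
  qed
  then have "card {d. d dvd p ^ k * m} \<le> card ((\<lambda>(i, e). p ^ i * e) ` ({..k} \<times> {d. d dvd m}))"
    using \<open>m > 0\<close> by (intro card_mono) auto
  also have "\<dots> \<le> card ({..k} \<times> {d. d dvd m})"
    using \<open>m > 0\<close> by (intro card_image_le) auto
  finally show ?thesis by (simp add: card_cartesian_product)
qed

text \<open>One prime power p ^ k is removed at a time, at the cost of a factor k + 1. For p \<ge> P
  this is at most 2 ^ k \<le> p powr (\<epsilon> * k); each of the at most P smaller primes costs an
  extra factor C, whence the constant C ^ P.\<close>

lemma card_divisors_bigo:
  fixes \<epsilon> :: real
  assumes "\<epsilon> > 0"
  shows "(\<lambda>n. real (card {d. d dvd n})) \<in> O(\<lambda>n. real n powr \<epsilon>)"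
proof -
  \<comment> \<open>Chosen so that 1 + k \<le> C * (1 + \<epsilon> * k * ln 2) \<le> C * 2 powr
    (\<epsilon> * k).\<close>
  define C where "C = max 1 (1 / (\<epsilon> * ln 2))"
  have C: "C \<ge> 1" by (simp add: C_def)
  have Ck: "real (Suc k) \<le> C * real p powr (\<epsilon> * k)" if "p \<ge> 2" for k p :: nat
  proof -
    have "1 \<le> C * (\<epsilon> * ln 2)"
      using assms by (auto simp: C_def max_def field_simps)
    then have "real k * 1 \<le> real k * (C * (\<epsilon> * ln 2))" by (intro mult_left_mono) auto
    then have "real (Suc k) \<le> C * (1 + \<epsilon> * k * ln 2)"
      using C by (simp add: algebra_simps)
    also have "1 + \<epsilon> * k * ln 2 \<le> 2 powr (\<epsilon> * k)"
      using exp_ge_add_one_self[of "\<epsilon> * k * ln 2"] by (simp add: powr_def)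
    also have "2 powr (\<epsilon> * k) \<le> real p powr (\<epsilon> * k)"
      using that assms by (intro powr_mono2) auto
    finally show ?thesis using C by simp
  qed
  define P where "P = nat \<lceil>2 powr (1 / \<epsilon>)\<rceil>"
  have Pk: "real (Suc k) \<le> real p powr (\<epsilon> * k)" if "p \<ge> P" for k p :: nat
  proof -
    have "2 powr (1/\<epsilon>) \<le> real p" using that by (auto simp: P_def nat_le_iff ceiling_le_iff)
    then have "(2 powr (1/\<epsilon>)) powr (\<epsilon> * k) \<le> real p powr (\<epsilon> * k)"
      using assms by (intro powr_mono2) auto
    moreover have "(2 powr (1/\<epsilon>)) powr (\<epsilon> * k) = 2 ^ k"
      using assms by (simp add: powr_powr powr_realpow)
    moreover have "real (Suc k) \<le> 2 ^ k"
      by (induction k) auto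
    ultimately show ?thesis by linarith
  qed
  define S where "S n = {p. prime p \<and> p dvd n \<and> p < P}" for n
  have finS: "finite (S n)" for n by (rule finite_subset[of _ "{..<P}"]) (auto simp: S_def)
  have main: "real (card {d. d dvd n}) \<le> C ^ card (S n) * real n powr \<epsilon>" if "n > 0" for n
    using that
  proof (induction n rule: less_induct)
    case (less n)
    show ?case
    proof (cases "n = 1")
      case True
      then have "S n = {}" "{d. d dvd n} = {1}" by (auto simp: S_def)
      then show ?thesis using True by simp
    next
      case False
      then obtain p where p: "prime p" "p dvd n" using prime_factor_nat by blast
      obtain k m where km: "n = p ^ k * m" "\<not> p dvd m"
        using multiplicity_decompose'[of n p] less.prems p by (metis not_prime_unit not_gr0)
      have k: "k > 0" using km p by (intro gr0I) auto
      have m: "m > 0" using km by (intro gr0I) auto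
      have "p ^ k > 1" using k prime_gt_1_nat[OF p(1)] by (intro one_less_power)
      then have mn: "m < n" using m km by simp
      have sub: "S m \<subseteq> S n" using km by (auto simp: S_def)
      have "real (card {d. d dvd n}) \<le> real (Suc k) * real (card {d. d dvd m})"
        using card_divisors_prime_power_mult[OF p(1) m, of k] km(1)
        by (metis of_nat_le_iff of_nat_mult)
      also have "\<dots> \<le> real (Suc k) * (C ^ card (S m) * real m powr \<epsilon>)"
        by (intro mult_left_mono less.IH mn m) auto
      also have "\<dots> \<le> (C ^ card (S n) * real p powr (\<epsilon> * k)) / C ^ card (S m) * (C ^ card (S m) * real m powr \<epsilon>)"
      proof (intro mult_right_mono)
        show "real (Suc k) \<le> C ^ card (S n) * real p powr (\<epsilon> * k) / C ^ card (S m)"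
        proof (cases "p < P")
          case True
          then have "insert p (S m) \<subseteq> S n" "p \<notin> S m" using sub p km by (auto simp: S_def)
          then have "Suc (card (S m)) \<le> card (S n)"
            by (metis card_insert_disjoint card_mono finS)
          then have "C ^ Suc (card (S m)) \<le> C ^ card (S n)"
            using C by (rule power_increasing)
          then have "C * C ^ card (S m) * real p powr (\<epsilon> * k) \<le> C ^ card (S n) * real p powr (\<epsilon> * k)"
            by (intro mult_right_mono) auto
          then have "C * real p powr (\<epsilon> * k) \<le> C ^ card (S n) * real p powr (\<epsilon> * k) / C ^ card (S m)"
            using C by (simp add: field_simps)
          then show ?thesis using Ck[OF prime_ge_2_nat[OF p(1)], of k] by linarith
        next
          case False
          have "C ^ card (S m) \<le> C ^ card (S n)"
            using C card_mono[OF finS sub] by (intro power_increasing)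
          then have "C ^ card (S m) * real p powr (\<epsilon> * k) \<le> C ^ card (S n) * real p powr (\<epsilon> * k)"
            by (intro mult_right_mono) auto
          then have "real p powr (\<epsilon> * k) \<le> C ^ card (S n) * real p powr (\<epsilon> * k) / C ^ card (S m)"
            using C by (simp add: field_simps)
          then show ?thesis using Pk[of p k] False by linarith
        qed
      qed (use C in auto)
      also have "\<dots> = C ^ card (S n) * (real p powr (\<epsilon> * k) * real m powr \<epsilon>)"
        using C by simp
      also have "real p powr (\<epsilon> * k) = real (p ^ k) powr \<epsilon>"
        using prime_gt_0_nat[OF p(1)] by (simp add: powr_realpow[symmetric] powr_powr mult.commute)
      also have "real (p ^ k) powr \<epsilon> * real m powr \<epsilon> = real n powr \<epsilon>"
        unfolding km of_nat_mult by (rule powr_mult[symmetric])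
      finally show ?thesis .
    qed
  qed
  show ?thesis
  proof (rule bigoI[where c = "C ^ P"], rule eventually_mono[OF eventually_gt_at_top[of 0]])
    fix n :: nat assume n: "n > 0"
    have "card (S n) \<le> P" using card_mono[of "{..<P}" "S n"] by (auto simp: S_def)
    then have "C ^ card (S n) * real n powr \<epsilon> \<le> C ^ P * real n powr \<epsilon>"
      using C by (intro mult_right_mono power_increasing) auto
    with main[OF n] show "norm (real (card {d. d dvd n})) \<le> C ^ P * norm (real n powr \<epsilon>)" by simp
  qed
qed

lemma ramanujan_bound:
  assumes "ramanujan a" "\<epsilon> > 0"
  obtains C where "C > 0" "\<And>n. n > 0 \<Longrightarrow> norm (a n) \<le> C * real n powr \<epsilon>"
proof -
  have "(\<lambda>n. norm (a n)) \<in> O(\<lambda>n. real n powr \<epsilon>)" using assms by (simp add: ramanujan_def)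
  then obtain c where c: "c > 0" "eventually (\<lambda>n. norm (a n) \<le> c * real n powr \<epsilon>) at_top"
    by (elim landau_o.bigE) auto
  then obtain N where N: "\<And>n. n \<ge> N \<Longrightarrow> norm (a n) \<le> c * real n powr \<epsilon>"
    by (auto simp: eventually_at_top_linorder)
  define C where "C = c + (\<Sum>n<N. norm (a n))"
  have "C > 0" unfolding C_def using c by (intro add_pos_nonneg sum_nonneg) auto
  moreover have "norm (a n) \<le> C * real n powr \<epsilon>" if "n > 0" for n
  proof (cases "n < N")
    case True
    have "norm (a n) \<le> (\<Sum>n<N. norm (a n))" using True by (intro member_le_sum) auto
    also have "\<dots> \<le> C * 1" using c by (simp add: C_def)
    also have "\<dots> \<le> C * real n powr \<epsilon>"
      using that assms \<open>C > 0\<close> by (intro mult_left_mono ge_one_powr_ge_zero) auto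
    finally show ?thesis .
  next
    case False
    then have "norm (a n) \<le> c * real n powr \<epsilon>" using N by simp
    also have "\<dots> \<le> C * real n powr \<epsilon>" by (intro mult_right_mono) (auto simp: C_def sum_nonneg)
    finally show ?thesis .
  qed
  ultimately show ?thesis using that by blast
qed

lemma ramanujan_dconv:
  assumes "ramanujan a" "ramanujan b"
  shows "ramanujan (dconv a b)"
  unfolding ramanujan_def
proof safe
  fix \<epsilon> :: real assume \<epsilon>: "\<epsilon> > 0"
  obtain A where A: "A > 0" "\<And>n. n > 0 \<Longrightarrow> norm (a n) \<le> A * real n powr (\<epsilon>/2)"
    using ramanujan_bound[OF assms(1), of "\<epsilon>/2"] \<epsilon> by auto
  obtain B where B: "B > 0" "\<And>n. n > 0 \<Longrightarrow> norm (b n) \<le> B * real n powr (\<epsilon>/2)"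
    using ramanujan_bound[OF assms(2), of "\<epsilon>/2"] \<epsilon> by auto
  have "(\<lambda>n. norm (dconv a b n)) \<in> O(\<lambda>n. real (card {d. d dvd n}) * real n powr (\<epsilon>/2))"
  proof (rule bigoI[where c = "A * B"], rule eventually_mono[OF eventually_gt_at_top[of 0]])
    fix n :: nat assume n: "n > 0"
    have "norm (dconv a b n) \<le> (\<Sum>d | d dvd n. norm (a d * b (n div d)))"
      using n by (auto simp: dconv_def intro: norm_sum)
    also have "\<dots> \<le> (\<Sum>d | d dvd n. A * B * real n powr (\<epsilon>/2))"
    proof (rule sum_mono)
      fix d assume "d \<in> {d. d dvd n}"
      then obtain e where e: "n = d * e" by auto
      have de: "d > 0" "e > 0" using n e by (auto intro!: gr0I)
      have "norm (a d * b e) \<le> (A * real d powr (\<epsilon>/2)) * (B * real e powr (\<epsilon>/2))"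
        unfolding norm_mult using A B de by (intro mult_mono) auto
      also have "\<dots> = A * B * real n powr (\<epsilon>/2)" by (simp add: e powr_mult)
      finally show "norm (a d * b (n div d)) \<le> A * B * real n powr (\<epsilon>/2)" using e de by simp
    qed
    finally show "norm (norm (dconv a b n)) \<le> A * B * norm (real (card {d. d dvd n}) * real n powr (\<epsilon>/2))"
      by (simp add: mult_ac)
  qed
  also have "(\<lambda>n. real (card {d. d dvd n}) * real n powr (\<epsilon>/2)) \<in> O(\<lambda>n. real n powr (\<epsilon>/2) * real n powr (\<epsilon>/2))"
    using \<epsilon> by (intro landau_o.big.mult card_divisors_bigo) auto
  also have "(\<lambda>n. real n powr (\<epsilon>/2) * real n powr (\<epsilon>/2)) = (\<lambda>n. real n powr \<epsilon>)"
    by (simp add: powr_add[symmetric])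
  finally show "(\<lambda>n. norm (dconv a b n)) \<in> O(\<lambda>n. real n powr \<epsilon>)" .
qed

lemma dirichlet_series_dconv:
  assumes "ramanujan a" "ramanujan b" "Re s > 1"
  shows "dirichlet_series (dconv a b) s = dirichlet_series a s * dirichlet_series b s"
  using dirichlet_series_product(1)[of a s b] ramanujan_abs_conv assms by simp

lemma ramanujan_unique:
  assumes "ramanujan a" "ramanujan b" "a 0 = b 0"
    "\<And>s. Re s > 1 \<Longrightarrow> dirichlet_series a s = dirichlet_series b s"
  shows "a = b"
proof
  fix n
  show "a n = b n"
    using assms dirichlet_series_unique[of a 2 b n] ramanujan_abs_conv[of _ 2] by (cases "n = 0") auto
qed

section \<open>Coefficients at primes and coefficients of the logarithm\<close>

lemma dconv_prime:
  assumes "prime p" "a 1 = 1" "b 1 = 1"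
  shows "dconv a b p = a p + b p"
proof -
  have "{d. d dvd p} = {1, p}" using assms(1) by (auto simp: prime_nat_iff)
  then show ?thesis
    using assms prime_gt_1_nat[OF assms(1)] by (auto simp: dconv_def)
qed

text \<open>Comparing coefficients in \<open>A' = A \<cdot> B'\<close> for \<open>A = exp B\<close>.\<close>

lemma exp_dirichlet_series_coeff:
  assumes a: "abs_conv a \<sigma>" and b: "abs_conv b \<sigma>"
    and eq: "\<And>s. Re s > \<sigma> \<Longrightarrow> exp (dirichlet_series b s) = dirichlet_series a s"
    and n: "n > 0"
  shows "a n * of_real (ln (real n)) = (\<Sum>d | d dvd n. a d * (b (n div d) * of_real (ln (real (n div d)))))"
proof -
  let ?la = "\<lambda>n. - a n * of_real (ln (real n))" and ?lb = "\<lambda>n. - b n * of_real (ln (real n))"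
  have neg: "abs_conv (\<lambda>n. - f n * of_real (ln (real n))) (\<sigma> + 1)" if "abs_conv f \<sigma>" for f
    using abs_conv_mult_ln[OF that, of "\<sigma>+1"] by (simp add: abs_conv_def norm_mult)
  have a': "abs_conv a (\<sigma> + 1)" using abs_conv_mono[OF a] by simp
  have key: "?la n = dconv a ?lb n"
  proof (rule dirichlet_series_unique[where \<alpha> = "\<sigma> + 1"])
    show "abs_conv ?la (\<sigma> + 1)" by (rule neg[OF a])
    show "abs_conv (dconv a ?lb) (\<sigma> + 1)"
      using dirichlet_series_product(2)[of a "of_real (\<sigma> + 1)" ?lb] neg[OF b] a' by simp
    fix x assume x: "x \<ge> \<sigma> + 1"
    let ?s = "complex_of_real x"
    have 1: "(dirichlet_series a has_field_derivative dirichlet_series ?la ?s) (at ?s)"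
      using x by (intro dirichlet_series_has_field_derivative[OF a]) auto
    have "((\<lambda>s. exp (dirichlet_series b s)) has_field_derivative
        exp (dirichlet_series b ?s) * dirichlet_series ?lb ?s) (at ?s)"
      using x by (intro DERIV_chain2[OF DERIV_exp] dirichlet_series_has_field_derivative[OF b]) auto
    then have "((\<lambda>s. exp (dirichlet_series b s)) has_field_derivative
        dirichlet_series a ?s * dirichlet_series ?lb ?s) (at ?s)"
      using x eq[of ?s] by simp
    then have "(dirichlet_series a has_field_derivative dirichlet_series a ?s * dirichlet_series ?lb ?s) (at ?s)"
      by (rule has_field_derivative_transform_within_open[of _ _ _ "{s. Re s > \<sigma>}"])
         (use x eq in \<open>auto simp: open_halfspace_Re_gt\<close>)
    with 1 have "dirichlet_series ?la ?s = dirichlet_series a ?s * dirichlet_series ?lb ?s"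
      by (rule DERIV_unique)
    also have "\<dots> = dirichlet_series (dconv a ?lb) ?s"
      using abs_conv_mono[OF a', of x] abs_conv_mono[OF neg[OF b], of x] x
      by (intro dirichlet_series_product(1)) simp_all
    finally show "dirichlet_series ?la ?s = dirichlet_series (dconv a ?lb) ?s" .
  qed (rule n)
  show ?thesis using key n by (simp add: dconv_def sum_negf)
qed

text \<open>At a prime p the coefficient recursion has only the terms d = 1 and d = p, and ln 1 = 0
  removes the second; this identifies \<open>b p\<close> with \<open>a p\<close>. The recursion is
  derived at abscissa 2, where both series converge absolutely since \<theta> < 1/2.\<close>

lemma euler_productE:
  assumes "euler_product a" "ramanujan a"
  obtains b \<theta> where "\<theta> < 1/2" "\<And>n. \<not> primepow n \<Longrightarrow> b n = 0"
    "(\<lambda>n. norm (b n)) \<in> O(\<lambda>n. real n powr \<theta>)"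
    "\<And>s. Re s > 1 \<Longrightarrow> summable (\<lambda>n. b n * of_nat n powr (-s))"
    "\<And>s. Re s > 1 \<Longrightarrow> exp (dirichlet_series b s) = dirichlet_series a s"
    "\<And>p. prime p \<Longrightarrow> b p = a p"
    "\<And>n. n > 0 \<Longrightarrow> a n * of_real (ln (real n)) = (\<Sum>d | d dvd n. a d * (b (n div d) * of_real (ln (real (n div d)))))"
proof -
  obtain b \<theta> where b: "\<theta> < 1/2" "\<And>n. \<not> primepow n \<Longrightarrow> b n = 0"
    "(\<lambda>n. norm (b n)) \<in> O(\<lambda>n. real n powr \<theta>)"
    "\<And>s. Re s > 1 \<Longrightarrow> summable (\<lambda>n. b n * of_nat n powr (-s)) \<and> exp (dirichlet_series b s) = dirichlet_series a s"
    using assms(1) unfolding euler_product_def by blast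
  have a1: "a 1 = 1" using assms(1) by (simp add: euler_product_def)
  have coeff: "a n * of_real (ln (real n)) = (\<Sum>d | d dvd n. a d * (b (n div d) * of_real (ln (real (n div d)))))"
    if "n > 0" for n
  proof (rule exp_dirichlet_series_coeff[where \<sigma> = 2])
    show "abs_conv a 2" using ramanujan_abs_conv[OF assms(2), of 2] by simp
    show "abs_conv b 2" using abs_conv_bigo[OF b(3), of 2] b(1) by simp
    show "exp (dirichlet_series b s) = dirichlet_series a s" if "Re s > 2" for s
      using b(4)[of s] that by simp
  qed (rule that)
  have "b p = a p" if p: "prime p" for p
  proof -
    have "{d. d dvd p} = {1, p}" using p by (auto simp: prime_nat_iff)
    moreover have "p > 1" using prime_gt_1_nat[OF p] .
    ultimately show ?thesis using coeff[of p] a1 by simp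
  qed
  with b coeff show ?thesis by (intro that[of \<theta> b]) auto
qed

section \<open>Products in the Selberg class\<close>

text \<open>Makes the description operator behind \<open>Dfun\<close> concrete: the quotient of the
  entire function by the power of s - 1, with removable singularities filled in, is the continuation
  that it denotes.\<close>

lemma selberg_analyticE:
  assumes "selberg_analytic a"
  obtains m g where "g holomorphic_on UNIV" "finite_order g"
    "\<And>s. s \<noteq> 1 \<Longrightarrow> Dfun a s = g s / (s - 1) ^ m"
    "\<And>s. Re s > 1 \<Longrightarrow> Dfun a s = dirichlet_series a s"
    "Dfun a nicely_meromorphic_on UNIV"
proof -
  obtain m g where g: "g holomorphic_on UNIV" "finite_order g"
      "\<And>s. Re s > 1 \<Longrightarrow> g s = (s - 1) ^ m * dirichlet_series a s"
    using assms by (auto simp: selberg_analytic_def)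
  define h where "h s = g s / (s - 1) ^ m" for s
  have "h meromorphic_on UNIV"
    unfolding h_def using g(1)
    by (intro meromorphic_intros analytic_on_imp_meromorphic_on) (auto simp: analytic_on_open)
  then have nm: "remove_sings h nicely_meromorphic_on UNIV"
    by (rule remove_sings_nicely_meromorphic)
  have h: "remove_sings h s = h s" if "s \<noteq> 1" for s
  proof (rule remove_sings_at_analytic)
    have "g analytic_on {s}" using g(1) by (meson analytic_on_holomorphic open_UNIV subset_UNIV)
    then show "h analytic_on {s}" unfolding h_def using that by (intro analytic_intros) auto
  qed
  have "Dfun a = remove_sings h"
  proof (rule Dfun_eqI[OF nm])
    fix s :: complex assume s: "Re s > 1"
    then have "s \<noteq> 1" by auto
    with s show "remove_sings h s = dirichlet_series a s" by (simp add: h h_def g(3))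
  qed
  then have D: "Dfun a s = g s / (s - 1) ^ m" if "s \<noteq> 1" for s
    using h[OF that] by (simp add: h_def)
  have "Dfun a s = dirichlet_series a s" if "Re s > 1" for s
    using that D[of s] g(3)[OF that] by (cases "s = 1") auto
  then show ?thesis using that g D nm \<open>Dfun a = _\<close> by metis
qed

lemma Dfun_eq_dirichlet_series:
  assumes "selberg_analytic a" "Re s > 1"
  shows "Dfun a s = dirichlet_series a s"
  using assms by (elim selberg_analyticE) auto

lemma Dfun_holomorphic:
  assumes "selberg_analytic a"
  shows "Dfun a holomorphic_on -{1}"
proof -
  obtain m g where g: "g holomorphic_on UNIV" "\<And>s. s \<noteq> 1 \<Longrightarrow> Dfun a s = g s / (s - 1) ^ m"
    using selberg_analyticE[OF assms] by metis
  have "(\<lambda>s. g s / (s - 1) ^ m) holomorphic_on -{1}"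
    by (intro holomorphic_intros holomorphic_on_subset[OF g(1)]) auto
  then show ?thesis
    by (rule holomorphic_transform) (use g in auto)
qed

lemma holomorphic_eq_Dfun:
  assumes a: "selberg_analytic a" and f: "f holomorphic_on -{1}"
    and eq: "\<And>s. Re s > 1 \<Longrightarrow> f s = dirichlet_series a s" and "s \<noteq> 1"
  shows "f s = Dfun a s"
proof (rule analytic_continuation_open[of "{s. Re s > 1}" "-{1}" f "Dfun a"])
  show "open {s. 1 < Re s}" by (simp add: open_halfspace_Re_gt)
  show "{s. 1 < Re s} \<noteq> {}" by (auto intro!: exI[of _ 2])
  show "connected (- {1::complex})" by (rule connected_punctured_universe) simp
  show "f z = Dfun a z" if "z \<in> {s. 1 < Re s}" for z
    using that eq Dfun_eq_dirichlet_series[OF a] by simp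
qed (use assms Dfun_holomorphic[OF a] in auto)

lemma finite_order_mult:
  assumes "finite_order f" "finite_order g"
  shows "finite_order (\<lambda>s. f s * g s)"
proof -
  obtain p q where p: "(\<lambda>s. norm (f s)) \<in> O[at_infinity](\<lambda>s. exp (norm s powr p))"
      and q: "(\<lambda>s. norm (g s)) \<in> O[at_infinity](\<lambda>s. exp (norm s powr q))"
    using assms by (auto simp: finite_order_def)
  \<comment> \<open>The additional 1 absorbs the factor 2 that arises from adding the exponents, as
    2 \<le> norm s.\<close>
  define r where "r = max p q + 1"
  have "(\<lambda>s. norm (f s * g s)) \<in> O[at_infinity](\<lambda>s. exp (norm s powr p) * exp (norm s powr q))"
    unfolding norm_mult by (rule landau_o.big.mult[OF p q])
  also have "(\<lambda>s::complex. exp (norm s powr p) * exp (norm s powr q)) \<in> O[at_infinity](\<lambda>s. exp (norm s powr r))"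
  proof (rule bigoI[where c = 1], rule eventually_at_infinityI[of 2])
    fix s :: complex assume s: "2 \<le> norm s"
    have "norm s powr p \<le> norm s powr (max p q)" "norm s powr q \<le> norm s powr (max p q)"
      using s by (auto intro: powr_mono)
    then have "norm s powr p + norm s powr q \<le> 2 * norm s powr (max p q)" by simp
    also have "\<dots> \<le> norm s * norm s powr (max p q)" using s by (intro mult_right_mono) auto
    also have "\<dots> = norm s powr r" using s by (auto simp: r_def powr_add)
    finally show "norm (exp (norm s powr p) * exp (norm s powr q)) \<le> 1 * norm (exp (norm s powr r))"
      by (simp add: exp_add[symmetric])
  qed
  finally show ?thesis unfolding finite_order_def by blast
qed

lemma selberg_analytic_dconv:
  assumes "selberg_analytic a" "selberg_analytic b" "ramanujan a" "ramanujan b"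
  shows "selberg_analytic (dconv a b)"
proof -
  obtain m f where f: "f holomorphic_on UNIV" "finite_order f"
      "\<And>s. Re s > 1 \<Longrightarrow> f s = (s - 1) ^ m * dirichlet_series a s"
    using assms(1) by (auto simp: selberg_analytic_def)
  obtain n g where g: "g holomorphic_on UNIV" "finite_order g"
      "\<And>s. Re s > 1 \<Longrightarrow> g s = (s - 1) ^ n * dirichlet_series b s"
    using assms(2) by (auto simp: selberg_analytic_def)
  show ?thesis
    unfolding selberg_analytic_def
    using f g assms
    by (intro exI[of _ "m + n"] exI[of _ "\<lambda>s. f s * g s"])
       (auto simp: dirichlet_series_dconv power_add intro!: holomorphic_intros finite_order_mult)
qed

text \<open>The point 1 has to be left out: \<open>Dfun\<close> is 0 at a pole by convention, while
  the pole of one factor may be cancelled by a zero of the other, and then the product need not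
  vanish there.\<close>

lemma Dfun_dconv:
  assumes "selberg_analytic a" "selberg_analytic b" "ramanujan a" "ramanujan b" "s \<noteq> 1"
  shows "Dfun (dconv a b) s = Dfun a s * Dfun b s"
proof (rule holomorphic_eq_Dfun[symmetric, OF selberg_analytic_dconv[OF assms(1-4)] _ _ assms(5)])
  show "(\<lambda>s. Dfun a s * Dfun b s) holomorphic_on -{1}"
    by (intro holomorphic_intros Dfun_holomorphic assms)
qed (use assms in \<open>auto simp: Dfun_eq_dirichlet_series dirichlet_series_dconv\<close>)

lemma euler_product_dconv:
  assumes "euler_product a" "euler_product b" "ramanujan a" "ramanujan b"
  shows "euler_product (dconv a b)"
proof -
  obtain u \<theta>1 where u: "\<theta>1 < 1/2" "\<And>n. \<not> primepow n \<Longrightarrow> u n = 0"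
    "(\<lambda>n. norm (u n)) \<in> O(\<lambda>n. real n powr \<theta>1)"
    "\<And>s. Re s > 1 \<Longrightarrow> summable (\<lambda>n. u n * of_nat n powr (-s))"
    "\<And>s. Re s > 1 \<Longrightarrow> exp (dirichlet_series u s) = dirichlet_series a s"
    by (rule euler_productE[OF assms(1,3)]) blast
  obtain v \<theta>2 where v: "\<theta>2 < 1/2" "\<And>n. \<not> primepow n \<Longrightarrow> v n = 0"
    "(\<lambda>n. norm (v n)) \<in> O(\<lambda>n. real n powr \<theta>2)"
    "\<And>s. Re s > 1 \<Longrightarrow> summable (\<lambda>n. v n * of_nat n powr (-s))"
    "\<And>s. Re s > 1 \<Longrightarrow> exp (dirichlet_series v s) = dirichlet_series b s"
    by (rule euler_productE[OF assms(2,4)]) blast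
  define \<theta> where "\<theta> = max \<theta>1 \<theta>2"
  have le: "(\<lambda>n. real n powr \<theta>1) \<in> O(\<lambda>n. real n powr \<theta>)" "(\<lambda>n. real n powr \<theta>2) \<in> O(\<lambda>n. real n powr \<theta>)"
    by (rule bigoI[where c=1], rule eventually_mono[OF eventually_gt_at_top[of 0]],
        auto simp: \<theta>_def intro!: powr_mono)+
  have uv: "(\<lambda>n. norm (u n) + norm (v n)) \<in> O(\<lambda>n. real n powr \<theta>)"
    using landau_o.big.trans[OF u(3) le(1)] landau_o.big.trans[OF v(3) le(2)] by (rule sum_in_bigo)
  have "(\<lambda>n. norm (u n + v n)) \<in> O(\<lambda>n. norm (u n) + norm (v n))"
    by (intro bigoI[where c=1] always_eventually) (auto intro: norm_triangle_ineq)
  then have O: "(\<lambda>n. norm (u n + v n)) \<in> O(\<lambda>n. real n powr \<theta>)"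
    using uv by (rule landau_o.big.trans)
  have sum: "summable (\<lambda>n. (u n + v n) * of_nat n powr (-s))"
            "dirichlet_series (\<lambda>n. u n + v n) s = dirichlet_series u s + dirichlet_series v s" if "Re s > 1" for s
    using summable_add[OF u(4)[OF that] v(4)[OF that]] suminf_add[OF u(4)[OF that] v(4)[OF that]]
    by (auto simp: distrib_right dirichlet_series_def)
  have "{d. d dvd (1::nat)} = {1}" by auto
  then have "dconv a b 1 = 1"
    using assms by (auto simp: dconv_def euler_product_def)
  then show ?thesis
    unfolding euler_product_def
    using u v O sum assms
    by (intro conjI exI[of _ "\<lambda>n. u n + v n"] exI[of _ \<theta>])
       (auto simp: \<theta>_def exp_add dirichlet_series_dconv)
qed

lemma eventually_cosparse_neq: "\<forall>\<^sub>\<approx>s\<in>UNIV. s \<noteq> (c :: complex)"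
  by (auto simp: eventually_cosparse_open_eq eventually_neq_at_within)

lemma functional_equation_dconv:
  assumes "functional_equation a" "functional_equation b"
    and ana: "selberg_analytic a" "selberg_analytic b" "ramanujan a" "ramanujan b"
  shows "functional_equation (dconv a b)"
proof -
  obtain \<epsilon>1 Q1 k1 w1 \<mu>1 where 1: "norm \<epsilon>1 = 1" "Q1 > 0" "\<forall>i<k1. w1 i > 0 \<and> Re (\<mu>1 i) \<ge> 0"
      "\<forall>\<^sub>\<approx>s\<in>UNIV. gamma_factor \<epsilon>1 Q1 k1 w1 \<mu>1 s * Dfun a s =
        cnj_fun (\<lambda>s. gamma_factor \<epsilon>1 Q1 k1 w1 \<mu>1 s * Dfun a s) (1 - s)"
    using assms(1) by (auto simp: functional_equation_def Let_def)
  obtain \<epsilon>2 Q2 k2 w2 \<mu>2 where 2: "norm \<epsilon>2 = 1" "Q2 > 0" "\<forall>i<k2. w2 i > 0 \<and> Re (\<mu>2 i) \<ge> 0"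
      "\<forall>\<^sub>\<approx>s\<in>UNIV. gamma_factor \<epsilon>2 Q2 k2 w2 \<mu>2 s * Dfun b s =
        cnj_fun (\<lambda>s. gamma_factor \<epsilon>2 Q2 k2 w2 \<mu>2 s * Dfun b s) (1 - s)"
    using assms(2) by (auto simp: functional_equation_def Let_def)
  define w where "w i = (if i < k1 then w1 i else w2 (i - k1))" for i
  define \<mu> where "\<mu> i = (if i < k1 then \<mu>1 i else \<mu>2 (i - k1))" for i
  have gam: "gamma_factor (\<epsilon>1 * \<epsilon>2) (Q1 * Q2) (k1 + k2) w \<mu> s =
      gamma_factor \<epsilon>1 Q1 k1 w1 \<mu>1 s * gamma_factor \<epsilon>2 Q2 k2 w2 \<mu>2 s" for s
  proof -
    have "(\<Prod>i<k1 + k2. Gamma (of_real (w i) * s + \<mu> i)) =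
        (\<Prod>i<k1. Gamma (of_real (w i) * s + \<mu> i)) * (\<Prod>i<k2. Gamma (of_real (w (i + k1)) * s + \<mu> (i + k1)))"
      using prod.atLeastLessThan_concat[of 0 k1 "k1 + k2" "\<lambda>i. Gamma (of_real (w i) * s + \<mu> i)"]
        prod.shift_bounds_nat_ivl[of "\<lambda>i. Gamma (of_real (w i) * s + \<mu> i)" 0 k1 k2]
      by (simp add: atLeast0LessThan add.commute)
    also have "\<dots> = (\<Prod>i<k1. Gamma (of_real (w1 i) * s + \<mu>1 i)) * (\<Prod>i<k2. Gamma (of_real (w2 i) * s + \<mu>2 i))"
      by (intro arg_cong2[of _ _ _ _ "(*)"] prod.cong) (auto simp: w_def \<mu>_def)
    finally show ?thesis
      using 1(2) 2(2) by (simp add: gamma_factor_def powr_times_real)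
  qed
  have "\<forall>\<^sub>\<approx>s\<in>UNIV. gamma_factor (\<epsilon>1 * \<epsilon>2) (Q1 * Q2) (k1 + k2) w \<mu> s * Dfun (dconv a b) s =
        cnj_fun (\<lambda>s. gamma_factor (\<epsilon>1 * \<epsilon>2) (Q1 * Q2) (k1 + k2) w \<mu> s * Dfun (dconv a b) s) (1 - s)"
    \<comment> \<open>Besides the two exceptional sets, the points 1 and 0 are removed, because the
      product formula for \<open>Dfun\<close> is applied at s and at the reflected point.\<close>
    using 1(4) 2(4) eventually_cosparse_neq[of 1] eventually_cosparse_neq[of 0]
  proof eventually_elim
    case (elim s)
    have "cnj (1 - s) \<noteq> 1" using elim(4) by auto
    then show ?case
      using elim(1-3) by (simp add: gam Dfun_dconv[OF ana] cnj_fun_def) algebra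
  qed
  then show ?thesis
    unfolding functional_equation_def Let_def
    using 1 2 by (intro exI[of _ "\<epsilon>1 * \<epsilon>2"] exI[of _ "Q1 * Q2"] exI[of _ "k1 + k2"] exI[of _ w] exI[of _ \<mu>])
       (auto simp: norm_mult w_def \<mu>_def)
qed

lemma selberg_class_dconv:
  assumes "a \<in> selberg_class" "b \<in> selberg_class"
  shows "dconv a b \<in> selberg_class"
proof -
  have "dconv a b 0 = 0" by (simp add: dconv_def)
  then show ?thesis
    using assms selberg_analytic_dconv[of a b] ramanujan_dconv[of a b] functional_equation_dconv[of a b]
      euler_product_dconv[of a b] by (simp add: selberg_class_def)
qed

lemma dirichlet_series_one: "dirichlet_series one_series s = 1"
proof -
  have "(\<lambda>n. one_series n * of_nat n powr (-s)) sums (\<Sum>n\<in>{1}. one_series n * of_nat n powr (-s))"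
    by (rule sums_finite) (auto simp: one_series_def)
  then show ?thesis by (simp add: dirichlet_series_def sums_iff one_series_def)
qed

lemma Dfun_one: "Dfun one_series = (\<lambda>_. 1)"
  by (rule Dfun_eqI) (auto simp: dirichlet_series_one intro!: analytic_on_imp_nicely_meromorphic_on)

lemma one_series_in_selberg: "one_series \<in> selberg_class"
proof -
  have "finite_order (\<lambda>_. 1)"
    unfolding finite_order_def
    by (intro exI[of _ 1] bigoI[where c=1] always_eventually) auto
  then have "selberg_analytic one_series"
    unfolding selberg_analytic_def
    by (intro exI[of _ 0] exI[of _ "\<lambda>_. 1"]) (auto simp: dirichlet_series_one)
  moreover have "ramanujan one_series"
    unfolding ramanujan_def
    by (intro allI impI bigoI[where c=1] eventually_mono[OF eventually_gt_at_top[of 1]]) (auto simp: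
        one_series_def)
  moreover have "functional_equation one_series"
    unfolding functional_equation_def
    by (rule exI[of _ 1], rule exI[of _ 1], rule exI[of _ 0]) (auto simp: Dfun_one gamma_factor_def cnj_fun_def)
  moreover have "euler_product one_series"
    unfolding euler_product_def
    by (intro conjI exI[of _ "\<lambda>_. 0"] exI[of _ 0])
       (auto simp: one_series_def dirichlet_series_one, auto simp: dirichlet_series_def)
  ultimately show ?thesis by (simp add: selberg_class_def one_series_def)
qed

section \<open>The functional equation on vertical lines\<close>

text \<open>Where the imaginary part dominates, z + k is bounded below linearly in k and |Im z|
  together. Sums of inverse squares over k thus become O(1 / |Im z|).\<close>

lemma norm_add_of_nat_ge:
  assumes "\<bar>Re z\<bar> \<le> \<bar>Im z\<bar> / 2"
  shows "norm (z + of_nat k) \<ge> (real k + \<bar>Im z\<bar> / 2) / 2"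
proof -
  have 1: "norm (z + of_nat k) \<ge> \<bar>Re z + real k\<bar>" "norm (z + of_nat k) \<ge> \<bar>Im z\<bar>"
    using abs_Re_le_cmod[of "z + of_nat k"] abs_Im_le_cmod[of "z + of_nat k"] by auto
  have "real k + \<bar>Im z\<bar> / 2 \<le> \<bar>Re z + real k\<bar> + \<bar>Im z\<bar>" using assms by linarith
  also have "\<dots> \<le> 2 * norm (z + of_nat k)" using 1 by linarith
  finally show ?thesis by simp
qed

lemma sum_inverse_norm_square:
  assumes "\<bar>Re z\<bar> \<le> \<bar>Im z\<bar> / 2" "\<bar>Im z\<bar> \<ge> 2"
  shows "summable (\<lambda>k. 1 / norm (z + of_nat k) ^ 2)" "(\<Sum>k. 1 / norm (z + of_nat k) ^ 2) \<le> 16 / \<bar>Im z\<bar>"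
proof -
  define Y where "Y = \<bar>Im z\<bar> / 2"
  have Y: "Y \<ge> 1" using assms by (simp add: Y_def)
  \<comment> \<open>Shift by 1/2: 1 / (k + Y)^2 is at most 1 / ((k + Y - 1/2) * (k + Y + 1/2)),
    which is the telescoping difference \<open>f k - f (Suc k)\<close>.\<close>
  define f where "f k = 1 / (real k + Y - 1/2)" for k
  have "f \<longlonglongrightarrow> 0" unfolding f_def by real_asymp
  then have tel: "(\<lambda>k. 4 * (f k - f (Suc k))) sums (4 * (f 0 - 0))"
    by (intro sums_mult telescope_sums')
  have le: "1 / norm (z + of_nat k) ^ 2 \<le> 4 * (f k - f (Suc k))" for k
  proof -
    have "((real k + Y) / 2) ^ 2 \<le> norm (z + of_nat k) ^ 2"
      using norm_add_of_nat_ge[OF assms(1), of k] Y by (intro power_mono) (auto simp: Y_def)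
    then have "1 / norm (z + of_nat k) ^ 2 \<le> 1 / ((real k + Y) / 2) ^ 2"
      using Y by (intro divide_left_mono mult_pos_pos zero_less_power) (auto intro: less_le_trans)
    also have "\<dots> = 4 * (1 / (real k + Y)^2)" by (simp add: power_divide)
    also have "1 / (real k + Y)^2 \<le> 1 / ((real k + Y - 1/2) * (real k + Y + 1/2))"
    proof (rule divide_left_mono)
      show "(real k + Y - 1/2) * (real k + Y + 1/2) \<le> (real k + Y)^2"
        by (simp add: algebra_simps power2_eq_square)
    qed (use Y in auto)
    also have "\<dots> = f k - f (Suc k)"
    proof -
      have "real k + Y - 1/2 > 0" using Y by simp
      then show ?thesis unfolding f_def by (simp add: field_simps)
    qed
    finally show ?thesis by simp
  qed
  show s: "summable (\<lambda>k. 1 / norm (z + of_nat k) ^ 2)"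
    by (rule summable_comparison_test'[OF sums_summable[OF tel], of 0]) (use le in auto)
  have "(\<Sum>k. 1 / norm (z + of_nat k) ^ 2) \<le> 4 * (f 0 - 0)"
    using suminf_le[OF le s sums_summable[OF tel]] tel by (simp add: sums_iff)
  also have "\<dots> \<le> 8 / Y" using Y by (simp add: f_def field_simps)
  also have "\<dots> = 16 / \<bar>Im z\<bar>" by (simp add: Y_def)
  finally show "(\<Sum>k. 1 / norm (z + of_nat k) ^ 2) \<le> 16 / \<bar>Im z\<bar>" .
qed

lemma norm_Polygamma_1_le:
  fixes z :: complex
  assumes "\<bar>Re z\<bar> \<le> \<bar>Im z\<bar> / 2" "\<bar>Im z\<bar> \<ge> 2"
  shows "norm (Polygamma 1 z) \<le> 16 / \<bar>Im z\<bar>"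
proof -
  have "z \<noteq> 0" using assms by auto
  from Polygamma_LIMSEQ[OF this, of 1]
  have s: "(\<lambda>k. inverse ((z + of_nat k)^2)) sums Polygamma 1 z" by (simp add: numeral_2_eq_2)
  have eq: "norm (inverse ((z + of_nat k)^2)) = 1 / norm (z + of_nat k)^2" for k
    by (simp add: norm_divide norm_power inverse_eq_divide)
  have "norm (\<Sum>k. inverse ((z + of_nat k)^2)) \<le> (\<Sum>k. 1 / norm (z + of_nat k)^2)"
    unfolding eq[symmetric] by (rule summable_norm) (simp only: eq sum_inverse_norm_square[OF assms])
  also have "\<dots> \<le> 16 / \<bar>Im z\<bar>" by (rule sum_inverse_norm_square[OF assms])
  finally show ?thesis using s by (simp add: sums_iff)
qed

text \<open>A substitute for Stirling's formula. In the limit for \<open>Digamma\<close>, each Re (1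
  / (z + n)) is compared with ln |z + n + 1| - ln |z + n|; these differences telescope, and the
  errors are at most 2 / |z + n|^2. Their sum is at most 2 * 8 = 16, and replacing ln |z| by ln |Im
  z| costs ln 2 \<le> 1.\<close>

lemma Re_Digamma_approx:
  fixes z :: complex
  assumes "\<bar>Re z\<bar> \<le> \<bar>Im z\<bar> / 2" "\<bar>Im z\<bar> \<ge> 2"
  shows "\<bar>Re (Digamma z) - ln \<bar>Im z\<bar>\<bar> \<le> 17"
proof -
  have z0: "z \<noteq> 0" using assms by auto
  have nz: "norm (z + of_nat n) \<ge> 2" for n
    using abs_Im_le_cmod[of "z + of_nat n"] assms by simp
  define e where "e n = Re (inverse (z + of_nat n)) - (ln (norm (z + of_nat (Suc n))) - ln (norm (z + of_nat
      n)))" for n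
  have e: "\<bar>e n\<bar> \<le> 2 * (1 / norm (z + of_nat n) ^ 2)" for n
  proof -
    define u where "u = inverse (z + of_nat n)"
    have zn: "z + of_nat n \<noteq> 0" using nz[of n] by auto
    have "norm u = 1 / norm (z + of_nat n)" by (simp add: u_def norm_divide inverse_eq_divide)
    also have "\<dots> \<le> 1 / 2" using nz[of n] by (intro divide_left_mono) auto
    finally have u: "norm u \<le> 1/2" .
    have u1: "1 + u \<noteq> 0"
    proof
      assume "1 + u = 0"
      then have "u = -1" by (metis add_eq_0_iff)
      with u show False by simp
    qed
    have "z + of_nat (Suc n) = (z + of_nat n) * (1 + u)"
    proof -
      have "(z + of_nat n) * u = 1" using zn unfolding u_def by (rule right_inverse)
      then show ?thesis by (simp add: distrib_left)
    qed
    then have "ln (norm (z + of_nat (Suc n))) = ln (norm (z + of_nat n)) + ln (norm (1 + u))"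
      using zn u1 by (simp add: norm_mult ln_mult)
    then have "\<bar>e n\<bar> = \<bar>Re (Ln (1 + u) - u)\<bar>"
      using u1 by (simp add: e_def u_def)
    also have "\<dots> \<le> norm (Ln (1 + u) - u)" by (rule abs_Re_le_cmod)
    also have "\<dots> \<le> norm u ^ 2 / (1 - norm u)" using u by (intro Ln_approx_linear) auto
    also have "\<dots> \<le> norm u ^ 2 / (1/2)" using u by (intro divide_left_mono) auto
    also have "\<dots> = 2 * (1 / norm (z + of_nat n) ^ 2)"
      by (simp add: u_def norm_divide power_divide inverse_eq_divide)
    finally show ?thesis .
  qed
  note S = sum_inverse_norm_square[OF assms]
  have "16 / \<bar>Im z\<bar> \<le> 8" using assms by (simp add: field_simps)
  then have Sle: "(\<Sum>n. 1 / norm (z + of_nat n) ^ 2) \<le> 8" using S(2) by linarith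
  have bound: "\<bar>\<Sum>n<m. e n\<bar> \<le> 16" for m
  proof -
    have "\<bar>\<Sum>n<m. e n\<bar> \<le> (\<Sum>n<m. 2 * (1 / norm (z + of_nat n) ^ 2))"
      using e by (intro order.trans[OF sum_abs] sum_mono)
    also have "\<dots> = 2 * (\<Sum>n<m. (1 / norm (z + of_nat n) ^ 2))"
      by (simp add: sum_distrib_left)
    also have "\<dots> \<le> 2 * (\<Sum>n. 1 / norm (z + of_nat n) ^ 2)"
      using S(1) by (intro mult_left_mono sum_le_suminf) auto
    finally show ?thesis using Sle by linarith
  qed
  have LA: "(\<lambda>m. Re (of_real (ln (real m)) - (\<Sum>n<m. inverse (z + of_nat n)))) \<longlonglongrightarrow> Re (Digamma z)"
    by (intro tendsto_intros Digamma_LIMSEQ z0)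
  have LB: "(\<lambda>m. ln (real m) - ln (norm (z + of_nat m))) \<longlonglongrightarrow> 0"
  proof -
    have "(\<lambda>m. ln (real m) - ln (sqrt ((Re z + real m)^2 + Im z ^2))) \<longlonglongrightarrow> 0"
      by real_asymp
    then show ?thesis by (simp add: cmod_def)
  qed
  have "(\<lambda>m. \<bar>Re (of_real (ln (real m)) - (\<Sum>n<m. inverse (z + of_nat n))) -
       (ln (real m) - ln (norm (z + of_nat m))) - ln (norm z)\<bar>) \<longlonglongrightarrow> \<bar>Re (Digamma z) - 0 - ln (norm z)\<bar>"
    by (rule tendsto_rabs[OF tendsto_diff[OF tendsto_diff[OF LA LB] tendsto_const]])
  moreover have "\<bar>Re (of_real (ln (real m)) - (\<Sum>n<m. inverse (z + of_nat n))) -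
       (ln (real m) - ln (norm (z + of_nat m))) - ln (norm z)\<bar> \<le> 16" for m
  proof -
    have "(\<Sum>n<m. e n) = (\<Sum>n<m. Re (inverse (z + of_nat n))) - (ln (norm (z + of_nat m)) - ln (norm (z +
        of_nat 0)))"
      unfolding e_def sum_subtractf
      by (subst sum_lessThan_telescope[of "\<lambda>n. ln (norm (z + of_nat n))", symmetric]) (simp add: sum_subtractf)
    then have "\<bar>Re (of_real (ln (real m)) - (\<Sum>n<m. inverse (z + of_nat n))) -
       (ln (real m) - ln (norm (z + of_nat m))) - ln (norm z)\<bar> = \<bar>\<Sum>n<m. e n\<bar>"
      by (simp add: Re_sum)
    then show ?thesis using bound[of m] by simp
  qed
  ultimately have 1: "\<bar>Re (Digamma z) - ln (norm z)\<bar> \<le> 16"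
    using LIMSEQ_le_const2 by fastforce
  have "norm z \<le> 2 * \<bar>Im z\<bar>" using cmod_le[of z] assms by linarith
  then have "ln (norm z) \<le> ln (2 * \<bar>Im z\<bar>)" using z0 assms by (subst ln_le_cancel_iff) auto
  also have "\<dots> = ln 2 + ln \<bar>Im z\<bar>" using assms by (simp add: ln_mult)
  also have "ln 2 \<le> (1::real)" using ln_le_minus_one[of 2] by simp
  finally have "ln (norm z) \<le> 1 + ln \<bar>Im z\<bar>" by simp
  moreover have "ln \<bar>Im z\<bar> \<le> ln (norm z)"
    using z0 assms abs_Im_le_cmod[of z] by (subst ln_le_cancel_iff) auto
  ultimately show ?thesis using 1 by linarith
qed

lemma not_nonpos_Reals_Im: "Im z \<noteq> 0 \<Longrightarrow> z \<notin> \<real>\<^sub>\<le>\<^sub>0"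
  by (auto simp: complex_nonpos_Reals_iff)

lemma not_nonpos_Ints_Im: "Im z \<noteq> 0 \<Longrightarrow> z \<notin> \<int>\<^sub>\<le>\<^sub>0"
  by (auto elim!: nonpos_Ints_cases)

lemma exp_ln_Gamma_Im: "Im z \<noteq> 0 \<Longrightarrow> exp (ln_Gamma z) = Gamma z"
  using Gamma_complex_altdef[of z] not_nonpos_Ints_Im[of z] by simp

text \<open>The real part is ln |Gamma z|, which conjugation preserves; the branch of the logarithm
  does not enter.\<close>

lemma Re_ln_Gamma_cnj:
  assumes "Im z \<noteq> 0"
  shows "Re (ln_Gamma (cnj z)) = Re (ln_Gamma z)"
proof -
  have "exp (Re (ln_Gamma (cnj z))) = norm (Gamma (cnj z))"
    using exp_ln_Gamma_Im[of "cnj z"] assms by (simp flip: norm_exp_eq_Re)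
  also have "\<dots> = norm (Gamma z)" by (metis cnj_Gamma complex_mod_cnj)
  also have "\<dots> = exp (Re (ln_Gamma z))"
    using exp_ln_Gamma_Im[of z] assms by (simp flip: norm_exp_eq_Re)
  finally show ?thesis by simp
qed

text \<open>Mean value theorem in the horizontal direction. The functional equation only compares
  Gamma values at heights equal up to sign, so differences suffice in place of an asymptotic formula
  for a single value.\<close>

lemma Re_ln_Gamma_diff:
  assumes "\<bar>y\<bar> \<ge> 2" "\<bar>a\<bar> \<le> \<bar>y\<bar> / 2" "\<bar>b\<bar> \<le> \<bar>y\<bar> / 2" "a \<le> b"
  shows "\<bar>Re (ln_Gamma (Complex b y)) - Re (ln_Gamma (Complex a y)) - (b - a) * ln \<bar>y\<bar>\<bar> \<le> 17 * (b - a)"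
proof (cases "a = b")
  case False
  define f where "f x = Re (ln_Gamma (Complex x y))" for x
  have der: "(f has_real_derivative Re (Digamma (Complex x y))) (at x)" for x
  proof -
    have nn: "Complex x y \<notin> \<real>\<^sub>\<le>\<^sub>0" using assms(1) by (intro not_nonpos_Reals_Im) auto
    have "((\<lambda>x. Complex x y) has_vector_derivative 1) (at x)"
      unfolding Complex_eq
      by (rule has_vector_derivative_eq_rhs) (auto intro!: derivative_eq_intros has_vector_derivative_of_real)
    from field_vector_diff_chain_at[OF this has_field_derivative_ln_Gamma_complex[OF nn]]
    have "((\<lambda>x. ln_Gamma (Complex x y)) has_vector_derivative Digamma (Complex x y)) (at x)"
      by (simp add: o_def)
    from bounded_linear.has_vector_derivative[OF bounded_linear_Re this]
    show ?thesis unfolding f_def has_real_derivative_iff_has_vector_derivative .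
  qed
  obtain z where z: "a < z" "z < b" "f b - f a = (b - a) * Re (Digamma (Complex z y))"
    using MVT2[of a b f "\<lambda>x. Re (Digamma (Complex x y))"] der assms False by auto
  have "\<bar>Re (Digamma (Complex z y)) - ln \<bar>y\<bar>\<bar> \<le> 17"
    using Re_Digamma_approx[of "Complex z y"] z assms by auto
  then have "\<bar>(b - a) * (Re (Digamma (Complex z y)) - ln \<bar>y\<bar>)\<bar> \<le> (b - a) * 17"
    unfolding abs_mult using assms by (intro mult_mono) auto
  with z(3) show ?thesis by (simp add: f_def algebra_simps)
qed simp

text \<open>For \<open>Im s\<close> large, the functional equation reads
  \<open>F s = cnj \<epsilon> / \<epsilon> * exp (fe_G s) * cnj (F (1 - cnj s))\<close>; \<open>fe_L\<close> and \<open>fe_L'\<close> are the first two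
  derivatives of \<open>fe_G\<close>.\<close>

definition fe_G :: "real \<Rightarrow> nat \<Rightarrow> (nat \<Rightarrow> real) \<Rightarrow> (nat \<Rightarrow> complex) \<Rightarrow> complex \<Rightarrow> complex" where
  "fe_G Q k w \<mu> s = (1 - 2 * s) * of_real (ln Q) +
     (\<Sum>i<k. ln_Gamma (of_real (w i) * (1 - s) + cnj (\<mu> i)) - ln_Gamma (of_real (w i) * s + \<mu> i))"

definition fe_L :: "real \<Rightarrow> nat \<Rightarrow> (nat \<Rightarrow> real) \<Rightarrow> (nat \<Rightarrow> complex) \<Rightarrow> complex \<Rightarrow> complex" where
  "fe_L Q k w \<mu> s = - 2 * of_real (ln Q) -
     (\<Sum>i<k. of_real (w i) * (Digamma (of_real (w i) * (1 - s) + cnj (\<mu> i)) + Digamma (of_real (w i) * s + \<mu> i)))"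

definition fe_L' :: "nat \<Rightarrow> (nat \<Rightarrow> real) \<Rightarrow> (nat \<Rightarrow> complex) \<Rightarrow> complex \<Rightarrow> complex" where
  "fe_L' k w \<mu> s =
     (\<Sum>i<k. of_real (w i ^ 2) * (Polygamma 1 (of_real (w i) * (1 - s) + cnj (\<mu> i)) - Polygamma 1 (of_real (w
         i) * s + \<mu> i)))"

lemma fe_G_has_field_derivative:
  assumes "\<And>i. i < k \<Longrightarrow> w i * Im s + Im (\<mu> i) > 0"
  shows "(fe_G Q k w \<mu> has_field_derivative fe_L Q k w \<mu> s) (at s)"
proof -
  have 1: "((\<lambda>s. ln_Gamma (of_real (w i) * (1 - s) + cnj (\<mu> i))) has_field_derivative
      Digamma (of_real (w i) * (1 - s) + cnj (\<mu> i)) * (- of_real (w i))) (at s)" if "i < k" for i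
    using assms[OF that]
    by (intro DERIV_chain2[where f = ln_Gamma] has_field_derivative_ln_Gamma_complex not_nonpos_Reals_Im)
       (auto intro!: derivative_eq_intros)
  have 2: "((\<lambda>s. ln_Gamma (of_real (w i) * s + \<mu> i)) has_field_derivative
      Digamma (of_real (w i) * s + \<mu> i) * of_real (w i)) (at s)" if "i < k" for i
    using assms[OF that]
    by (intro DERIV_chain2[where f = ln_Gamma] has_field_derivative_ln_Gamma_complex not_nonpos_Reals_Im)
       (auto intro!: derivative_eq_intros)
  have "((\<lambda>s. \<Sum>i<k. ln_Gamma (of_real (w i) * (1 - s) + cnj (\<mu> i)) - ln_Gamma (of_real (w i) * s + \<mu> i))
      has_field_derivative (\<Sum>i<k. Digamma (of_real (w i) * (1 - s) + cnj (\<mu> i)) * (- of_real (w i)) -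
        Digamma (of_real (w i) * s + \<mu> i) * of_real (w i))) (at s)"
    by (intro DERIV_sum DERIV_diff 1 2) auto
  then have "(fe_G Q k w \<mu> has_field_derivative (- 2 * of_real (ln Q) +
      (\<Sum>i<k. Digamma (of_real (w i) * (1 - s) + cnj (\<mu> i)) * (- of_real (w i)) -
        Digamma (of_real (w i) * s + \<mu> i) * of_real (w i)))) (at s)"
    unfolding fe_G_def by (intro DERIV_add) (auto intro!: derivative_eq_intros)
  moreover have "(- 2 * of_real (ln Q) +
      (\<Sum>i<k. Digamma (of_real (w i) * (1 - s) + cnj (\<mu> i)) * (- of_real (w i)) -
        Digamma (of_real (w i) * s + \<mu> i) * of_real (w i))) = fe_L Q k w \<mu> s"
    unfolding fe_L_def by (simp add: sum_negf[symmetric] algebra_simps flip: sum.distrib)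
  ultimately show ?thesis by simp
qed

lemma fe_L_has_field_derivative:
  assumes "\<And>i. i < k \<Longrightarrow> w i * Im s + Im (\<mu> i) > 0"
  shows "(fe_L Q k w \<mu> has_field_derivative fe_L' k w \<mu> s) (at s)"
proof -
  have D: "(Digamma has_field_derivative Polygamma 1 z) (at z)" if "Im z \<noteq> 0" for z :: complex
    using has_field_derivative_Polygamma[of z 0 UNIV] not_nonpos_Ints_Im[OF that] by simp
  have 1: "((\<lambda>s. Digamma (of_real (w i) * (1 - s) + cnj (\<mu> i))) has_field_derivative
      Polygamma 1 (of_real (w i) * (1 - s) + cnj (\<mu> i)) * (- of_real (w i))) (at s)" if "i < k" for i
    using assms[OF that]
    by (intro DERIV_chain2[where f = Digamma] D) (auto intro!: derivative_eq_intros)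
  have 2: "((\<lambda>s. Digamma (of_real (w i) * s + \<mu> i)) has_field_derivative
      Polygamma 1 (of_real (w i) * s + \<mu> i) * of_real (w i)) (at s)" if "i < k" for i
    using assms[OF that]
    by (intro DERIV_chain2[where f = Digamma] D) (auto intro!: derivative_eq_intros)
  have "((\<lambda>s. \<Sum>i<k. of_real (w i) * (Digamma (of_real (w i) * (1 - s) + cnj (\<mu> i)) + Digamma (of_real (w i)
      * s + \<mu> i)))
      has_field_derivative (\<Sum>i<k. of_real (w i) * (Polygamma 1 (of_real (w i) * (1 - s) + cnj (\<mu> i)) * (-
          of_real (w i)) +
        Polygamma 1 (of_real (w i) * s + \<mu> i) * of_real (w i)))) (at s)"
    by (intro DERIV_sum DERIV_cmult DERIV_add 1 2) auto
  then have "(fe_L Q k w \<mu> has_field_derivative (0 -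
      (\<Sum>i<k. of_real (w i) * (Polygamma 1 (of_real (w i) * (1 - s) + cnj (\<mu> i)) * (- of_real (w i)) +
        Polygamma 1 (of_real (w i) * s + \<mu> i) * of_real (w i))))) (at s)"
    unfolding fe_L_def by (intro DERIV_diff DERIV_const)
  moreover have "(0 -
      (\<Sum>i<k. of_real (w i) * (Polygamma 1 (of_real (w i) * (1 - s) + cnj (\<mu> i)) * (- of_real (w i)) +
        Polygamma 1 (of_real (w i) * s + \<mu> i) * of_real (w i)))) = fe_L' k w \<mu> s"
    unfolding fe_L'_def by (simp add: sum_negf[symmetric] algebra_simps power2_eq_square)
  ultimately show ?thesis by simp
qed

text \<open>On Re s = -1 the two Gamma arguments have real parts -w + Re \<mu> and 2 * w + Re \<mu>
  and opposite imaginary parts. Conjugation brings both to the same height y of order w * t, and the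
  distance 3 * w of the real parts becomes the factor of ln t; the sum of the two
  \<open>Digamma\<close> values gives 2 * w.\<close>

lemma gamma_term_estimate:
  assumes w: "w > 0"
  shows "\<exists>C T. \<forall>t\<ge>T. let z1 = of_real w * Complex (-1) t + \<mu>; z2 = of_real w * (1 - Complex (-1) t) + cnj \<mu> in
     \<bar>Re (ln_Gamma z2 - ln_Gamma z1) - 3 * w * ln t\<bar> \<le> C \<and>
     \<bar>Re (of_real w * (Digamma z2 + Digamma z1)) - 2 * w * ln t\<bar> \<le> C \<and>
     norm (of_real (w ^ 2) * (Polygamma 1 z2 - Polygamma 1 z1)) \<le> C / t"
proof -
  \<comment> \<open>\<open>K\<close> forces y \<ge> 2 and both real parts into [-y / 2, y / 2];
    \<open>T\<close> forces w * t / 2 \<ge> |Im \<mu>| + K, so that y lies between w * t / 2 and 2 *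
    w * t. \<open>B\<close> bounds |ln y - ln t|.\<close>
  define K where "K = 2 + 2 * (2 * w + \<bar>Re \<mu>\<bar>)"
  define B where "B = \<bar>ln w\<bar> + ln 2"
  have B: "B \<ge> 0" by (simp add: B_def)
  define C where "C = 51 * w + 34 * w + 3 * w * B + 64 * w"
  define T where "T = 1 + 2 * (\<bar>Im \<mu>\<bar> + K) / w"
  have K: "K > 2" using w by (auto simp: K_def)
  have "let z1 = of_real w * Complex (-1) t + \<mu>; z2 = of_real w * (1 - Complex (-1) t) + cnj \<mu> in
     \<bar>Re (ln_Gamma z2 - ln_Gamma z1) - 3 * w * ln t\<bar> \<le> C \<and>
     \<bar>Re (of_real w * (Digamma z2 + Digamma z1)) - 2 * w * ln t\<bar> \<le> C \<and>
     norm (of_real (w ^ 2) * (Polygamma 1 z2 - Polygamma 1 z1)) \<le> C / t" if t: "t \<ge> T" for t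
  proof -
    define y where "y = w * t + Im \<mu>"
    define x1 where "x1 = - w + Re \<mu>"
    define x2 where "x2 = 2 * w + Re \<mu>"
    have z1: "of_real w * Complex (-1) t + \<mu> = Complex x1 y"
      by (simp add: complex_eq_iff x1_def y_def)
    have z2: "of_real w * (1 - Complex (-1) t) + cnj \<mu> = Complex x2 (- y)"
      by (simp add: complex_eq_iff x2_def y_def)
    have "2 * (\<bar>Im \<mu>\<bar> + K) / w \<ge> 0" using w K by (intro divide_nonneg_pos) auto
    then have t0: "t > 0" "t \<ge> 1" using t by (auto simp: T_def)
    have wt: "w * t / 2 \<ge> \<bar>Im \<mu>\<bar> + K"
    proof -
      have "2 * (\<bar>Im \<mu>\<bar> + K) / w \<le> t" using t by (simp add: T_def)
      then show ?thesis using w by (simp add: field_simps)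
    qed
    have y: "y \<ge> w * t / 2" "y \<le> 2 * w * t" "y \<ge> K"
    proof -
      show "y \<ge> w * t / 2" using wt K unfolding y_def by linarith
      show "y \<le> 2 * w * t" using wt K unfolding y_def by linarith
      show "y \<ge> K" using wt K unfolding y_def by linarith
    qed
    have y2: "y \<ge> 2" "\<bar>x1\<bar> \<le> y / 2" "\<bar>x2\<bar> \<le> y / 2"
    proof -
      have Ky: "2 + 2 * (2 * w + \<bar>Re \<mu>\<bar>) \<le> y" using y(3) by (simp add: K_def)
      then show "y \<ge> 2" using w by (smt (verit))
      show "\<bar>x1\<bar> \<le> y / 2" using Ky w unfolding x1_def by (smt (verit) field_sum_of_halves)
      show "\<bar>x2\<bar> \<le> y / 2" using Ky w unfolding x2_def by (smt (verit) field_sum_of_halves)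
    qed
    have "ln (w * t / 2) \<le> ln y" using y y2(1) w t0 by (subst ln_le_cancel_iff) auto
    moreover have "ln (w * t / 2) = ln w + ln t - ln 2" using w t0 by (simp add: ln_mult ln_div)
    moreover have "ln y \<le> ln (2 * w * t)" using y y2(1) w t0 by (subst ln_le_cancel_iff) auto
    moreover have "ln (2 * w * t) = ln 2 + ln w + ln t" using w t0 by (simp add: ln_mult)
    ultimately have lny: "\<bar>ln y - ln t\<bar> \<le> B"
      unfolding B_def abs_le_iff using abs_ge_self[of "ln w"] abs_ge_minus_self[of "ln w"]
      by (intro conjI; linarith)
    have "Re (ln_Gamma (Complex x2 (-y))) = Re (ln_Gamma (Complex x2 y))"
      using Re_ln_Gamma_cnj[of "Complex x2 y"] y2 by (simp add: complex_cnj)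
    moreover have "\<bar>Re (ln_Gamma (Complex x2 y)) - Re (ln_Gamma (Complex x1 y)) - (x2 - x1) * ln \<bar>y\<bar>\<bar> \<le>
        17 * (x2 - x1)"
      using y2 w by (intro Re_ln_Gamma_diff) (auto simp: x1_def x2_def)
    moreover have "x2 - x1 = 3 * w" by (simp add: x1_def x2_def)
    ultimately have a: "\<bar>Re (ln_Gamma (Complex x2 (-y)) - ln_Gamma (Complex x1 y)) - 3 * w * ln y\<bar> \<le> 51 * w"
      using y2 by simp
    have "\<bar>3 * w * (ln y - ln t)\<bar> \<le> 3 * w * B"
      using lny w by (simp add: abs_mult mult_left_mono)
    with a have A: "\<bar>Re (ln_Gamma (Complex x2 (-y)) - ln_Gamma (Complex x1 y)) - 3 * w * ln t\<bar> \<le>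
        51 * w + 3 * w * B"
      by (simp add: algebra_simps abs_le_iff)
    have "\<bar>Re (Digamma (Complex x2 (-y))) - ln y\<bar> \<le> 17" "\<bar>Re (Digamma (Complex x1 y)) - ln y\<bar> \<le> 17"
      using Re_Digamma_approx[of "Complex x2 (-y)"] Re_Digamma_approx[of "Complex x1 y"] y2 by auto
    with lny have "\<bar>Re (Digamma (Complex x2 (-y)) + Digamma (Complex x1 y)) - 2 * ln t\<bar> \<le> 34 + 2 * B"
      by simp
    then have "w * \<bar>Re (Digamma (Complex x2 (-y)) + Digamma (Complex x1 y)) - 2 * ln t\<bar> \<le> w * (34 + 2 * B)"
      using w by (intro mult_left_mono) auto
    also have "w * \<bar>Re (Digamma (Complex x2 (-y)) + Digamma (Complex x1 y)) - 2 * ln t\<bar> =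
        \<bar>Re (of_real w * (Digamma (Complex x2 (-y)) + Digamma (Complex x1 y))) - 2 * w * ln t\<bar>"
      using w by (simp add: abs_mult[symmetric, of w, unfolded abs_of_pos[OF w]] algebra_simps)
    finally have Bd: "\<bar>Re (of_real w * (Digamma (Complex x2 (-y)) + Digamma (Complex x1 y))) - 2 * w * ln t\<bar>
        \<le> w * (34 + 2 * B)" .
    have "norm (Polygamma 1 (Complex x2 (-y))) \<le> 16 / y" "norm (Polygamma 1 (Complex x1 y)) \<le> 16 / y"
      using norm_Polygamma_1_le[of "Complex x2 (-y)"] norm_Polygamma_1_le[of "Complex x1 y"] y2 by auto
    then have "norm (Polygamma 1 (Complex x2 (-y)) - Polygamma 1 (Complex x1 y)) \<le> 16 / y + 16 / y"
      by (intro order.trans[OF norm_triangle_ineq4] add_mono)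
    also have "\<dots> = 32 / y" by simp
    also have "\<dots> \<le> 32 / (w * t / 2)" using y(1) y2(1) w t0 by (intro divide_left_mono mult_pos_pos) auto
    finally have "norm (of_real (w ^ 2) * (Polygamma 1 (Complex x2 (-y)) - Polygamma 1 (Complex x1 y))) \<le>
        w ^ 2 * (32 / (w * t / 2))"
      unfolding norm_mult using w by (intro mult_mono) (auto simp: norm_power)
    also have "\<dots> = 64 * w / t" using w by (simp add: power2_eq_square)
    also have "\<dots> \<le> C / t" using t0 w B by (intro divide_right_mono) (auto simp: C_def)
    finally have P: "norm (of_real (w ^ 2) * (Polygamma 1 (Complex x2 (-y)) - Polygamma 1 (Complex x1 y))) \<le>
        C / t" .
    have "51 * w + 3 * w * B \<le> C" "w * (34 + 2 * B) \<le> C"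
      using w mult_nonneg_nonneg[of w B] B unfolding C_def distrib_left
      by (simp_all add: mult_ac)
    with A Bd P show ?thesis unfolding z1 z2 Let_def by linarith
  qed
  then show ?thesis by blast
qed

lemma fe_estimates:
  assumes w: "\<And>i. i < k \<Longrightarrow> w i > 0"
  obtains C T where "T \<ge> 2" "C > 0"
    "\<And>s i. Im s \<ge> T \<Longrightarrow> i < k \<Longrightarrow> w i * Im s + Im (\<mu> i) > 0"
    "\<And>t. t \<ge> T \<Longrightarrow> \<bar>Re (fe_G Q k w \<mu> (Complex (-1) t)) - 3 * (\<Sum>i<k. w i) * ln t\<bar> \<le> C"
    "\<And>t. t \<ge> T \<Longrightarrow> \<bar>Re (fe_L Q k w \<mu> (Complex (-1) t)) + 2 * (\<Sum>i<k. w i) * ln t\<bar> \<le> C"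
    "\<And>t. t \<ge> T \<Longrightarrow> norm (fe_L' k w \<mu> (Complex (-1) t)) \<le> C / t"
proof -
  define z1 where "z1 i t = of_real (w i) * Complex (-1) t + \<mu> i" for i t
  define z2 where "z2 i t = of_real (w i) * (1 - Complex (-1) t) + cnj (\<mu> i)" for i t
  have "\<forall>i\<in>{..<k}. \<exists>CT. \<forall>t\<ge>snd CT.
     \<bar>Re (ln_Gamma (z2 i t) - ln_Gamma (z1 i t)) - 3 * w i * ln t\<bar> \<le> fst CT \<and>
     \<bar>Re (of_real (w i) * (Digamma (z2 i t) + Digamma (z1 i t))) - 2 * w i * ln t\<bar> \<le> fst CT \<and>
     norm (of_real (w i ^ 2) * (Polygamma 1 (z2 i t) - Polygamma 1 (z1 i t))) \<le> fst CT / t"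
    using gamma_term_estimate[OF w] unfolding z1_def z2_def Let_def by fastforce
  then obtain CT where CT: "\<And>i t. i < k \<Longrightarrow> t \<ge> snd (CT i) \<Longrightarrow>
     \<bar>Re (ln_Gamma (z2 i t) - ln_Gamma (z1 i t)) - 3 * w i * ln t\<bar> \<le> fst (CT i) \<and>
     \<bar>Re (of_real (w i) * (Digamma (z2 i t) + Digamma (z1 i t))) - 2 * w i * ln t\<bar> \<le> fst (CT i) \<and>
     norm (of_real (w i ^ 2) * (Polygamma 1 (z2 i t) - Polygamma 1 (z1 i t))) \<le> fst (CT i) / t"
    unfolding bchoice_iff by auto
  \<comment> \<open>The last sum makes every w i * t + Im (\<mu> i) positive, so that no Gamma
    argument meets the real axis.\<close>
  define T where "T = 2 + (\<Sum>i<k. \<bar>snd (CT i)\<bar>) + (\<Sum>i<k. (\<bar>Im (\<mu> i)\<bar> + 1) / w i)"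
  define C where "C = 1 + 3 * \<bar>ln Q\<bar> + (\<Sum>i<k. \<bar>fst (CT i)\<bar>)"
  have nn: "(\<Sum>i<k. (\<bar>Im (\<mu> i)\<bar> + 1) / w i) \<ge> 0" using w by (intro sum_nonneg) (auto intro!: divide_nonneg_pos)
  have nn': "(\<Sum>i<k. \<bar>snd (CT i)\<bar>) \<ge> 0" "(\<Sum>i<k. \<bar>fst (CT i)\<bar>) \<ge> 0" by (auto intro: sum_nonneg)
  have T2: "T \<ge> 2" using nn nn' by (simp add: T_def)
  have Ti: "snd (CT i) \<le> T" if "i < k" for i
    using member_le_sum[of i "{..<k}" "\<lambda>i. \<bar>snd (CT i)\<bar>"] that nn by (auto simp: T_def)
  have C0: "C > 0" unfolding C_def using nn' by linarith
  note CT' = CT[OF _ order.trans[OF Ti]]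
  show ?thesis
  proof (rule that[OF T2 C0])
    fix s i assume s: "Im s \<ge> T" and i: "i < k"
    have "(\<bar>Im (\<mu> i)\<bar> + 1) / w i \<le> (\<Sum>i<k. (\<bar>Im (\<mu> i)\<bar> + 1) / w i)"
      using w i by (intro member_le_sum) (auto intro!: divide_nonneg_pos)
    then have "(\<bar>Im (\<mu> i)\<bar> + 1) / w i \<le> Im s" using s nn'(1) unfolding T_def by linarith
    then show "w i * Im s + Im (\<mu> i) > 0" using w[OF i] by (simp add: field_simps)
  next
    fix t assume t: "t \<ge> T"
    have "Re (fe_G Q k w \<mu> (Complex (-1) t)) - 3 * (\<Sum>i<k. w i) * ln t =
        3 * ln Q + (\<Sum>i<k. Re (ln_Gamma (z2 i t) - ln_Gamma (z1 i t)) - 3 * w i * ln t)"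
      by (simp add: fe_G_def Re_sum z1_def z2_def sum_subtractf sum_distrib_left sum_distrib_right)
    also have "\<bar>\<dots>\<bar> \<le> 3 * \<bar>ln Q\<bar> + \<bar>(\<Sum>i<k. Re (ln_Gamma (z2 i t) - ln_Gamma (z1 i t)) - 3 * w i * ln t)\<bar>"
      by linarith
    also have "\<bar>(\<Sum>i<k. Re (ln_Gamma (z2 i t) - ln_Gamma (z1 i t)) - 3 * w i * ln t)\<bar> \<le> (\<Sum>i<k. \<bar>fst (CT i)\<bar>)"
      using CT'[OF _ _ t] by (intro order.trans[OF sum_abs] sum_mono order.trans[OF _ abs_ge_self]) blast
    finally show "\<bar>Re (fe_G Q k w \<mu> (Complex (-1) t)) - 3 * (\<Sum>i<k. w i) * ln t\<bar> \<le> C"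
      by (simp add: C_def)
    have "Re (fe_L Q k w \<mu> (Complex (-1) t)) + 2 * (\<Sum>i<k. w i) * ln t =
        - 2 * ln Q - (\<Sum>i<k. Re (of_real (w i) * (Digamma (z2 i t) + Digamma (z1 i t))) - 2 * w i * ln t)"
      by (simp add: fe_L_def Re_sum z1_def z2_def sum_subtractf sum_distrib_left sum_distrib_right)
    also have "\<bar>\<dots>\<bar> \<le> 2 * \<bar>ln Q\<bar> + \<bar>(\<Sum>i<k. Re (of_real (w i) * (Digamma (z2 i t) + Digamma (z1 i t))) - 2 * w
        i * ln t)\<bar>"
      by linarith
    also have "\<bar>(\<Sum>i<k. Re (of_real (w i) * (Digamma (z2 i t) + Digamma (z1 i t))) - 2 * w i * ln t)\<bar> \<le>
        (\<Sum>i<k. \<bar>fst (CT i)\<bar>)"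
      using CT'[OF _ _ t] by (intro order.trans[OF sum_abs] sum_mono order.trans[OF _ abs_ge_self]) blast
    finally show "\<bar>Re (fe_L Q k w \<mu> (Complex (-1) t)) + 2 * (\<Sum>i<k. w i) * ln t\<bar> \<le> C"
      by (simp add: C_def)
    have t0: "t > 0" using t T2 by simp
    have "norm (fe_L' k w \<mu> (Complex (-1) t)) \<le>
        (\<Sum>i<k. norm (of_real (w i ^ 2) * (Polygamma 1 (z2 i t) - Polygamma 1 (z1 i t))))"
      unfolding fe_L'_def z1_def z2_def by (rule norm_sum)
    also have "\<dots> \<le> (\<Sum>i<k. \<bar>fst (CT i)\<bar> / t)"
    proof (rule sum_mono)
      fix i assume "i \<in> {..<k}"
      then have "norm (of_real (w i ^ 2) * (Polygamma 1 (z2 i t) - Polygamma 1 (z1 i t))) \<le> fst (CT i) / t"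
        using CT'[OF _ _ t] by blast
      also have "\<dots> \<le> \<bar>fst (CT i)\<bar> / t" using t0 by (intro divide_right_mono) auto
      finally show "norm (of_real (w i ^ 2) * (Polygamma 1 (z2 i t) - Polygamma 1 (z1 i t))) \<le> \<bar>fst (CT i)\<bar> / t" .
    qed
    also have "\<dots> = (\<Sum>i<k. \<bar>fst (CT i)\<bar>) / t" by (simp add: sum_divide_distrib)
    also have "\<dots> \<le> C / t" using t0 by (intro divide_right_mono) (auto simp: C_def)
    finally show "norm (fe_L' k w \<mu> (Complex (-1) t)) \<le> C / t" .
  qed
qed

text \<open>Passes from the functional equation off a sparse set to its value at a point of
  continuity.\<close>

lemma eventually_eq_at_imp_eq:
  fixes f g :: "complex \<Rightarrow> complex"
  assumes "eventually (\<lambda>w. f w = g w) (at z)" "isCont f z" "isCont g z"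
  shows "f z = g z"
proof -
  have "f \<midarrow>z\<rightarrow> f z" "g \<midarrow>z\<rightarrow> g z" using assms by (auto simp: isCont_def)
  with tendsto_cong[OF assms(1)] show ?thesis by (metis at_neq_bot tendsto_unique)
qed

lemma functional_equation_exp:
  assumes ana: "selberg_analytic a"
    and fe: "\<forall>\<^sub>\<approx>s\<in>UNIV. gamma_factor \<epsilon> Q k w \<mu> s * Dfun a s =
        cnj_fun (\<lambda>s. gamma_factor \<epsilon> Q k w \<mu> s * Dfun a s) (1 - s)"
    and \<epsilon>: "norm \<epsilon> = 1" and Q: "Q > 0"
    and s: "Im s > 0" "\<And>i. i < k \<Longrightarrow> w i * Im s + Im (\<mu> i) > 0"
  shows "Dfun a s = cnj \<epsilon> / \<epsilon> * exp (fe_G Q k w \<mu> s) * cnj (Dfun a (1 - cnj s))"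
proof -
  define \<gamma> where "\<gamma> = gamma_factor \<epsilon> Q k w \<mu>"
  have D: "isCont (Dfun a) z" if "z \<noteq> 1" for z
    using that holomorphic_on_imp_continuous_on[OF Dfun_holomorphic[OF ana]]
    by (auto simp: continuous_on_eq_continuous_at open_Compl)
  have s2: "w i * Im s + Im (\<mu> i) \<noteq> 0" if "i < k" for i
    using s(2)[OF that] by simp
  have g1: "isCont \<gamma> s"
    unfolding \<gamma>_def gamma_factor_def using Q s2
    by (intro continuous_intros isCont_powr_complex isCont_Gamma not_nonpos_Ints_Im) auto
  have g2: "isCont \<gamma> (1 - cnj s)"
    unfolding \<gamma>_def gamma_factor_def using Q s2
    by (intro continuous_intros isCont_powr_complex isCont_Gamma not_nonpos_Ints_Im) auto
  have s1: "s \<noteq> 1" "1 - cnj s \<noteq> 1" using s by auto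
  have c1: "isCont (\<lambda>s. \<gamma> s * Dfun a s) s" by (intro continuous_intros g1 D s1)
  have c2: "isCont (\<lambda>s. \<gamma> s * Dfun a s) (1 - cnj s)" by (intro continuous_intros g2 D s1)
  have c3: "isCont (\<lambda>s. cnj_fun (\<lambda>s. \<gamma> s * Dfun a s) (1 - s)) s"
  proof -
    have "isCont (\<lambda>s. \<gamma> s * Dfun a s) (cnj (1 - s))" using c2 by simp
    then have "isCont (\<lambda>s. (\<lambda>s. \<gamma> s * Dfun a s) (cnj (1 - s))) s"
      by (rule isCont_o2[rotated]) (intro continuous_intros)
    then show ?thesis unfolding cnj_fun_def by (rule isCont_cnj)
  qed
  have "\<gamma> s * Dfun a s = cnj_fun (\<lambda>s. \<gamma> s * Dfun a s) (1 - s)"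
    using fe c1 c3 unfolding \<gamma>_def[symmetric]
    by (intro eventually_eq_at_imp_eq) (auto simp: eventually_cosparse_open_eq)
  then have eq: "\<gamma> s * Dfun a s = cnj (\<gamma> (1 - cnj s)) * cnj (Dfun a (1 - cnj s))"
    by (simp add: cnj_fun_def)
  have \<gamma>1: "\<gamma> s = \<epsilon> * exp (s * of_real (ln Q)) * exp (\<Sum>i<k. ln_Gamma (of_real (w i) * s + \<mu> i))"
    unfolding \<gamma>_def gamma_factor_def using Q s
    by (auto simp: powr_def Ln_of_real exp_sum intro!: prod.cong exp_ln_Gamma_Im[symmetric] dest: s2)
  have "cnj (Gamma (of_real (w i) * (1 - cnj s) + \<mu> i)) =
      exp (ln_Gamma (of_real (w i) * (1 - s) + cnj (\<mu> i)))" if "i < k" for i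
    using s2[OF that] by (subst exp_ln_Gamma_Im) (auto simp: cnj_Gamma)
  then have \<gamma>2: "cnj (\<gamma> (1 - cnj s)) = cnj \<epsilon> * exp ((1 - s) * of_real (ln Q)) *
      exp (\<Sum>i<k. ln_Gamma (of_real (w i) * (1 - s) + cnj (\<mu> i)))"
    unfolding \<gamma>_def gamma_factor_def using Q
    by (auto simp: powr_def Ln_of_real exp_sum cnj_prod exp_cnj)
  have E: "exp (fe_G Q k w \<mu> s) = exp ((1 - s) * of_real (ln Q)) *
      exp (\<Sum>i<k. ln_Gamma (of_real (w i) * (1 - s) + cnj (\<mu> i))) /
      (exp (s * of_real (ln Q)) * exp (\<Sum>i<k. ln_Gamma (of_real (w i) * s + \<mu> i)))"
    unfolding fe_G_def
    by (simp add: exp_add[symmetric] exp_diff[symmetric] sum_subtractf algebra_simps)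
  have e0: "\<epsilon> \<noteq> 0" using \<epsilon> by auto
  have alg: "D = c / e * E * X" if "e * u * v * D = c * p * r * X" "E = p * r / (u * v)" "u \<noteq> 0" "v \<noteq> 0" "e \<noteq> 0"
    for D c e E X p r u v :: complex
  proof -
    have "E * (u * v) = p * r" using that by simp
    then have "(c * X) * (E * (u * v)) = (c * X) * (p * r)" by (simp only:)
    then have "(e * D) * (u * v) = (c * E * X) * (u * v)" using that(1) by (simp only: mult_ac)
    then have "e * D = c * E * X" using that(3,4) by (metis mult_cancel_right no_zero_divisors)
    then show ?thesis using that(5) by (simp add: field_simps)
  qed
  show ?thesis
    by (rule alg[OF eq[unfolded \<gamma>1 \<gamma>2] E exp_not_eq_zero exp_not_eq_zero e0])
qed

section \<open>Growth in a half-strip and shift of the line of integration\<close>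

lemma half_strip_norm_bounds:
  assumes "-1 \<le> Re s" "Re s \<le> 2" "Im s \<ge> 2"
  shows "Im s \<le> norm s" "norm s \<le> 2 * Im s"
  using abs_Im_le_cmod[of s] cmod_le[of s] assms by linarith+

text \<open>One has -\<i> * s = t * (1 + u) with t = Im s and u of order 1 / t, so for large t the
  N-th power stays close to t ^ N. This is the exponent of the damping factor below.\<close>

lemma Re_power_half_strip:
  "\<exists>T\<ge>2. \<forall>s. -1 \<le> Re s \<and> Re s \<le> 2 \<and> Im s \<ge> T \<longrightarrow> Re ((- \<i> * s) ^ N) \<ge> Im s ^ N / 2"
proof -
  have "isCont (\<lambda>u::complex. (1 + u) ^ N) 0" by (intro continuous_intros)
  then have "(\<lambda>u::complex. (1 + u) ^ N) \<midarrow>0\<rightarrow> 1" by (simp add: isCont_def)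
  from LIM_D[OF this, of "1/2"] obtain d where d0: "d > 0"
      "\<And>u::complex. u \<noteq> 0 \<Longrightarrow> norm u < d \<Longrightarrow> norm ((1 + u) ^ N - 1) < 1/2" by auto
  have d: "norm ((1 + u) ^ N - 1) < 1/2" if "norm u < d" for u :: complex
    using d0(2)[of u] that by (cases "u = 0") auto

  define T where "T = 2 + 4 / d"
  have "Re ((- \<i> * s) ^ N) \<ge> Im s ^ N / 2" if s: "-1 \<le> Re s" "Re s \<le> 2" "Im s \<ge> T" for s
  proof -
    define t where "t = Im s"
    have "0 < 2 / d" "4 / d = 2 * (2 / d)" using d0(1) by auto
    then have t: "t \<ge> 2" "t > 2 / d" using s(3) unfolding T_def t_def by linarith+
    define u where "u = - \<i> * of_real (Re s / t)"
    have "norm u = \<bar>Re s\<bar> / t" using t by (simp add: u_def norm_mult norm_divide)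
    also have "\<dots> \<le> 2 / t" using s t by (intro divide_right_mono) auto
    also have "\<dots> < d" using t d0(1) by (simp add: field_simps)
    finally have nu: "norm ((1 + u) ^ N - 1) < 1/2" by (rule d)
    have "- \<i> * s = of_real t * (1 + u)"
      using t by (simp add: u_def t_def complex_eq_iff)
    then have "(- \<i> * s) ^ N = of_real (t ^ N) * (1 + u) ^ N" by (simp add: power_mult_distrib)
    then have "Re ((- \<i> * s) ^ N) = t ^ N * Re ((1 + u) ^ N)" by simp
    moreover have "Re ((1 + u) ^ N) \<ge> 1/2"
      using nu abs_Re_le_cmod[of "(1 + u)^N - 1"] by simp
    ultimately show ?thesis
      using t mult_left_mono[of "1/2" "Re ((1 + u) ^ N)" "t ^ N"] by (simp add: t_def)
  qed
  moreover have "T \<ge> 2" using d0(1) by (simp add: T_def)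
  ultimately show ?thesis by blast
qed

lemma phragmen_lindelof_half_strip:
  fixes f :: "complex \<Rightarrow> complex"
  assumes hol: "f holomorphic_on {s. Im s > U}"
    and growth: "\<And>s. -1 \<le> Re s \<Longrightarrow> Re s \<le> 2 \<Longrightarrow> Im s \<ge> V \<Longrightarrow> norm (f s) \<le> C * exp (norm s powr r)"
    and left: "\<And>t. t \<ge> V \<Longrightarrow> norm (f (Complex (-1) t)) \<le> B * t powr A"
    and right: "\<And>t. t \<ge> V \<Longrightarrow> norm (f (Complex 2 t)) \<le> B * t powr A"
    and A: "A \<ge> 0"
  obtains T K where "T \<ge> 2" "T > U" "T \<ge> V" "K > 0"
    "\<And>s. -1 \<le> Re s \<Longrightarrow> Re s \<le> 2 \<Longrightarrow> Im s \<ge> T \<Longrightarrow> norm (f s) \<le> K * Im s powr A"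
proof -
  \<comment> \<open>\<open>f\<close> is damped by \<open>(-\<i> * s) powr (-A) * exp (- e * (-\<i> * s) ^ N)\<close>, and then \<open>e\<close> tends to \<open>0\<close>.\<close>
  define N where "N = Suc (nat \<lceil>r\<rceil>)"
  have Nr: "r \<le> real (N - 1)" unfolding N_def by simp linarith
  obtain T0 where T0: "T0 \<ge> 2" "\<And>s. -1 \<le> Re s \<Longrightarrow> Re s \<le> 2 \<Longrightarrow> Im s \<ge> T0 \<Longrightarrow> Re ((- \<i> * s) ^ N) \<ge> Im s ^ N / 2"
    using Re_power_half_strip[of N] by blast
  define T where "T = max T0 (max (U + 1) V)"
  have T: "T \<ge> T0" "T > U" "T \<ge> V" "T \<ge> 2" using T0 by (auto simp: T_def)
  define h where "h s = f s * (- \<i> * s) powr (of_real (- A))" for s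
  have holh: "h holomorphic_on {s. Im s > max U 0}"
    unfolding h_def
    by (intro holomorphic_intros holomorphic_on_subset[OF hol]) (auto simp: complex_nonpos_Reals_iff)
  have normh: "norm (h s) = norm (f s) * norm s powr (- A)" if "Im s > 0" for s
    unfolding h_def norm_mult by (subst norm_powr_real_powr') (auto simp: norm_mult)
  have opn: "open {s. Im s > max U 0}" by (rule open_halfspace_Im_gt)
  have conth: "continuous_on {s. Im s > max U 0} h" by (rule holomorphic_on_imp_continuous_on[OF holh])
  have "compact (h ` cbox (Complex (-1) T) (Complex 2 T))"
    using T by (intro compact_continuous_image continuous_on_subset[OF conth]) (auto simp: in_cbox_complex_iff)
  then obtain B2 where "\<forall>x\<in>h ` cbox (Complex (-1) T) (Complex 2 T). norm x \<le> B2"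
    using compact_imp_bounded bounded_iff by blast
  then have B2: "norm (h s) \<le> B2" if "-1 \<le> Re s" "Re s \<le> 2" "Im s = T" for s
    using that by (auto simp: in_cbox_complex_iff)
  define M where "M = max 1 (max \<bar>B\<bar> B2)"
  have M: "M \<ge> 1" "M \<ge> \<bar>B\<bar>" "M \<ge> B2" by (auto simp: M_def)
  have side: "norm (h s) \<le> M" if s: "Re s = -1 \<or> Re s = 2" "Im s \<ge> T" for s
  proof -
    have "s = Complex (-1) (Im s) \<or> s = Complex 2 (Im s)" using s(1) by (auto simp: complex_eq_iff)
    then have "norm (f s) \<le> B * Im s powr A"
      using s left[of "Im s"] right[of "Im s"] T by fastforce
    also have "\<dots> \<le> \<bar>B\<bar> * norm s powr A"
      using A half_strip_norm_bounds(1)[of s] s T by (intro mult_mono powr_mono2) auto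
    finally have "norm (f s) * norm s powr (-A) \<le> \<bar>B\<bar> * norm s powr A * norm s powr (-A)"
      by (rule mult_right_mono) auto
    also have "\<dots> = \<bar>B\<bar>"
    proof -
      have "norm s > 0" using half_strip_norm_bounds(1)[of s] s T by fastforce
      then show ?thesis by (simp add: powr_minus)
    qed
    finally show ?thesis using M normh[of s] s T by simp
  qed
  have main: "norm (h s) \<le> M" if s: "-1 \<le> Re s" "Re s \<le> 2" "Im s \<ge> T" for s
  proof -
    define c where "c = Re ((- \<i> * s) ^ N)"
    have eps: "norm (h s) \<le> M * exp (\<epsilon> * c)" if \<epsilon>: "\<epsilon> > 0" for \<epsilon>
    proof -
      define k where "k z = h z * exp (- of_real \<epsilon> * (- \<i> * z) ^ N)" for z
      have normk: "norm (k z) = norm (h z) * exp (- \<epsilon> * Re ((- \<i> * z) ^ N))" for z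
      proof -
        have "Re (- of_real \<epsilon> * (- \<i> * z) ^ N) = - \<epsilon> * Re ((- \<i> * z) ^ N)"
          by simp
        then show ?thesis unfolding k_def norm_mult norm_exp_eq_Re by simp
      qed
      have kle: "norm (k z) \<le> norm (h z)" if "-1 \<le> Re z" "Re z \<le> 2" "Im z \<ge> T" for z
      proof -
        have "Re ((- \<i> * z) ^ N) \<ge> 0"
          using T0(2)[of z] that T zero_le_power[of "Im z" N] by linarith
        then show ?thesis using \<epsilon> unfolding normk by (intro mult_left_le) auto
      qed
      define K where "K = max 0 (ln (max 1 C))"
      \<comment> \<open>On the top edge Im z = R the damping \<epsilon> * R ^ N / 2 has to exceed (2
        * R) ^ (N - 1) + K, where \<open>K\<close> takes care of the constant \<open>C\<close> of
        the growth hypothesis.\<close>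
      define R where "R = max (Im s + 1) (2 * (2 ^ (N - 1) + K) / \<epsilon>)"
      have R: "R > Im s" "R \<ge> 2 * (2 ^ (N - 1) + K) / \<epsilon>" "R \<ge> 2" "R > T"
        using s T by (auto simp: R_def)
      define S where "S = cbox (Complex (-1) T) (Complex 2 R)"
      have Sin: "z \<in> S \<longleftrightarrow> -1 \<le> Re z \<and> Re z \<le> 2 \<and> T \<le> Im z \<and> Im z \<le> R" for z
        by (auto simp: S_def in_cbox_complex_iff)
      have Ssub: "S \<subseteq> {s. Im s > max U 0}" using T by (auto simp: Sin)
      have holk: "k holomorphic_on {s. Im s > max U 0}"
        unfolding k_def by (intro holomorphic_intros holh)
      have "norm (k s) \<le> M"
      proof (rule maximum_modulus_frontier[of k S])
        show "k holomorphic_on interior S"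
          using holomorphic_on_subset[OF holk] Ssub interior_subset by blast
        show "continuous_on (closure S) k"
          using continuous_on_subset[OF holomorphic_on_imp_continuous_on[OF holk] Ssub]
          by (simp add: S_def)
        show "bounded S" by (simp add: S_def)
        show "s \<in> S" using s R by (simp add: Sin)
        fix z assume "z \<in> frontier S"
        then have z: "z \<in> S" "z \<notin> box (Complex (-1) T) (Complex 2 R)"
          by (auto simp: S_def frontier_cbox)
        then have cases: "Re z = -1 \<or> Re z = 2 \<or> Im z = T \<or> Im z = R"
          by (auto simp: Sin in_box_complex_iff)
        show "norm (k z) \<le> M"
        proof (cases "Im z = R")
          case False
          then have "norm (h z) \<le> M" using cases side[of z] B2[of z] z M by (auto simp: Sin)
          then show ?thesis using kle[of z] z by (auto simp: Sin)
        next
          case True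
          have zs: "-1 \<le> Re z" "Re z \<le> 2" "Im z \<ge> T" using z by (auto simp: Sin)
          have z0: "norm z \<ge> 1" using half_strip_norm_bounds(1)[of z] zs T by simp
          have "norm z powr r \<le> norm z powr real (N - 1)"
            using z0 Nr by (intro powr_mono) auto
          also have "\<dots> = norm z ^ (N - 1)" using z0 by (intro powr_realpow) auto
          also have "\<dots> \<le> (2 * R) ^ (N - 1)"
            using half_strip_norm_bounds(2)[of z] zs T True by (intro power_mono) auto
          finally have e1: "norm z powr r \<le> 2 ^ (N - 1) * R ^ (N - 1)" by (simp add: power_mult_distrib)
          have "R ^ N = R * R ^ (N - 1)" by (simp add: N_def)
          moreover have "\<epsilon> * (R * R ^ (N-1) / 2) \<ge> (2 ^ (N - 1) + K) * R ^ (N - 1)"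
          proof -
            have "\<epsilon> * R / 2 \<ge> 2 ^ (N - 1) + K" using R(2) \<epsilon> by (simp add: field_simps)
            then have "\<epsilon> * R / 2 * R ^ (N-1) \<ge> (2 ^ (N - 1) + K) * R ^ (N-1)"
              using R by (intro mult_right_mono) auto
            then show ?thesis by (simp add: mult_ac)
          qed
          moreover have "\<epsilon> * Re ((- \<i> * z) ^ N) \<ge> \<epsilon> * (R ^ N / 2)"
            using T0(2)[of z] zs T True \<epsilon> by (intro mult_left_mono) auto
          ultimately have e2: "\<epsilon> * Re ((- \<i> * z) ^ N) \<ge> 2 ^ (N - 1) * R ^ (N - 1) + K * R ^ (N - 1)"
            by (simp add: distrib_right)
          have "K * R ^ (N - 1) \<ge> K * 1"
            using R by (intro mult_left_mono one_le_power) (auto simp: K_def)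
          with e1 e2 have e3: "norm z powr r - \<epsilon> * Re ((- \<i> * z) ^ N) \<le> - K" by linarith
          have "norm z powr (- A) \<le> norm z powr 0" using z0 A by (intro powr_mono) auto
          also have "\<dots> = 1"
          proof -
            have "norm z \<noteq> 0" using z0 by linarith
            then show ?thesis by simp
          qed
          finally have "norm (f z) * norm z powr (- A) \<le> norm (f z) * 1" by (intro mult_left_mono) auto
          moreover have "Im z > 0" using zs T by linarith
          ultimately have "norm (h z) \<le> norm (f z) * 1" using normh[of z] by simp
          also have "\<dots> \<le> max 1 C * exp (norm z powr r)"
          proof -
            have "norm (f z) \<le> C * exp (norm z powr r)" using growth[of z] zs T by simp
            also have "\<dots> \<le> max 1 C * exp (norm z powr r)" by (intro mult_right_mono) auto
            finally show ?thesis by simp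
          qed
          finally have "norm (k z) \<le> max 1 C * exp (norm z powr r) * exp (- \<epsilon> * Re ((- \<i> * z) ^ N))"
            unfolding normk by (intro mult_right_mono) auto
          also have "\<dots> = max 1 C * exp (norm z powr r - \<epsilon> * Re ((- \<i> * z) ^ N))"
            by (simp add: exp_diff exp_minus field_simps)
          also have "\<dots> \<le> max 1 C * exp (- K)" using e3 by (intro mult_left_mono) auto
          also have "\<dots> = 1"
          proof -
            have "ln (max 1 C) \<ge> 0" by (intro ln_ge_zero) auto
            then have "K = ln (max 1 C)" by (simp add: K_def)
            moreover have "max 1 C > 0" by linarith
            ultimately show ?thesis by (simp add: exp_minus)
          qed
          finally show ?thesis using M by linarith
        qed
      qed
      then have "norm (h s) * exp (- \<epsilon> * c) \<le> M" by (simp add: normk c_def)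
      then show ?thesis by (simp add: exp_minus field_simps)
    qed
    have "((\<lambda>\<epsilon>. M * exp (\<epsilon> * c)) \<longlongrightarrow> M * exp (0 * c)) (at_right 0)"
      by (intro tendsto_intros)
    then have "norm (h s) \<le> M * exp (0 * c)"
      by (rule tendsto_lowerbound) (use eps in \<open>auto intro!: eventually_mono[OF eventually_at_right_less]\<close>)
    then show ?thesis by simp
  qed
  have "norm (f s) \<le> (M * 2 powr A) * Im s powr A" if s: "-1 \<le> Re s" "Re s \<le> 2" "Im s \<ge> T" for s
  proof -
    have "Im s \<le> norm s" using half_strip_norm_bounds(1)[of s] s T by simp
    then have n0: "norm s > 0" using s T by linarith
    have "norm (f s) * norm s powr (-A) \<le> M" using main[OF s] normh[of s] s T by simp
    then have "norm (f s) * norm s powr (-A) * norm s powr A \<le> M * norm s powr A" by (intro mult_right_mono) auto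
    then have "norm (f s) \<le> M * norm s powr A" using n0 by (simp add: powr_minus field_simps)
    also have "\<dots> \<le> M * (2 * Im s) powr A"
      using half_strip_norm_bounds(2)[of s] s T A M by (intro mult_left_mono powr_mono2) auto
    also have "\<dots> = (M * 2 powr A) * Im s powr A" by (simp add: powr_mult)
    finally show ?thesis .
  qed
  then show ?thesis using that[of T "M * 2 powr A"] T M by auto
qed

text \<open>A primitive P on the convex half-plane replaces Cauchy's theorem for the rectangle: the
  vertical integrals are differences of P, and along each of the two horizontal sides, of length 3,
  P varies by at most 3 * K.\<close>

lemma vertical_integral_shift:
  fixes f :: "complex \<Rightarrow> complex"
  assumes hol: "f holomorphic_on {s. Im s > U}" and "U < p" "p \<le> q"
    and bound: "\<And>s. -1 \<le> Re s \<Longrightarrow> Re s \<le> 2 \<Longrightarrow> Im s = p \<or> Im s = q \<Longrightarrow> norm (f s) \<le> K"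
  shows "norm (integral {p..q} (\<lambda>t. f (Complex (-1) t)) - integral {p..q} (\<lambda>t. f (Complex 2 t))) \<le> 6 * K"
proof -
  let ?S = "{s. Im s > U}"
  have opn: "open ?S" by (rule open_halfspace_Im_gt)
  have cvx: "convex ?S" by (rule convex_halfspace_Im_gt)
  obtain P where P: "\<And>s. s \<in> ?S \<Longrightarrow> (P has_field_derivative f s) (at s)"
    using holomorphic_convex_primitive'[OF cvx opn hol] at_within_open[OF _ opn] by metis
  have int: "\<i> * integral {p..q} (\<lambda>t. f (Complex x t)) = P (Complex x q) - P (Complex x p)" for x
  proof -
    have "((\<lambda>t. \<i> * f (Complex x t)) has_integral (P (Complex x q) - P (Complex x p))) {p..q}"
    proof (rule fundamental_theorem_of_calculus)
      fix t assume t: "t \<in> {p..q}"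
      have "((\<lambda>t. Complex x t) has_vector_derivative \<i>) (at t)"
        unfolding Complex_eq
        by (rule has_vector_derivative_eq_rhs) (auto intro!: derivative_eq_intros has_vector_derivative_of_real)
      from field_vector_diff_chain_at[OF this P] t \<open>U < p\<close>
      have "((\<lambda>t. P (Complex x t)) has_vector_derivative \<i> * f (Complex x t)) (at t)"
        by (simp add: o_def)
      then show "((\<lambda>t. P (Complex x t)) has_vector_derivative \<i> * f (Complex x t)) (at t within {p..q})"
        by (rule has_vector_derivative_at_within)
    qed fact
    then have "integral {p..q} (\<lambda>t. \<i> * f (Complex x t)) = P (Complex x q) - P (Complex x p)"
      by (rule integral_unique)
    then show ?thesis by (simp add: integral_mult_right)
  qed
  have hor: "norm (P (Complex (-1) y) - P (Complex 2 y)) \<le> K * 3" if y: "y = p \<or> y = q" for y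
  proof -
    have "norm (P (Complex (-1) y) - P (Complex 2 y)) \<le> K * norm (Complex (-1) y - Complex 2 y)"
    proof (rule field_differentiable_bound[of "{s. -1 \<le> Re s \<and> Re s \<le> 2 \<and> Im s = y}"])
      show "convex {s. -1 \<le> Re s \<and> Re s \<le> 2 \<and> Im s = y}"
      proof -
        have "{s. -1 \<le> Re s \<and> Re s \<le> 2 \<and> Im s = y} =
            {s. Re s \<ge> -1} \<inter> {s. Re s \<le> 2} \<inter> {s. Im s \<ge> y} \<inter> {s. Im s \<le> y}" by auto
        then show ?thesis
          by (simp only:) (intro convex_Int convex_halfspace_Re_le convex_halfspace_Re_ge
              convex_halfspace_Im_le convex_halfspace_Im_ge)
      qed
      fix z assume z: "z \<in> {s. -1 \<le> Re s \<and> Re s \<le> 2 \<and> Im s = y}"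
      then have "z \<in> ?S" using y assms by auto
      then show "(P has_field_derivative f z) (at z within {s. -1 \<le> Re s \<and> Re s \<le> 2 \<and> Im s = y})"
        using P has_field_derivative_at_within by blast
      show "norm (f z) \<le> K" using bound[of z] z y by auto
    qed auto
    also have "norm (Complex (-1) y - Complex 2 y) = 3" by (simp add: cmod_def)
    finally show ?thesis .
  qed
  have "norm (integral {p..q} (\<lambda>t. f (Complex (-1) t)) - integral {p..q} (\<lambda>t. f (Complex 2 t))) =
      norm (\<i> * integral {p..q} (\<lambda>t. f (Complex (-1) t)) - \<i> * integral {p..q} (\<lambda>t. f (Complex 2 t)))"
    by (simp add: right_diff_distrib[symmetric] norm_mult)
  also have "\<dots> = norm ((P (Complex (-1) q) - P (Complex 2 q)) - (P (Complex (-1) p) - P (Complex 2 p)))"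
    unfolding int by (simp add: algebra_simps)
  also have "\<dots> \<le> K * 3 + K * 3" by (intro order.trans[OF norm_triangle_ineq4] add_mono hor) auto
  finally show ?thesis by simp
qed

section \<open>Oscillatory integrals\<close>

text \<open>Partial integration: with u = v / (\<i> * \<Lambda>) one has v = u' + v * \<Lambda>' /
  (\<i> * \<Lambda>^2). The boundary values of u contribute 2 * M / d, and the remainder M * L / d^2
  per unit of length.\<close>

lemma oscillatory_integral_bound:
  fixes v \<Lambda> \<Lambda>' :: "real \<Rightarrow> complex"
  assumes "p \<le> q"
    and v: "\<And>t. t \<in> {p..q} \<Longrightarrow> (v has_vector_derivative \<i> * v t * \<Lambda> t) (at t)"
    and \<Lambda>: "\<And>t. t \<in> {p..q} \<Longrightarrow> (\<Lambda> has_vector_derivative \<Lambda>' t) (at t)"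
    and bounds: "\<And>t. t \<in> {p..q} \<Longrightarrow> norm (v t) \<le> M" "\<And>t. t \<in> {p..q} \<Longrightarrow> norm (\<Lambda> t) \<ge> d"
      "\<And>t. t \<in> {p..q} \<Longrightarrow> norm (\<Lambda>' t) \<le> L" and d: "d > 0"
  shows "norm (integral {p..q} v) \<le> 2 * M / d + (q - p) * (M * L / d ^ 2)"
proof -
  have nz: "\<Lambda> t \<noteq> 0" if "t \<in> {p..q}" for t using bounds(2)[OF that] d by auto
  define u where "u t = v t / (\<i> * \<Lambda> t)" for t
  have M0: "M \<ge> 0" using bounds(1)[of p] \<open>p \<le> q\<close> norm_ge_zero[of "v p"] by (auto simp del: norm_ge_zero)
  have L0: "L \<ge> 0" using bounds(3)[of p] \<open>p \<le> q\<close> norm_ge_zero[of "\<Lambda>' p"] by (auto simp del: norm_ge_zero)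
  have du: "(u has_vector_derivative (v t - v t * \<Lambda>' t / (\<i> * \<Lambda> t ^ 2))) (at t)" if t: "t \<in> {p..q}" for t
  proof -
    have "(\<Lambda> has_derivative (\<lambda>x. x *\<^sub>R \<Lambda>' t)) (at t)" "(v has_derivative (\<lambda>x. x *\<^sub>R (\<i> * v t * \<Lambda> t))) (at t)"
      using v[OF t] \<Lambda>[OF t] by (auto simp: has_vector_derivative_def)
    then have "(u has_derivative (\<lambda>h. (h *\<^sub>R (\<i> * v t * \<Lambda> t * (\<i> * \<Lambda> t)) - h *\<^sub>R (v t * (\<i> * \<Lambda>' t))) /
             (\<i> * \<Lambda> t * (\<i> * \<Lambda> t)))) (at t)"
      unfolding u_def using nz[OF t] by (auto intro!: derivative_eq_intros)
    moreover have "(\<lambda>h. (h *\<^sub>R (\<i> * v t * \<Lambda> t * (\<i> * \<Lambda> t)) - h *\<^sub>R (v t * (\<i> * \<Lambda>' t))) /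
             (\<i> * \<Lambda> t * (\<i> * \<Lambda> t))) = (\<lambda>x. x *\<^sub>R (v t - v t * \<Lambda>' t / (\<i> * \<Lambda> t ^ 2)))"
      using nz[OF t] by (intro ext) (simp add: field_simps power2_eq_square scaleR_conv_of_real)
    ultimately show ?thesis by (simp add: has_vector_derivative_def)
  qed
  have I1: "((\<lambda>t. v t - v t * \<Lambda>' t / (\<i> * \<Lambda> t ^ 2)) has_integral (u q - u p)) {p..q}"
    using du by (intro fundamental_theorem_of_calculus \<open>p \<le> q\<close>) (auto intro: has_vector_derivative_at_within)
  have "continuous_on {p..q} v"
    by (intro continuous_at_imp_continuous_on ballI has_vector_derivative_continuous[OF v])
  then have I2: "(v has_integral integral {p..q} v) {p..q}"
    using integrable_continuous_real by blast
  have I3: "((\<lambda>t. v t * \<Lambda>' t / (\<i> * \<Lambda> t ^ 2)) has_integral (integral {p..q} v - (u q - u p))) {p..q}"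
    using has_integral_diff[OF I2 I1] by simp
  have "norm (integral {p..q} v - (u q - u p)) \<le> (M * L / d ^ 2) * (q - p)"
  proof -
    have "norm (integral {p..q} v - (u q - u p)) \<le> (M * L / d ^ 2) * Henstock_Kurzweil_Integration.content
        (cbox p q)"
    proof (rule has_integral_bound)
      fix t assume t: "t \<in> cbox p q"
      have "norm (v t * \<Lambda>' t / (\<i> * \<Lambda> t ^ 2)) = norm (v t) * norm (\<Lambda>' t) / norm (\<Lambda> t) ^ 2"
        by (simp add: norm_mult norm_divide norm_power)
      also have "\<dots> \<le> M * L / d ^ 2"
        using bounds t d M0 L0 by (intro frac_le mult_mono power_mono) auto
      finally show "norm (v t * \<Lambda>' t / (\<i> * \<Lambda> t ^ 2)) \<le> M * L / d ^ 2" .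
    qed (use I3 M0 L0 in auto)
    then show ?thesis using \<open>p \<le> q\<close> by simp
  qed
  moreover have ub: "norm (u t) \<le> M / d" if t: "t \<in> {p..q}" for t
  proof -
    have "norm (u t) = norm (v t) / norm (\<Lambda> t)" by (simp add: u_def norm_mult norm_divide)
    also have "\<dots> \<le> M / d" using bounds t d M0 by (intro frac_le) auto
    finally show ?thesis .
  qed
  have "norm (u q - u p) \<le> M / d + M / d"
    using \<open>p \<le> q\<close> by (intro order.trans[OF norm_triangle_ineq4] add_mono ub) auto
  ultimately show ?thesis
    using norm_triangle_ineq[of "integral {p..q} v - (u q - u p)" "u q - u p"] by (simp add: mult.commute)
qed

lemma integral_exp_bound:
  assumes "p \<le> q" "l \<noteq> (0::real)"
  shows "norm (integral {p..q} (\<lambda>t. exp (\<i> * of_real (l * t)))) \<le> 2 / \<bar>l\<bar>"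
proof -
  have "norm (integral {p..q} (\<lambda>t. exp (\<i> * of_real (l * t)))) \<le> 2 * 1 / \<bar>l\<bar> + (q - p) * (1 * 0 / \<bar>l\<bar> ^ 2)"
  proof (rule oscillatory_integral_bound[where \<Lambda> = "\<lambda>_. of_real l" and \<Lambda>' = "\<lambda>_. 0"])
    fix t
    have "((\<lambda>t. \<i> * of_real (l * t)) has_vector_derivative \<i> * of_real l) (at t)"
      by (rule has_vector_derivative_eq_rhs) (auto intro!: derivative_eq_intros has_vector_derivative_of_real)
    from field_vector_diff_chain_at[OF this DERIV_exp]
    show "((\<lambda>t. exp (\<i> * of_real (l * t))) has_vector_derivative
        \<i> * exp (\<i> * of_real (l * t)) * of_real l) (at t)"
      by (simp add: o_def mult_ac)
  qed (use assms in auto)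
  then show ?thesis by simp
qed

lemma integral_series:
  fixes c :: "nat \<Rightarrow> complex" and e :: "nat \<Rightarrow> real \<Rightarrow> complex"
  assumes c: "summable (\<lambda>n. norm (c n))" and cont: "\<And>n. continuous_on {p..q} (e n)"
    and e: "\<And>n t. t \<in> {p..q} \<Longrightarrow> norm (e n t) \<le> M"
  shows "(\<lambda>n. c n * integral {p..q} (e n)) sums integral {p..q} (\<lambda>t. \<Sum>n. c n * e n t)"
proof -
  have ul: "uniform_limit {p..q} (\<lambda>N t. \<Sum>n<N. c n * e n t) (\<lambda>t. \<Sum>n. c n * e n t) sequentially"
  proof (rule Weierstrass_m_test)
    show "norm (c n * e n t) \<le> norm (c n) * M" if "t \<in> {p..q}" for n t
      using e[OF that] by (simp add: norm_mult mult_left_mono)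
    show "summable (\<lambda>n. norm (c n) * M)" using c by (rule summable_mult2)
  qed
  obtain I J where I: "\<And>N. ((\<lambda>t. \<Sum>n<N. c n * e n t) has_integral I N) {p..q}"
      and J: "((\<lambda>t. \<Sum>n. c n * e n t) has_integral J) {p..q}" "(I \<longlongrightarrow> J) sequentially"
    by (rule uniform_limit_integral[OF ul]) (auto intro!: continuous_intros cont)
  have "I N = (\<Sum>n<N. c n * integral {p..q} (e n))" for N
  proof -
    have "I N = integral {p..q} (\<lambda>t. \<Sum>n<N. c n * e n t)" by (rule integral_unique[OF I, symmetric])
    also have "\<dots> = (\<Sum>n<N. integral {p..q} (\<lambda>t. c n * e n t))"
      by (intro integral_sum integrable_continuous_real continuous_intros cont) auto
    finally show ?thesis by (simp add: integral_mult_right)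
  qed
  then have "I = (\<lambda>N. \<Sum>n<N. c n * integral {p..q} (e n))" by auto
  then show ?thesis using J by (simp add: sums_def integral_unique)
qed

text \<open>Beyond exp 1 * x the logarithms are at distance at least 1, and below there are only
  finitely many integers.\<close>

lemma ln_nat_gap:
  fixes x :: real
  assumes "x > 0"
  obtains d where "d > 0" "\<And>n::nat. n > 0 \<Longrightarrow> real n \<noteq> x \<Longrightarrow> \<bar>ln (real n) - ln x\<bar> \<ge> d"
proof -
  define A where "A = insert 1 ((\<lambda>n. \<bar>ln (real n) - ln x\<bar>) ` {n::nat. n > 0 \<and> real n \<noteq> x \<and> n \<le> nat \<lceil>exp 1 * x\<rceil>})"
  have fin: "finite A" unfolding A_def by auto
  have "Min A \<in> A" using fin by (intro Min_in) (auto simp: A_def)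
  moreover have "y > 0" if "y \<in> A" for y using that assms by (auto simp: A_def)
  ultimately have 1: "Min A > 0" by blast
  have "\<bar>ln (real n) - ln x\<bar> \<ge> Min A" if n: "n > 0" "real n \<noteq> x" for n :: nat
  proof (cases "n \<le> nat \<lceil>exp 1 * x\<rceil>")
    case True
    then show ?thesis using n by (intro Min_le fin) (auto simp: A_def)
  next
    case False
    then have "real n \<ge> exp 1 * x" by linarith
    then have "ln (real n) \<ge> ln (exp 1 * x)" using assms n by (subst ln_le_cancel_iff) auto
    then have "ln (real n) - ln x \<ge> 1" using assms by (simp add: ln_mult)
    moreover have "Min A \<le> 1" by (intro Min_le fin) (auto simp: A_def)
    ultimately show ?thesis by linarith
  qed
  with 1 show ?thesis using that by blast
qed

section \<open>The degree\<close>

text \<open>Gives names to the data that \<open>functional_equation\<close> hides under quantifiers,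
  since the argument has to speak of the sum of the \<open>w i\<close>.\<close>

definition fe_datum ::
  "(nat \<Rightarrow> complex) \<Rightarrow> complex \<Rightarrow> real \<Rightarrow> nat \<Rightarrow> (nat \<Rightarrow> real) \<Rightarrow> (nat \<Rightarrow> complex) \<Rightarrow> bool" where
  "fe_datum a \<epsilon> Q k w \<mu> \<longleftrightarrow> norm \<epsilon> = 1 \<and> Q > 0 \<and> (\<forall>i<k. w i > 0) \<and>
     (\<forall>\<^sub>\<approx>s\<in>UNIV. gamma_factor \<epsilon> Q k w \<mu> s * Dfun a s =
        cnj_fun (\<lambda>s. gamma_factor \<epsilon> Q k w \<mu> s * Dfun a s) (1 - s))"

lemma selberg_class_fe_datum:
  assumes "a \<in> selberg_class"
  obtains \<epsilon> Q k w \<mu> where "fe_datum a \<epsilon> Q k w \<mu>"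
proof -
  have "functional_equation a" using assms by (simp add: selberg_class_def)
  then obtain \<epsilon> Q k w \<mu> where "norm \<epsilon> = 1 \<and> Q > 0 \<and> (\<forall>i<k. w i > 0 \<and> Re (\<mu> i) \<ge> 0) \<and>
     (\<forall>\<^sub>\<approx>s\<in>UNIV. gamma_factor \<epsilon> Q k w \<mu> s * Dfun a s =
        cnj_fun (\<lambda>s. gamma_factor \<epsilon> Q k w \<mu> s * Dfun a s) (1 - s))"
    unfolding functional_equation_def Let_def by blast
  then show ?thesis by (intro that[of \<epsilon> Q k w \<mu>]) (auto simp: fe_datum_def)
qed

lemma selberg_classD:
  assumes "a \<in> selberg_class"
  shows "a 0 = 0" "a 1 = 1" "selberg_analytic a" "ramanujan a" "functional_equation a" "euler_product a"
  using assms by (auto simp: selberg_class_def euler_product_def)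

text \<open>The reflection s \<mapsto> 1 - cnj s keeps the height t and sends Re s = -1 to Re s = 2,
  a line of absolute convergence.\<close>

lemma Dfun_minus_one_line:
  assumes a: "a \<in> selberg_class" and fe: "fe_datum a \<epsilon> Q k w \<mu>"
    and t: "t > 0" "\<And>i. i < k \<Longrightarrow> w i * t + Im (\<mu> i) > 0"
  shows "Dfun a (Complex (-1) t) = cnj \<epsilon> / \<epsilon> * exp (fe_G Q k w \<mu> (Complex (-1) t)) * cnj (Dfun a (Complex 2 t))"
proof -
  have "1 - cnj (Complex (-1) t) = Complex 2 t" by (simp add: complex_eq_iff)
  then show ?thesis
    using functional_equation_exp[OF selberg_classD(3)[OF a], of \<epsilon> Q k w \<mu> "Complex (-1) t"] fe t
    by (simp add: fe_datum_def)
qed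

text \<open>log F is an absolutely convergent series at abscissa 2, because \<theta> < 1/2; hence
  |F| is bounded from both sides on this line.\<close>

lemma ln_norm_Dfun_line_2:
  assumes a: "a \<in> selberg_class"
  obtains C where "\<And>t. Dfun a (Complex 2 t) \<noteq> 0" "\<And>t. \<bar>ln (norm (Dfun a (Complex 2 t)))\<bar> \<le> C"
proof -
  obtain b \<theta> where b: "\<theta> < 1/2" "(\<lambda>n. norm (b n)) \<in> O(\<lambda>n. real n powr \<theta>)"
    "\<And>s. Re s > 1 \<Longrightarrow> exp (dirichlet_series b s) = dirichlet_series a s"
    by (rule euler_productE[OF selberg_classD(6,4)[OF a]]) blast
  have eq: "Dfun a (Complex 2 t) = exp (dirichlet_series b (Complex 2 t))" for t
    using b(3)[of "Complex 2 t"] Dfun_eq_dirichlet_series[OF selberg_classD(3)[OF a], of "Complex 2 t"] by simp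
  have abs: "abs_conv b 2" using abs_conv_bigo[OF b(2), of 2] b(1) by simp
  show ?thesis
  proof (rule that)
    show "Dfun a (Complex 2 t) \<noteq> 0" for t by (simp add: eq)
    show "\<bar>ln (norm (Dfun a (Complex 2 t)))\<bar> \<le> (\<Sum>n. norm (b n) * real n powr (-2))" for t
      using abs_Re_le_cmod[of "dirichlet_series b (Complex 2 t)"]
        norm_dirichlet_series_le[OF abs, of "Complex 2 t"] by (simp add: eq)
  qed
qed

text \<open>Half of the degree of the literature. Defined by growth, so that it does not depend on the
  choice of a functional equation; the factor \<open>3\<close> is the distance of the line \<open>Re s = -1\<close> from
  its mirror image \<open>Re s = 2\<close>.\<close>

definition has_half_degree :: "(nat \<Rightarrow> complex) \<Rightarrow> real \<Rightarrow> bool" where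
  "has_half_degree a W \<longleftrightarrow> (\<exists>C T. \<forall>t\<ge>T. Dfun a (Complex (-1) t) \<noteq> 0 \<and>
     \<bar>ln (norm (Dfun a (Complex (-1) t))) - 3 * W * ln t\<bar> \<le> C)"

lemma has_half_degree_sum:
  assumes a: "a \<in> selberg_class" and fe: "fe_datum a \<epsilon> Q k w \<mu>"
  shows "has_half_degree a (\<Sum>i<k. w i)"
proof -
  have w: "w i > 0" if "i < k" for i using fe that by (simp add: fe_datum_def)
  obtain C T where CT: "T \<ge> 2"
    "\<And>s i. Im s \<ge> T \<Longrightarrow> i < k \<Longrightarrow> w i * Im s + Im (\<mu> i) > 0"
    "\<And>t. t \<ge> T \<Longrightarrow> \<bar>Re (fe_G Q k w \<mu> (Complex (-1) t)) - 3 * (\<Sum>i<k. w i) * ln t\<bar> \<le> C"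
    by (rule fe_estimates[of k w \<mu> Q, OF w]) blast+
  obtain C' where C': "\<And>t. Dfun a (Complex 2 t) \<noteq> 0" "\<And>t. \<bar>ln (norm (Dfun a (Complex 2 t)))\<bar> \<le> C'"
    using ln_norm_Dfun_line_2[OF a] by blast
  have \<epsilon>: "norm \<epsilon> = 1" "\<epsilon> \<noteq> 0" using fe by (auto simp: fe_datum_def)
  have "Dfun a (Complex (-1) t) \<noteq> 0 \<and>
     \<bar>ln (norm (Dfun a (Complex (-1) t))) - 3 * (\<Sum>i<k. w i) * ln t\<bar> \<le> C + C'" if t: "t \<ge> T" for t
  proof -
    have D: "Dfun a (Complex (-1) t) = cnj \<epsilon> / \<epsilon> * exp (fe_G Q k w \<mu> (Complex (-1) t)) * cnj (Dfun a
        (Complex 2 t))"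
      using CT(1) CT(2)[of "Complex (-1) t"] t by (intro Dfun_minus_one_line[OF a fe]) auto
    then have "norm (Dfun a (Complex (-1) t)) = exp (Re (fe_G Q k w \<mu> (Complex (-1) t))) * norm (Dfun a
        (Complex 2 t))"
      using \<epsilon> by (simp add: norm_mult norm_divide)
    then have "ln (norm (Dfun a (Complex (-1) t))) = Re (fe_G Q k w \<mu> (Complex (-1) t)) + ln (norm (Dfun a
        (Complex 2 t)))"
      using C'(1)[of t] by (simp add: ln_mult)
    moreover have "Dfun a (Complex (-1) t) \<noteq> 0" using D \<epsilon> C'(1)[of t] by simp
    ultimately show ?thesis using CT(3)[OF t] C'(2)[of t] by linarith
  qed
  then show ?thesis unfolding has_half_degree_def by blast
qed

lemma has_half_degree_unique:
  assumes "has_half_degree a U" "has_half_degree a V"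
  shows "U = V"
proof (rule ccontr)
  assume "U \<noteq> V"
  obtain C T where 1: "\<And>t. t \<ge> T \<Longrightarrow> \<bar>ln (norm (Dfun a (Complex (-1) t))) - 3 * U * ln t\<bar> \<le> C"
    using assms(1) by (auto simp: has_half_degree_def)
  obtain C' T' where 2: "\<And>t. t \<ge> T' \<Longrightarrow> \<bar>ln (norm (Dfun a (Complex (-1) t))) - 3 * V * ln t\<bar> \<le> C'"
    using assms(2) by (auto simp: has_half_degree_def)
  define y where "y = (C + C' + 1) / (3 * \<bar>U - V\<bar>)"
  define t where "t = max (max T T') (max 1 (exp y))"
  have t: "t \<ge> T" "t \<ge> T'" "t \<ge> exp y" "t \<ge> 1" by (auto simp: t_def)
  have "y \<le> ln t" using t by (simp add: ln_ge_iff)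
  then have "3 * \<bar>U - V\<bar> * y \<le> 3 * \<bar>U - V\<bar> * ln t" by (intro mult_left_mono) auto
  moreover have "3 * \<bar>U - V\<bar> * y = C + C' + 1" using \<open>U \<noteq> V\<close> by (simp add: y_def)
  moreover have "3 * \<bar>U - V\<bar> * ln t = \<bar>3 * U * ln t - 3 * V * ln t\<bar>"
  proof -
    have "\<bar>3 * U * ln t - 3 * V * ln t\<bar> = \<bar>3 * (U - V) * ln t\<bar>"
        by (simp only: left_diff_distrib right_diff_distrib)
    also have "\<dots> = 3 * \<bar>U - V\<bar> * ln t" using t(4) unfolding abs_mult by simp
    finally show ?thesis by simp
  qed
  moreover have "\<bar>3 * U * ln t - 3 * V * ln t\<bar> \<le> C + C'"
  proof -
    have "\<bar>y - z\<bar> \<le> C + C'" if "\<bar>x - y\<bar> \<le> C" "\<bar>x - z\<bar> \<le> C'" for x y z :: real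
      using abs_triangle_ineq4[of "x - z" "x - y"] that by simp
    then show ?thesis using 1[OF t(1)] 2[OF t(2)] .
  qed
  ultimately show False by linarith
qed

lemma has_half_degree_dconv:
  assumes "a \<in> selberg_class" "b \<in> selberg_class" "has_half_degree a U" "has_half_degree b V"
  shows "has_half_degree (dconv a b) (U + V)"
proof -
  obtain C T where 1: "\<And>t. t \<ge> T \<Longrightarrow> Dfun a (Complex (-1) t) \<noteq> 0 \<and>
      \<bar>ln (norm (Dfun a (Complex (-1) t))) - 3 * U * ln t\<bar> \<le> C"
    using assms(3) by (auto simp: has_half_degree_def)
  obtain C' T' where 2: "\<And>t. t \<ge> T' \<Longrightarrow> Dfun b (Complex (-1) t) \<noteq> 0 \<and>
      \<bar>ln (norm (Dfun b (Complex (-1) t))) - 3 * V * ln t\<bar> \<le> C'"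
    using assms(4) by (auto simp: has_half_degree_def)
  have "Dfun (dconv a b) (Complex (-1) t) \<noteq> 0 \<and>
     \<bar>ln (norm (Dfun (dconv a b) (Complex (-1) t))) - 3 * (U + V) * ln t\<bar> \<le> C + C'" if t: "t \<ge> max T T'" for t
  proof -
    have "Complex (-1) t \<noteq> 1" by (simp add: complex_eq_iff)
    then have D: "Dfun (dconv a b) (Complex (-1) t) = Dfun a (Complex (-1) t) * Dfun b (Complex (-1) t)"
      using assms by (intro Dfun_dconv) (auto simp: selberg_class_def)
    have nz: "Dfun a (Complex (-1) t) \<noteq> 0" "Dfun b (Complex (-1) t) \<noteq> 0" using 1[of t] 2[of t] t by auto
    then have "ln (norm (Dfun (dconv a b) (Complex (-1) t))) =
        ln (norm (Dfun a (Complex (-1) t))) + ln (norm (Dfun b (Complex (-1) t)))"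
      by (simp add: D norm_mult ln_mult)
    moreover have "3 * (U + V) * ln t = 3 * U * ln t + 3 * V * ln t" by (simp add: algebra_simps)
    moreover have "\<bar>ln (norm (Dfun a (Complex (-1) t))) - 3 * U * ln t\<bar> \<le> C"
        "\<bar>ln (norm (Dfun b (Complex (-1) t))) - 3 * V * ln t\<bar> \<le> C'" using 1[of t] 2[of t] t by auto
    ultimately show ?thesis using nz D by (simp; linarith)
  qed
  then show ?thesis unfolding has_half_degree_def by blast
qed

text \<open>Phragmen-Lindelof between the lines -1 and 2. The a priori growth is the finite order
  demanded by the class; one exponent 3 * W serves both edges, although |F| is bounded on the right
  one.\<close>

lemma Dfun_growth:
  assumes a: "a \<in> selberg_class" and fe: "fe_datum a \<epsilon> Q k w \<mu>"
  obtains T K where "T \<ge> 2" "K > 0"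
    "\<And>s. -1 \<le> Re s \<Longrightarrow> Re s \<le> 2 \<Longrightarrow> Im s \<ge> T \<Longrightarrow> norm (Dfun a s) \<le> K * Im s powr (3 * (\<Sum>i<k. w i))"
proof -
  define W where "W = (\<Sum>i<k. w i)"
  have w: "w i > 0" if "i < k" for i using fe that by (simp add: fe_datum_def)
  have W: "W \<ge> 0" unfolding W_def using w by (intro sum_nonneg) (auto intro: less_imp_le)
  obtain m g where g: "finite_order g" "\<And>s. s \<noteq> 1 \<Longrightarrow> Dfun a s = g s / (s - 1) ^ m"
    by (rule selberg_analyticE[OF selberg_classD(3)[OF a]]) blast
  obtain r where "(\<lambda>s. norm (g s)) \<in> O[at_infinity](\<lambda>s. exp (norm s powr r))"
    using g(1) by (auto simp: finite_order_def)
  then obtain c where c: "c > 0" "eventually (\<lambda>s. norm (g s) \<le> c * exp (norm s powr r)) at_infinity"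
    by (elim landau_o.bigE) auto
  then obtain b where b: "\<And>s. norm s \<ge> b \<Longrightarrow> norm (g s) \<le> c * exp (norm s powr r)"
    by (auto simp: eventually_at_infinity)
  obtain C T where CT: "\<And>t. t \<ge> T \<Longrightarrow> Dfun a (Complex (-1) t) \<noteq> 0 \<and>
      \<bar>ln (norm (Dfun a (Complex (-1) t))) - 3 * W * ln t\<bar> \<le> C"
    using has_half_degree_sum[OF a fe] by (auto simp: has_half_degree_def W_def)
  obtain C' where C': "\<And>t. Dfun a (Complex 2 t) \<noteq> 0" "\<And>t. \<bar>ln (norm (Dfun a (Complex 2 t)))\<bar> \<le> C'"
    using ln_norm_Dfun_line_2[OF a] by blast
  define V where "V = max 2 (max T b)"
  define B where "B = exp (max C C')"
  have "Dfun a holomorphic_on {s. Im s > 0}"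
    by (rule holomorphic_on_subset[OF Dfun_holomorphic[OF selberg_classD(3)[OF a]]]) auto
  then obtain T' K where "T' \<ge> 2" "K > 0"
      "\<And>s. -1 \<le> Re s \<Longrightarrow> Re s \<le> 2 \<Longrightarrow> Im s \<ge> T' \<Longrightarrow> norm (Dfun a s) \<le> K * Im s powr (3 * W)"
  proof (rule phragmen_lindelof_half_strip[where V = V and C = c and r = r and B = B and A = "3 * W"])
    fix s assume s: "-1 \<le> Re s" "Re s \<le> 2" "Im s \<ge> V"
    have V: "V \<ge> 2" "V \<ge> b" by (auto simp: V_def)
    have ns: "norm s \<ge> Im s" "norm (s - 1) \<ge> Im s"
      using abs_Im_le_cmod[of s] abs_Im_le_cmod[of "s - 1"] by auto
    have "s \<noteq> 1" using s V by auto
    then have "norm (Dfun a s) = norm (g s) / norm (s - 1) ^ m" using g(2) by (simp add: norm_divide norm_power)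
    also have "\<dots> \<le> norm (g s) / 1"
      using ns s V by (intro divide_left_mono one_le_power mult_pos_pos zero_less_power) auto
    also have "\<dots> \<le> c * exp (norm s powr r)" using b[of s] ns s V by simp
    finally show "norm (Dfun a s) \<le> c * exp (norm s powr r)" .
  next
    fix t assume t: "t \<ge> V"
    have t1: "t \<ge> T" "t \<ge> 2" using t by (auto simp: V_def)
    have "norm (Dfun a (Complex (-1) t)) = exp (ln (norm (Dfun a (Complex (-1) t))))"
      using CT[OF t1(1)] by simp
    also have "\<dots> \<le> exp (max C C' + 3 * W * ln t)"
    proof (subst exp_le_cancel_iff)
      have "ln (norm (Dfun a (Complex (-1) t))) - 3 * W * ln t \<le> C" using CT[OF t1(1)] abs_le_D1 by blast
      then show "ln (norm (Dfun a (Complex (-1) t))) \<le> max C C' + 3 * W * ln t" by simp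
    qed
    also have "\<dots> = B * t powr (3 * W)" using t1 by (simp add: B_def exp_add powr_def)
    finally show "norm (Dfun a (Complex (-1) t)) \<le> B * t powr (3 * W)" .
    have "norm (Dfun a (Complex 2 t)) = exp (ln (norm (Dfun a (Complex 2 t))))"
      using C'(1)[of t] by simp
    also have "\<dots> \<le> exp (max C C' + 3 * W * ln t)"
    proof (subst exp_le_cancel_iff)
      have "0 \<le> 3 * W * ln t" using W t1 by (intro mult_nonneg_nonneg) auto
      moreover have "ln (norm (Dfun a (Complex 2 t))) \<le> C'" using C'(2)[of t] abs_le_D1 by blast
      ultimately show "ln (norm (Dfun a (Complex 2 t))) \<le> max C C' + 3 * W * ln t" by simp
    qed
    also have "\<dots> = B * t powr (3 * W)" using t1 by (simp add: B_def exp_add powr_def)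
    finally show "norm (Dfun a (Complex 2 t)) \<le> B * t powr (3 * W)" .
  qed (use W in auto)
  then show ?thesis using that unfolding W_def by blast
qed

section \<open>Mean values on the line Re s = 2\<close>

lemma Dfun_line_2_sums:
  assumes a: "a \<in> selberg_class"
  shows "(\<lambda>n. a n * of_nat n powr (-2) * exp (- (\<i> * of_real (ln (real n) * t)))) sums Dfun a (Complex 2 t)"
    and "summable (\<lambda>n. norm (a n * of_nat n powr (-2)))"
proof -
  have abs: "abs_conv a 2" using ramanujan_abs_conv[OF selberg_classD(4)[OF a], of 2] by simp
  have "(\<lambda>n. a n * of_nat n powr (- Complex 2 t)) sums Dfun a (Complex 2 t)"
    using abs_conv_sums[OF abs, of "Complex 2 t"] Dfun_eq_dirichlet_series[OF selberg_classD(3)[OF a],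
        of "Complex 2 t"]
    by simp
  moreover have "a n * of_nat n powr (- Complex 2 t) = a n * of_nat n powr (-2) * exp (- (\<i> * of_real (ln
      (real n) * t)))" for n
    by (cases "n = 0") (simp_all add: powr_def Complex_eq exp_add[symmetric] algebra_simps)
  ultimately show "(\<lambda>n. a n * of_nat n powr (-2) * exp (- (\<i> * of_real (ln (real n) * t)))) sums Dfun a
      (Complex 2 t)"
    by simp
  show "summable (\<lambda>n. norm (a n * of_nat n powr (-2)))"
    using abs_conv_norm_summable[OF abs, of 2] by simp
qed

lemma norm_integral_exp_le:
  assumes "p \<le> q" "\<bar>l\<bar> \<ge> d" "d > 0"
  shows "norm (integral {p..q} (\<lambda>t. exp (\<i> * of_real (l * t)))) \<le> 2 / d"
proof -
  have "norm (integral {p..q} (\<lambda>t. exp (\<i> * of_real (l * t)))) \<le> 2 / \<bar>l\<bar>"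
    using assms by (intro integral_exp_bound) auto
  also have "\<dots> \<le> 2 / d" using assms by (intro divide_left_mono) auto
  finally show ?thesis .
qed

text \<open>After multiplication by m powr (\<i> * t) only the term n = m is constant. Every other
  frequency ln m - ln n is at least d in modulus, so its integral is at most 2 / d, uniformly in p
  and q.\<close>

lemma Dfun_line_2_mean:
  assumes a: "a \<in> selberg_class" and m: "m > 0"
  obtains E where "\<And>p q. p \<le> q \<Longrightarrow>
     norm (integral {p..q} (\<lambda>t. Dfun a (Complex 2 t) * exp (\<i> * of_real (ln (real m) * t)))
        - of_real (q - p) * (a m * of_nat m powr (-2))) \<le> E"
proof -
  obtain d where d: "d > 0" "\<And>n::nat. n > 0 \<Longrightarrow> real n \<noteq> real m \<Longrightarrow> \<bar>ln (real n) - ln (real m)\<bar> \<ge> d"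
    using ln_nat_gap[of "real m"] m by auto
  define c where "c n = a n * of_nat n powr (-2)" for n
  have c: "summable (\<lambda>n. norm (c n))" unfolding c_def by (rule Dfun_line_2_sums(2)[OF a])
  define e where "e n t = exp (\<i> * of_real ((ln (real m) - ln (real n)) * t))" for n t
  have eq: "Dfun a (Complex 2 t) * exp (\<i> * of_real (ln (real m) * t)) = (\<Sum>n. c n * e n t)" for t
  proof -
    have S: "(\<lambda>n. c n * exp (- (\<i> * of_real (ln (real n) * t))) * exp (\<i> * of_real (ln (real m) * t))) sums
       (Dfun a (Complex 2 t) * exp (\<i> * of_real (ln (real m) * t)))"
      unfolding c_def by (intro sums_mult2 Dfun_line_2_sums[OF a])
    have eqn: "c n * exp (- (\<i> * of_real (ln (real n) * t))) * exp (\<i> * of_real (ln (real m) * t)) =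
        c n * e n t" for n
      by (simp add: e_def mult.assoc algebra_simps flip: exp_add)
    show ?thesis using S unfolding eqn by (simp only: sums_iff)
  qed
  show ?thesis
  proof (rule that)
    fix p q :: real assume pq: "p \<le> q"
    have "(\<lambda>n. c n * integral {p..q} (e n)) sums integral {p..q} (\<lambda>t. \<Sum>n. c n * e n t)"
      by (rule integral_series[OF c, where M = 1]) (auto simp: e_def intro!: continuous_intros)
    then have "(\<lambda>n. c n * integral {p..q} (e n) - (if n = m then c n * integral {p..q} (e n) else 0)) sums
        (integral {p..q} (\<lambda>t. \<Sum>n. c n * e n t) - c m * integral {p..q} (e m))"
      by (rule sums_diff) (use sums_single[of m "\<lambda>n. c n * integral {p..q} (e n)"] in simp)
    moreover have "integral {p..q} (e m) = of_real (q - p)"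
    proof -
      have "e m = (\<lambda>_. 1)" by (simp add: e_def fun_eq_iff)
      then show ?thesis using pq by (simp add: scaleR_conv_of_real)
    qed
    ultimately have S: "(\<lambda>n. c n * integral {p..q} (e n) - (if n = m then c n * integral {p..q} (e n) else 0)) sums
        (integral {p..q} (\<lambda>t. \<Sum>n. c n * e n t) - of_real (q - p) * c m)" by (simp add: mult.commute)
    have "norm (\<Sum>n. c n * integral {p..q} (e n) - (if n = m then c n * integral {p..q} (e n) else 0)) \<le>
        (\<Sum>n. norm (c n) * (2 / d))"
    proof (rule norm_suminf_le)
      fix n
      show "norm (c n * integral {p..q} (e n) - (if n = m then c n * integral {p..q} (e n) else 0)) \<le>
          norm (c n) * (2 / d)"
      proof (cases "n = m \<or> n = 0")
        case True
        then show ?thesis using d by (auto simp: c_def)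
      next
        case False
        then have "norm (integral {p..q} (e n)) \<le> 2 / d"
          unfolding e_def using d(1) d(2)[of n] pq
          by (intro norm_integral_exp_le) (auto simp: abs_minus_commute[of "ln (real m)"])
        then have "norm (c n * integral {p..q} (e n)) \<le> norm (c n) * (2 / d)"
          unfolding norm_mult by (rule mult_left_mono) simp
        then show ?thesis using False by simp
      qed
    qed (rule summable_mult2[OF c])
    then show "norm (integral {p..q} (\<lambda>t. Dfun a (Complex 2 t) * exp (\<i> * of_real (ln (real m) * t)))
        - of_real (q - p) * (a m * of_nat m powr (-2))) \<le> (\<Sum>n. norm (c n) * (2 / d))"
      using S by (simp only: eq c_def[symmetric] sums_iff)
  qed
qed

text \<open>The line is shifted for F s * m powr s. The twist has modulus 1 / m on the left line, m
  ^ 2 on the right line and at most m ^ 2 between them, which explains the weights.\<close>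

lemma Dfun_line_shift:
  assumes a: "a \<in> selberg_class" and m: "m > 0" and p: "0 < p" "p \<le> q"
    and bound: "\<And>s. -1 \<le> Re s \<Longrightarrow> Re s \<le> 2 \<Longrightarrow> Im s = p \<or> Im s = q \<Longrightarrow> norm (Dfun a s) \<le> K"
  shows "norm (of_real (1 / real m) * integral {p..q} (\<lambda>t. Dfun a (Complex (-1) t) * exp (\<i> * of_real (ln
      (real m) * t)))
     - of_real (real m ^ 2) * integral {p..q} (\<lambda>t. Dfun a (Complex 2 t) * exp (\<i> * of_real (ln (real m) *
         t)))) \<le> 6 * (K * real m ^ 2)"
proof -
  define f where "f s = Dfun a s * exp (s * of_real (ln (real m)))" for s
  have f1: "f (Complex (-1) t) = of_real (1 / real m) * (Dfun a (Complex (-1) t) * exp (\<i> * of_real (ln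
      (real m) * t)))" for t
  proof -
    have "exp (Complex (-1) t * of_real (ln (real m))) = exp (of_real (- ln (real m))) * exp (\<i> * of_real
        (ln (real m) * t))"
      by (simp add: Complex_eq algebra_simps flip: exp_add)
    also have "exp (of_real (- ln (real m))) = (of_real (1 / real m) :: complex)"
      using m unfolding exp_of_real by (simp add: exp_minus inverse_eq_divide)
    finally show ?thesis by (simp add: f_def)
  qed
  have f2: "f (Complex 2 t) = of_real (real m ^ 2) * (Dfun a (Complex 2 t) * exp (\<i> * of_real (ln (real m) *
      t)))" for t
  proof -
    have "exp (Complex 2 t * of_real (ln (real m))) = exp (of_real (2 * ln (real m))) * exp (\<i> * of_real (ln
        (real m) * t))"
      by (simp add: Complex_eq algebra_simps flip: exp_add)
    also have "exp (of_real (2 * ln (real m))) = (of_real (real m ^ 2) :: complex)"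
      using m unfolding exp_of_real by (simp add: exp_double)
    finally show ?thesis by (simp add: f_def)
  qed
  have "f holomorphic_on {s. Im s > 0}"
    unfolding f_def
    by (intro holomorphic_intros holomorphic_on_subset[OF Dfun_holomorphic[OF selberg_classD(3)[OF a]]]) auto
  then have "norm (integral {p..q} (\<lambda>t. f (Complex (-1) t)) - integral {p..q} (\<lambda>t. f (Complex 2 t))) \<le>
      6 * (K * real m ^ 2)"
  proof (rule vertical_integral_shift)
    fix s assume s: "-1 \<le> Re s" "Re s \<le> 2" "Im s = p \<or> Im s = q"
    have "norm (exp (s * of_real (ln (real m)))) = exp (Re s * ln (real m))" by simp
    also have "\<dots> \<le> exp (2 * ln (real m))" using s m by (simp add: mult_right_mono)
    also have "\<dots> = real m ^ 2" using m by (simp add: exp_double)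
    finally show "norm (f s) \<le> K * real m ^ 2"
      unfolding f_def norm_mult using bound[OF s] by (intro mult_mono) (auto intro: order.trans[OF norm_ge_zero])
  qed (use p in auto)
  then show ?thesis unfolding f1 f2 integral_mult_right .
qed

text \<open>An integer has distance at least 1/2 from X = N + 1/2. Below X this gives 1 / (2 * X) by
  ln x \<le> x - 1; above X it gives (1/2) / (X + 1/2), which is at least 1 / (4 * X) as X \<ge>
  1/2.\<close>

lemma one_half_gap:
  fixes n N :: nat
  assumes "n > 0"
  shows "\<bar>ln (real n) - ln (real N + 1/2)\<bar> \<ge> 1 / (4 * (real N + 1/2))"
proof -
  define X where "X = real N + 1/2"
  have X: "X \<ge> 1/2" by (simp add: X_def)
  show ?thesis
  proof (cases "n \<le> N")
    case True
    then have "real n \<le> X - 1/2" by (simp add: X_def)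
    moreover have "ln (real n / X) \<le> real n / X - 1" using assms X by (intro ln_le_minus_one) auto
    ultimately have "ln (real n) - ln X \<le> (X - 1/2) / X - 1"
      using assms X divide_right_mono[of "real n" "X - 1/2" X] by (simp add: ln_div)
    also have "\<dots> \<le> - (1 / (4 * X))" using X by (simp add: field_simps)
    finally show ?thesis unfolding X_def by linarith
  next
    case False
    then have n: "real n \<ge> X + 1/2" by (simp add: X_def)
    have "ln (X / real n) \<le> X / real n - 1" using assms X by (intro ln_le_minus_one) auto
    moreover have "X / real n \<le> X / (X + 1/2)" using n X by (intro divide_left_mono) auto
    ultimately have "ln X - ln (real n) \<le> X / (X + 1/2) - 1" using assms X by (simp add: ln_div)
    also have "\<dots> \<le> - (1 / (4 * X))" using X by (simp add: field_simps)
    finally show ?thesis unfolding X_def by linarith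
  qed
qed

text \<open>The phase \<open>Im (fe_G s) + t * ln n\<close> on \<open>s = -1 + \<i> * t\<close> is stationary when \<open>n\<close> is near
  \<open>exp (l t)\<close> with \<open>l t = - Re (fe_L s)\<close>, of order \<open>t powr (2 * W)\<close>. At a height \<open>T\<close> where \<open>exp (l T)\<close> is a half-integer \<open>X\<close> no
  term is stationary on \<open>[T, T + H]\<close> with \<open>H\<close> a small multiple of \<open>T / X\<close>, and partial integration
  bounds the integral of \<open>F\<close> by a multiple of \<open>T powr (5 * W)\<close>. The mean value of \<open>F\<close> on
  \<open>Re s = 2\<close> makes it about \<open>H\<close>, of order \<open>T powr (1 - 2 * W)\<close>.\<close>

lemma half_degree_lower_bound:
  assumes a: "a \<in> selberg_class" and fe: "fe_datum a \<epsilon> Q k w \<mu>" and "k > 0"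
  shows "(\<Sum>i<k. w i) \<ge> 1/7"
proof (rule ccontr)
  assume "\<not> (\<Sum>i<k. w i) \<ge> 1/7"
  define W where "W = (\<Sum>i<k. w i)"
  have w: "w i > 0" if "i < k" for i using fe that by (simp add: fe_datum_def)
  have W: "W > 0" "W < 1/7"
    using \<open>\<not> _\<close> \<open>k > 0\<close> w unfolding W_def by (auto intro!: sum_pos)
  have \<epsilon>: "norm (cnj \<epsilon> / \<epsilon>) = 1" using fe by (auto simp: fe_datum_def norm_divide)
  obtain C T0 where C: "T0 \<ge> 2" "C > 0"
    "\<And>s i. Im s \<ge> T0 \<Longrightarrow> i < k \<Longrightarrow> w i * Im s + Im (\<mu> i) > 0"
    "\<And>t. t \<ge> T0 \<Longrightarrow> \<bar>Re (fe_G Q k w \<mu> (Complex (-1) t)) - 3 * (\<Sum>i<k. w i) * ln t\<bar> \<le> C"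
    "\<And>t. t \<ge> T0 \<Longrightarrow> \<bar>Re (fe_L Q k w \<mu> (Complex (-1) t)) + 2 * (\<Sum>i<k. w i) * ln t\<bar> \<le> C"
    "\<And>t. t \<ge> T0 \<Longrightarrow> norm (fe_L' k w \<mu> (Complex (-1) t)) \<le> C / t"
    by (rule fe_estimates[of k w \<mu> Q, OF w]) blast+
  obtain T1 B where B: "T1 \<ge> 2" "B > 0"
    "\<And>s. -1 \<le> Re s \<Longrightarrow> Re s \<le> 2 \<Longrightarrow> Im s \<ge> T1 \<Longrightarrow> norm (Dfun a s) \<le> B * Im s powr (3 * (\<Sum>i<k. w i))"
    using Dfun_growth[OF a fe] by blast
  obtain E where E: "\<And>p q. p \<le> q \<Longrightarrow>
     norm (integral {p..q} (\<lambda>t. Dfun a (Complex 2 t) * exp (\<i> * of_real (ln (real 1) * t)))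
        - of_real (q - p) * (a 1 * of_nat 1 powr (-2))) \<le> E"
    using Dfun_line_2_mean[OF a, of 1] by auto
  define G where "G t = fe_G Q k w \<mu> (Complex (-1) t)" for t
  define L where "L t = fe_L Q k w \<mu> (Complex (-1) t)" for t
  define L' where "L' t = fe_L' k w \<mu> (Complex (-1) t)" for t
  have line: "((\<lambda>t. Complex (-1) t) has_vector_derivative \<i>) (at t)" for t
    unfolding Complex_eq
    by (rule has_vector_derivative_eq_rhs) (auto intro!: derivative_eq_intros has_vector_derivative_of_real)
  have dG: "(G has_vector_derivative \<i> * L t) (at t)" if "t \<ge> T0" for t
    using field_vector_diff_chain_at[OF line fe_G_has_field_derivative[of k w "Complex (-1) t"
        \<mu> Q]] C(3)[of "Complex (-1) t"] that
    by (simp add: o_def G_def[abs_def] L_def)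
  have dL: "(L has_vector_derivative \<i> * L' t) (at t)" if "t \<ge> T0" for t
    using field_vector_diff_chain_at[OF line fe_L_has_field_derivative[of k w "Complex (-1) t"
        \<mu> Q]] C(3)[of "Complex (-1) t"] that
    by (simp add: o_def L_def[abs_def] L'_def)
  define c where "c n = cnj (a n * of_nat n powr (-2))" for n
  have c: "summable (\<lambda>n. norm (c n))" unfolding c_def complex_mod_cnj by (rule Dfun_line_2_sums(2)[OF a])
  have c0: "c 0 = 0" by (simp add: c_def)
  define A where "A = (\<Sum>n. norm (c n))"
  have A: "A \<ge> 0" unfolding A_def by (intro suminf_nonneg c) auto
  define v where "v n t = exp (G t + \<i> * of_real (ln (real n) * t))" for n t
  have dv: "(v n has_vector_derivative \<i> * v n t * (L t + of_real (ln (real n)))) (at t)" if "t \<ge> T0" for n t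
  proof -
    have "((\<lambda>t. G t + \<i> * of_real (ln (real n) * t)) has_vector_derivative (\<i> * L t + \<i> * of_real (ln (real
        n)))) (at t)"
      by (rule has_vector_derivative_eq_rhs)
         (auto intro!: derivative_eq_intros has_vector_derivative_of_real dG that)
    from field_vector_diff_chain_at[OF this DERIV_exp] show ?thesis
      by (simp add: v_def[abs_def] o_def algebra_simps)
  qed
  have Dv: "Dfun a (Complex (-1) t) = cnj \<epsilon> / \<epsilon> * (\<Sum>n. c n * v n t)" if t: "t \<ge> T0" for t
  proof -
    have S: "(\<lambda>n. exp (G t) * cnj (a n * of_nat n powr (-2) * exp (- (\<i> * of_real (ln (real n) * t))))) sums
        (exp (G t) * cnj (Dfun a (Complex 2 t)))"
      by (intro sums_mult sums_cnj[THEN iffD2] Dfun_line_2_sums(1)[OF a])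
    have eqn: "exp (G t) * cnj (a n * of_nat n powr (-2) * exp (- (\<i> * of_real (ln (real n) * t)))) =
        c n * v n t" for n
      by (simp add: c_def v_def exp_add exp_cnj)
    have "Dfun a (Complex (-1) t) = cnj \<epsilon> / \<epsilon> * exp (G t) * cnj (Dfun a (Complex 2 t))"
      unfolding G_def using C(1) C(3)[of "Complex (-1) t"] t by (intro Dfun_minus_one_line[OF a fe]) auto
    then show ?thesis using S unfolding eqn by (simp add: sums_iff)
  qed
  define l where "l t = - Re (L t)" for t
  have lest: "\<bar>l t - 2 * W * ln t\<bar> \<le> C" if "t \<ge> T0" for t
    using C(5)[OF that] unfolding l_def L_def W_def by (simp add: abs_minus_commute)
  have dl: "(l has_real_derivative - Re (\<i> * L' t)) (at t)" if "t \<ge> T0" for t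
    unfolding l_def has_real_derivative_iff_has_vector_derivative
    by (intro has_vector_derivative_minus bounded_linear.has_vector_derivative[OF bounded_linear_Re] dL that)
  \<comment> \<open>H * C / T = \<eta> * C / X \<le> 1 / (8 * X) lets \<open>l\<close> move by at
    most half of the gap 1 / (4 * X) to the logarithms of integers; \<eta> \<le> 1/2 \<le> X gives H
    \<le> T.\<close>
  define \<eta> where "\<eta> = min (1/2) (1 / (8 * C))"
  have \<eta>: "\<eta> > 0" "\<eta> \<le> 1/2" "\<eta> * C \<le> 1/8"
    using C(2) by (auto simp: \<eta>_def min_def field_simps)
  have key: "\<exists>T\<ge>R. \<eta> * T \<le> (E + 6 * B * (2 * T) powr (3 * W) + 24 * A * exp C * (2 * T) powr (3 * W) * (exp
      C * T powr (2 * W))) * (exp C * T powr (2 * W))"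
    if R: "R \<ge> max T0 T1" for R
  proof -
    \<comment> \<open>X is a half-integer above exp (l R). Since W > 0, \<open>l\<close> is
      unbounded, and by the intermediate value theorem it takes the value ln X at some T \<ge>
      R.\<close>
    define N where "N = nat \<lceil>exp (l R)\<rceil>"
    define X where "X = real N + 1/2"
    have X: "X \<ge> exp (l R)" "X > 0" "X \<ge> 1/2" unfolding X_def N_def using exp_gt_zero[of "l R"] by linarith+
    have lR: "l R \<le> ln X" using X(1,2) by (simp add: ln_ge_iff)
    \<comment> \<open>At \<open>R2\<close> the lower estimate 2 * W * ln t - C of \<open>l t\<close>
      has reached ln X.\<close>
    define R2 where "R2 = max R (exp ((ln X + C) / (2 * W)))"
    have R2: "R2 \<ge> R" "R2 \<ge> exp ((ln X + C) / (2 * W))" by (auto simp: R2_def)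
    have "R2 > 0" using R2(2) exp_gt_zero less_le_trans by blast
    then have "ln R2 \<ge> (ln X + C) / (2 * W)" using R2(2) by (simp add: ln_ge_iff)
    then have "2 * W * ln R2 \<ge> ln X + C" using W by (simp add: field_simps)
    moreover have "2 * W * ln R2 - l R2 \<le> C"
      using lest[of R2] R R2(1) abs_le_D2[of "l R2 - 2 * W * ln R2" C] by simp
    ultimately have lR2: "ln X \<le> l R2" by simp
    have "\<exists>T. R \<le> T \<and> T \<le> R2 \<and> l T = ln X"
      using lR lR2 R2(1) R by (intro IVT) (auto intro!: DERIV_isCont dl)
    then obtain T where T: "T \<ge> R" "l T = ln X" by blast
    have T': "T \<ge> T0" "T \<ge> T1" "T \<ge> 2" using T(1) R C(1) by auto
    have XT: "X \<le> exp C * T powr (2 * W)"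
    proof -
      have "ln X - 2 * W * ln T \<le> C" using lest[OF T'(1)] T(2) abs_le_D1 by metis
      then have "exp (ln X) \<le> exp (C + 2 * W * ln T)" by (simp only: exp_le_cancel_iff)
      then show ?thesis using X T' by (simp add: exp_add powr_def)
    qed
    define H where "H = \<eta> * T / X"
    have H: "H > 0" "H \<le> T"
    proof -
      show "H > 0" using \<eta> T' X by (simp add: H_def)
      have "\<eta> * T \<le> X * T" using \<eta> X T' by (intro mult_right_mono) auto
      then show "H \<le> T" using X by (simp add: H_def field_simps)
    qed
    define M where "M = exp C * (2 * T) powr (3 * W)"
    have M: "M > 0" using T' by (simp add: M_def)
    have vM: "norm (v n t) \<le> M" if t: "t \<in> {T..T+H}" for n t
    proof -
      have t': "t \<ge> T0" "t \<le> 2 * T" "t > 0" using t H T' by auto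
      have "Re (G t) - 3 * W * ln t \<le> C" using C(4)[OF t'(1)] abs_le_D1 unfolding G_def W_def by blast
      moreover have "3 * W * ln t \<le> 3 * W * ln (2 * T)" using t' W T' by (intro mult_left_mono) auto
      ultimately have "Re (G t) \<le> C + 3 * W * ln (2 * T)" by linarith
      then have "exp (Re (G t)) \<le> exp (C + 3 * W * ln (2 * T))" by simp
      also have "\<dots> = M" using T' by (simp add: M_def exp_add powr_def)
      finally show ?thesis by (simp add: v_def)
    qed
    have Lam: "norm (L t + of_real (ln (real n))) \<ge> 1 / (8 * X)" if t: "t \<in> {T..T+H}" and n: "n > 0" for n t
    proof -
      have "\<bar>l t - l T\<bar> \<le> H * (C / T)"
      proof (cases "t = T")
        case False
        then have "T < t" using t by simp
        then obtain z where z: "T < z" "z < t" "l t - l T = (t - T) * (- Re (\<i> * L' z))"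
          using MVT2[of T t l "\<lambda>z. - Re (\<i> * L' z)"] dl T'(1) by force
        have "\<bar>Re (\<i> * L' z)\<bar> \<le> norm (\<i> * L' z)" by (rule abs_Re_le_cmod)
        also have "\<dots> = norm (L' z)" by (simp add: norm_mult)
        also have "\<dots> \<le> C / z" using C(6)[of z] z T' by (simp add: L'_def)
        also have "\<dots> \<le> C / T" using C(2) z T' by (intro divide_left_mono) auto
        finally have "\<bar>t - T\<bar> * \<bar>- Re (\<i> * L' z)\<bar> \<le> H * (C / T)" using t H by (intro mult_mono) auto
        then show ?thesis unfolding z(3) abs_mult .
      qed (use H C(2) T' in auto)
      also have "H * (C / T) = \<eta> * C / X" using T' by (simp add: H_def)
      also have "\<dots> \<le> (1/8) / X" using \<eta> X by (intro divide_right_mono) auto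
      finally have 1: "\<bar>l t - ln X\<bar> \<le> 1 / (8 * X)" using T(2) by simp
      have 2: "\<bar>ln (real n) - ln X\<bar> \<ge> 1 / (4 * X)" unfolding X_def by (rule one_half_gap[OF n])
      have tri: "u \<le> \<bar>x - y\<bar>" if "\<bar>y - z\<bar> \<le> u" "2 * u \<le> \<bar>x - z\<bar>" for x y z u :: real
        using abs_triangle_ineq[of "x - y" "y - z"] that by simp
      have "\<bar>ln (real n) - l t\<bar> \<ge> 1 / (8 * X)"
        by (rule tri[OF 1]) (use 2 in simp)
      also have "ln (real n) - l t = Re (L t + of_real (ln (real n)))" by (simp add: l_def)
      also have "\<bar>\<dots>\<bar> \<le> norm (L t + of_real (ln (real n)))" by (rule abs_Re_le_cmod)
      finally show ?thesis .
    qed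
    \<comment> \<open>With d = 1 / (8 * X) the boundary terms are 16 * M * X, and the remaining
      integral over the length H is at most 64 * \<eta> * C * M * X \<le> 8 * M * X.\<close>
    have Iv: "norm (integral {T..T+H} (v n)) \<le> 24 * M * X" if n: "n > 0" for n
    proof -
      have "norm (integral {T..T+H} (v n)) \<le> 2 * M / (1 / (8 * X)) + (T + H - T) * (M * (C / T) / (1 / (8 *
          X)) ^ 2)"
      proof (rule oscillatory_integral_bound[where \<Lambda> = "\<lambda>t. L t + of_real (ln (real n))" and \<Lambda>' = "\<lambda>t. \<i> * L' t"])
        fix t assume t: "t \<in> {T..T+H}"
        then have t0: "t \<ge> T0" "t \<ge> T" using T' by auto
        show "(v n has_vector_derivative \<i> * v n t * (L t + of_real (ln (real n)))) (at t)" by (rule dv[OF t0(1)])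
        show "((\<lambda>t. L t + of_real (ln (real n))) has_vector_derivative \<i> * L' t) (at t)"
          by (rule has_vector_derivative_eq_rhs) (auto intro!: derivative_eq_intros dL t0)
        have "norm (\<i> * L' t) = norm (L' t)" by (simp add: norm_mult)
        also have "\<dots> \<le> C / t" using C(6)[OF t0(1)] by (simp add: L'_def)
        also have "\<dots> \<le> C / T" using C(2) t0 T' by (intro divide_left_mono) auto
        finally show "norm (\<i> * L' t) \<le> C / T" .
      qed (use H X vM Lam n in auto)
      also have "\<dots> = 16 * M * X + 64 * (\<eta> * C) * (M * X)"
      proof -
        have "(1 / (8 * X)) ^ 2 = 1 / (64 * X ^ 2)" by (simp add: power_divide power_mult_distrib)
        then have "M * (C / T) / (1 / (8 * X)) ^ 2 = 64 * (M * C * X ^ 2 / T)" by simp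
        moreover have "H * (64 * (M * C * X ^ 2 / T)) = 64 * (\<eta> * C) * (M * X)"
          using X T' by (simp add: H_def power2_eq_square)
        ultimately show ?thesis by simp
      qed
      also have "\<dots> \<le> 16 * M * X + 64 * (1/8) * (M * X)"
        using \<eta> M X by (intro add_left_mono mult_right_mono mult_left_mono) auto
      also have "\<dots> = 24 * M * X" by simp
      finally show ?thesis .
    qed
    have left: "norm (integral {T..T+H} (\<lambda>t. Dfun a (Complex (-1) t))) \<le> 24 * A * M * X"
    proof -
      have cv: "continuous_on {T..T+H} (v n)" for n
        using T' by (intro continuous_at_imp_continuous_on ballI has_vector_derivative_continuous[OF dv]) auto
      have S: "(\<lambda>n. c n * integral {T..T+H} (v n)) sums integral {T..T+H} (\<lambda>t. \<Sum>n. c n * v n t)"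
        by (rule integral_series[OF c cv, where M = M]) (rule vM)
      have "norm (\<Sum>n. c n * integral {T..T+H} (v n)) \<le> (\<Sum>n. norm (c n) * (24 * M * X))"
      proof (rule norm_suminf_le)
        show "norm (c n * integral {T..T+H} (v n)) \<le> norm (c n) * (24 * M * X)" for n
          using Iv[of n] c0 by (cases "n = 0") (simp_all add: norm_mult mult_left_mono del: mult.assoc)
      qed (rule summable_mult2[OF c])
      also have "\<dots> = A * (24 * M * X)" unfolding A_def by (rule suminf_mult2[OF c, symmetric])
      finally have "norm (integral {T..T+H} (\<lambda>t. \<Sum>n. c n * v n t)) \<le> 24 * A * M * X"
        using S by (simp add: sums_iff mult_ac)
      moreover have "integral {T..T+H} (\<lambda>t. Dfun a (Complex (-1) t)) =
          integral {T..T+H} (\<lambda>t. cnj \<epsilon> / \<epsilon> * (\<Sum>n. c n * v n t))"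
        using Dv T' by (intro integral_cong) auto
      ultimately show ?thesis using \<epsilon> by (simp only: integral_mult_right norm_mult mult_1_left)
    qed
    have shift: "norm (integral {T..T+H} (\<lambda>t. Dfun a (Complex (-1) t)) - integral {T..T+H} (\<lambda>t. Dfun a
        (Complex 2 t)))
        \<le> 6 * (B * (2 * T) powr (3 * W))"
    proof -
      have "norm (Dfun a s) \<le> B * (2 * T) powr (3 * W)"
        if "-1 \<le> Re s" "Re s \<le> 2" "Im s = T \<or> Im s = T + H" for s
      proof -
        have "norm (Dfun a s) \<le> B * Im s powr (3 * W)" using B(3)[of s] that T' H by (auto simp: W_def)
        also have "\<dots> \<le> B * (2 * T) powr (3 * W)"
          using B(2) W that T' H by (intro mult_left_mono powr_mono2) auto
        finally show ?thesis .
      qed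
      from Dfun_line_shift[OF a _ _ _ this, of 1 T "T + H"] show ?thesis using T' H by simp
    qed
    have right: "norm (integral {T..T+H} (\<lambda>t. Dfun a (Complex 2 t)) - of_real H) \<le> E"
      using E[of T "T + H"] H selberg_classD(2)[OF a] by simp
    have "H = norm (of_real H :: complex)" using H by simp
    also have "\<dots> \<le> E + 6 * (B * (2 * T) powr (3 * W)) + 24 * A * M * X"
    proof -
      have tri: "norm h \<le> e1 + e2 + e3" if "norm (y - h) \<le> e1" "norm (x - y) \<le> e2" "norm x \<le> e3"
          for h x y :: complex and e1 e2 e3
      proof -
        have "norm h = norm (x - (x - y) - (y - h))" by simp
        also have "\<dots> \<le> norm x + norm (x - y) + norm (y - h)"
          by (meson norm_triangle_ineq4 order_trans add_right_mono)
        finally show ?thesis using that by linarith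
      qed
      show ?thesis by (rule tri[OF right shift left])
    qed
    also have "\<dots> \<le> E + 6 * (B * (2 * T) powr (3 * W)) + 24 * A * M * (exp C * T powr (2 * W))"
      using XT A M by (intro add_left_mono mult_left_mono) auto
    finally have "\<eta> * T \<le> (E + 6 * (B * (2 * T) powr (3 * W)) + 24 * A * M * (exp C * T powr (2 * W))) * X"
      using X by (simp add: H_def field_simps)
    also have "\<dots> \<le> (E + 6 * (B * (2 * T) powr (3 * W)) + 24 * A * M * (exp C * T powr (2 * W))) * (exp C * T
        powr (2 * W))"
    proof (rule mult_left_mono[OF XT])
      have "E \<ge> 0" using right norm_ge_zero order.trans by blast
      then show "0 \<le> E + 6 * (B * (2 * T) powr (3 * W)) + 24 * A * M * (exp C * T powr (2 * W))"
        using A M B(2) by (intro add_nonneg_nonneg mult_nonneg_nonneg) auto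
    qed
    finally show ?thesis using T(1) by (intro exI[of _ T]) (simp add: M_def mult_ac)
  qed
  \<comment> \<open>In \<open>key\<close>, M contributes the exponent 3 * W, the reciprocal of the
    gap 2 * W, and the multiplication by X that turns H into \<eta> * T another 2 * W. The largest
    total 7 * W is below 1.\<close>
  have "eventually (\<lambda>T. \<eta> * T > (E + 6 * B * (2 * T) powr (3 * W) + 24 * A * exp C * (2 * T) powr (3 * W) *
      (exp C * T powr (2 * W))) * (exp C * T powr (2 * W))) at_top"
  proof -
    define K1 K2 K3 where "K1 = E * exp C" and "K2 = 6 * B * 2 powr (3 * W) * exp C"
      and "K3 = 24 * A * exp C * 2 powr (3 * W) * exp C * exp C"
    have lim: "((\<lambda>T. K1 * T powr (2 * W - 1) + K2 * T powr (5 * W - 1) + K3 * T powr (7 * W - 1)) \<longlongrightarrow> K1 * 0 +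
        K2 * 0 + K3 * 0) at_top"
      by (intro tendsto_intros tendsto_neg_powr filterlim_ident) (use W in auto)
    then have "eventually (\<lambda>T. K1 * T powr (2 * W - 1) + K2 * T powr (5 * W - 1) + K3 * T powr (7 * W - 1) <
        \<eta>) at_top"
      using \<eta>(1) by (intro order_tendstoD(2)) auto
    then show ?thesis using eventually_gt_at_top[of 0]
    proof eventually_elim
      case (elim T)
      have "(E + 6 * B * (2 * T) powr (3 * W) + 24 * A * exp C * (2 * T) powr (3 * W) * (exp C * T powr (2 *
          W))) * (exp C * T powr (2 * W))
          = K1 * T powr (2 * W) + K2 * (T powr (3 * W) * T powr (2 * W)) + K3 * (T powr (3 * W) * T powr (2
              * W) * T powr (2 * W))"
        by (simp add: K1_def K2_def K3_def powr_mult algebra_simps)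
      also have "\<dots> = K1 * T powr (2 * W) + K2 * T powr (5 * W) + K3 * T powr (7 * W)"
        by (simp add: powr_add[symmetric])
      also have "\<dots> = (K1 * T powr (2 * W - 1) + K2 * T powr (5 * W - 1) + K3 * T powr (7 * W - 1)) * T"
        using elim(2) by (simp add: powr_diff field_simps)
      also have "\<dots> < \<eta> * T" using elim by (intro mult_strict_right_mono)
      finally show ?case .
    qed
  qed
  then obtain R where R: "\<And>T. T \<ge> R \<Longrightarrow> \<eta> * T > (E + 6 * B * (2 * T) powr (3 * W) + 24 * A * exp C * (2 * T)
      powr (3 * W) * (exp C * T powr (2 * W))) * (exp C * T powr (2 * W))"
    by (auto simp: eventually_at_top_linorder)
  obtain T where T: "T \<ge> max (max T0 T1) R" "\<eta> * T \<le> (E + 6 * B * (2 * T) powr (3 * W) + 24 * A * exp C * (2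
      * T) powr (3 * W) * (exp C * T powr (2 * W))) * (exp C * T powr (2 * W))"
    using key[of "max (max T0 T1) R"] by auto
  have "T \<ge> R" using T(1) by simp
  from R[OF this] T(2) show False by linarith
qed

text \<open>For \<open>W = 0\<close> the \<open>m\<close>-th mean value of \<open>F\<close>, computed on \<open>Re s = -1\<close> by the functional
  equation, only sees the coefficient with index \<open>n = Q\<^sup>2 / m\<close>.\<close>

lemma degree_zero_coeff:
  assumes a: "a \<in> selberg_class" and fe: "fe_datum a \<epsilon> Q 0 w \<mu>" and m: "m > 0" and nz: "a m \<noteq> 0"
  shows "\<exists>n>0. real n * real m = Q ^ 2"
proof (rule ccontr)
  assume no: "\<not> (\<exists>n>0. real n * real m = Q ^ 2)"
  have Q: "Q > 0" using fe by (simp add: fe_datum_def)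
  obtain d where d: "d > 0" "\<And>n::nat. n > 0 \<Longrightarrow> real n \<noteq> Q ^ 2 / real m \<Longrightarrow> \<bar>ln (real n) - ln (Q ^ 2 / real m)\<bar> \<ge> d"
    using ln_nat_gap[of "Q ^ 2 / real m"] m Q by auto
  obtain T B where B: "T \<ge> 2" "B > 0"
    "\<And>s. -1 \<le> Re s \<Longrightarrow> Re s \<le> 2 \<Longrightarrow> Im s \<ge> T \<Longrightarrow> norm (Dfun a s) \<le> B * Im s powr (3 * (\<Sum>i<0. w i))"
    using Dfun_growth[OF a fe] by blast
  obtain E where E: "\<And>p q. p \<le> q \<Longrightarrow>
     norm (integral {p..q} (\<lambda>t. Dfun a (Complex 2 t) * exp (\<i> * of_real (ln (real m) * t)))
        - of_real (q - p) * (a m * of_nat m powr (-2))) \<le> E"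
    using Dfun_line_2_mean[OF a m] by auto
  define c where "c n = cnj (a n * of_nat n powr (-2))" for n
  have c: "summable (\<lambda>n. norm (c n))" unfolding c_def complex_mod_cnj by (rule Dfun_line_2_sums(2)[OF a])
  have c0: "c 0 = 0" by (simp add: c_def)
  \<comment> \<open>Frequency of the n-th term after the functional equation; for n > 0 it is ln (n
    * m / Q ^ 2) and vanishes only if n * m = Q ^ 2.\<close>
  define l where "l n = ln (real n) + ln (real m) - 2 * ln Q" for n
  define e where "e n t = exp (\<i> * of_real (l n * t))" for n t
  \<comment> \<open>Without Gamma factors exp of \<open>fe_G\<close> is Q powr (1 - 2 * s), of
    modulus Q ^ 3 on Re s = -1.\<close>
  define K where "K = cnj \<epsilon> / \<epsilon> * of_real (Q ^ 3)"
  have Dv: "Dfun a (Complex (-1) t) * exp (\<i> * of_real (ln (real m) * t)) = K * (\<Sum>n. c n * e n t)"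
      if t: "t > 0" for t
  proof -
    have S: "(\<lambda>n. exp (fe_G Q 0 w \<mu> (Complex (-1) t)) * cnj (a n * of_nat n powr (-2) * exp (- (\<i> * of_real
        (ln (real n) * t)))) * exp (\<i> * of_real (ln (real m) * t)))
        sums (exp (fe_G Q 0 w \<mu> (Complex (-1) t)) * cnj (Dfun a (Complex 2 t)) * exp (\<i> * of_real (ln (real
            m) * t)))"
      by (intro sums_mult sums_mult2 sums_cnj[THEN iffD2] Dfun_line_2_sums(1)[OF a])
    have Q3: "exp (of_real (3 * ln Q)) = (of_real (Q ^ 3) :: complex)"
      using Q unfolding exp_of_real exp_of_nat_mult[of 3 "ln Q", simplified] by simp
    have "fe_G Q 0 w \<mu> (Complex (-1) t) = of_real (3 * ln Q) - \<i> * of_real (2 * ln Q * t)"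
      by (simp add: fe_G_def Complex_eq algebra_simps)
    then have G: "exp (fe_G Q 0 w \<mu> (Complex (-1) t)) = of_real (Q ^ 3) * exp (- (\<i> * of_real (2 * ln Q * t)))"
      using Q3 by (simp only: diff_conv_add_uminus exp_add)
    have eqn: "exp (fe_G Q 0 w \<mu> (Complex (-1) t)) * cnj (a n * of_nat n powr (-2) * exp (- (\<i> * of_real (ln
        (real n) * t)))) * exp (\<i> * of_real (ln (real m) * t))
        = of_real (Q ^ 3) * (c n * e n t)" for n
    proof -
      have "e n t = exp (- (\<i> * of_real (2 * ln Q * t))) * exp (\<i> * of_real (ln (real n) * t)) * exp (\<i> *
          of_real (ln (real m) * t))"
        unfolding e_def l_def exp_add[symmetric] by (simp add: algebra_simps)
      then show ?thesis unfolding G c_def by (simp add: exp_cnj mult_ac)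
    qed
    have "Dfun a (Complex (-1) t) = cnj \<epsilon> / \<epsilon> * exp (fe_G Q 0 w \<mu> (Complex (-1) t)) * cnj (Dfun a (Complex 2 t))"
      using t by (intro Dfun_minus_one_line[OF a fe]) auto
    then have D: "Dfun a (Complex (-1) t) * exp (\<i> * of_real (ln (real m) * t)) = cnj \<epsilon> / \<epsilon> *
        (exp (fe_G Q 0 w \<mu> (Complex (-1) t)) * cnj (Dfun a (Complex 2 t)) * exp (\<i> * of_real (ln (real m) * t)))"
      by (simp only: mult.assoc)
    have sm: "summable (\<lambda>n. c n * e n t)"
      using c by (intro summable_norm_cancel[of "\<lambda>n. c n * e n t"]) (simp add: e_def norm_mult)
    have "(\<Sum>n. of_real (Q ^ 3) * (c n * e n t)) = of_real (Q ^ 3) * (\<Sum>n. c n * e n t)"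
      by (rule suminf_mult[OF sm])
    then show ?thesis using S D unfolding eqn K_def by (simp only: sums_iff mult.assoc)
  qed
  have ld: "\<bar>l n\<bar> \<ge> d" if n: "n > 0" for n
  proof -
    have "real n \<noteq> Q ^ 2 / real m"
    proof
      assume "real n = Q ^ 2 / real m"
      then have "real n * real m = Q ^ 2" using m by simp
      with no n show False by blast
    qed
    from d(2)[OF n this] show ?thesis using Q m by (simp add: l_def ln_div ln_realpow algebra_simps)
  qed
  define A where "A = (\<Sum>n. norm (c n) * (2 / d))"
  have left: "norm (integral {p..q} (\<lambda>t. Dfun a (Complex (-1) t) * exp (\<i> * of_real (ln (real m) * t)))) \<le>
      norm K * A"
    if pq: "0 < p" "p \<le> q" for p q
  proof -
    have S: "(\<lambda>n. c n * integral {p..q} (e n)) sums integral {p..q} (\<lambda>t. \<Sum>n. c n * e n t)"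
      by (rule integral_series[OF c, where M = 1]) (auto simp: e_def intro!: continuous_intros)
    have "norm (\<Sum>n. c n * integral {p..q} (e n)) \<le> A"
      unfolding A_def
    proof (rule norm_suminf_le)
      fix n
      show "norm (c n * integral {p..q} (e n)) \<le> norm (c n) * (2 / d)"
      proof (cases "n = 0")
        case False
        then have "norm (integral {p..q} (e n)) \<le> 2 / d"
          unfolding e_def using d(1) ld[of n] pq by (intro norm_integral_exp_le) auto
        then show ?thesis unfolding norm_mult by (rule mult_left_mono) simp
      qed (use c0 in auto)
    qed (rule summable_mult2[OF c])
    then have "norm K * norm (integral {p..q} (\<lambda>t. \<Sum>n. c n * e n t)) \<le> norm K * A"
      using S by (intro mult_left_mono) (simp_all add: sums_iff)
    moreover have "integral {p..q} (\<lambda>t. Dfun a (Complex (-1) t) * exp (\<i> * of_real (ln (real m) * t))) =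
        integral {p..q} (\<lambda>t. K * (\<Sum>n. c n * e n t))"
      using Dv pq by (intro integral_cong) auto
    ultimately show ?thesis by (simp only: integral_mult_right norm_mult)
  qed
  define M where "M = norm (a m * of_nat m powr (-2))"
  have M: "M > 0" using nz m by (simp add: M_def)
  \<comment> \<open>This bound does not depend on the length H of the interval, whereas the mean
    value grows like H * M with M > 0.\<close>
  define R where "R = E + (6 * (B * real m ^ 2) + norm K * A) / real m ^ 2"
  have bound: "H * M \<le> R" if H: "H > 0" for H
  proof -
    have sh: "norm (of_real (1 / real m) * integral {T..T+H} (\<lambda>t. Dfun a (Complex (-1) t) * exp (\<i> * of_real
        (ln (real m) * t)))
     - of_real (real m ^ 2) * integral {T..T+H} (\<lambda>t. Dfun a (Complex 2 t) * exp (\<i> * of_real (ln (real m) *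
         t)))) \<le> 6 * (B * real m ^ 2)"
    proof (rule Dfun_line_shift[OF a m])
      fix s assume s: "-1 \<le> Re s" "Re s \<le> 2" "Im s = T \<or> Im s = T + H"
      then have "Im s \<ge> T" "Im s > 0" using B(1) H by auto
      then show "norm (Dfun a s) \<le> B" using B(3)[of s] s by simp
    qed (use B H in auto)
    have lf: "norm (of_real (1 / real m) * integral {T..T+H} (\<lambda>t. Dfun a (Complex (-1) t) * exp (\<i> * of_real
        (ln (real m) * t)))) \<le> norm K * A"
    proof -
      have "norm (of_real (1 / real m) * integral {T..T+H} (\<lambda>t. Dfun a (Complex (-1) t) * exp (\<i> * of_real
          (ln (real m) * t))))
          \<le> 1 * norm (integral {T..T+H} (\<lambda>t. Dfun a (Complex (-1) t) * exp (\<i> * of_real (ln (real m) * t))))"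
        unfolding norm_mult using m by (intro mult_right_mono) (auto simp: norm_divide)
      then show ?thesis using left[of T "T + H"] B(1) H by simp
    qed
    have "norm (of_real (real m ^ 2) * integral {T..T+H} (\<lambda>t. Dfun a (Complex 2 t) * exp (\<i> * of_real (ln
        (real m) * t)))) \<le> 6 * (B * real m ^ 2) + norm K * A"
    proof -
      have "norm y \<le> e1 + e2" if "norm (x - y) \<le> e1" "norm x \<le> e2" for x y :: complex and e1 e2
        using norm_triangle_ineq4[of x "x - y"] that by simp
      from this[OF sh lf] show ?thesis .
    qed
    then have "real m ^ 2 * norm (integral {T..T+H} (\<lambda>t. Dfun a (Complex 2 t) * exp (\<i> * of_real (ln (real
        m) * t)))) \<le> 6 * (B * real m ^ 2) + norm K * A"
      by (simp add: norm_mult norm_power)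
    then have I: "norm (integral {T..T+H} (\<lambda>t. Dfun a (Complex 2 t) * exp (\<i> * of_real (ln (real m) * t))))
        \<le> (6 * (B * real m ^ 2) + norm K * A) / real m ^ 2"
      using m by (simp add: pos_le_divide_eq mult.commute)
    have "norm (integral {T..T+H} (\<lambda>t. Dfun a (Complex 2 t) * exp (\<i> * of_real (ln (real m) * t)))
        - of_real H * (a m * of_nat m powr (-2))) \<le> E" using E[of T "T + H"] H by simp
    then have "norm (of_real H * (a m * of_nat m powr (-2))) \<le> R"
    proof -
      assume J: "norm (integral {T..T+H} (\<lambda>t. Dfun a (Complex 2 t) * exp (\<i> * of_real (ln (real m) * t)))
        - of_real H * (a m * of_nat m powr (-2))) \<le> E"
      have "norm y \<le> e1 + e2" if "norm (x - y) \<le> e1" "norm x \<le> e2" for x y :: complex and e1 e2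
        using norm_triangle_ineq4[of x "x - y"] that by simp
      from this[OF J I] show ?thesis by (simp add: R_def)
    qed
    moreover have "norm (of_real H * (a m * of_nat m powr (-2))) = H * M"
      using H unfolding M_def norm_mult[of "of_real H"] by simp
    ultimately show ?thesis by simp
  qed
  have "R > 0" using bound[of 1] M by simp
  then have "(2 * R / M) * M \<le> R" using M by (intro bound) auto
  then show False using M \<open>R > 0\<close> by simp
qed

text \<open>The case m = 1 shows that Q ^ 2 is an integer q; then every n in the support has a
  partner k with k * n = q.\<close>

lemma degree_zero_support:
  assumes a: "a \<in> selberg_class" and fe: "fe_datum a \<epsilon> Q 0 w \<mu>"
  obtains q :: nat where "q > 0" "real q = Q ^ 2" "\<And>n. a n \<noteq> 0 \<Longrightarrow> n dvd q"
proof -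
  have "a 1 \<noteq> 0" using selberg_classD(2)[OF a] by simp
  from degree_zero_coeff[OF a fe _ this] obtain q where q: "q > 0" "real q = Q ^ 2" by auto
  have "n dvd q" if "a n \<noteq> 0" for n
  proof -
    have "n > 0" using that selberg_classD(1)[OF a] by (cases "n = 0") auto
    from degree_zero_coeff[OF a fe this that] obtain k where "real k * real n = real q" using q by auto
    then have "k * n = q" by (metis of_nat_eq_iff of_nat_mult)
    then show ?thesis by auto
  qed
  with q show ?thesis using that by blast
qed

text \<open>\<open>F\<close> is now a Dirichlet polynomial, and \<open>b\<close> is supported on the powers of finitely many
  primes, so that \<open>log F\<close> converges absolutely on \<open>Re s = 1/2\<close> because \<open>\<theta> < 1/2\<close>. There the
  functional equation makes \<open>2 * Im (log F) + 2 * ln Q * t\<close> constant, while \<open>Im (log F)\<close> is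
  bounded. Hence \<open>Q = 1\<close>.\<close>

lemma degree_zero_imp_one:
  assumes a: "a \<in> selberg_class" and fe: "fe_datum a \<epsilon> Q 0 w \<mu>"
  shows "a = one_series"
proof -
  obtain q :: nat where q: "q > 0" "real q = Q ^ 2" "\<And>n. a n \<noteq> 0 \<Longrightarrow> n dvd q"
    using degree_zero_support[OF a fe] by blast
  have Q: "Q > 0" using fe by (simp add: fe_datum_def)
  obtain b \<theta> where b: "\<theta> < 1/2" "\<And>n. \<not> primepow n \<Longrightarrow> b n = 0"
    "(\<lambda>n. norm (b n)) \<in> O(\<lambda>n. real n powr \<theta>)"
    "\<And>s. Re s > 1 \<Longrightarrow> exp (dirichlet_series b s) = dirichlet_series a s"
    "\<And>n. n > 0 \<Longrightarrow> a n * of_real (ln (real n)) = (\<Sum>d | d dvd n. a d * (b (n div d) * of_real (ln (real (n div d)))))"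
    by (rule euler_productE[OF selberg_classD(6,4)[OF a]]) blast
  \<comment> \<open>If p does not divide q, then neither does any p ^ i with i > 0, so the recursion
    at p ^ k keeps only d = 1 and its left side vanishes.\<close>
  have bp: "b (p ^ k) = 0" if p: "prime p" "\<not> p dvd q" and k: "k > 0" for p k
  proof -
    have "d = 1" if d: "d dvd p ^ k" "a d \<noteq> 0" for d
    proof -
      obtain i where i: "d = p ^ i" using d(1) divides_primepow_nat[OF p(1)] by blast
      have "d dvd q" using q(3)[OF d(2)] .
      then show ?thesis using i p(2) by (cases i) (auto dest: dvd_mult_left)
    qed
    then have "(\<Sum>d | d dvd p ^ k. a d * (b (p ^ k div d) * of_real (ln (real (p ^ k div d))))) =
        (\<Sum>d\<in>{1}. a d * (b (p ^ k div d) * of_real (ln (real (p ^ k div d)))))"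
      using p(1) by (intro sum.mono_neutral_right) (auto simp: prime_gt_0_nat)
    also have "\<dots> = b (p ^ k) * of_real (ln (real (p ^ k)))" using selberg_classD(2)[OF a] by simp
    finally have "a (p ^ k) * of_real (ln (real (p ^ k))) = b (p ^ k) * of_real (ln (real (p ^ k)))"
      using b(5)[of "p ^ k"] p(1) by (simp add: prime_gt_0_nat)
    moreover have gt: "p ^ k > 1" using k prime_gt_1_nat[OF p(1)] by (intro one_less_power)
    moreover have "a (p ^ k) = 0"
      using q(3)[of "p ^ k"] p(2) k by (meson dvd_power dvd_trans)
    moreover have "ln (real (p ^ k)) \<noteq> 0"
    proof -
      have "real (p ^ k) > 1" using gt by (metis of_nat_1 of_nat_less_iff)
      then show ?thesis using ln_gt_zero by fastforce
    qed
    ultimately show ?thesis by simp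
  qed
  have abs: "abs_conv b (1/2)"
  proof -
    obtain c where c: "c > 0" "eventually (\<lambda>n. norm (b n) \<le> c * real n powr \<theta>) at_top"
      using b(3) by (elim landau_o.bigE) auto
    then obtain N where N: "\<And>n. n \<ge> N \<Longrightarrow> norm (b n) \<le> c * real n powr \<theta>"
      by (auto simp: eventually_at_top_linorder)
    define P where "P = {p. prime p \<and> p dvd q}"
    have P: "finite P" using q(1) by (auto simp: P_def intro!: finite_subset[of _ "{..q}"] dvd_imp_le)
    define S where "S = (\<lambda>(p,k). p ^ Suc k) ` (P \<times> (UNIV :: nat set))"
    \<comment> \<open>The ratio for p = 2, the largest possible one, and below 1 as \<theta> < 1/2;
      each of the finitely many primes contributes at most a geometric series.\<close>
    define r where "r = (2::real) powr (\<theta> - 1/2)"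
    have r: "0 < r" "r < 1" using b(1) by (auto simp: r_def powr_less_one)
    have inj: "inj_on (\<lambda>(p,k). p ^ Suc k) (P \<times> (UNIV :: nat set))"
      by (rule inj_onI) (auto simp: P_def dest: prime_power_inj' simp del: power_Suc)
    have "(\<lambda>(p,k). r * r ^ k) summable_on (P \<times> (UNIV :: nat set))"
    proof (rule summable_on_SigmaI[where g = "\<lambda>_. r * (1 / (1 - r))"])
      have "((\<lambda>k. r ^ k) has_sum 1 / (1 - r)) UNIV"
        using r geometric_sums[of r]
        by (intro norm_summable_imp_has_sum) (simp_all add: norm_power summable_geometric)
      then have "((\<lambda>k. r * r ^ k) has_sum r * (1 / (1 - r))) UNIV" by (rule has_sum_cmult_right)
      then show "((\<lambda>y. case (x, y) of (p, k) \<Rightarrow> r * r ^ k) has_sum r * (1 / (1 - r))) UNIV" if "x \<in> P" for x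
        by simp
    qed (use P r in auto)
    from summable_on_cmult_right[OF this, of c]
    have sm: "(\<lambda>(p,k). c * (r * r ^ k)) summable_on (P \<times> (UNIV :: nat set))"
      by (simp add: case_prod_unfold)
    have le: "real (p ^ Suc k) powr (\<theta> - 1/2) \<le> r * r ^ k" if "p \<in> P" for p k
    proof -
      have p2: "p \<ge> 2" using that by (auto simp: P_def prime_ge_2_nat)
      have "real (p ^ Suc k) powr (\<theta> - 1/2) = (real p powr (\<theta> - 1/2)) ^ Suc k"
        using p2 by (simp add: powr_realpow[symmetric] powr_powr mult.commute del: power_Suc of_nat_Suc)
      also have "\<dots> \<le> r ^ Suc k"
        unfolding r_def using p2 b(1) by (intro power_mono powr_mono2') auto
      finally show ?thesis by simp
    qed
    have "(\<lambda>n. c * real n powr (\<theta> - 1/2)) summable_on S"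
      unfolding S_def
    proof (subst summable_on_reindex[OF inj], rule summable_on_comparison_test[OF sm])
      fix x assume "x \<in> P \<times> (UNIV :: nat set)"
      then show "((\<lambda>n. c * real n powr (\<theta> - 1 / 2)) \<circ> (\<lambda>(p, k). p ^ Suc k)) x \<le> (case x of (p,
          k) \<Rightarrow> c * (r * r ^ k))"
        using le c(1) by (auto intro!: mult_left_mono simp del: power_Suc of_nat_power)
    qed (use c in auto)
    then have "(\<lambda>n. if n \<in> S then c * real n powr (\<theta> - 1/2) else 0) summable_on UNIV"
      by (rule summable_on_cong_neutral[THEN iffD1, rotated -1]) auto
    then have smS: "summable (\<lambda>n. if n \<in> S then c * real n powr (\<theta> - 1/2) else 0)"
      by (rule summable_on_imp_summable)
    show ?thesis
      unfolding abs_conv_def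
    proof (rule summable_comparison_test'[OF smS, of "max N 1"])
      fix n assume n: "n \<ge> max N 1"
      show "norm (norm (b n) * real n powr - (1/2)) \<le> (if n \<in> S then c * real n powr (\<theta> - 1/2) else 0)"
      proof (cases "n \<in> S")
        case True
        have "norm (b n) * real n powr - (1/2) \<le> c * real n powr \<theta> * real n powr - (1/2)"
          using N[of n] n by (intro mult_right_mono) auto
        also have "\<dots> = c * real n powr (\<theta> - 1/2)" by (simp add: mult.assoc flip: powr_add)
        finally show ?thesis using True by simp
      next
        case False
        have "b n = 0"
        proof (cases "primepow n")
          case True
          then obtain p k where pk: "prime p" "k > 0" "n = p ^ k" by (auto simp: primepow_def)
          then obtain j where j: "k = Suc j" by (cases k) auto
          have "p \<notin> P"
          proof
            assume "p \<in> P"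
            then have "n \<in> S" unfolding S_def using pk(3) j by (intro image_eqI[of _ _ "(p, j)"]) auto
            with False show False by simp
          qed
          then show ?thesis using bp[of p k] pk by (auto simp: P_def)
        qed (rule b(2))
        then show ?thesis using False by simp
      qed
    qed
  qed
  have fin: "a n = 0" if "n > q" for n using q(3)[of n] q(1) that dvd_imp_le by force
  define F where "F s = (\<Sum>n\<le>q. a n * of_nat n powr (-s))" for s :: complex
  have Fa: "dirichlet_series a s = F s" for s
    unfolding dirichlet_series_def F_def by (rule suminf_finite) (auto intro!: fin)
  have holF: "F holomorphic_on A" for A
  proof -
    have hn: "(\<lambda>s. a n * of_nat n powr (-s)) holomorphic_on A" for n
      by (cases "n = 0") (auto intro!: holomorphic_intros)
    show ?thesis unfolding F_def[abs_def] by (intro holomorphic_on_sum hn)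
  qed
  have FD: "F s = Dfun a s" if "s \<noteq> 1" for s
    by (rule holomorphic_eq_Dfun[OF selberg_classD(3)[OF a] holF]) (use Fa that in auto)
  \<comment> \<open>Continuation from Re s > 1 to Re s > 1/2; the boundary line follows afterwards
    by continuity.\<close>
  have expb: "exp (dirichlet_series b s) = F s" if "Re s > 1/2" for s
  proof (rule analytic_continuation_open[of "{s. Re s > 1}" "{s. Re s > 1/2}" "\<lambda>s. exp (dirichlet_series b s)" F])
    show "open {s. 1 < Re s}" by (rule open_halfspace_Re_gt)
    show "open {s. 1/2 < Re s}" by (rule open_halfspace_Re_gt)
    show "{s. 1 < Re s} \<noteq> {}" by (auto intro!: exI[of _ 2])
    show "connected {s. 1/2 < Re s}" by (intro convex_connected convex_halfspace_Re_gt)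
    show "(\<lambda>s. exp (dirichlet_series b s)) holomorphic_on {s. 1/2 < Re s}"
      by (intro holomorphic_intros dirichlet_series_holomorphic[OF abs])
    show "exp (dirichlet_series b s) = F s" if "s \<in> {s. 1 < Re s}" for s using b(4)[of s] that Fa by simp
  qed (use that holF in auto)
  define A where "A = (\<Sum>n. norm (b n) * real n powr (- (1/2)))"
  define g where "g t = dirichlet_series b (Complex (1/2) t)" for t
  have holb: "continuous_on {s. Re s \<ge> 1/2} (dirichlet_series b)"
  proof -
    have "uniform_limit {s. Re s \<ge> 1/2} (\<lambda>N s. \<Sum>n<N. b n * of_nat n powr (-s)) (\<lambda>s. \<Sum>n. b n * of_nat n powr
        (-s)) sequentially"
    proof (rule Weierstrass_m_test)
      show "summable (\<lambda>n. norm (b n) * real n powr (- (1/2)))" using abs by (simp add: abs_conv_def)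
      fix n and s :: complex assume "s \<in> {s. Re s \<ge> 1/2}"
      then have "real n powr (- Re s) \<le> real n powr (- (1/2))" by (cases "n = 0") (auto intro!: powr_mono)
      then show "norm (b n * of_nat n powr (-s)) \<le> norm (b n) * real n powr (- (1/2))"
        by (simp only: norm_dirichlet_term mult_left_mono norm_ge_zero)
    qed
    then show ?thesis
      unfolding dirichlet_series_def
    proof (rule uniform_limit_theorem[rotated])
      have cn: "continuous_on X (\<lambda>s. b n * of_nat n powr (-s))" for n X
        by (cases "n = 0") (auto intro!: continuous_intros)
      show "\<forall>\<^sub>F N in sequentially. continuous_on {s. Re s \<ge> 1/2} (\<lambda>s. \<Sum>n<N. b n * of_nat n powr (-s))"
        by (intro always_eventually allI continuous_on_sum cn)
    qed simp
  qed
  have expg: "exp (g t) = F (Complex (1/2) t)" for t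
  proof -
    have cl: "closure {s. Re s > 1/2} = {s. Re s \<ge> 1/2}"
      using closure_halfspace_gt[of "1::complex" "1/2"] by (simp add: inner_complex_def)
    have "exp (dirichlet_series b s) - F s = 0" if "s \<in> {s. Re s \<ge> 1/2}" for s
    proof (rule continuous_constant_on_closure[of "{s. Re s > 1/2}" "\<lambda>s. exp (dirichlet_series b s) - F s"])
      show "continuous_on (closure {s. 1/2 < Re s}) (\<lambda>s. exp (dirichlet_series b s) - F s)"
        unfolding cl
        by (intro continuous_intros holb holomorphic_on_imp_continuous_on holF)
      show "s \<in> closure {s. 1/2 < Re s}" using that by (simp only: cl)
      show "exp (dirichlet_series b z) - F z = 0" if "z \<in> {s. 1/2 < Re s}" for z
        using that expb[of z] by simp
    qed
    from this[of "Complex (1/2) t"] show ?thesis by (simp add: g_def)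
  qed
  have contg: "continuous_on UNIV g"
    unfolding g_def
    by (rule continuous_on_compose2[OF holb]) (auto simp: Complex_eq intro!: continuous_intros)
  have bg: "\<bar>Im (g t)\<bar> \<le> A" for t
    unfolding g_def A_def
    by (rule order.trans[OF abs_Im_le_cmod norm_dirichlet_series_le[OF abs]]) simp
  define h where "h t = 2 * Im (g t) + 2 * ln Q * t" for t
  have h: "exp (\<i> * of_real (h t)) = cnj \<epsilon> / \<epsilon>" if t: "t > 0" for t
  proof -
    let ?s = "Complex (1/2) t"
    have G: "fe_G Q 0 w \<mu> ?s = - (\<i> * of_real (2 * ln Q * t))"
      by (simp add: fe_G_def Complex_eq algebra_simps)
    have s1: "1 - cnj ?s = ?s" by (simp add: complex_eq_iff)
    have "Dfun a ?s = cnj \<epsilon> / \<epsilon> * exp (fe_G Q 0 w \<mu> ?s) * cnj (Dfun a (1 - cnj ?s))"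
      using fe t by (intro functional_equation_exp[OF selberg_classD(3)[OF a]]) (auto simp: fe_datum_def)
    moreover have "Dfun a ?s = exp (g t)" using FD[of ?s] expg[of t] t by (simp add: complex_eq_iff)
    ultimately have eq: "exp (g t) = cnj \<epsilon> / \<epsilon> * exp (- (\<i> * of_real (2 * ln Q * t))) * cnj (exp (g t))"
      unfolding s1 G by simp
    have "exp (\<i> * of_real (h t)) = exp (g t) * exp (\<i> * of_real (2 * ln Q * t)) / exp (cnj (g t))"
    proof -
      have "\<i> * of_real (h t) = g t + \<i> * of_real (2 * ln Q * t) - cnj (g t)"
        by (simp add: h_def complex_eq_iff)
      then show ?thesis by (simp only: exp_add exp_diff)
    qed
    also have "\<dots> = cnj \<epsilon> / \<epsilon>"
      by (subst eq) (simp add: exp_minus exp_cnj field_simps)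
    finally show ?thesis .
  qed
  have conth: "continuous_on {0<..} h"
    unfolding h_def by (intro continuous_intros continuous_on_subset[OF contg]) auto
  \<comment> \<open>So far \<open>h\<close> is known modulo 2 * pi only; being continuous with
    distinct values at distance at least 1, it is constant.\<close>
  have const: "h constant_on {0<..}"
  proof (rule continuous_discrete_range_constant[OF _ conth])
    show "connected {0::real<..}" by simp
    fix x :: real assume x: "x \<in> {0<..}"
    show "\<exists>e>0. \<forall>y. y \<in> {0<..} \<and> h y \<noteq> h x \<longrightarrow> e \<le> norm (h y - h x)"
    proof (intro exI[of _ 1] conjI allI impI)
      fix y assume y: "y \<in> {0<..} \<and> h y \<noteq> h x"
      have "exp (\<i> * of_real (h y)) = exp (\<i> * of_real (h x))" using h x y by simp
      then obtain n :: int where "\<i> * of_real (h y) = \<i> * of_real (h x) + of_int (2 * n) * of_real pi * \<i>"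
        by (auto simp: exp_eq)
      then have "Im (\<i> * of_real (h y)) = Im (\<i> * of_real (h x) + of_int (2 * n) * of_real pi * \<i>)" by simp
      then have n: "h y - h x = 2 * real_of_int n * pi" by simp
      with y have "n \<noteq> 0" by auto
      then have "1 \<le> \<bar>real_of_int n\<bar>" by linarith
      then have "1 * 1 \<le> \<bar>2 * real_of_int n\<bar> * pi" using pi_ge_two by (intro mult_mono) auto
      then show "1 \<le> norm (h y - h x)" using n by (simp add: abs_mult)
    qed simp
  qed
  then obtain y where y: "\<And>t. t > 0 \<Longrightarrow> h t = y" by (auto simp: constant_on_def)
  have "ln Q = 0"
  proof (rule ccontr)
    assume lq: "ln Q \<noteq> 0"
    define t where "t = 1 + (2 * A + 1) / \<bar>ln Q\<bar>"
    have A0: "A \<ge> 0" using bg[of 0] by linarith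
    then have t: "t > 1" using lq by (auto simp: t_def intro!: divide_pos_pos)
    have "2 * ln Q * (t - 1) = 2 * Im (g 1) - 2 * Im (g t)"
      using y[of t] y[of 1] t by (simp add: h_def algebra_simps)
    then have "\<bar>2 * ln Q * (t - 1)\<bar> \<le> 4 * A" using bg[of 1] bg[of t] by linarith
    moreover have "\<bar>2 * ln Q * (t - 1)\<bar> = 2 * (2 * A + 1)" using lq A0 by (simp add: t_def abs_mult)
    ultimately show False by simp
  qed
  then have "Q = 1" using Q by simp
  then have q1: "q = 1" using q(2) by simp
  show ?thesis
  proof
    fix n
    show "a n = one_series n"
      using q(3)[of n] q1 selberg_classD(2)[OF a] by (cases "a n = 0") (auto simp: one_series_def)
  qed
qed

lemma half_degree_cases:
  assumes a: "a \<in> selberg_class" and W: "has_half_degree a W"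
  shows "a = one_series \<or> W \<ge> 1/7"
proof -
  obtain \<epsilon> Q k w \<mu> where fe: "fe_datum a \<epsilon> Q k w \<mu>" using selberg_class_fe_datum[OF a] .
  have "W = (\<Sum>i<k. w i)" by (rule has_half_degree_unique[OF W has_half_degree_sum[OF a fe]])
  then show ?thesis
    using degree_zero_imp_one[OF a] half_degree_lower_bound[OF a fe] fe by (cases "k = 0") auto
qed

section \<open>The Riemann zeta function\<close>

lemma has_integral_nonneg_series:
  fixes u :: "nat \<Rightarrow> real \<Rightarrow> real"
  assumes "\<And>n. (u n has_integral c n) S" "\<And>n x. x \<in> S \<Longrightarrow> u n x \<ge> 0"
    "\<And>x. x \<in> S \<Longrightarrow> (\<lambda>n. u n x) sums f x" "c sums C"
  shows "(f has_integral C) S"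
proof (rule has_integral_monotone_convergence_increasing)
  show "((\<lambda>x. \<Sum>n<k. u n x) has_integral (\<Sum>n<k. c n)) S" for k
    by (intro has_integral_sum assms) auto
qed (use assms in \<open>auto simp: sums_def\<close>)

lemma has_integral_change_of_variables_nonneg:
  fixes f g :: "real \<Rightarrow> real"
  assumes S: "S \<in> sets lebesgue" and g: "\<And>x. x \<in> S \<Longrightarrow> (g has_field_derivative g' x) (at x)" and inj: "inj_on g S"
    and f: "(f has_integral b) (g ` S)" and nonneg: "\<And>y. y \<in> g ` S \<Longrightarrow> f y \<ge> 0"
  shows "((\<lambda>x. \<bar>g' x\<bar> * f (g x)) has_integral b) S"
proof -
  have "f absolutely_integrable_on (g ` S) \<and> integral (g ` S) f = b"
    using f nonneg by (auto intro!: nonnegative_absolutely_integrable_1 simp: has_integral_iff)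
  then have "(\<lambda>x. \<bar>g' x\<bar> * f (g x)) absolutely_integrable_on S \<and> integral S (\<lambda>x. \<bar>g' x\<bar> * f (g x)) = b"
    using has_absolute_integral_change_of_variables_1'[OF S _ inj,
        of g' f b] g has_field_derivative_at_within by blast
  then show ?thesis by (auto simp: has_integral_iff absolutely_integrable_on_def)
qed

lemma has_integral_spike_point:
  fixes f :: "real \<Rightarrow> real"
  assumes "(f has_integral b) S" "S - {c} = T - {c}"
  shows "(f has_integral b) T"
proof -
  have sub: "{x \<in> S - T. f x \<noteq> 0} \<subseteq> {c}" "{x \<in> T - S. f x \<noteq> 0} \<subseteq> {c}" using assms(2) by blast+
  have "negligible {x \<in> S - T. f x \<noteq> 0}" by (rule negligible_subset[OF negligible_sing sub(1)])
  moreover have "negligible {x \<in> T - S. f x \<noteq> 0}" by (rule negligible_subset[OF negligible_sing sub(2)])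
  ultimately show ?thesis using has_integral_spike_set_eq assms(1) by blast
qed

lemma Gamma_integral_scaled:
  assumes s: "s > (0::real)" and a: "a > 0"
  shows "((\<lambda>x. x powr (s - 1) * exp (- (a * x))) has_integral (Gamma s * a powr (-s))) {0<..}"
proof -
  have "((\<lambda>t. t powr (s - 1) / exp t) has_integral Gamma s) {0<..}"
    by (rule has_integral_spike_point[OF Gamma_integral_real[OF s], of 0]) auto
  moreover have im: "(\<lambda>x. a * x) ` {0<..} = {0<..}"
  proof (intro equalityI subsetI)
    fix y :: real assume "y \<in> {0<..}"
    then show "y \<in> (\<lambda>x. a * x) ` {0<..}" using a by (intro image_eqI[of _ _ "y / a"]) auto
  qed (use a in auto)
  ultimately have "((\<lambda>x. \<bar>a\<bar> * ((a * x) powr (s - 1) / exp (a * x))) has_integral Gamma s) {0<..}"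
    using a by (intro has_integral_change_of_variables_nonneg[where g = "\<lambda>x. a * x" and g' = "\<lambda>_. a" and f =
        "\<lambda>t. t powr (s - 1) / exp t"])
      (auto intro!: derivative_eq_intros inj_onI)
  then have H: "((\<lambda>x. a powr (-s) * (\<bar>a\<bar> * ((a * x) powr (s - 1) / exp (a * x)))) has_integral (a powr (-s)
      * Gamma s)) {0<..}"
    by (rule has_integral_mult_right)
  have E: "a powr (-s) * (\<bar>a\<bar> * ((a * x) powr (s - 1) / exp (a * x))) = x powr (s - 1) * exp (- (a * x))"
      if "x > 0" for x
    using a that by (simp add: powr_mult powr_diff powr_minus exp_minus field_simps)
  have "((\<lambda>x. x powr (s - 1) * exp (- (a * x))) has_integral (a powr (-s) * Gamma s)) {0<..}"
    by (rule has_integral_eq[OF _ H]) (use E in auto)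
  then show ?thesis by (simp only: mult.commute)
qed

lemma zeta_real_summable:
  assumes "s > (1::real)"
  shows "summable (\<lambda>n. real (Suc n) powr (-s))"
  using assms by (subst summable_Suc_iff) (simp add: summable_real_powr_iff)

text \<open>1 / (exp x - 1) is expanded into a geometric series in exp (-x) and integrated termwise,
  all terms being nonnegative; the result is Gamma s * \<zeta> s.\<close>

lemma zeta_integral_real:
  assumes s: "s > (1::real)"
  shows "((\<lambda>x. x powr (s - 1) / (exp x - 1)) has_integral (Gamma s * (\<Sum>n. real (Suc n) powr (-s)))) {0<..}"
proof (rule has_integral_nonneg_series)
  show "((\<lambda>x. x powr (s - 1) * exp (- (real (Suc n) * x))) has_integral Gamma s * real (Suc n) powr (-s))
      {0<..}" for n
    using s by (intro Gamma_integral_scaled) auto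
  show "(\<lambda>n. Gamma s * real (Suc n) powr (-s)) sums (Gamma s * (\<Sum>n. real (Suc n) powr (-s)))"
    by (intro sums_mult summable_sums zeta_real_summable s)
  fix x :: real assume "x \<in> {0<..}"
  then have x: "x > 0" by simp
  have S: "(\<lambda>n. x powr (s - 1) * (exp (-x) * exp (-x) ^ n)) sums (x powr (s - 1) * (exp (-x) * (1 / (1 - exp
      (-x)))))"
    using x by (intro sums_mult geometric_sums) auto
  have e1: "exp (-x) * exp (-x) ^ n = exp (- (real (Suc n) * x))" for n
    by (simp add: exp_of_nat_mult[symmetric] algebra_simps flip: exp_add)
  have e2: "exp (-x) * (1 / (1 - exp (-x))) = 1 / (exp x - 1)"
    using x by (simp add: exp_minus field_simps)
  show "(\<lambda>n. x powr (s - 1) * exp (- (real (Suc n) * x))) sums (x powr (s - 1) / (exp x - 1))"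
    using S unfolding e1 e2 by simp
qed auto

text \<open>This is pi * coth (pi * y) - 1 / y. Differentiating the reflection formula for 1 / Gamma
  gives pi * cot (pi * z) = Digamma (1 - z) - Digamma z, and at z = \<i> * y the limit
  representation of \<open>Digamma\<close> yields the series.\<close>

lemma coth_partial_fractions:
  assumes y: "y > (0::real)"
  shows "(\<lambda>n. 2 * y / (real (Suc n) ^ 2 + y ^ 2)) sums (pi * (exp (2 * pi * y) + 1) / (exp (2 * pi * y) - 1)
      - 1 / y)"
proof -
  define z where "z = \<i> * of_real y"
  have z: "Im z \<noteq> 0" "z \<noteq> 0" "1 - z \<noteq> 0" "Im (1 - z) \<noteq> 0" using y by (auto simp: z_def complex_eq_iff)
  note nz = not_nonpos_Ints_Im[OF z(1)] not_nonpos_Ints_Im[OF z(4)]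
  have d1: "(rGamma has_field_derivative - rGamma z * Digamma z) (at z)"
    by (rule has_field_derivative_rGamma_no_nonpos_int[OF nz(1)])
  have "(rGamma has_field_derivative - rGamma (1 - z) * Digamma (1 - z)) (at (1 - z))"
    by (rule has_field_derivative_rGamma_no_nonpos_int[OF nz(2)])
  then have d2: "((\<lambda>z. rGamma (1 - z)) has_field_derivative (- rGamma (1 - z) * Digamma (1 - z)) * (-1)) (at z)"
    by (rule DERIV_chain2) (auto intro!: derivative_eq_intros)
  have "((\<lambda>z. rGamma z * rGamma (1 - z)) has_field_derivative
      (- rGamma z * Digamma z) * rGamma (1 - z) + ((- rGamma (1 - z) * Digamma (1 - z)) * (-1)) * rGamma z) (at z)"
    by (rule DERIV_mult[OF d1 d2])
  then have "((\<lambda>z. sin (of_real pi * z) / of_real pi) has_field_derivative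
      (- rGamma z * Digamma z) * rGamma (1 - z) + ((- rGamma (1 - z) * Digamma (1 - z)) * (-1)) * rGamma z) (at z)"
    by (simp add: rGamma_reflection_complex)
  moreover have "((\<lambda>z. sin (of_real pi * z) / of_real pi) has_field_derivative cos (of_real pi * z)) (at z)"
    by (auto intro!: derivative_eq_intros)
  ultimately have "(- rGamma z * Digamma z) * rGamma (1 - z) + ((- rGamma (1 - z) * Digamma (1 - z)) * (-1))
      * rGamma z = cos (of_real pi * z)"
    by (rule DERIV_unique)
  then have "rGamma z * rGamma (1 - z) * (Digamma (1 - z) - Digamma z) = cos (of_real pi * z)"
    by (simp add: algebra_simps)
  then have cot: "sin (of_real pi * z) * (Digamma (1 - z) - Digamma z) = of_real pi * cos (of_real pi * z)"
    by (simp add: rGamma_reflection_complex field_simps)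
  define e where "e = exp (pi * y)"
  have e: "e > 1" using y by (simp add: e_def)
  have piz: "exp (\<i> * (of_real pi * z)) = of_real (1 / e)" "exp (- (\<i> * (of_real pi * z))) = of_real e"
    by (simp_all add: z_def e_def exp_minus exp_of_real field_simps flip: of_real_mult)
  have sin: "sin (of_real pi * z) = (of_real (1 / e) - of_real e) / (2 * \<i>)"
    unfolding sin_exp_eq piz ..
  have cos: "cos (of_real pi * z) = (of_real (1 / e) + of_real e) / 2"
    unfolding cos_exp_eq piz ..
  have D: "\<i> * (Digamma (1 - z) - Digamma z) = of_real (pi * (e ^ 2 + 1) / (e ^ 2 - 1))"
  proof -
    have e2: "e ^ 2 - 1 \<noteq> 0" using e by (simp add: power2_eq_1_iff)
    have ne: "complex_of_real (1 / e) - of_real e = of_real ((1 - e ^ 2) / e)"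
      using e by (simp add: field_simps power2_eq_square)
    have pe: "complex_of_real (1 / e) + of_real e = of_real ((1 + e ^ 2) / e)"
      using e by (simp add: field_simps power2_eq_square)
    have gen: "\<i> * Dg = - (P * B) / A" if "A / (2 * \<i>) * Dg = P * (B / 2)" "A \<noteq> 0" for A B P Dg :: complex
    proof -
      have c: "A / (2 * \<i>) * (2 * \<i>) = A" by (subst nonzero_eq_divide_eq[symmetric]) simp_all
      have "A * Dg = (A / (2 * \<i>) * (2 * \<i>)) * Dg" by (simp only: c)
      also have "\<dots> = (A / (2 * \<i>) * Dg) * (2 * \<i>)" by (simp only: mult_ac)
      also have "\<dots> = P * (B / 2) * (2 * \<i>)" by (simp only: that(1))
      also have "\<dots> = \<i> * (P * B)" by simp
      finally have "\<i> * (A * Dg) = - (P * B)" by (simp add: mult.assoc[symmetric])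
      then have "\<i> * Dg * A = - (P * B)" by (simp add: mult_ac)
      then show ?thesis by (simp only: nonzero_eq_divide_eq[OF that(2)])
    qed
    have "(1 - e ^ 2) / e \<noteq> 0" using e e2 by auto
    then have "\<i> * (Digamma (1 - z) - Digamma z) = - (of_real pi * of_real ((1 + e ^ 2) / e)) / of_real ((1
        - e ^ 2) / e)"
      using cot unfolding sin cos ne pe by (intro gen) (auto simp del: of_real_divide)
    also have "\<dots> = of_real (- (pi * ((1 + e ^ 2) / e)) / ((1 - e ^ 2) / e))" by simp
    also have "- (pi * ((1 + e ^ 2) / e)) / ((1 - e ^ 2) / e) = pi * (e ^ 2 + 1) / (e ^ 2 - 1)"
    proof -
      have "1 - e\<^sup>2 \<noteq> 0" using e2 by simp
      then show ?thesis using e e2 by (simp add: divide_simps) (simp add: algebra_simps)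
    qed
    finally show ?thesis .
  qed
  \<comment> \<open>The vanishing term 1 / (z + m) is added to shift one index, so that z + (n + 1)
    meets its conjugate 1 - z + n.\<close>
  have "(\<lambda>m. (of_real (ln (real m)) - (\<Sum>n<m. inverse (1 - z + of_nat n))) -
      (of_real (ln (real m)) - (\<Sum>n<m. inverse (z + of_nat n))) + inverse (z + of_nat m)) \<longlonglongrightarrow> Digamma (1 - z) -
          Digamma z + 0"
    by (intro tendsto_intros Digamma_LIMSEQ z filterlim_compose[OF tendsto_inverse_0]
        tendsto_add_filterlim_at_infinity[OF tendsto_const] tendsto_of_nat)
  moreover have "(of_real (ln (real m)) - (\<Sum>n<m. inverse (1 - z + of_nat n))) -
      (of_real (ln (real m)) - (\<Sum>n<m. inverse (z + of_nat n))) + inverse (z + of_nat m) =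
      inverse z + (\<Sum>n<m. inverse (z + of_nat (Suc n)) - inverse (1 - z + of_nat n))" for m
  proof -
    have "(\<Sum>n<m. inverse (z + of_nat n)) + inverse (z + of_nat m) = (\<Sum>n<Suc m. inverse (z + of_nat n))" by simp
    also have "\<dots> = inverse z + (\<Sum>n<m. inverse (z + of_nat (Suc n)))" by (subst sum.lessThan_Suc_shift) simp
    finally show ?thesis by (simp add: sum_subtractf algebra_simps)
  qed
  ultimately have "(\<lambda>m. inverse z + (\<Sum>n<m. inverse (z + of_nat (Suc n)) - inverse (1 - z + of_nat n))) \<longlonglongrightarrow>
      Digamma (1 - z) - Digamma z"
    by simp
  from tendsto_mult_left[OF tendsto_diff[OF this tendsto_const[of "inverse z"]], of \<i>]
  have "(\<lambda>n. \<i> * (inverse (z + of_nat (Suc n)) - inverse (1 - z + of_nat n))) sums (\<i> * (Digamma (1 - z) -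
      Digamma z - inverse z))"
    by (simp add: sums_def sum_distrib_left)
  moreover have "\<i> * (inverse (z + of_nat (Suc n)) - inverse (1 - z + of_nat n)) =
      of_real (2 * y / (real (Suc n) ^ 2 + y ^ 2))" for n
  proof -
    define N where "N = real (Suc n)"
    have N: "N > 0" by (simp add: N_def)
    have "z + of_nat (Suc n) = Complex N y" "1 - z + of_nat n = Complex N (-y)"
      by (auto simp: z_def N_def complex_eq_iff)
    then have "\<i> * (inverse (z + of_nat (Suc n)) - inverse (1 - z + of_nat n)) =
        \<i> * (inverse (Complex N y) - inverse (Complex N (-y)))" by (simp only:)
    also have "inverse (Complex N y) = Complex (N / (N ^ 2 + y ^ 2)) (- (y / (N ^ 2 + y ^ 2)))"
        by (simp add: complex_eq_iff)
    also have "inverse (Complex N (-y)) = Complex (N / (N ^ 2 + y ^ 2)) (y / (N ^ 2 + y ^ 2))"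
        by (simp add: complex_eq_iff)
    also have "\<i> * (Complex (N / (N ^ 2 + y ^ 2)) (- (y / (N ^ 2 + y ^ 2))) - Complex (N / (N ^ 2 + y ^ 2))
        (y / (N ^ 2 + y ^ 2)))
        = of_real (2 * y / (N ^ 2 + y ^ 2))"
      unfolding complex_eq_iff by simp
    finally show ?thesis by (simp only: N_def)
  qed
  moreover have "\<i> * (Digamma (1 - z) - Digamma z - inverse z) = of_real (pi * (e ^ 2 + 1) / (e ^ 2 - 1) - 1 / y)"
  proof -
    have "\<i> * inverse z = of_real (1 / y)" using y by (simp add: z_def inverse_eq_divide)
    then show ?thesis using D by (simp only: right_diff_distrib of_real_diff)
  qed
  ultimately have "(\<lambda>n. complex_of_real (2 * y / (real (Suc n) ^ 2 + y ^ 2))) sums of_real (pi * (e ^ 2 + 1)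
      / (e ^ 2 - 1) - 1 / y)"
    by simp
  then have "(\<lambda>n. 2 * y / (real (Suc n) ^ 2 + y ^ 2)) sums (pi * (e ^ 2 + 1) / (e ^ 2 - 1) - 1 / y)"
    by (simp only: sums_of_real_iff)
  moreover have "e ^ 2 = exp (2 * pi * y)" by (simp add: e_def exp_double[symmetric] mult_ac)
  ultimately show ?thesis by simp
qed

text \<open>1 / (exp x - 1) + 1/2 is half of coth (x / 2), so this is the preceding expansion at y =
  x / (2 * pi).\<close>

lemma zeta_kernel_series:
  assumes x: "x > (0::real)"
  shows "(\<lambda>n. 2 * x / (x ^ 2 + (2 * pi * real (Suc n)) ^ 2)) sums (1 / (exp x - 1) - 1 / x + 1/2)"
proof -
  define y where "y = x / (2 * pi)"
  have y: "y > 0" "x = 2 * pi * y" using x by (auto simp: y_def)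
  have ex: "exp x > 1" using x by simp
  have "(\<lambda>n. 1 / (2 * pi) * (2 * y / (real (Suc n) ^ 2 + y ^ 2))) sums
      (1 / (2 * pi) * (pi * (exp (2 * pi * y) + 1) / (exp (2 * pi * y) - 1) - 1 / y))"
    by (intro sums_mult coth_partial_fractions y)
  moreover have "1 / (2 * pi) * (2 * y / (real (Suc n) ^ 2 + y ^ 2)) =
      2 * x / (x ^ 2 + (2 * pi * real (Suc n)) ^ 2)" for n
  proof -
    define N where "N = real (Suc n)"
    have "N ^ 2 + y ^ 2 > 0" using y by (intro add_nonneg_pos) auto
    moreover have "x ^ 2 + (2 * pi * N) ^ 2 = (2 * pi) ^ 2 * (N ^ 2 + y ^ 2)"
      unfolding y(2) by (simp add: power_mult_distrib algebra_simps)
    moreover have "1 / (2 * pi) * (2 * y / Z) = 2 * (2 * pi * y) / ((2 * pi) ^ 2 * Z)" for Z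
      by (simp add: power2_eq_square)
    ultimately have "1 / (2 * pi) * (2 * y / (N ^ 2 + y ^ 2)) = 2 * x / (x ^ 2 + (2 * pi * N) ^ 2)"
      using y(2) by simp
    then show ?thesis by (simp only: N_def)
  qed
  moreover have "1 / (2 * pi) * (pi * (exp (2 * pi * y) + 1) / (exp (2 * pi * y) - 1) - 1 / y) =
      1 / (exp x - 1) - 1 / x + 1/2"
    unfolding y(2)[symmetric] using ex x by (simp add: y_def field_simps)
  ultimately show ?thesis by simp
qed

text \<open>The substitution t = x^2 / (x^2 + a^2) turns the integral into the Beta integral with
  parameters p = (1 + s) / 2 and 1 - p.\<close>

lemma beta_type_integral:
  fixes s a :: real
  assumes s: "-1 < s" "s < 1" and a: "a > 0"
  shows "((\<lambda>x. 2 * x powr s / (x ^ 2 + a ^ 2)) has_integral (a powr (s - 1) * (Gamma ((1 + s) / 2) * Gamma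
      ((1 - s) / 2)))) {0<..}"
proof -
  define p where "p = (1 + s) / 2"
  have p: "p > 0" "1 - p > 0" "(1 - s) / 2 = 1 - p" using s by (auto simp: p_def field_simps)
  define g where "g x = x ^ 2 / (x ^ 2 + a ^ 2)" for x
  define g' where "g' x = 2 * x * a ^ 2 / (x ^ 2 + a ^ 2) ^ 2" for x
  have pos: "x ^ 2 + a ^ 2 > 0" for x using a by (intro add_nonneg_pos) auto
  have "((\<lambda>t. t powr (p - 1) * (1 - t) powr ((1 - p) - 1)) has_integral Beta p (1 - p)) {0<..<1}"
    using has_integral_Beta_real[OF p(1,2)] by (simp add: has_integral_Icc_iff_Ioo)
  then have I: "((\<lambda>t. t powr (p - 1) * (1 - t) powr (- p)) has_integral (Gamma p * Gamma (1 - p))) {0<..<1}"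
    by (simp add: Beta_def)
  have im: "g ` {0<..} = {0<..<1}"
  proof (intro equalityI subsetI)
    fix t :: real assume t: "t \<in> {0<..<1}"
    define x where "x = a * sqrt (t / (1 - t))"
    have x: "x > 0" "x ^ 2 = a ^ 2 * (t / (1 - t))" using t a by (auto simp: x_def power_mult_distrib)
    have "x ^ 2 + a ^ 2 = a ^ 2 * (1 / (1 - t))" unfolding x(2) using t by (simp add: field_simps)
    then have "g x = t" unfolding g_def x(2) using a t by simp
    then show "t \<in> g ` {0<..}" using x by auto
  qed (use pos a in \<open>auto simp: g_def\<close>)
  have "((\<lambda>x. \<bar>g' x\<bar> * (g x powr (p - 1) * (1 - g x) powr (- p))) has_integral (Gamma p * Gamma (1 - p))) {0<..}"
  proof (rule has_integral_change_of_variables_nonneg[where g = g and g' = g' and f =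
      "\<lambda>t. t powr (p - 1) * (1 - t) powr (- p)"])
    fix x :: real
    show "(g has_field_derivative g' x) (at x)"
      unfolding g_def g'_def using pos[of x]
      by (auto intro!: derivative_eq_intros simp: field_simps power2_eq_square)
  next
    show "inj_on g {0<..}"
    proof (rule inj_onI)
      fix x y assume xy: "x \<in> {0<..}" "y \<in> {0<..}" "g x = g y"
      then have "x ^ 2 * (y ^ 2 + a ^ 2) = y ^ 2 * (x ^ 2 + a ^ 2)"
        using pos[of x] pos[of y] by (simp add: g_def frac_eq_eq)
      then have "x ^ 2 = y ^ 2" using a by (simp add: algebra_simps)
      then show "x = y" using xy by (simp add: power2_eq_iff)
    qed
  qed (use I im in auto)
  then have "((\<lambda>x. a powr (s - 1) * (\<bar>g' x\<bar> * (g x powr (p - 1) * (1 - g x) powr (- p)))) has_integral (a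
      powr (s - 1) * (Gamma p * Gamma (1 - p)))) {0<..}"
    by (rule has_integral_mult_right)
  moreover have "a powr (s - 1) * (\<bar>g' x\<bar> * (g x powr (p - 1) * (1 - g x) powr (- p))) =
      2 * x powr s / (x ^ 2 + a ^ 2)"
    if x: "x > 0" for x
  proof -
    define w where "w = x ^ 2 + a ^ 2"
    have w: "w > 0" using pos by (simp add: w_def)
    have "1 - g x = (w - x ^ 2) / w" using w by (simp add: g_def w_def[symmetric] diff_divide_distrib)
    then have 1: "1 - g x = a ^ 2 / w" by (simp add: w_def)
    have sp: "s = 2 * p - 1" by (simp add: p_def field_simps)
    have "x ^ 2 = x powr 2" "a ^ 2 = a powr 2" using x a by simp_all
    then have x2: "(x ^ 2) powr (p - 1) = x powr (2 * p - 2)" "(a ^ 2) powr (- p) = a powr (- (2 * p))"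
      by (auto simp: powr_powr right_diff_distrib)
    have f1: "x powr (2 * p - 2) * x powr 1 = x powr (2 * p - 1)" unfolding powr_add[symmetric] by simp
    have f2: "a powr (2 * p - 2) * a powr 2 * a powr (- (2 * p)) = 1" unfolding powr_add[symmetric] using a by simp
    have f3: "w powr (-2) * w powr (1 - p) * w powr p = w powr (-1)" unfolding powr_add[symmetric] by simp
    have "a powr (s - 1) * (\<bar>g' x\<bar> * (g x powr (p - 1) * (1 - g x) powr (- p))) =
       a powr (2 * p - 2) * (2 * x * a ^ 2 / w ^ 2 * (x powr (2 * p - 2) / w powr (p - 1) * (a powr (- (2 *
           p)) / w powr (- p))))"
      unfolding 1 using x w a by (simp add: g'_def g_def w_def[symmetric] powr_divide x2 sp)
    also have "\<dots> = 2 * (x powr (2 * p - 2) * x powr 1) * (a powr (2 * p - 2) * a powr 2 * a powr (- (2 * p))) *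
        (w powr (-2) * w powr (1 - p) * w powr p)"
      using x w a by (simp add: powr_minus powr_realpow powr_diff field_simps)
    also have "\<dots> = 2 * x powr (2 * p - 1) * 1 * w powr (-1)"
      unfolding f1 f2 f3 ..
    also have "\<dots> = 2 * x powr s / w" using w by (simp add: sp powr_minus field_simps)
    finally show ?thesis by (simp add: w_def)
  qed
  ultimately have "((\<lambda>x. 2 * x powr s / (x ^ 2 + a ^ 2)) has_integral (a powr (s - 1) * (Gamma p * Gamma (1
      - p)))) {0<..}"
    by (elim has_integral_eq[rotated]) auto
  then show ?thesis unfolding p(3) by (simp add: p_def)
qed

text \<open>The source of the functional equation: the kernel is expanded into partial fractions
  instead of exponentials, and its n-th term, with a = 2 * pi * (n + 1), contributes (n + 1) powr (s
  - 1). The result is \<zeta> (1 - s) times Gamma factors.\<close>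

lemma zeta_integral_real_strip:
  assumes s: "-1 < s" "s < (0::real)"
  shows "((\<lambda>x. (1 / (exp x - 1) - 1 / x + 1/2) * x powr (s - 1)) has_integral
     ((2 * pi) powr (s - 1) * (Gamma ((1 + s) / 2) * Gamma ((1 - s) / 2)) * (\<Sum>n. real (Suc n) powr (- (1 -
         s))))) {0<..}"
proof (rule has_integral_nonneg_series)
  show "((\<lambda>x. 2 * x powr s / (x ^ 2 + (2 * pi * real (Suc n)) ^ 2)) has_integral
     ((2 * pi * real (Suc n)) powr (s - 1) * (Gamma ((1 + s) / 2) * Gamma ((1 - s) / 2)))) {0<..}" for n
    using s by (intro beta_type_integral) auto
  have "(\<lambda>n. (2 * pi) powr (s - 1) * (Gamma ((1 + s) / 2) * Gamma ((1 - s) / 2)) * real (Suc n) powr (- (1 -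
      s))) sums
    ((2 * pi) powr (s - 1) * (Gamma ((1 + s) / 2) * Gamma ((1 - s) / 2)) * (\<Sum>n. real (Suc n) powr (- (1 - s))))"
    using s by (intro sums_mult summable_sums zeta_real_summable) auto
  moreover have "(2 * pi * real (Suc n)) powr (s - 1) = (2 * pi) powr (s - 1) * real (Suc n) powr (- (1 -
      s))" for n
    by (simp add: powr_mult)
  ultimately show "(\<lambda>n. (2 * pi * real (Suc n)) powr (s - 1) * (Gamma ((1 + s) / 2) * Gamma ((1 - s) / 2))) sums
    ((2 * pi) powr (s - 1) * (Gamma ((1 + s) / 2) * Gamma ((1 - s) / 2)) * (\<Sum>n. real (Suc n) powr (- (1 - s))))"
    by (simp only: mult_ac)
  fix x :: real assume "x \<in> {0<..}"
  then have x: "x > 0" by simp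
  have "x powr s = x * x powr (s - 1)" using x by (simp add: powr_diff)
  then show "(\<lambda>n. 2 * x powr s / (x ^ 2 + (2 * pi * real (Suc n)) ^ 2)) sums ((1 / (exp x - 1) - 1 / x +
      1/2) * x powr (s - 1))"
    using sums_mult2[OF zeta_kernel_series[OF x], of "x powr (s - 1)"] by (simp add: mult_ac)
qed auto

text \<open>Mellin kernel of \<open>\<Gamma> s * \<zeta> s\<close>, freed on \<open>(0, 1]\<close> from the part of its expansion at \<open>0\<close>
  that limits convergence to \<open>Re s > 1\<close>.\<close>

definition zeta_kernel :: "real \<Rightarrow> real" where
  "zeta_kernel x = 1 / (exp x - 1) - (if x \<le> 1 then 1 / x - 1/2 else 0)"

text \<open>On (0, 1] nonnegativity is read off from the partial fractions. The upper bound, from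
  exp x \<ge> 1 + x + x^2 / 2, gives the order x at 0 and hence Mellin convergence down to Re s >
  -1.\<close>

lemma zeta_kernel_bounds:
  assumes x: "x > 0"
  shows "zeta_kernel x \<ge> 0" "x \<le> 1 \<Longrightarrow> zeta_kernel x \<le> x"
proof -
  have "0 \<le> 1 / (exp x - 1) - 1 / x + 1/2"
    using sums_le[OF _ sums_zero zeta_kernel_series[OF x]] x by simp
  then show "zeta_kernel x \<ge> 0" using x by (auto simp: zeta_kernel_def)
  assume x1: "x \<le> 1"
  have "1 + x + x ^ 2 / 2 \<le> exp x" using exp_lower_Taylor_quadratic[of x] x by simp
  then have "1 / (exp x - 1) \<le> 1 / (x + x ^ 2 / 2)"
    using x by (intro divide_left_mono mult_pos_pos) (auto intro!: add_pos_pos)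
  also have "\<dots> \<le> 1 / x - 1/2 + x"
  proof -
    have "1 \<le> (1 / x - 1/2 + x) * (x + x ^ 2 / 2)"
    proof -
      have "(1 / x - 1/2 + x) * (x + x ^ 2 / 2) = 1 + x ^ 2 * (3 / 4) + x ^ 3 / 2"
        using x by (simp add: field_simps power2_eq_square power3_eq_cube)
      then show ?thesis using x by simp
    qed
    then show ?thesis using x by (subst pos_divide_le_eq) (auto intro!: add_pos_pos)
  qed
  finally show "zeta_kernel x \<le> x" using x1 by (simp add: zeta_kernel_def)
qed

lemma zeta_kernel_measurable [measurable]: "zeta_kernel \<in> borel_measurable borel"
  unfolding zeta_kernel_def by measurable

lemma borel_measurable_lebesgue_on:
  fixes f :: "real \<Rightarrow> 'b::{second_countable_topology, topological_space}"
  assumes "f \<in> borel_measurable borel"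
  shows "f \<in> borel_measurable (lebesgue_on S)"
proof -
  have "f \<in> borel_measurable lebesgue" using assms by (simp add: measurable_completion)
  then show ?thesis by (rule measurable_restrict_space1)
qed

lemma zeta_kernel_integrable:
  assumes c: "c > (-1::real)"
  shows "(\<lambda>x. zeta_kernel x * x powr (c - 1)) integrable_on {0<..}"
proof (rule measurable_bounded_by_integrable_imp_integrable_real)
  show "(\<lambda>x. zeta_kernel x * x powr (c - 1)) \<in> borel_measurable (lebesgue_on {0<..})"
    using zeta_kernel_measurable by (auto intro!: borel_measurable_lebesgue_on)
  \<comment> \<open>For x > 1 the exponent may be raised from c to d \<ge> 2, where the integral of
    \<open>zeta_integral_real\<close> supplies the majorant.\<close>
  define d where "d = max c 2"
  have "(\<lambda>x. x powr c) integrable_on {0<..1}"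
    by (rule integrable_on_powr_from_0') (use c in auto)
  then have "(\<lambda>x. if x \<in> {0<..1} then x powr c else 0) integrable_on {0<..}"
  proof -
    assume I: "(\<lambda>x. x powr c) integrable_on {0<..1}"
    have "{0<..1::real} \<inter> {0<..} = {0<..1}" by auto
    then show ?thesis using I by (subst integrable_restrict_Int) simp
  qed
  moreover have "(\<lambda>x. x powr (d - 1) / (exp x - 1)) integrable_on {0<..}"
    using zeta_integral_real[of d] by (auto simp: d_def has_integral_iff)
  ultimately show "(\<lambda>x. (if x \<in> {0<..1} then x powr c else 0) + x powr (d - 1) / (exp x - 1)) integrable_on {0<..}"
    by (rule integrable_add)
  fix x :: real assume "x \<in> {0<..}"
  then have x: "x > 0" by simp
  have k0: "zeta_kernel x \<ge> 0" by (rule zeta_kernel_bounds[OF x])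
  show "\<bar>zeta_kernel x * x powr (c - 1)\<bar> \<le> (if x \<in> {0<..1} then x powr c else 0) + x powr (d - 1) / (exp x - 1)"
  proof (cases "x \<le> 1")
    case True
    have "zeta_kernel x * x powr (c - 1) \<le> x * x powr (c - 1)"
      using zeta_kernel_bounds(2)[OF x True] by (intro mult_right_mono) auto
    also have "\<dots> = x powr c" using x by (simp add: powr_diff)
    finally show ?thesis using x True k0 by (simp add: abs_mult add_increasing2)
  next
    case False
    have "x powr (c - 1) \<le> x powr (d - 1)" using False by (intro powr_mono) (auto simp: d_def)
    then have "1 / (exp x - 1) * x powr (c - 1) \<le> 1 / (exp x - 1) * x powr (d - 1)"
      using x by (intro mult_left_mono) auto
    then show ?thesis using x False k0 by (simp add: abs_mult zeta_kernel_def)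
  qed
qed auto

lemma zeta_kernel_integral_gt_1:
  assumes s: "s > (1::real)"
  shows "integral {0<..} (\<lambda>x. zeta_kernel x * x powr (s - 1)) =
     Gamma s * (\<Sum>n. real (Suc n) powr (-s)) - (1 / (s - 1) - 1 / (2 * s))"
proof -
  have "((\<lambda>x. x powr (s - 2) - 1/2 * x powr (s - 1)) has_integral (1 powr (s - 2 + 1) / (s - 2 + 1) - 1/2 *
      (1 powr (s - 1 + 1) / (s - 1 + 1)))) {0..1}"
    using s by (intro has_integral_diff has_integral_mult_right has_integral_powr_from_0) auto
  then have "((\<lambda>x. x powr (s - 2) - 1/2 * x powr (s - 1)) has_integral (1 / (s - 1) - 1 / (2 * s))) {0..1}"
    by simp
  then have "((\<lambda>x. x powr (s - 2) - 1/2 * x powr (s - 1)) has_integral (1 / (s - 1) - 1 / (2 * s))) {0<..1}"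
    by (rule has_integral_spike_point[of _ _ _ 0]) auto
  then have "((\<lambda>x. if x \<in> {0<..1} then x powr (s - 2) - 1/2 * x powr (s - 1) else 0) has_integral (1 / (s -
      1) - 1 / (2 * s))) {0<..}"
    by (subst has_integral_restrict) auto
  from has_integral_diff[OF zeta_integral_real[OF s] this]
  have "((\<lambda>x. zeta_kernel x * x powr (s - 1)) has_integral (Gamma s * (\<Sum>n. real (Suc n) powr (-s)) - (1 / (s
      - 1) - 1 / (2 * s)))) {0<..}"
  proof (rule has_integral_eq[rotated])
    fix x :: real assume "x \<in> {0<..}"
    then have "x > 0" "x powr (s - 2) = 1 / x * x powr (s - 1)"
        by (auto simp: powr_diff power2_eq_square powr_numeral)
    then show "x powr (s - 1) / (exp x - 1) - (if x \<in> {0<..1} then x powr (s - 2) - 1 / 2 * x powr (s - 1)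
        else 0) = zeta_kernel x * x powr (s - 1)"
      by (simp add: zeta_kernel_def left_diff_distrib)
  qed
  then show ?thesis by (rule integral_unique)
qed

text \<open>Beyond 1 the kernel lacks the terms -1 / x + 1/2. Their Mellin integral over (1,
  \<infinity>) converges for s < 0 and is minus the expression that the same terms give on (0, 1]
  for s > 1, so the correction 1 / (s - 1) - 1 / (2 * s) has one form in both ranges.\<close>

lemma zeta_kernel_integral_strip:
  assumes s: "-1 < s" "s < (0::real)"
  shows "integral {0<..} (\<lambda>x. zeta_kernel x * x powr (s - 1)) =
     (2 * pi) powr (s - 1) * (Gamma ((1 + s) / 2) * Gamma ((1 - s) / 2)) * (\<Sum>n. real (Suc n) powr (- (1 - s)))
       - (1 / (s - 1) - 1 / (2 * s))"
proof -
  have "((\<lambda>x. x powr (s - 2) - 1/2 * x powr (s - 1)) has_integral (- (1 powr (s - 2 + 1)) / (s - 2 + 1) -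
      1/2 * (- (1 powr (s - 1 + 1)) / (s - 1 + 1)))) {1..}"
    using s by (intro has_integral_diff has_integral_mult_right has_integral_powr_to_inf) auto
  then have "((\<lambda>x. x powr (s - 2) - 1/2 * x powr (s - 1)) has_integral (- (1 / (s - 1) - 1 / (2 * s)))) {1..}"
    by simp
  then have "((\<lambda>x. x powr (s - 2) - 1/2 * x powr (s - 1)) has_integral (- (1 / (s - 1) - 1 / (2 * s)))) {1<..}"
    by (rule has_integral_spike_point[of _ _ _ 1]) auto
  then have "((\<lambda>x. if x \<in> {1<..} then x powr (s - 2) - 1/2 * x powr (s - 1) else 0) has_integral (- (1 / (s
      - 1) - 1 / (2 * s)))) {0<..}"
    by (subst has_integral_restrict) auto
  from has_integral_add[OF zeta_integral_real_strip[OF s] this]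
  have "((\<lambda>x. zeta_kernel x * x powr (s - 1)) has_integral ((2 * pi) powr (s - 1) * (Gamma ((1 + s) / 2) *
      Gamma ((1 - s) / 2)) * (\<Sum>n. real (Suc n) powr (- (1 - s)))
       + (- (1 / (s - 1) - 1 / (2 * s))))) {0<..}"
  proof (rule has_integral_eq[rotated])
    fix x :: real assume "x \<in> {0<..}"
    then have "x > 0" "x powr (s - 2) = 1 / x * x powr (s - 1)"
        by (auto simp: powr_diff power2_eq_square powr_numeral)
    then show "(1 / (exp x - 1) - 1 / x + 1/2) * x powr (s - 1) + (if x \<in> {1<..} then x powr (s - 2) - 1 / 2
        * x powr (s - 1) else 0) = zeta_kernel x * x powr (s - 1)"
      by (simp add: zeta_kernel_def algebra_simps)
  qed
  from integral_unique[OF this] show ?thesis by simp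
qed

section \<open>Holomorphy of Mellin transforms\<close>

lemma norm_exp_minus_1_le: "norm (exp z - 1 :: complex) \<le> norm z * exp (norm z)"
proof -
  have "norm (exp z - exp 0) \<le> exp (norm z) * norm (z - 0)"
  proof (rule field_differentiable_bound[of "cball 0 (norm z)"])
    fix w :: complex assume w: "w \<in> cball 0 (norm z)"
    show "(exp has_field_derivative exp w) (at w within cball 0 (norm z))"
      by (rule DERIV_subset[OF DERIV_exp]) auto
    have "norm (exp w) \<le> exp (norm w)" by (rule norm_exp)
    also have "\<dots> \<le> exp (norm z)" using w by simp
    finally show "norm (exp w) \<le> exp (norm z)" .
  qed auto
  then show ?thesis by (simp add: mult.commute)
qed

lemma mellin_integrable:
  fixes k :: "real \<Rightarrow> real"
  assumes k: "k \<in> borel_measurable borel" and int: "(\<lambda>x. \<bar>k x\<bar> * x powr (Re s - 1)) integrable_on {0<..}"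
  shows "(\<lambda>x. of_real (k x) * of_real x powr (s - 1)) integrable_on {0<..}"
    and "norm (integral {0<..} (\<lambda>x. of_real (k x) * of_real x powr (s - 1))) \<le>
        integral {0<..} (\<lambda>x. \<bar>k x\<bar> * x powr (Re s - 1))"
proof -
  have le: "norm (of_real (k x) * of_real x powr (s - 1)) \<le> \<bar>k x\<bar> * x powr (Re s - 1)" if "x \<in> {0<..}" for x
    using that by (simp add: norm_mult norm_powr_real_powr)
  show 1: "(\<lambda>x. of_real (k x) * of_real x powr (s - 1)) integrable_on {0<..}"
    by (rule measurable_bounded_by_integrable_imp_integrable[OF _ int le])
       (use k in \<open>auto intro!: borel_measurable_lebesgue_on\<close>)
  show "norm (integral {0<..} (\<lambda>x. of_real (k x) * of_real x powr (s - 1))) \<le>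
      integral {0<..} (\<lambda>x. \<bar>k x\<bar> * x powr (Re s - 1))"
    by (rule integral_norm_bound_integral[OF 1 int le])
qed

text \<open>Differentiation under the integral by dominated convergence. The difference quotient of
  x powr (s - 1) at z is dominated by the powers with exponents shifted up and down by 2 * \<delta>:
  one \<delta> for the increment of s, one for the logarithm, as |ln x| \<le> exp (\<delta> * |ln
  x|) / \<delta>.\<close>

lemma mellin_holomorphic:
  fixes k :: "real \<Rightarrow> real"
  assumes k[measurable]: "k \<in> borel_measurable borel"
    and int: "\<And>c. c > \<alpha> \<Longrightarrow> (\<lambda>x. \<bar>k x\<bar> * x powr (c - 1)) integrable_on {0<..}"
  shows "(\<lambda>s. integral {0<..} (\<lambda>x. of_real (k x) * of_real x powr (s - 1))) holomorphic_on {s. Re s > \<alpha>}"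
proof -
  define f where "f s x = of_real (k x) * of_real x powr (s - 1)" for s :: complex and x
  define F where "F s = integral {0<..} (f s)" for s
  have "\<exists>D. (F has_field_derivative D) (at z)" if z: "Re z > \<alpha>" for z
  proof -
    define \<delta> where "\<delta> = (Re z - \<alpha>) / 4"
    have \<delta>: "\<delta> > 0" "Re z - 2 * \<delta> > \<alpha>" using z by (auto simp: \<delta>_def field_simps)
    define h where "h x = 1 / \<delta> * (\<bar>k x\<bar> * x powr (Re z + 2 * \<delta> - 1) + \<bar>k x\<bar> * x powr (Re z - 2 * \<delta> - 1))" for x
    have hint: "h integrable_on {0<..}"
      unfolding h_def[abs_def] using \<delta>
      by (intro integrable_on_mult_right integrable_add int) auto
    define g where "g x = of_real (k x) * of_real x powr (z - 1) * of_real (ln x)" for x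
    have fint: "f s integrable_on {0<..}" if "s \<in> ball z \<delta>" for s
    proof -
      have "\<bar>Re (z - s)\<bar> \<le> norm (z - s)" by (rule abs_Re_le_cmod)
      also have "\<dots> < \<delta>" using that by (simp add: dist_norm)
      finally have "Re s > \<alpha>" using \<delta> by simp
      then show ?thesis unfolding f_def[abs_def] by (intro mellin_integrable k int)
    qed
    have "((\<lambda>s. (F s - F z) / (s - z)) \<longlongrightarrow> integral {0<..} g) (at z within ball z \<delta>)"
      unfolding tendsto_at_iff_sequentially
    proof (intro allI impI)
      fix X assume X: "\<forall>i. X i \<in> ball z \<delta> - {z}" "X \<longlonglongrightarrow> z"
      define q where "q i x = (f (X i) x - f z x) / (X i - z)" for i x
      have qint: "q i integrable_on {0<..}" for i
        unfolding q_def[abs_def] using X fint \<delta> by (intro integrable_on_divide integrable_diff) auto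
      have bound: "norm (q i x) \<le> h x" if "x \<in> {0<..}" for i x
      proof -
        have x: "x > 0" using that by simp
        define w where "w = X i - z"
        have w: "w \<noteq> 0" "norm w \<le> \<delta>" using X(1)[rule_format, of i] by (auto simp: w_def dist_norm
            norm_minus_commute)
        define L where "L = ln x"
        have "f (X i) x - f z x = f z x * (exp (w * of_real L) - 1)"
        proof -
          have "of_real x powr (X i - 1) = of_real x powr (z - 1) * exp (w * of_real L)"
            using x by (simp add: powr_def L_def Ln_of_real w_def algebra_simps flip: exp_add)
          then show ?thesis by (simp add: f_def algebra_simps)
        qed
        then have "norm (q i x) = norm (f z x) * norm (exp (w * of_real L) - 1) / norm w"
          by (simp add: q_def w_def norm_mult norm_divide)
        also have "\<dots> \<le> norm (f z x) * (norm w * \<bar>L\<bar> * exp (norm w * \<bar>L\<bar>)) / norm w"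
          using norm_exp_minus_1_le[of "w * of_real L"] by (intro divide_right_mono mult_left_mono) (auto
              simp: norm_mult)
        also have "\<dots> = norm (f z x) * (\<bar>L\<bar> * exp (norm w * \<bar>L\<bar>))" using w by simp
        also have "\<dots> \<le> norm (f z x) * ((exp (\<delta> * \<bar>L\<bar>) / \<delta>) * exp (\<delta> * \<bar>L\<bar>))"
        proof (intro mult_left_mono mult_mono)
          have "\<delta> * \<bar>L\<bar> \<le> exp (\<delta> * \<bar>L\<bar>)" using exp_ge_add_one_self[of "\<delta> * \<bar>L\<bar>"] by linarith
          then show "\<bar>L\<bar> \<le> exp (\<delta> * \<bar>L\<bar>) / \<delta>" using \<delta> by (simp add: field_simps)
          show "exp (norm w * \<bar>L\<bar>) \<le> exp (\<delta> * \<bar>L\<bar>)" using w by (simp add: mult_right_mono)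
        qed (use \<delta> in auto)
        also have "\<dots> = norm (f z x) * (1 / \<delta> * exp (2 * \<delta> * \<bar>L\<bar>))"
          by (simp add: exp_add[symmetric] field_simps)
        also have "\<dots> \<le> norm (f z x) * (1 / \<delta> * (exp (2 * \<delta> * L) + exp (- (2 * \<delta> * L))))"
          using \<delta> by (intro mult_left_mono) (auto simp: abs_if)
        also have "\<dots> = h x"
        proof -
          have "norm (f z x) = \<bar>k x\<bar> * x powr (Re z - 1)" using x by (simp add: f_def norm_mult
              norm_powr_real_powr)
          moreover have "x powr (Re z - 1) * exp (2 * \<delta> * L) = x powr (Re z + 2 * \<delta> - 1)"
              "x powr (Re z - 1) * exp (- (2 * \<delta> * L)) = x powr (Re z - 2 * \<delta> - 1)"
            using x by (simp_all add: powr_def L_def algebra_simps flip: exp_add)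
          ultimately show ?thesis by (simp add: h_def algebra_simps)
        qed
        finally show ?thesis .
      qed
      have lim: "(\<lambda>i. q i x) \<longlonglongrightarrow> g x" if "x \<in> {0<..}" for x
      proof -
        have x: "x > 0" using that by simp
        have "((\<lambda>s. of_real x powr (s - 1)) has_field_derivative of_real x powr (z - 1) * of_real (ln x)) (at z)"
          using x by (auto simp: powr_def Ln_of_real intro!: derivative_eq_intros)
        then have "(f' has_field_derivative g x) (at z)" if "f' = (\<lambda>s. f s x)" for f'
          unfolding that f_def g_def mult.assoc by (rule DERIV_cmult)
        then have "((\<lambda>s. (f s x - f z x) / (s - z)) \<longlongrightarrow> g x) (at z)"
          by (simp add: has_field_derivative_iff)
        moreover have "filterlim X (at z) sequentially"
          using X by (auto simp: filterlim_at)
        ultimately show ?thesis unfolding q_def by (rule filterlim_compose)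
      qed
      have "(\<lambda>i. integral {0<..} (q i)) \<longlonglongrightarrow> integral {0<..} g"
        by (rule dominated_convergence(2)[OF qint hint bound lim])
      moreover have "integral {0<..} (q i) = (F (X i) - F z) / (X i - z)" for i
        unfolding q_def F_def using X fint \<delta> by (subst integral_divide, subst integral_diff) auto
      ultimately show "((\<lambda>s. (F s - F z) / (s - z)) \<circ> X) \<longlonglongrightarrow> integral {0<..} g"
        by (simp add: o_def)
    qed
    moreover have "at z within ball z \<delta> = at z" using \<delta> by (intro at_within_open) auto
    ultimately show ?thesis by (auto simp: has_field_derivative_iff)
  qed
  then have "F holomorphic_on {s. Re s > \<alpha>}"
    unfolding holomorphic_on_def field_differentiable_def using has_field_derivative_at_within by blast
  then show ?thesis unfolding F_def[abs_def] f_def[abs_def] .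
qed

section \<open>The Euler product of zeta\<close>

lemma ramanujan_zeta: "ramanujan zeta_series"
  unfolding ramanujan_def
proof (intro allI impI bigoI[where c = 1] eventually_mono[OF eventually_gt_at_top[of 0]])
  fix \<epsilon> :: real and n :: nat assume "\<epsilon> > 0" "n > 0"
  then show "norm (norm (zeta_series n)) \<le> 1 * norm (real n powr \<epsilon>)"
    by (simp add: zeta_series_def ge_one_powr_ge_zero)
qed

lemma zeta_dirichlet_of_real:
  assumes "c > 1"
  shows "dirichlet_series zeta_series (of_real c) = of_real (\<Sum>n. real (Suc n) powr (-c))"
proof -
  have "(\<lambda>n. zeta_series n * of_nat n powr (- of_real c)) sums dirichlet_series zeta_series (of_real c)"
    using ramanujan_abs_conv[OF ramanujan_zeta, of c] assms by (intro abs_conv_sums[where \<sigma> = c]) auto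
  then have "(\<lambda>n. zeta_series (Suc n) * of_nat (Suc n) powr (- of_real c)) sums dirichlet_series zeta_series
      (of_real c)"
    by (subst sums_Suc_iff) (simp add: zeta_series_def)
  moreover have "zeta_series (Suc n) * of_nat (Suc n) powr (- of_real c) = of_real (real (Suc n) powr (-c))" for n
  proof -
    have "complex_of_real (real (Suc n) powr (-c)) = of_real (real (Suc n)) powr of_real (-c)"
      by (rule powr_of_real[symmetric]) simp
    then show ?thesis by (simp add: zeta_series_def)
  qed
  ultimately have "(\<lambda>n. complex_of_real (real (Suc n) powr (-c))) sums dirichlet_series zeta_series (of_real c)"
    by simp
  moreover have "(\<lambda>n. complex_of_real (real (Suc n) powr (-c))) sums of_real (\<Sum>n. real (Suc n) powr (-c))"
    unfolding sums_of_real_iff by (intro summable_sums zeta_real_summable assms)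
  ultimately show ?thesis using sums_unique2 by blast
qed

lemma dirichlet_series_tendsto_at_top:
  assumes a: "abs_conv a 2" and "a 0 = 0"
  shows "((\<lambda>\<sigma>::real. dirichlet_series a (of_real \<sigma>)) \<longlongrightarrow> a 1) at_top"
proof -
  define C where "C = (\<Sum>n. norm (a n) * real n powr (-2))"
  have bound: "norm (dirichlet_series a (of_real \<sigma>) - a 1) \<le> C * 2 powr (2 - \<sigma>)" if \<sigma>: "\<sigma> \<ge> 2" for \<sigma>
  proof -
    define u where "u n = a n * of_nat n powr (- of_real \<sigma>)" for n
    have u: "u sums dirichlet_series a (of_real \<sigma>)" unfolding u_def using \<sigma> by (intro abs_conv_sums[OF a]) auto
    have "(\<lambda>n. u n - (if n = 1 then u n else 0)) sums (dirichlet_series a (of_real \<sigma>) - u 1)"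
      by (intro sums_diff u) (use sums_single[of 1 u] in simp)
    then have "norm (dirichlet_series a (of_real \<sigma>) - u 1) = norm (\<Sum>n. u n - (if n = 1 then u n else 0))"
        by (simp add: sums_iff)
    also have "\<dots> \<le> (\<Sum>n. norm (a n) * real n powr (-2) * 2 powr (2 - \<sigma>))"
    proof (rule norm_suminf_le)
      fix n
      show "norm (u n - (if n = 1 then u n else 0)) \<le> norm (a n) * real n powr (-2) * 2 powr (2 - \<sigma>)"
      proof (cases "n \<le> 1")
        case True
        then have "n = 0 \<or> n = 1" by auto
        then show ?thesis using assms(2) by (auto simp: u_def)
      next
        case False
        have "real n powr (-\<sigma>) = real n powr (-2) * real n powr (2 - \<sigma>)" by (simp flip: powr_add)
        also have "\<dots> \<le> real n powr (-2) * 2 powr (2 - \<sigma>)"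
          using False \<sigma> by (intro mult_left_mono powr_mono2') auto
        finally have "norm (a n) * real n powr (-\<sigma>) \<le> norm (a n) * (real n powr (-2) * 2 powr (2 - \<sigma>))"
          by (rule mult_left_mono) simp
        moreover have "norm (u n) = norm (a n) * real n powr (-\<sigma>)"
          unfolding u_def by (subst norm_dirichlet_term) simp
        ultimately show ?thesis using False by simp
      qed
    qed (use a in \<open>auto simp: abs_conv_def intro!: summable_mult2\<close>)
    also have "\<dots> = C * 2 powr (2 - \<sigma>)" unfolding C_def by (rule suminf_mult2[symmetric]) (use a in \<open>simp
        add: abs_conv_def\<close>)
    also have "u 1 = a 1" by (simp add: u_def)
    finally show ?thesis .
  qed
  have "((\<lambda>\<sigma>::real. C * 2 powr (2 - \<sigma>)) \<longlongrightarrow> 0) at_top" by real_asymp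
  then have "((\<lambda>\<sigma>::real. dirichlet_series a (of_real \<sigma>) - a 1) \<longlongrightarrow> 0) at_top"
  proof (rule Lim_null_comparison[rotated])
    show "\<forall>\<^sub>F \<sigma> in at_top. norm (dirichlet_series a (complex_of_real \<sigma>) - a 1) \<le> C * 2 powr (2 - \<sigma>)"
      using eventually_ge_at_top[of 2] by eventually_elim (rule bound)
  qed
  then show ?thesis by (simp add: LIM_zero_iff)
qed

text \<open>log \<zeta> has the coefficients mangoldt n / ln n. The divisor sum of
  \<open>mangoldt\<close> says Z' = Z * B', so Z * exp (-B) is constant on the half-plane, and its
  limit as \<sigma> tends to infinity is 1.\<close>

lemma euler_product_zeta: "euler_product zeta_series"
proof -
  \<comment> \<open>At n = 1 this is 0 / 0 = 0. Since mangoldt n \<le> ln n, the coefficients are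
    bounded by 1 and \<theta> = 0 is admissible.\<close>
  define b where "b n = (mangoldt n / of_real (ln (real n)) :: complex)" for n
  have b1: "b 0 = 0" "b 1 = 0" "b (Suc 0) = 0" by (simp_all add: b_def)
  have nb: "norm (b n) \<le> 1" for n
  proof (cases "n \<le> 1")
    case False
    then have "ln (real n) > 0" by simp
    moreover have "mangoldt n \<le> ln (real n)" using False by (intro mangoldt_le) auto
    ultimately show ?thesis by (simp add: b_def norm_divide mangoldt_nonneg)
  qed (use b1 in \<open>auto simp: le_Suc_eq\<close>)
  have O: "(\<lambda>n. norm (b n)) \<in> O(\<lambda>n. real n powr 0)"
    by (rule bigoI[where c = 1], rule eventually_mono[OF eventually_gt_at_top[of 0]]) (use nb in auto)
  have absb: "abs_conv b \<sigma>" if "\<sigma> > 1" for \<sigma> using abs_conv_bigo[OF O, of \<sigma>] that by simp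
  have absz: "abs_conv zeta_series \<sigma>" if "\<sigma> > 1" for \<sigma> by (rule ramanujan_abs_conv[OF ramanujan_zeta that])
  define Z where "Z = dirichlet_series zeta_series"
  define B where "B = dirichlet_series b"
  have mid: "abs_conv f ((1 + Re s) / 2) \<and> (1 + Re s) / 2 < Re s" if "Re s > 1" "\<And>\<sigma>. \<sigma> > 1 \<Longrightarrow> abs_conv f \<sigma>" for f s
    using that by (auto simp: field_simps)
  have dZ: "(Z has_field_derivative dirichlet_series (\<lambda>n. - zeta_series n * of_real (ln (real n))) s) (at
      s)" if "Re s > 1" for s
    unfolding Z_def using mid[OF that absz] dirichlet_series_has_field_derivative by blast
  have dB: "(B has_field_derivative dirichlet_series (\<lambda>n. - b n * of_real (ln (real n))) s) (at s)"
      if "Re s > 1" for s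
    unfolding B_def using mid[OF that absb] dirichlet_series_has_field_derivative by blast
  have neg: "abs_conv (\<lambda>n. - f n * of_real (ln (real n))) \<sigma>" if "\<sigma> > 1" "\<And>\<sigma>. \<sigma> > 1 \<Longrightarrow> abs_conv f \<sigma>" for f \<sigma>
    using abs_conv_mult_ln[of f "(1 + \<sigma>) / 2" \<sigma>] that by (simp add: abs_conv_def norm_mult)
  have eq: "dirichlet_series (\<lambda>n. - zeta_series n * of_real (ln (real n))) s =
      Z s * dirichlet_series (\<lambda>n. - b n * of_real (ln (real n))) s"
    if s: "Re s > 1" for s
  proof -
    have "dconv (\<lambda>n. - b n * of_real (ln (real n))) zeta_series n = - zeta_series n * of_real (ln (real n))" for n
    proof (cases "n = 0")
      case False
      have "(\<Sum>d | d dvd n. - b d * of_real (ln (real d)) * zeta_series (n div d)) = (\<Sum>d | d dvd n. - mangoldt d)"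
      proof (intro sum.cong refl)
        fix d assume "d \<in> {d. d dvd n}"
        then have d: "d dvd n" "d > 0" "n div d > 0" using False by (auto intro!: Nat.gr0I)
        show "- b d * of_real (ln (real d)) * zeta_series (n div d) = - mangoldt d"
          using d by (cases "d = 1") (auto simp: b_def zeta_series_def)
      qed
      also have "\<dots> = - of_real (ln (real n))" using False by (simp add: sum_negf mangoldt_sum)
      finally show ?thesis using False by (simp add: dconv_def zeta_series_def)
    qed (simp add: dconv_def)
    then have "dconv (\<lambda>n. - b n * of_real (ln (real n))) zeta_series =
        (\<lambda>n. - zeta_series n * of_real (ln (real n)))" by auto
    moreover have "dirichlet_series (\<lambda>n. - b n * of_real (ln (real n))) s * dirichlet_series zeta_series s =
        dirichlet_series (dconv (\<lambda>n. - b n * of_real (ln (real n))) zeta_series) s"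
      using s by (intro dirichlet_series_product(1) neg absb absz) auto
    ultimately show ?thesis by (simp add: Z_def mult.commute)
  qed
  define Hf where "Hf s = Z s * exp (- B s)" for s
  have "(Hf has_field_derivative 0) (at s)" if s: "Re s > 1" for s
  proof -
    have "(Hf has_field_derivative (dirichlet_series (\<lambda>n. - zeta_series n * of_real (ln (real n))) s * exp
        (- B s) +
        exp (- B s) * (- dirichlet_series (\<lambda>n. - b n * of_real (ln (real n))) s) * Z s)) (at s)"
      unfolding Hf_def
      by (intro DERIV_mult dZ[OF s] DERIV_chain2[OF DERIV_exp] DERIV_minus dB[OF s])
    then show ?thesis unfolding eq[OF s] by (simp add: algebra_simps)
  qed
  then have "Hf constant_on {s. Re s > 1}"
    by (intro has_field_derivative_0_imp_constant_on[of "{s. Re s > 1}"])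
       (auto simp: open_halfspace_Re_gt intro!: convex_connected convex_halfspace_Re_gt)
  then obtain c where c: "\<And>s. Re s > 1 \<Longrightarrow> Hf s = c" by (auto simp: constant_on_def)
  have "((\<lambda>\<sigma>::real. Hf (of_real \<sigma>)) \<longlongrightarrow> zeta_series 1 * exp (- b 1)) at_top"
    unfolding Hf_def Z_def B_def
    by (intro tendsto_intros dirichlet_series_tendsto_at_top absz absb) (auto simp: zeta_series_def b1)
  moreover have "eventually (\<lambda>\<sigma>::real. Hf (of_real \<sigma>) = c) at_top"
    using eventually_gt_at_top[of 1] by eventually_elim (auto intro: c)
  then have "((\<lambda>\<sigma>::real. Hf (of_real \<sigma>)) \<longlongrightarrow> c) at_top"
    by (rule tendsto_eventually)
  ultimately have "c = zeta_series 1 * exp (- b 1)"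
    using tendsto_unique[OF trivial_limit_at_top_linorder] by blast
  then have c1: "c = 1" by (simp add: b1 zeta_series_def)
  have exp: "exp (B s) = Z s" if "Re s > 1" for s
  proof -
    have "Z s * exp (- B s) = 1" using c[OF that] c1 by (simp add: Hf_def)
    then have "Z s * exp (- B s) * exp (B s) = exp (B s)" by simp
    then show ?thesis by (simp add: mult.assoc flip: exp_add)
  qed
  show ?thesis
    unfolding euler_product_def
  proof (intro conjI exI[of _ b] exI[of _ 0] allI impI)
    show "zeta_series 1 = 1" by (simp add: zeta_series_def)
    show "b n = 0" if "\<not> primepow n" for n using that by (simp add: b_def mangoldt_def)
    show "(\<lambda>n. norm (b n)) \<in> O(\<lambda>n. real n powr 0)" by (rule O)
    fix s :: complex assume s: "Re s > 1"
    show "summable (\<lambda>n. b n * of_nat n powr (- s))"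
      by (rule sums_summable[OF abs_conv_sums[OF absb[of "Re s"]]]) (use s in auto)
    show "exp (dirichlet_series b s) = dirichlet_series zeta_series s"
      using exp[OF s] by (simp add: B_def Z_def)
  qed auto
qed

section \<open>Continuation of zeta\<close>

text \<open>The integrals are evaluated at real arguments only; this carries the resulting
  identities over to domains in the plane.\<close>

lemma holomorphic_eq_on_reals:
  assumes "f holomorphic_on S" "g holomorphic_on S" "open S" "connected S" "a < b"
    and sub: "\<And>x. a < x \<Longrightarrow> x < b \<Longrightarrow> of_real x \<in> S"
    and eq: "\<And>x. a < x \<Longrightarrow> x < b \<Longrightarrow> f (of_real x) = g (of_real x)" and "z \<in> S"
  shows "f z = (g z :: complex)"
proof -
  define c where "c = (a + b) / 2"
  have c: "a < c" "c < b" using \<open>a < b\<close> by (auto simp: c_def)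
  have "f z - g z = 0"
  proof (rule analytic_continuation[of "\<lambda>z. f z - g z" S "of_real ` {a<..<b}" "of_real c"])
    show "(\<lambda>z. f z - g z) holomorphic_on S" by (intro holomorphic_on_diff assms)
    show "complex_of_real c \<in> S" using sub c by simp
    show "of_real ` {a<..<b} \<subseteq> S" using sub by auto
    show "f w - g w = 0" if "w \<in> of_real ` {a<..<b}" for w using that eq by auto
    show "complex_of_real c islimpt of_real ` {a<..<b}"
      unfolding islimpt_approachable
    proof (intro allI impI)
      fix e :: real assume e: "e > 0"
      define d where "d = min (e / 2) ((b - c) / 2)"
      have d: "d > 0" "d < e" "c + d < b" using e c by (auto simp: d_def min_def field_simps)
      show "\<exists>x'\<in>of_real ` {a<..<b}. x' \<noteq> complex_of_real c \<and> dist x' (complex_of_real c) < e"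
      proof (intro bexI conjI)
        show "complex_of_real (c + d) \<noteq> of_real c" using d by simp
        show "dist (complex_of_real (c + d)) (of_real c) < e" using d by (simp add: dist_norm)
        show "complex_of_real (c + d) \<in> of_real ` {a<..<b}" using d c by (intro imageI) auto
      qed
    qed
  qed (fact assms)+
  then show ?thesis by simp
qed

text \<open>Converges for Re s > -1, because the kernel is of order x at 0; for Re s > 1 it is Gamma
  s * \<zeta> s without the elementary part 1 / (s - 1) - 1 / (2 * s).\<close>

definition zeta_E :: "complex \<Rightarrow> complex" where
  "zeta_E s = integral {0<..} (\<lambda>x. of_real (zeta_kernel x) * of_real x powr (s - 1))"

lemma zeta_kernel_abs_integrable:
  assumes "c > -1"
  shows "(\<lambda>x. \<bar>zeta_kernel x\<bar> * x powr (c - 1)) integrable_on {0<..}"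
  by (rule integrable_eq[OF zeta_kernel_integrable[OF assms]]) (auto simp: zeta_kernel_bounds)

lemma zeta_E_holomorphic: "zeta_E holomorphic_on {s. Re s > -1}"
  unfolding zeta_E_def[abs_def]
  by (rule mellin_holomorphic) (auto intro: zeta_kernel_abs_integrable)

lemma zeta_E_of_real:
  assumes "c > -1"
  shows "zeta_E (of_real c) = of_real (integral {0<..} (\<lambda>x. zeta_kernel x * x powr (c - 1)))"
proof -
  have "((\<lambda>x. zeta_kernel x * x powr (c - 1)) has_integral integral {0<..} (\<lambda>x. zeta_kernel x * x powr (c -
      1))) {0<..}"
    using zeta_kernel_integrable[OF assms] by (rule integrable_integral)
  from has_integral_linear[OF this bounded_linear_of_real]
  have int: "((\<lambda>x. complex_of_real (zeta_kernel x * x powr (c - 1))) has_integral of_real (integral {0<..}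
      (\<lambda>x. zeta_kernel x * x powr (c - 1)))) {0<..}"
    by (simp add: o_def)
  have "((\<lambda>x. of_real (zeta_kernel x) * complex_of_real x powr (of_real c - 1)) has_integral of_real
      (integral {0<..} (\<lambda>x. zeta_kernel x * x powr (c - 1)))) {0<..}"
  proof (rule has_integral_eq[OF _ int])
    show "complex_of_real (zeta_kernel x * x powr (c - 1)) = of_real (zeta_kernel x) * of_real x powr
        (of_real c - 1)" if "x \<in> {0<..}" for x
      using that powr_of_real[of x "c - 1"] by simp
  qed
  then show ?thesis unfolding zeta_E_def by (rule integral_unique)
qed

lemma zeta_E_bounded:
  obtains M where "M \<ge> 0" "\<And>s. -1/2 \<le> Re s \<Longrightarrow> Re s \<le> 2 \<Longrightarrow> norm (zeta_E s) \<le> M"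
proof
  let ?h = "\<lambda>x. \<bar>zeta_kernel x\<bar> * x powr (-1/2 - 1) + \<bar>zeta_kernel x\<bar> * x powr (2 - 1)"
  have h: "?h integrable_on {0<..}"
    using zeta_kernel_abs_integrable[of "-1/2"] zeta_kernel_abs_integrable[of 2] by (intro integrable_add) auto
  show "integral {0<..} ?h \<ge> 0" by (intro integral_nonneg h) auto
  fix s :: complex assume s: "-1/2 \<le> Re s" "Re s \<le> 2"
  have "norm (zeta_E s) \<le> integral {0<..} (\<lambda>x. \<bar>zeta_kernel x\<bar> * x powr (Re s - 1))"
    unfolding zeta_E_def using s by (intro mellin_integrable(2) zeta_kernel_measurable
        zeta_kernel_abs_integrable) auto
  also have "\<dots> \<le> integral {0<..} ?h"
  proof (rule integral_le[OF _ h])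
    show "(\<lambda>x. \<bar>zeta_kernel x\<bar> * x powr (Re s - 1)) integrable_on {0<..}"
      using s by (intro zeta_kernel_abs_integrable) auto
    fix x :: real assume "x \<in> {0<..}"
    then have x: "x > 0" by simp
    have "x powr (Re s - 1) \<le> x powr (-1/2 - 1) + x powr (2 - 1)"
    proof (cases "x \<ge> 1")
      case True
      then have "x powr (Re s - 1) \<le> x powr (2 - 1)" using s by (intro powr_mono) auto
      then show ?thesis using powr_ge_zero[of x "-1/2 - 1"] by linarith
    next
      case False
      then have "x powr (Re s - 1) \<le> x powr (-1/2 - 1)" using s x by (intro powr_mono') auto
      then show ?thesis using powr_ge_zero[of x "2 - 1"] by linarith
    qed
    then have "\<bar>zeta_kernel x\<bar> * x powr (Re s - 1) \<le> \<bar>zeta_kernel x\<bar> * (x powr (-1/2 - 1) + x powr (2 - 1))"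
      by (rule mult_left_mono) simp
    then show "\<bar>zeta_kernel x\<bar> * x powr (Re s - 1) \<le> ?h x" by (simp only: distrib_left)
  qed
  finally show "norm (zeta_E s) \<le> integral {0<..} ?h" .
qed

text \<open>Two expressions for \<open>(s - 1) * \<zeta> s\<close>: on \<open>Re s > -1\<close> by the Mellin transform of the
  kernel, and on \<open>Re s < 0\<close> by the functional equation.\<close>

definition zeta_g1 :: "complex \<Rightarrow> complex" where
  "zeta_g1 s = (s - 1) * zeta_E s * rGamma s + rGamma s - (s - 1) * rGamma (s + 1) / 2"

definition zeta_g2 :: "complex \<Rightarrow> complex" where
  "zeta_g2 s = (s - 1) * exp ((s - 1/2) * of_real (ln pi)) * rGamma (s / 2) * Gamma ((1 - s) / 2) *
      dirichlet_series zeta_series (1 - s)"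

lemma zeta_g1_holomorphic: "zeta_g1 holomorphic_on {s. Re s > -1}"
  unfolding zeta_g1_def[abs_def]
  by (intro holomorphic_intros zeta_E_holomorphic holomorphic_rGamma') auto

text \<open>The multiplied-out form in the definition is regular at 0 and 1; away from these points
  1 / Gamma (s + 1) = 1 / (s * Gamma s) allows the factored form, into which the evaluated integrals
  can be inserted.\<close>

lemma zeta_g1_eq:
  assumes "s \<noteq> 0" "s \<noteq> 1"
  shows "zeta_g1 s = (s - 1) * rGamma s * (zeta_E s + (1 / (s - 1) - 1 / (2 * s)))"
proof -
  have "rGamma (s + 1) = rGamma s / s" using rGamma_plus1[of s] assms by (simp add: field_simps)
  then have "zeta_g1 s = (s - 1) * zeta_E s * rGamma s + rGamma s - (s - 1) * (rGamma s / s) / 2"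
      by (simp add: zeta_g1_def)
  also have "\<dots> = (s - 1) * rGamma s * (zeta_E s + (1 / (s - 1) - 1 / (2 * s)))"
    using assms by (simp add: field_simps)
  finally show ?thesis .
qed

lemma zeta_dirichlet_holomorphic: "dirichlet_series zeta_series holomorphic_on {s. Re s > 1}"
proof -
  have "dirichlet_series zeta_series field_differentiable at s" if "Re s > 1" for s
    using dirichlet_series_has_field_derivative[OF ramanujan_abs_conv[OF ramanujan_zeta,
        of "(1 + Re s) / 2"], of s] that
    by (auto simp: field_differentiable_def field_simps)
  then show ?thesis by (auto simp: holomorphic_on_def intro: field_differentiable_at_within)
qed

lemma zeta_g2_holomorphic: "zeta_g2 holomorphic_on {s. Re s < 0}"
proof -
  have "(dirichlet_series zeta_series \<circ> (\<lambda>s. 1 - s)) holomorphic_on {s. Re s < 0}"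
    by (rule holomorphic_on_compose_gen[OF _ zeta_dirichlet_holomorphic]) (auto intro!: holomorphic_intros)
  then have 1: "(\<lambda>s. dirichlet_series zeta_series (1 - s)) holomorphic_on {s. Re s < 0}" by (simp add: o_def)
  have "(1 - s) / 2 \<notin> \<int>\<^sub>\<le>\<^sub>0" if "Re s < 0" for s :: complex
    using that by (auto elim!: nonpos_Ints_cases simp: complex_eq_iff)
  then show ?thesis
    unfolding zeta_g2_def[abs_def]
    by (intro holomorphic_intros 1 holomorphic_rGamma' holomorphic_Gamma') auto
qed

lemma zeta_g1_gt_1:
  assumes "Re s > 1"
  shows "zeta_g1 s = (s - 1) * dirichlet_series zeta_series s"
proof (rule holomorphic_eq_on_reals[where f = zeta_g1 and g = "\<lambda>s. (s - 1) * dirichlet_series zeta_series s"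
    and S = "{s. Re s > 1}" and a = 1 and b = 2])
  show "zeta_g1 holomorphic_on {s. 1 < Re s}"
    by (rule holomorphic_on_subset[OF zeta_g1_holomorphic]) auto
  show "(\<lambda>s. (s - 1) * dirichlet_series zeta_series s) holomorphic_on {s. 1 < Re s}"
    by (intro holomorphic_intros zeta_dirichlet_holomorphic)
  show "open {s. 1 < Re s}" by (rule open_halfspace_Re_gt)
  show "connected {s. 1 < Re s}" by (intro convex_connected convex_halfspace_Re_gt)
  fix x :: real assume x: "1 < x" "x < 2"
  define Z where "Z = (\<Sum>n. real (Suc n) powr (-x))"
  have "zeta_E (of_real x) + (1 / (of_real x - 1) - 1 / (2 * of_real x)) = of_real (Gamma x * Z)"
    using zeta_E_of_real[of x] zeta_kernel_integral_gt_1[OF x(1)] x by (simp add: Z_def)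
  moreover have "rGamma (complex_of_real x) * of_real (Gamma x * Z) = of_real Z"
    using x by (simp add: rGamma_inverse_Gamma Gamma_complex_of_real Gamma_eq_zero_iff nonpos_Ints_def)
  ultimately show "zeta_g1 (of_real x) = (of_real x - 1) * dirichlet_series zeta_series (of_real x)"
    using x zeta_g1_eq[of "of_real x"] zeta_dirichlet_of_real[OF x(1)] by (simp add: Z_def mult.assoc)
qed (use assms in auto)

text \<open>Legendre duplication turns Gamma ((1 + s) / 2) / Gamma s into 2 powr (1 - s) * sqrt pi /
  Gamma (s / 2). The powers of 2 cancel against (2 * pi) powr (s - 1), leaving pi powr (s -
  1/2).\<close>

lemma zeta_g1_eq_g2:
  assumes "-1 < Re s" "Re s < 0"
  shows "zeta_g1 s = zeta_g2 s"
proof (rule holomorphic_eq_on_reals[where f = zeta_g1 and g = zeta_g2 and S =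
    "{s. Re s > -1} \<inter> {s. Re s < 0}" and a = "-1" and b = 0])
  show "zeta_g1 holomorphic_on {s. Re s > -1} \<inter> {s. Re s < 0}"
    by (rule holomorphic_on_subset[OF zeta_g1_holomorphic]) auto
  show "zeta_g2 holomorphic_on {s. Re s > -1} \<inter> {s. Re s < 0}"
    by (rule holomorphic_on_subset[OF zeta_g2_holomorphic]) auto
  show "open ({s. Re s > -1} \<inter> {s. Re s < 0})" by (intro open_Int open_halfspace_Re_gt open_halfspace_Re_lt)
  show "connected ({s. Re s > -1} \<inter> {s. Re s < 0})"
    by (intro convex_connected convex_Int convex_halfspace_Re_gt convex_halfspace_Re_lt)
  fix c :: real assume c: "-1 < c" "c < 0"
  let ?s = "complex_of_real c"
  have nn: "?s \<notin> \<int>\<^sub>\<le>\<^sub>0" "?s / 2 \<notin> \<int>\<^sub>\<le>\<^sub>0" "?s / 2 + 1/2 \<notin> \<int>\<^sub>\<le>\<^sub>0"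
    using c by (auto elim!: nonpos_Ints_cases simp: complex_eq_iff field_simps)
  define Z where "Z = (\<Sum>n. real (Suc n) powr (- (1 - c)))"
  have Zeq: "dirichlet_series zeta_series (1 - ?s) = of_real Z"
    using zeta_dirichlet_of_real[of "1 - c"] c by (simp add: Z_def)
  have E: "zeta_E ?s + (1 / (?s - 1) - 1 / (2 * ?s)) =
      of_real ((2 * pi) powr (c - 1)) * (Gamma ((1 + ?s) / 2) * Gamma ((1 - ?s) / 2)) * of_real Z"
  proof -
    have "Gamma ((1 + ?s) / 2) = of_real (Gamma ((1 + c) / 2))" "Gamma ((1 - ?s) / 2) =
        of_real (Gamma ((1 - c) / 2))"
      using Gamma_complex_of_real[of "(1 + c) / 2"] Gamma_complex_of_real[of "(1 - c) / 2"] by simp_all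
    then show ?thesis
      using zeta_E_of_real[of c] zeta_kernel_integral_strip[OF c] c by (simp add: Z_def)
  qed
  have "Gamma (?s / 2) * Gamma (?s / 2 + 1/2) = exp ((1 - 2 * (?s / 2)) * of_real (ln 2)) * of_real (sqrt
      pi) * Gamma (2 * (?s / 2))"
    by (rule Gamma_legendre_duplication[OF nn(2,3)])
  then have "Gamma (?s / 2) * Gamma ((1 + ?s) / 2) = exp ((1 - ?s) * of_real (ln 2)) * of_real (sqrt pi) *
      Gamma ?s"
    by (simp add: add_divide_distrib add.commute)
  then have "rGamma (?s / 2) * rGamma ?s * (Gamma (?s / 2) * Gamma ((1 + ?s) / 2)) =
     rGamma (?s / 2) * rGamma ?s * (exp ((1 - ?s) * of_real (ln 2)) * of_real (sqrt pi) * Gamma ?s)" by simp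
  moreover have "rGamma (?s / 2) * Gamma (?s / 2) = 1" "rGamma ?s * Gamma ?s = 1"
    using nn by (simp_all add: rGamma_inverse_Gamma Gamma_eq_zero_iff)
  ultimately have dup: "rGamma ?s * Gamma ((1 + ?s) / 2) = exp ((1 - ?s) * of_real (ln 2)) * of_real (sqrt
      pi) * rGamma (?s / 2)"
  proof -
    assume a: "rGamma (?s / 2) * rGamma ?s * (Gamma (?s / 2) * Gamma ((1 + ?s) / 2)) =
     rGamma (?s / 2) * rGamma ?s * (exp ((1 - ?s) * of_real (ln 2)) * of_real (sqrt pi) * Gamma ?s)"
      and b: "rGamma (?s / 2) * Gamma (?s / 2) = 1" "rGamma ?s * Gamma ?s = 1"
    have "rGamma ?s * Gamma ((1 + ?s) / 2) = (rGamma (?s / 2) * Gamma (?s / 2)) * (rGamma ?s * Gamma ((1 +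
        ?s) / 2))" by (simp add: b(1))
    also have "\<dots> = rGamma (?s / 2) * rGamma ?s * (Gamma (?s / 2) * Gamma ((1 + ?s) / 2))" by (simp only: mult_ac)
    also have "\<dots> = (rGamma ?s * Gamma ?s) * (exp ((1 - ?s) * of_real (ln 2)) * of_real (sqrt pi) * rGamma
        (?s / 2))"
      unfolding a by (simp only: mult_ac)
    finally show ?thesis by (simp add: b(2))
  qed
  have pw: "of_real ((2 * pi) powr (c - 1)) * (exp ((1 - ?s) * of_real (ln 2)) * of_real (sqrt pi)) =
      exp ((?s - 1/2) * of_real (ln pi))"
  proof -
    have "(2 * pi) powr (c - 1) = exp ((c - 1) * (ln 2 + ln pi))" by (simp add: powr_def ln_mult)
    moreover have "sqrt pi = exp (1/2 * ln pi)" by (simp add: powr_half_sqrt[symmetric] powr_def)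
    moreover have "exp ((1 - ?s) * of_real (ln 2)) = of_real (exp ((1 - c) * ln 2))"
        by (simp add: exp_of_real[symmetric])
    ultimately have "of_real ((2 * pi) powr (c - 1)) * (exp ((1 - ?s) * of_real (ln 2)) * of_real (sqrt pi)) =
        complex_of_real (exp ((c - 1) * (ln 2 + ln pi)) * (exp ((1 - c) * ln 2) * exp (1/2 * ln pi)))"
            by (simp only: of_real_mult)
    also have "exp ((c - 1) * (ln 2 + ln pi)) * (exp ((1 - c) * ln 2) * exp (1/2 * ln pi)) =
        exp ((c - 1/2) * ln pi)"
      unfolding exp_add[symmetric] by (simp add: algebra_simps)
    finally show ?thesis by (simp add: exp_of_real[symmetric])
  qed
  have "zeta_g1 ?s = (?s - 1) * rGamma ?s * (of_real ((2 * pi) powr (c - 1)) * (Gamma ((1 + ?s) / 2) * Gamma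
      ((1 - ?s) / 2)) * of_real Z)"
    using zeta_g1_eq[of ?s] c by (simp only: E) auto
  also have "\<dots> = (?s - 1) * of_real ((2 * pi) powr (c - 1)) * (rGamma ?s * Gamma ((1 + ?s) / 2)) * Gamma ((1
      - ?s) / 2) * of_real Z"
    by (simp only: mult_ac)
  also have "\<dots> = (?s - 1) * (of_real ((2 * pi) powr (c - 1)) * (exp ((1 - ?s) * of_real (ln 2)) * of_real
      (sqrt pi))) * rGamma (?s / 2) * Gamma ((1 - ?s) / 2) * of_real Z"
    unfolding dup by (simp only: mult_ac)
  also have "\<dots> = zeta_g2 ?s" unfolding pw zeta_g2_def Zeq ..
  finally show "zeta_g1 ?s = zeta_g2 ?s" .
qed (use assms in auto)

text \<open>The two expressions agree on -1 < Re s < 0; the line Re s = -1/2 is merely one inside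
  this overlap.\<close>

definition zeta_g :: "complex \<Rightarrow> complex" where
  "zeta_g s = (if Re s > -1/2 then zeta_g1 s else zeta_g2 s)"

lemma zeta_g_eq_g1: "Re s > -1 \<Longrightarrow> zeta_g s = zeta_g1 s"
  using zeta_g1_eq_g2[of s] by (auto simp: zeta_g_def)

lemma zeta_g_eq_g2: "Re s < 0 \<Longrightarrow> zeta_g s = zeta_g2 s"
  using zeta_g1_eq_g2[of s] by (auto simp: zeta_g_def)

lemma zeta_g_holomorphic: "zeta_g holomorphic_on UNIV"
proof -
  have "zeta_g holomorphic_on {s. Re s > -1}"
    by (rule holomorphic_transform[OF zeta_g1_holomorphic]) (simp add: zeta_g_eq_g1)
  moreover have "zeta_g holomorphic_on {s. Re s < 0}"
    by (rule holomorphic_transform[OF zeta_g2_holomorphic]) (simp add: zeta_g_eq_g2)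
  ultimately have "zeta_g holomorphic_on ({s. Re s > -1} \<union> {s. Re s < 0})"
    by (intro holomorphic_on_Un) (auto simp: open_halfspace_Re_gt open_halfspace_Re_lt)
  moreover have "{s. Re s > -1} \<union> {s. Re s < 0} = UNIV" by auto
  ultimately show ?thesis by simp
qed

section \<open>Finite order of zeta\<close>

lemma norm_Gamma_le:
  assumes z: "Re z > 0"
  shows "norm (Gamma z) \<le> Gamma (Re z)"
proof -
  have 1: "((\<lambda>t. t powr (Re z - 1) / exp t) has_integral Gamma (Re z)) {0<..}"
    by (rule has_integral_spike_point[OF Gamma_integral_real[OF z], of 0]) auto
  have "norm (integral {0<..} (\<lambda>t. of_real t powr (z - 1) / of_real (exp t))) \<le>
      integral {0<..} (\<lambda>t. t powr (Re z - 1) / exp t)"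
    using Gamma_integral_complex'[OF z] 1
    by (intro integral_norm_bound_integral) (auto simp: has_integral_iff norm_divide norm_powr_real_powr)
  then show ?thesis using integral_unique[OF Gamma_integral_complex'[OF z]] integral_unique[OF 1] by simp
qed

text \<open>(N - 1)! \<le> (N - 1) ^ (N - 1) \<le> exp ((N - 1)^2) with N the ceiling of x: crude,
  but of finite order.\<close>

lemma Gamma_real_growth:
  obtains C :: real where "C > 0" "\<And>x. x \<ge> 1/2 \<Longrightarrow> Gamma x \<le> C * exp ((x + 1) ^ 2)"
proof -
  have "compact (Gamma ` {1/2..2::real})"
    by (intro compact_continuous_image continuous_on_Gamma) (auto elim!: nonpos_Ints_cases)
  then obtain B where B: "\<And>x. x \<in> {1/2..2::real} \<Longrightarrow> norm (Gamma x) \<le> B"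
    using compact_imp_bounded bounded_iff by (metis imageI)
  define C where "C = max 1 B"
  have "Gamma x \<le> C * exp ((x + 1) ^ 2)" if x: "x \<ge> 1/2" for x
  proof (cases "x \<le> 2")
    case True
    then have "Gamma x \<le> C * 1" using B[of x] x by (auto simp: C_def)
    also have "\<dots> \<le> C * exp ((x + 1) ^ 2)" by (intro mult_left_mono) (auto simp: C_def)
    finally show ?thesis .
  next
    case False
    define N where "N = nat \<lceil>x\<rceil>"
    have N: "x \<le> real N" "real N \<le> x + 1" "N \<ge> 1" using False unfolding N_def by linarith+
    have "Gamma x \<le> Gamma (real N)"
      using False N Gamma_real_strict_mono[of x "real N"] by (cases "x = real N") auto
    also have "\<dots> = fact (N - 1)" using Gamma_fact[of "N - 1", where ?'a = real] N by (simp add: of_nat_diff)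
    also have "\<dots> \<le> real ((N - 1) ^ (N - 1))" using fact_le_power[of "N - 1" , where ?'a = real] by simp
    also have "\<dots> \<le> exp (real (N - 1)) ^ (N - 1)"
      unfolding of_nat_power using exp_ge_add_one_self[of "real (N - 1)"] by (intro power_mono) linarith+
    also have "\<dots> = exp (real (N - 1) * real (N - 1))" by (simp add: exp_of_nat_mult)
    also have "\<dots> \<le> exp ((x + 1) ^ 2)"
      unfolding power2_eq_square using N by (subst exp_le_cancel_iff, intro mult_mono) auto
    also have "\<dots> \<le> C * exp ((x + 1) ^ 2)" by (simp add: C_def)
    finally show ?thesis .
  qed
  moreover have "C > 0" by (simp add: C_def)
  ultimately show ?thesis using that by blast
qed

lemma norm_sin_le_exp: "norm (sin z :: complex) \<le> exp (norm z)"
proof -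
  have 1: "norm (exp (\<i> * z)) \<le> exp (norm z)" "norm (exp (- (\<i> * z))) \<le> exp (norm z)"
    using norm_exp[of "\<i> * z"] norm_exp[of "- (\<i> * z)"] by (auto simp: norm_mult)
  have "norm (sin z) = norm (exp (\<i> * z) - exp (- (\<i> * z))) / 2"
    unfolding sin_exp_eq by (simp add: norm_divide norm_mult)
  also have "\<dots> \<le> (exp (norm z) + exp (norm z)) / 2"
    by (intro divide_right_mono order.trans[OF norm_triangle_ineq4] add_mono 1) auto
  finally show ?thesis by simp
qed

text \<open>Reflection: 1 / Gamma z = sin (pi * z) * Gamma (1 - z) / pi, where Re (1 - z) \<ge>
  1/2.\<close>

lemma rGamma_growth_left:
  obtains C where "C > 0" "\<And>z::complex. Re z \<le> 1/2 \<Longrightarrow> norm (rGamma z) \<le> C * exp ((norm z + 4) ^ 2)"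
proof -
  obtain C :: real where C: "C > 0" "\<And>x. x \<ge> 1/2 \<Longrightarrow> Gamma x \<le> C * exp ((x + 1) ^ 2)"
    by (rule Gamma_real_growth) blast
  have "norm (rGamma z) \<le> C * exp ((norm z + 4) ^ 2)" if z: "Re z \<le> 1/2" for z :: complex
  proof -
    have nn: "1 - z \<notin> \<int>\<^sub>\<le>\<^sub>0" using z by (auto elim!: nonpos_Ints_cases simp: complex_eq_iff)
    have "rGamma z = rGamma z * (rGamma (1 - z) * Gamma (1 - z))"
      using nn by (simp add: rGamma_inverse_Gamma Gamma_eq_zero_iff)
    also have "\<dots> = sin (of_real pi * z) / of_real pi * Gamma (1 - z)"
      by (simp add: rGamma_reflection_complex flip: mult.assoc)
    finally have "norm (rGamma z) = norm (sin (of_real pi * z)) / pi * norm (Gamma (1 - z))"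
      by (simp add: norm_mult norm_divide)
    also have "\<dots> \<le> exp (4 * norm z) * (C * exp ((norm z + 2) ^ 2))"
    proof (intro mult_mono)
      have "norm (sin (of_real pi * z)) / pi \<le> norm (sin (of_real pi * z)) / 1"
        using pi_ge_two by (intro divide_left_mono) auto
      also have "\<dots> \<le> exp (norm (of_real pi * z))" using norm_sin_le_exp by simp
      also have "\<dots> \<le> exp (4 * norm z)" using pi_less_4 by (simp add: norm_mult mult_right_mono)
      finally show "norm (sin (of_real pi * z)) / pi \<le> exp (4 * norm z)" .
      have "norm (Gamma (1 - z)) \<le> Gamma (Re (1 - z))" using z by (intro norm_Gamma_le) auto
      also have "\<dots> \<le> C * exp ((Re (1 - z) + 1) ^ 2)" using z by (intro C) auto
      also have "\<dots> \<le> C * exp ((norm z + 2) ^ 2)"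
        using C(1) z abs_Re_le_cmod[of z] by (intro mult_left_mono, subst exp_le_cancel_iff, intro power_mono) auto
      finally show "norm (Gamma (1 - z)) \<le> C * exp ((norm z + 2) ^ 2)" .
    qed auto
    also have "\<dots> = C * exp (4 * norm z + (norm z + 2) ^ 2)" by (simp add: exp_add)
    also have "\<dots> \<le> C * exp ((norm z + 4) ^ 2)"
      using C(1) by (intro mult_left_mono) (auto simp: power2_eq_square algebra_simps)
    finally show ?thesis .
  qed
  with C(1) show ?thesis using that by blast
qed

text \<open>Three steps of the recurrence lead from Re z \<le> 3 to Re z \<le> 0; the factors z - 1,
  z - 2, z - 3 have modulus at least 1 because |Im z| \<ge> 1.\<close>

lemma rGamma_growth_strip:
  obtains C where "C > 0" "\<And>z::complex. Re z \<le> 3 \<Longrightarrow> \<bar>Im z\<bar> \<ge> 1 \<Longrightarrow> norm (rGamma z) \<le> C * exp ((norm z + 7) ^ 2)"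
proof -
  obtain C where C: "C > 0" "\<And>z::complex. Re z \<le> 1/2 \<Longrightarrow> norm (rGamma z) \<le> C * exp ((norm z + 4) ^ 2)"
    by (rule rGamma_growth_left) blast
  have "norm (rGamma z) \<le> C * exp ((norm z + 7) ^ 2)" if z: "Re z \<le> 3" "\<bar>Im z\<bar> \<ge> 1" for z :: complex
  proof -
    have ge: "1 \<le> norm (z - of_real c)" for c using abs_Im_le_cmod[of "z - of_real c"] z by simp
    have "rGamma (z - 3) = (z - 3) * rGamma (z - 3 + 1)" by (rule rGamma_plus1[symmetric])
    also have "z - 3 + 1 = z - 2" by simp
    also have "rGamma (z - 2) = (z - 2) * rGamma (z - 2 + 1)" by (rule rGamma_plus1[symmetric])
    also have "z - 2 + 1 = z - 1" by simp
    also have "rGamma (z - 1) = (z - 1) * rGamma (z - 1 + 1)" by (rule rGamma_plus1[symmetric])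
    finally have eq: "rGamma (z - 3) = (z - 3) * ((z - 2) * ((z - 1) * rGamma z))" by simp
    have "1 * (1 * (1 * norm (rGamma z))) \<le> norm (z - 3) * (norm (z - 2) * (norm (z - 1) * norm (rGamma z)))"
      using ge[of 3] ge[of 2] ge[of 1] by (intro mult_mono) auto
    also have "\<dots> = norm (rGamma (z - 3))" unfolding eq norm_mult ..
    also have "\<dots> \<le> C * exp ((norm (z - 3) + 4) ^ 2)" using z by (intro C) auto
    also have "\<dots> \<le> C * exp ((norm z + 7) ^ 2)"
      using C(1) norm_triangle_ineq4[of z 3] by (intro mult_left_mono, subst exp_le_cancel_iff,
          intro power_mono) auto
    finally show ?thesis by simp
  qed
  with C(1) show ?thesis using that by blast
qed

text \<open>Three regions: the Dirichlet series for Re s \<ge> 2, the reflected expression for Re s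
  \<le> -1/2, the Mellin expression between them. In the strip norm s \<ge> 4 forces |Im s| \<ge> 1,
  as the bound for 1 / Gamma demands.\<close>

lemma zeta_g_finite_order: "finite_order zeta_g"
proof -
  obtain C1 where C1: "C1 > 0" "\<And>x::real. x \<ge> 1/2 \<Longrightarrow> Gamma x \<le> C1 * exp ((x + 1) ^ 2)"
    by (rule Gamma_real_growth) blast
  obtain C2 where C2: "C2 > 0" "\<And>z::complex. Re z \<le> 1/2 \<Longrightarrow> norm (rGamma z) \<le> C2 * exp ((norm z + 4) ^ 2)"
    by (rule rGamma_growth_left) blast
  obtain C3 where C3: "C3 > 0" "\<And>z::complex. Re z \<le> 3 \<Longrightarrow> \<bar>Im z\<bar> \<ge> 1 \<Longrightarrow> norm (rGamma z) \<le> C3 * exp ((norm z + 7) ^ 2)"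
    by (rule rGamma_growth_strip) blast
  obtain M where M: "M \<ge> 0" "\<And>s. -1/2 \<le> Re s \<Longrightarrow> Re s \<le> 2 \<Longrightarrow> norm (zeta_E s) \<le> M"
    by (rule zeta_E_bounded) blast
  define Z where "Z = (\<Sum>n. norm (zeta_series n) * real n powr (- (3/2)))"
  have absz: "abs_conv zeta_series (3/2)" by (rule ramanujan_abs_conv[OF ramanujan_zeta]) simp
  have Z: "norm (dirichlet_series zeta_series s) \<le> Z" if "Re s \<ge> 3/2" for s
    unfolding Z_def using norm_dirichlet_series_le[OF absz that] .
  have Z0: "Z \<ge> 0" using Z[of 2] norm_ge_zero[of "dirichlet_series zeta_series 2"] by (auto simp del: norm_ge_zero)
  define K where "K = Z + C2 * C1 * Z + (M * C3 + C3 + C3)"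
  have K: "K \<ge> Z" "K \<ge> C2 * C1 * Z" "K \<ge> M * C3 + C3 + C3" "K \<ge> 0"
    using Z0 C1(1) C2(1) C3(1) M(1) by (auto simp: K_def intro!: add_nonneg_nonneg mult_nonneg_nonneg)
  have main: "norm (zeta_g s) \<le> K * exp (3 * (norm s + 8) ^ 2)" if s: "norm s \<ge> 4" for s
  proof -
    define e where "e = exp ((norm s + 8) ^ 2)"
    have e1: "e \<ge> 1" by (simp add: e_def)
    have lin: "norm (s - 1) \<le> e"
    proof -
      have "norm (s - 1) \<le> norm s + 1" using norm_triangle_ineq4[of s 1] by simp
      also have "\<dots> \<le> (norm s + 8) ^ 2 + 1" by (simp add: power2_eq_square algebra_simps)
      also have "\<dots> \<le> e" unfolding e_def by (metis exp_ge_add_one_self add.commute)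
      finally show ?thesis .
    qed
    have le_e: "exp ((x + y) ^ 2) \<le> e" if "x + y \<le> norm s + 8" "x + y \<ge> 0" for x y
      unfolding e_def using that by (subst exp_le_cancel_iff) (intro power_mono)
    have e3: "exp (3 * (norm s + 8) ^ 2) = e * e * e"
      by (simp add: e_def flip: exp_add)
    consider "Re s \<ge> 2" | "Re s \<le> -1/2" | "-1/2 < Re s" "Re s < 2" by linarith
    then have "norm (zeta_g s) \<le> K * (e * e * e)"
    proof cases
      case 1
      have "zeta_g s = (s - 1) * dirichlet_series zeta_series s"
        using 1 zeta_g_eq_g1[of s] zeta_g1_gt_1[of s] by simp
      then have "norm (zeta_g s) \<le> e * Z"
        using Z[of s] 1 lin e1 by (simp add: norm_mult mult_mono)
      also have "\<dots> \<le> K * (e * e * e)"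
      proof -
        have "Z * (e * 1 * 1) \<le> K * (e * e * e)" using K Z0 e1 by (intro mult_mono) auto
        then show ?thesis by (simp add: mult.commute)
      qed
      finally show ?thesis .
    next
      case 2
      have n1: "norm (exp ((s - 1/2) * of_real (ln pi))) \<le> 1"
        using 2 pi_ge_two by (auto intro!: mult_nonpos_nonneg)
      have n2: "norm (rGamma (s / 2)) \<le> C2 * e"
      proof -
        have "norm (rGamma (s / 2)) \<le> C2 * exp ((norm (s / 2) + 4) ^ 2)" using 2 by (intro C2) auto
        also have "\<dots> \<le> C2 * e" using C2(1) by (intro mult_left_mono le_e) (auto simp: norm_divide)
        finally show ?thesis .
      qed
      have n3: "norm (Gamma ((1 - s) / 2)) \<le> C1 * e"
      proof -
        have "norm (Gamma ((1 - s) / 2)) \<le> Gamma (Re ((1 - s) / 2))" using 2 by (intro norm_Gamma_le) auto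
        also have "\<dots> \<le> C1 * exp ((Re ((1 - s) / 2) + 1) ^ 2)" using 2 by (intro C1) auto
        also have "\<dots> \<le> C1 * e"
          using C1(1) abs_Re_le_cmod[of s] 2 by (intro mult_left_mono le_e) auto
        finally show ?thesis .
      qed
      have "norm (zeta_g s) = norm (s - 1) * norm (exp ((s - 1/2) * of_real (ln pi))) * norm (rGamma (s /
          2)) * norm (Gamma ((1 - s) / 2)) * norm (dirichlet_series zeta_series (1 - s))"
        using 2 zeta_g_eq_g2[of s] unfolding zeta_g2_def norm_mult[symmetric] by simp
      also have "\<dots> \<le> e * 1 * (C2 * e) * (C1 * e) * Z"
        using lin n1 n2 n3 Z[of "1 - s"] 2 e1 C1(1) C2(1) Z0 by (intro mult_mono) auto
      also have "\<dots> = (C2 * C1 * Z) * (e * e * e)" by simp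
      also have "\<dots> \<le> K * (e * e * e)" using K e1 by (intro mult_right_mono) auto
      finally show ?thesis .
    next
      case 3
      have im: "\<bar>Im s\<bar> \<ge> 1" using cmod_le[of s] s 3 by linarith
      have g1: "norm (rGamma s) \<le> C3 * e"
      proof -
        have "norm (rGamma s) \<le> C3 * exp ((norm s + 7) ^ 2)" using 3 im by (intro C3) auto
        also have "\<dots> \<le> C3 * e" using C3(1) by (intro mult_left_mono le_e) auto
        finally show ?thesis .
      qed
      have g2: "norm (rGamma (s + 1)) \<le> C3 * e"
      proof -
        have "norm (rGamma (s + 1)) \<le> C3 * exp ((norm (s + 1) + 7) ^ 2)" using 3 im by (intro C3) auto
        also have "\<dots> \<le> C3 * e" using C3(1) norm_triangle_ineq[of s 1] by (intro mult_left_mono le_e) auto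
        finally show ?thesis .
      qed
      have "norm (zeta_g s) = norm ((s - 1) * zeta_E s * rGamma s + rGamma s - (s - 1) * rGamma (s + 1) / 2)"
        using 3 zeta_g_eq_g1[of s] by (simp add: zeta_g1_def)
      also have "\<dots> \<le> norm ((s - 1) * zeta_E s * rGamma s) + norm (rGamma s) + norm ((s - 1) * rGamma (s + 1) / 2)"
        by (intro order.trans[OF norm_triangle_ineq4] add_right_mono norm_triangle_ineq)
      also have "\<dots> \<le> e * M * (C3 * e) + C3 * e + e * (C3 * e)"
      proof (intro add_mono)
        show "norm ((s - 1) * zeta_E s * rGamma s) \<le> e * M * (C3 * e)"
          unfolding norm_mult using lin g1 M 3 e1 by (intro mult_mono) auto
        have "norm ((s - 1) * rGamma (s + 1) / 2) \<le> norm (s - 1) * norm (rGamma (s + 1))"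
          by (simp add: norm_mult norm_divide)
        also have "\<dots> \<le> e * (C3 * e)" using lin g2 e1 by (intro mult_mono) auto
        finally show "norm ((s - 1) * rGamma (s + 1) / 2) \<le> e * (C3 * e)" .
      qed (rule g1)
      also have "\<dots> \<le> (M * C3 + C3 + C3) * (e * e * e)"
      proof -
        have a: "M * C3 * (e * e * 1) \<le> M * C3 * (e * e * e)" using M(1) C3(1) e1 by (intro mult_left_mono
            mult_mono) auto
        have b: "C3 * (1 * 1 * e) \<le> C3 * (e * e * e)" using C3(1) e1 by (intro mult_left_mono mult_mono) auto
        have c: "C3 * (e * e * 1) \<le> C3 * (e * e * e)" using C3(1) e1 by (intro mult_left_mono mult_mono) auto
        have "e * M * (C3 * e) + C3 * e + e * (C3 * e) = M * C3 * (e * e * 1) + C3 * (1 * 1 * e) + C3 * (e *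
            e * 1)" by simp
        also have "\<dots> \<le> M * C3 * (e * e * e) + C3 * (e * e * e) + C3 * (e * e * e)" by (intro add_mono a b c)
        also have "\<dots> = (M * C3 + C3 + C3) * (e * e * e)" by (simp only: distrib_right)
        finally show ?thesis .
      qed
      also have "\<dots> \<le> K * (e * e * e)" using K e1 by (intro mult_right_mono) auto
      finally show ?thesis .
    qed
    then show ?thesis by (simp only: e3)
  qed
  show ?thesis
    unfolding finite_order_def
  \<comment> \<open>For norm s \<ge> 12 one has 3 * (norm s + 8)^2 \<le> 12 * (norm s)^2 \<le> (norm
    s)^3.\<close>
  proof (intro exI[of _ 3] bigoI[where c = K] eventually_at_infinityI[of 12])
    fix s :: complex assume s: "12 \<le> norm s"
    have "3 * (norm s + 8) ^ 2 \<le> 3 * (2 * norm s) ^ 2" using s by (intro mult_left_mono power_mono) auto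
    also have "\<dots> = 12 * norm s ^ 2" by (simp add: power2_eq_square)
    also have "\<dots> \<le> norm s * norm s ^ 2" using s by (intro mult_right_mono) auto
    also have "\<dots> = norm s powr 3"
    proof -
      have "norm s > 0" using s by linarith
      then show ?thesis by (simp add: power2_eq_square power3_eq_cube)
    qed
    finally have "K * exp (3 * (norm s + 8) ^ 2) \<le> K * exp (norm s powr 3)" using K by (intro mult_left_mono) auto
    then show "norm (norm (zeta_g s)) \<le> K * norm (exp (norm s powr 3))" using main[of s] s by simp
  qed
qed

section \<open>Zeta as an element of the Selberg class\<close>

lemma selberg_analytic_zeta: "selberg_analytic zeta_series"
  unfolding selberg_analytic_def
  using zeta_g_holomorphic zeta_g_finite_order zeta_g_eq_g1 zeta_g1_gt_1
  by (intro exI[of _ 1] exI[of _ zeta_g]) auto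

lemma Dfun_zeta_eq:
  assumes "s \<noteq> 1"
  shows "Dfun zeta_series s = zeta_g s / (s - 1)"
proof (rule holomorphic_eq_Dfun[symmetric, OF selberg_analytic_zeta _ _ assms])
  show "(\<lambda>s. zeta_g s / (s - 1)) holomorphic_on -{1}"
    by (intro holomorphic_intros holomorphic_on_subset[OF zeta_g_holomorphic]) auto
  show "zeta_g s / (s - 1) = dirichlet_series zeta_series s" if "Re s > 1" for s
  proof -
    have "s \<noteq> 1" using that by auto
    then show ?thesis using that zeta_g_eq_g1[of s] zeta_g1_gt_1[of s] by simp
  qed
qed

lemma zeta_g_1: "zeta_g 1 = 1"
  using zeta_g_eq_g1[of 1] by (simp add: zeta_g1_def)

lemma zeta_g_cnj: "cnj (zeta_g (cnj s)) = zeta_g s"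
proof (rule holomorphic_eq_on_reals[where f = "\<lambda>s. cnj (zeta_g (cnj s))" and g = zeta_g and S = UNIV and a =
    1 and b = 2])
  show "(\<lambda>s. cnj (zeta_g (cnj s))) holomorphic_on UNIV"
    using holomorphic_on_compose_cnj_cnj[of zeta_g UNIV] zeta_g_holomorphic
    by (simp add: o_def holomorphic_on_subset)
  fix x :: real assume x: "1 < x" "x < 2"
  have "zeta_g (of_real x) = of_real ((x - 1) * (\<Sum>n. real (Suc n) powr (-x)))"
    using x zeta_g_eq_g1[of "of_real x"] zeta_g1_gt_1[of "of_real x"] zeta_dirichlet_of_real[OF x(1)] by simp
  then show "cnj (zeta_g (cnj (of_real x))) = zeta_g (of_real x)" by simp
qed (use zeta_g_holomorphic in auto)

text \<open>The integers contain all points where conventional values of Gamma or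
  \<open>Dfun\<close> could disturb the functional equation of \<zeta>; being isolated, they form a
  negligible set.\<close>

lemma eventually_not_Ints: "\<forall>\<^sub>\<approx>s\<in>UNIV. s \<notin> (\<int> :: complex set)"
proof -
  have "eventually (\<lambda>w. w \<notin> \<int>) (at z)" for z :: complex
  proof -
    define F where "F = complex_of_int ` {\<lfloor>Re z - 1\<rfloor>..\<lceil>Re z + 1\<rceil>}"
    have "finite F" by (simp add: F_def)
    then obtain d where d: "d > 0" "\<And>x. x \<in> F \<Longrightarrow> x \<noteq> z \<Longrightarrow> d \<le> dist z x"
      using finite_set_avoid[of F z] by blast
    show ?thesis
      unfolding eventually_at
    proof (intro exI[of _ "min d 1"] conjI ballI impI)
      fix w assume w: "w \<noteq> z \<and> dist w z < min d 1"
      show "w \<notin> \<int>"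
      proof
        assume "w \<in> \<int>"
        then obtain n where n: "w = of_int n" by (auto elim: Ints_cases)
        have "\<bar>Re (w - z)\<bar> < 1" using abs_Re_le_cmod[of "w - z"] w by (simp add: dist_norm)
        then have "Re z - 1 \<le> real_of_int n" "real_of_int n \<le> Re z + 1" by (simp_all add: n abs_less_iff)
        then have "n \<in> {\<lfloor>Re z - 1\<rfloor>..\<lceil>Re z + 1\<rceil>}" by (simp, linarith)
        then have "w \<in> F" by (simp add: F_def n)
        from d(2)[OF this] w show False by (simp add: dist_commute)
      qed
    qed (use d in auto)
  qed
  then show ?thesis by (simp add: eventually_cosparse_open_eq)
qed

text \<open>Left of 0 the completed function has the symmetry by \<open>zeta_g2\<close>, and right
  of 1 by exchanging s and 1 - s. The strip between is reached by continuing an identity of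
  pole-free functions.\<close>

lemma functional_equation_zeta: "functional_equation zeta_series"
proof -
  define \<gamma> where "\<gamma> s = exp (- (s / 2) * of_real (ln pi)) * Gamma (s / 2)" for s :: complex
  define \<Phi> where "\<Phi> s = \<gamma> s * Dfun zeta_series s" for s
  have half: "s / 2 \<notin> \<int>\<^sub>\<le>\<^sub>0" if "s \<notin> \<int>" for s :: complex
  proof
    assume "s / 2 \<in> \<int>\<^sub>\<le>\<^sub>0"
    then have "2 * (s / 2) \<in> \<int>" using nonpos_Ints_Int by (intro Ints_mult) auto
    with that show False by simp
  qed
  \<comment> \<open>Q = 1 / sqrt pi, w = 1/2 and \<mu> = 0 encode the classical factor pi powr (-s /
    2) * Gamma (s / 2).\<close>
  have gamma: "gamma_factor 1 (1 / sqrt pi) 1 (\<lambda>_. 1/2) (\<lambda>_. 0) s = \<gamma> s" for s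
  proof -
    have "ln (1 / sqrt pi) = - (ln pi / 2)" by (simp add: ln_div ln_sqrt)
    then have "Ln (complex_of_real (1 / sqrt pi)) = - (of_real (ln pi) / 2)"
      by (subst Ln_of_real) simp_all
    then have "complex_of_real (1 / sqrt pi) powr s = exp (- (s / 2) * of_real (ln pi))"
      unfolding powr_def by (subst if_not_P) simp_all
    moreover have "(\<Prod>i<1::nat. Gamma (complex_of_real (1/2) * s + 0)) = Gamma (s / 2)" by simp
    ultimately show ?thesis unfolding gamma_factor_def \<gamma>_def by (simp only: mult_1)
  qed
  have cnjs: "cnj (\<Phi> (cnj s)) = \<Phi> s" if "s \<noteq> 1" for s
  proof -
    have "cnj s \<noteq> 1" using that by (metis complex_cnj_cnj complex_cnj_one)
    then show ?thesis using that zeta_g_cnj[of s]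
      by (simp add: \<Phi>_def \<gamma>_def Dfun_zeta_eq exp_cnj cnj_Gamma)
  qed
  have left: "\<Phi> s = \<Phi> (1 - s)" if s: "Re s < 0" "s \<notin> \<int>" for s
  proof -
    have s1: "s \<noteq> 1" "s - 1 \<noteq> 0" using s by auto
    have "rGamma (s / 2) * Gamma (s / 2) = 1"
      using half[OF s(2)] by (simp add: rGamma_inverse_Gamma Gamma_eq_zero_iff)
    moreover have "Dfun zeta_series s = exp ((s - 1/2) * of_real (ln pi)) * rGamma (s / 2) * Gamma ((1 - s)
        / 2) * dirichlet_series zeta_series (1 - s)"
      using s1 zeta_g_eq_g2[OF s(1)] by (simp add: Dfun_zeta_eq zeta_g2_def)
    moreover have "x * y * (u * v * w * t) = (v * y) * (x * u * w * t)"
        for x y u v w t :: complex by (simp only: mult_ac)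
    ultimately have "\<Phi> s = (exp (- (s / 2) * of_real (ln pi)) * exp ((s - 1/2) * of_real (ln pi))) * Gamma
        ((1 - s) / 2) * dirichlet_series zeta_series (1 - s)"
      unfolding \<Phi>_def \<gamma>_def by (simp only: mult_1)
    also have "exp (- (s / 2) * of_real (ln pi)) * exp ((s - 1/2) * of_real (ln pi)) =
        exp (- ((1 - s) / 2) * of_real (ln pi))"
      unfolding exp_add[symmetric] by (rule arg_cong[where f = exp]) (simp add: diff_divide_distrib algebra_simps)
    also have "dirichlet_series zeta_series (1 - s) = Dfun zeta_series (1 - s)"
      using s by (intro Dfun_eq_dirichlet_series[OF selberg_analytic_zeta, symmetric]) auto
    finally show ?thesis by (simp add: \<Phi>_def \<gamma>_def)
  qed
  \<comment> \<open>This is s * (s - 1) / 2 times the completed function. Writing s / 2 * Gamma (s /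
    2) as Gamma (s / 2 + 1) makes it holomorphic on Re s > -2, so that its symmetry can be continued
    from -2 < Re s < -1 across the strip.\<close>
  define P where "P s = exp (- (s / 2) * of_real (ln pi)) * Gamma (s / 2 + 1) * zeta_g s" for s
  have P\<Phi>: "P s = s * (s - 1) / 2 * \<Phi> s" if "s \<notin> \<int>" for s
  proof -
    have "s \<noteq> 1" using that by auto
    then have "zeta_g s = (s - 1) * Dfun zeta_series s" by (simp add: Dfun_zeta_eq)
    moreover have "Gamma (s / 2 + 1) = s / 2 * Gamma (s / 2)" using Gamma_plus1[of "s / 2"] half[OF that] by auto
    ultimately show ?thesis
      by (simp add: P_def \<Phi>_def \<gamma>_def)
  qed
  have holP: "P holomorphic_on {s. Re s > -2}"
  proof -
    have "s / 2 + 1 \<notin> \<int>\<^sub>\<le>\<^sub>0" if "Re s > -2" for s :: complex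
      using that by (auto elim!: nonpos_Ints_cases simp: complex_eq_iff)
    then show ?thesis
      unfolding P_def[abs_def]
      by (intro holomorphic_intros holomorphic_Gamma' holomorphic_on_subset[OF zeta_g_holomorphic]) auto
  qed
  have holP': "(\<lambda>s. P (1 - s)) holomorphic_on {s. Re s < 3}"
  proof -
    have "(P \<circ> (\<lambda>s. 1 - s)) holomorphic_on {s. Re s < 3}"
      by (rule holomorphic_on_compose_gen[OF _ holP]) (auto intro!: holomorphic_intros)
    then show ?thesis by (simp add: o_def)
  qed
  have Psym: "P s = P (1 - s)" if "-2 < Re s" "Re s < 3" for s
  proof (rule analytic_continuation_open[of "{s. Re s > -2} \<inter> {s. Re s < -1}"
      "{s. Re s > -2} \<inter> {s. Re s < 3}" P "\<lambda>s. P (1 - s)"])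
    show "open ({s. Re s > -2} \<inter> {s. Re s < -1})" by (intro open_Int open_halfspace_Re_gt open_halfspace_Re_lt)
    show "open ({s. Re s > -2} \<inter> {s. Re s < 3})" by (intro open_Int open_halfspace_Re_gt open_halfspace_Re_lt)
    show "connected ({s. Re s > -2} \<inter> {s. Re s < 3})"
      by (intro convex_connected convex_Int convex_halfspace_Re_gt convex_halfspace_Re_lt)
    have "complex_of_real (-3/2) \<in> {s. Re s > -2} \<inter> {s. Re s < -1}" by simp
    then show "{s. Re s > -2} \<inter> {s. Re s < -1} \<noteq> {}" by blast
    show "P z = P (1 - z)" if "z \<in> {s. Re s > -2} \<inter> {s. Re s < -1}" for z
    proof -
      have z: "z \<notin> \<int>"
      proof
        assume "z \<in> \<int>"
        then obtain n where "z = of_int n" by (auto elim: Ints_cases)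
        with that have "of_int (-2) < (of_int n :: real)" "(of_int n :: real) < of_int (-1)" by simp_all
        then have "-2 < n" "n < -1" unfolding of_int_less_iff by simp_all
        then show False by simp
      qed
      have "1 - z \<notin> \<int>"
      proof
        assume "1 - z \<in> \<int>"
        then have "1 - (1 - z) \<in> \<int>" by (intro Ints_diff) auto
        with z show False by simp
      qed
      then show ?thesis using z left[of z] that by (simp add: P\<Phi> algebra_simps)
    qed
    show "P holomorphic_on {s. - 2 < Re s} \<inter> {s. Re s < 3}" by (rule holomorphic_on_subset[OF holP]) auto
    show "(\<lambda>s. P (1 - s)) holomorphic_on {s. - 2 < Re s} \<inter> {s. Re s < 3}"
        by (rule holomorphic_on_subset[OF holP']) auto
  qed (use that in auto)
  have sym: "\<Phi> s = \<Phi> (1 - s)" if s: "s \<notin> \<int>" for s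
  proof -
    have s': "1 - s \<notin> \<int>"
    proof
      assume "1 - s \<in> \<int>"
      then have "1 - (1 - s) \<in> \<int>" by (intro Ints_diff) auto
      with s show False by simp
    qed
    consider "Re s < 0" | "Re s > 1" | "-2 < Re s" "Re s < 3" by linarith
    then show ?thesis
    proof cases
      case 1 then show ?thesis using left s by blast
    next
      case 2 then show ?thesis using left[of "1 - s"] s' by simp
    next
      case 3
      have "s * (s - 1) / 2 * \<Phi> s = (1 - s) * (1 - s - 1) / 2 * \<Phi> (1 - s)"
        using Psym[OF 3] P\<Phi>[OF s] P\<Phi>[OF s'] by simp
      moreover have "(1 - s) * (1 - s - 1) / 2 = s * (s - 1) / 2" by (simp add: algebra_simps)
      moreover have "s * (s - 1) / 2 \<noteq> 0" using s by auto
      ultimately show ?thesis by (metis mult_left_cancel)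
    qed
  qed
  have "\<forall>\<^sub>\<approx>s\<in>UNIV. \<Phi> s = cnj_fun \<Phi> (1 - s)"
    using eventually_not_Ints
  proof eventually_elim
    case (elim s)
    then have "1 - s \<noteq> 1" by auto
    from cnjs[OF this] sym[OF elim] show ?case by (simp add: cnj_fun_def)
  qed
  then show ?thesis
    unfolding functional_equation_def Let_def
    by (intro exI[of _ 1] exI[of _ "1 / sqrt pi"] exI[of _ "\<lambda>_. 1/2"] exI[of _ "\<lambda>_. 0"] exI[of _ "1 :: nat"])
       (simp only: gamma flip: \<Phi>_def, auto)
qed

lemma zeta_in_selberg: "zeta_series \<in> selberg_class"
  using selberg_analytic_zeta ramanujan_zeta functional_equation_zeta euler_product_zeta
  by (simp add: selberg_class_def zeta_series_def)

section \<open>Factorization into primitive elements\<close>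

text \<open>Lists keep multiplicities, which decide how often \<zeta> divides F.\<close>

definition dconv_list :: "(nat \<Rightarrow> complex) list \<Rightarrow> nat \<Rightarrow> complex" where
  "dconv_list ps = foldr dconv ps one_series"

lemma dconv_list_simps [simp]: "dconv_list [] = one_series" "dconv_list (p # ps) = dconv p (dconv_list ps)"
  by (simp_all add: dconv_list_def)

lemma dconv_list_in_selberg: "set ps \<subseteq> selberg_class \<Longrightarrow> dconv_list ps \<in> selberg_class"
  by (induction ps) (auto intro: one_series_in_selberg selberg_class_dconv)

lemma dirichlet_series_dconv_list:
  assumes "set ps \<subseteq> selberg_class" "Re s > 1"
  shows "dirichlet_series (dconv_list ps) s = (\<Prod>p\<leftarrow>ps. dirichlet_series p s)"
  using assms(1)
proof (induction ps)
  case (Cons p ps)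
  then have "ramanujan p" "ramanujan (dconv_list ps)" using selberg_classD(4) dconv_list_in_selberg by auto
  with Cons show ?case using dirichlet_series_dconv[OF _ _ assms(2)] by simp
qed (simp add: dirichlet_series_one)

lemma Dfun_dconv_list:
  assumes "set ps \<subseteq> selberg_class" "s \<noteq> 1"
  shows "Dfun (dconv_list ps) s = (\<Prod>p\<leftarrow>ps. Dfun p s)"
  using assms(1)
proof (induction ps)
  case (Cons p ps)
  then have "p \<in> selberg_class" "dconv_list ps \<in> selberg_class" using dconv_list_in_selberg by auto
  with Cons show ?case using Dfun_dconv[of p "dconv_list ps" s] assms(2) selberg_classD(3,4) by simp
qed (simp add: Dfun_one)

lemma dconv_list_prime:
  assumes "set ps \<subseteq> selberg_class" "prime p"
  shows "dconv_list ps p = (\<Sum>a\<leftarrow>ps. a p)"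
  using assms(1)
proof (induction ps)
  case Nil
  have "p \<noteq> 1" using assms(2) by auto
  then show ?case by (simp add: one_series_def)
next
  case (Cons a ps)
  then have "a \<in> selberg_class" "dconv_list ps \<in> selberg_class" using dconv_list_in_selberg by auto
  with Cons show ?case using dconv_prime[OF assms(2), of a "dconv_list ps"] selberg_classD(2) by simp
qed

text \<open>Induction on a bound n for 7 * W. A factor different from 1 has W \<ge> 1/7, so in a
  proper splitting 7 * W drops by at least 1 for either part; for n = 0 only F = 1 remains.\<close>

lemma primitive_factorization_aux:
  assumes "a \<in> selberg_class" "has_half_degree a W" "7 * W < real n"
  shows "\<exists>ps. (\<forall>p\<in>set ps. primitive_elem p) \<and>
     (\<forall>s. Re s > 1 \<longrightarrow> dirichlet_series a s = (\<Prod>p\<leftarrow>ps. dirichlet_series p s))"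
  using assms
proof (induction n arbitrary: a W)
  case 0
  then have "a = one_series" using half_degree_cases[of a W] by auto
  then show ?case by (intro exI[of _ "[]"]) (simp add: dirichlet_series_one)
next
  case (Suc n)
  consider "a = one_series" | "primitive_elem a" | "a \<noteq> one_series" "\<not> primitive_elem a" by blast
  then show ?case
  proof cases
    case 1
    then show ?thesis by (intro exI[of _ "[]"]) (simp add: dirichlet_series_one)
  next
    case 2
    then show ?thesis by (intro exI[of _ "[a]"]) simp
  next
    case 3
    then obtain b c where b: "b \<in> selberg_class" "b \<noteq> one_series" and c: "c \<in> selberg_class" "c \<noteq> one_series"
      and eq: "\<And>s. Re s > 1 \<Longrightarrow> dirichlet_series a s = dirichlet_series b s * dirichlet_series c s"
      using Suc.prems(1) unfolding primitive_elem_def by blast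
    have "a = dconv b c"
    proof (rule ramanujan_unique)
      show "ramanujan a" using Suc.prems(1) by (rule selberg_classD)
      show "ramanujan (dconv b c)" using selberg_class_dconv[OF b(1) c(1)] by (rule selberg_classD)
      show "a 0 = dconv b c 0"
        using selberg_classD(1)[OF Suc.prems(1)] selberg_classD(1)[OF selberg_class_dconv[OF b(1) c(1)]] by simp
      show "dirichlet_series a s = dirichlet_series (dconv b c) s" if "Re s > 1" for s
        using eq[OF that] dirichlet_series_dconv[OF selberg_classD(4)[OF b(1)] selberg_classD(4)[OF c(1)]
            that] by simp
    qed
    obtain U where U: "has_half_degree b U"
      using selberg_class_fe_datum[OF b(1)] has_half_degree_sum[OF b(1)] by metis
    obtain V where V: "has_half_degree c V"
      using selberg_class_fe_datum[OF c(1)] has_half_degree_sum[OF c(1)] by metis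
    have "W = U + V"
      using has_half_degree_dconv[OF b(1) c(1) U V] has_half_degree_unique Suc.prems(2) \<open>a = dconv b c\<close> by blast
    moreover have "U \<ge> 1/7" using half_degree_cases[OF b(1) U] b(2) by blast
    moreover have "V \<ge> 1/7" using half_degree_cases[OF c(1) V] c(2) by blast
    ultimately have UV: "7 * U < real n" "7 * V < real n" using Suc.prems(3) by simp_all
    obtain ps where ps: "\<forall>p\<in>set ps. primitive_elem p"
        "\<And>s. Re s > 1 \<Longrightarrow> dirichlet_series b s = (\<Prod>p\<leftarrow>ps. dirichlet_series p s)"
      using Suc.IH[OF b(1) U UV(1)] by blast
    obtain qs where qs: "\<forall>p\<in>set qs. primitive_elem p"
        "\<And>s. Re s > 1 \<Longrightarrow> dirichlet_series c s = (\<Prod>p\<leftarrow>qs. dirichlet_series p s)"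
      using Suc.IH[OF c(1) V UV(2)] by blast
    show ?thesis
      using ps qs eq by (intro exI[of _ "ps @ qs"]) auto
  qed
qed

lemma primitive_factorization:
  assumes a: "a \<in> selberg_class"
  obtains ps where "\<And>p. p \<in> set ps \<Longrightarrow> primitive_elem p" "a = dconv_list ps"
proof -
  obtain W where W: "has_half_degree a W"
    using selberg_class_fe_datum[OF a] has_half_degree_sum[OF a] by metis
  obtain n :: nat where n: "7 * W < real n" using reals_Archimedean2 by blast
  obtain ps where ps: "\<forall>p\<in>set ps. primitive_elem p"
    "\<And>s. Re s > 1 \<Longrightarrow> dirichlet_series a s = (\<Prod>p\<leftarrow>ps. dirichlet_series p s)"
    using primitive_factorization_aux[OF a W n] by blast
  have sub: "set ps \<subseteq> selberg_class" using ps(1) by (auto simp: primitive_elem_def)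
  have "a = dconv_list ps"
  proof (rule ramanujan_unique)
    show "ramanujan a" using a by (rule selberg_classD)
    show "ramanujan (dconv_list ps)" using dconv_list_in_selberg[OF sub] by (rule selberg_classD)
    show "a 0 = dconv_list ps 0" using selberg_classD(1)[OF a] selberg_classD(1)[OF dconv_list_in_selberg[OF
        sub]] by simp
    show "dirichlet_series a s = dirichlet_series (dconv_list ps) s" if "Re s > 1" for s
      using ps(2)[OF that] dirichlet_series_dconv_list[OF sub that] by simp
  qed
  with ps(1) that show ?thesis by blast
qed

section \<open>Prime sums and the order at 1\<close>

definition prime_part :: "(nat \<Rightarrow> complex) \<Rightarrow> nat \<Rightarrow> complex" where
  "prime_part a n = (if prime n then a n else 0)"

lemma abs_conv_prime_part: "abs_conv a \<sigma> \<Longrightarrow> abs_conv (prime_part a) \<sigma>"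
  unfolding abs_conv_def by (rule summable_comparison_test'[where N = 0]) (auto simp: prime_part_def)

lemma abs_conv_scale: "abs_conv a \<sigma> \<Longrightarrow> abs_conv (\<lambda>n. c * a n) \<sigma>"
  unfolding abs_conv_def by (simp add: norm_mult mult.assoc summable_mult)

lemma abs_conv_add:
  assumes "abs_conv a \<sigma>" "abs_conv b \<sigma>"
  shows "abs_conv (\<lambda>n. a n + b n) \<sigma>"
  unfolding abs_conv_def
proof (rule summable_comparison_test'[where N = 0])
  show "summable (\<lambda>n. norm (a n) * real n powr (-\<sigma>) + norm (b n) * real n powr (-\<sigma>))"
    using assms by (intro summable_add) (simp_all add: abs_conv_def)
  show "norm (norm (a n + b n) * real n powr (-\<sigma>)) \<le> norm (a n) * real n powr (-\<sigma>) + norm (b n) * real n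
      powr (-\<sigma>)" for n
    by (simp add: norm_triangle_ineq mult_right_mono flip: distrib_right)
qed

lemma dirichlet_series_scale:
  assumes "abs_conv a (Re s)"
  shows "dirichlet_series (\<lambda>n. c * a n) s = c * dirichlet_series a s"
  using sums_mult[OF abs_conv_sums[OF assms order.refl], of c]
  by (simp add: dirichlet_series_def sums_iff mult.assoc)

lemma dirichlet_series_add:
  assumes "abs_conv a (Re s)" "abs_conv b (Re s)"
  shows "dirichlet_series (\<lambda>n. a n + b n) s = dirichlet_series a s + dirichlet_series b s"
  using sums_add[OF abs_conv_sums[OF assms(1) order.refl] abs_conv_sums[OF assms(2) order.refl]]
  by (simp add: dirichlet_series_def sums_iff distrib_right)

text \<open>The powers p ^ (k + 2) are summed over all integers p \<ge> 2: a geometric series in k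
  with ratio at most 2 powr (-\<delta>), and then the sum of p powr (-2 * \<delta>), which converges
  for \<delta> > 1/2.\<close>

lemma summable_proper_primepow:
  fixes \<delta> :: real
  assumes \<delta>: "\<delta> > 1/2"
  shows "summable (\<lambda>n. if primepow n \<and> \<not> prime n then real n powr (-\<delta>) else 0)"
proof (rule summableI_nonneg_bounded)
  define q where "q = (2::real) powr (-\<delta>)"
  have q: "0 < q" "q < 1" using \<delta> by (auto simp: q_def powr_less_one)
  define B where "B = (\<Sum>n. real n powr (-(2 * \<delta>)))"
  have sB: "summable (\<lambda>n. real n powr (-(2 * \<delta>)))" using \<delta> by (simp add: summable_real_powr_iff)
  fix N :: nat
  let ?S = "{n. n < N \<and> primepow n \<and> \<not> prime n}"
  have "(\<Sum>n<N. if primepow n \<and> \<not> prime n then real n powr (-\<delta>) else 0) = (\<Sum>n\<in>?S. real n powr (-\<delta>))"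
    by (simp add: sum.If_cases lessThan_def Int_def)
  also have "\<dots> \<le> (\<Sum>n\<in>(\<lambda>(p, k). p ^ (k + 2)) ` ({2..<N} \<times> {..<N}). real n powr (-\<delta>))"
  proof (rule sum_mono2)
    show "?S \<subseteq> (\<lambda>(p, k). p ^ (k + 2)) ` ({2..<N} \<times> {..<N})"
    proof
      fix n assume "n \<in> ?S"
      then have n: "n < N" "primepow n" "\<not> prime n" by auto
      then obtain p k where pk: "prime p" "k > 0" "n = p ^ k" by (auto simp: primepow_def)
      with n have "k \<noteq> 1" by auto
      with pk have k: "k \<ge> 2" by linarith
      have p: "p \<ge> 2" using pk(1) by (rule prime_ge_2_nat)
      have "k < p ^ k" using p by (intro power_gt_expt) auto
      then have "k - 2 < N" using n pk by linarith
      moreover have "p \<le> p ^ k" using p pk(2) by (simp add: self_le_power)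
      then have "p < N" using n pk by linarith
      ultimately show "n \<in> (\<lambda>(p, k). p ^ (k + 2)) ` ({2..<N} \<times> {..<N})"
        using p k pk(3) by (intro image_eqI[where x = "(p, k - 2)"]) (auto simp del: power_Suc simp:
            le_add_diff_inverse2)
    qed
  qed auto
  also have "\<dots> \<le> (\<Sum>x\<in>{2..<N} \<times> {..<N}. (\<lambda>n. real n powr (-\<delta>)) ((\<lambda>(p, k). p ^ (k + 2)) x))"
    by (rule sum_image_le[of _ "\<lambda>n. real n powr (-\<delta>)", unfolded o_def]) auto
  also have "\<dots> = (\<Sum>p\<in>{2..<N}. \<Sum>k<N. real (p ^ (k + 2)) powr (-\<delta>))"
    by (simp add: sum.cartesian_product case_prod_unfold)
  also have "\<dots> \<le> (\<Sum>p\<in>{2..<N}. real p powr (-(2 * \<delta>)) * (1 / (1 - q)))"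
  proof (rule sum_mono)
    fix p assume "p \<in> {2..<N}"
    then have p: "p \<ge> 2" by simp
    have "(\<Sum>k<N. real (p ^ (k + 2)) powr (-\<delta>)) \<le> (\<Sum>k<N. real p powr (-(2 * \<delta>)) * q ^ k)"
    proof (rule sum_mono)
      fix k assume "k \<in> {..<N}"
      have "real (p ^ (k + 2)) powr (-\<delta>) = real p powr (real (k + 2) * (-\<delta>))"
        using p by (simp only: of_nat_power flip: powr_realpow powr_powr)
      also have "\<dots> = real p powr (-(2 * \<delta>)) * (real p powr (-\<delta>)) powr (real k)"
        unfolding powr_powr powr_add[symmetric] by (simp add: algebra_simps)
      also have "(real p powr (-\<delta>)) powr (real k) = (real p powr (-\<delta>)) ^ k"
        using p by (intro powr_realpow) auto
      also have "\<dots> \<le> q ^ k" unfolding q_def using p \<delta> by (intro power_mono powr_mono2') auto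
      finally show "real (p ^ (k + 2)) powr (-\<delta>) \<le> real p powr (-(2 * \<delta>)) * q ^ k"
        by (simp add: mult_left_mono)
    qed
    also have "\<dots> = real p powr (-(2 * \<delta>)) * (\<Sum>k<N. q ^ k)" by (simp add: sum_distrib_left)
    also have "(\<Sum>k<N. q ^ k) \<le> (\<Sum>k. q ^ k)" using q by (intro sum_le_suminf summable_geometric) auto
    also have "(\<Sum>k. q ^ k) = 1 / (1 - q)" using q by (intro suminf_geometric) auto
    finally show "(\<Sum>k<N. real (p ^ (k + 2)) powr (-\<delta>)) \<le> real p powr (-(2 * \<delta>)) * (1 / (1 - q))"
      by (simp add: mult_left_mono)
  qed
  also have "\<dots> = (\<Sum>p\<in>{2..<N}. real p powr (-(2 * \<delta>))) * (1 / (1 - q))" by (rule sum_distrib_right[symmetric])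
  also have "\<dots> \<le> B * (1 / (1 - q))"
    unfolding B_def using q by (intro mult_right_mono sum_le_suminf sB) auto
  finally show "(\<Sum>n<N. if primepow n \<and> \<not> prime n then real n powr (-\<delta>) else 0) \<le> B * (1 / (1 - q))" .
qed auto

text \<open>In log F the coefficients at higher prime powers are O(n powr \<theta>), and 1 -
  \<theta> > 1/2 makes their sum absolutely convergent at \<sigma> = 1 already. Only the terms at
  primes, where b = a, can be unbounded.\<close>

lemma ln_Dfun_prime_part:
  assumes a: "a \<in> selberg_class"
  shows "(\<lambda>\<sigma>::real. ln (norm (Dfun a (of_real \<sigma>))) - Re (dirichlet_series (prime_part a) (of_real \<sigma>))) \<in>
      O[at_right 1](\<lambda>_. 1)"
proof -
  obtain b \<theta> where b: "\<theta> < 1/2" "\<And>n. \<not> primepow n \<Longrightarrow> b n = 0"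
    "(\<lambda>n. norm (b n)) \<in> O(\<lambda>n. real n powr \<theta>)"
    "\<And>s. Re s > 1 \<Longrightarrow> exp (dirichlet_series b s) = dirichlet_series a s"
    "\<And>p. prime p \<Longrightarrow> b p = a p"
    by (rule euler_productE[OF selberg_classD(6,4)[OF a]]) blast
  define r where "r n = (if prime n then 0 else b n)" for n
  have r1: "abs_conv r 1"
    unfolding abs_conv_def
  proof (rule summable_comparison_test_bigo)
    show "summable (\<lambda>n. norm (if primepow n \<and> \<not> prime n then real n powr (-(1 - \<theta>)) else 0))"
      using summable_proper_primepow[of "1 - \<theta>"] b(1) by (auto simp: if_distrib cong: if_cong)
    obtain c where "eventually (\<lambda>n. norm (b n) \<le> c * real n powr \<theta>) at_top"
      using b(3) by (auto elim: landau_o.bigE)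
    then have "eventually (\<lambda>n. norm (norm (r n) * real n powr (-1)) \<le> c * norm (if primepow n \<and>
        \<not> prime n then real n powr (-(1 - \<theta>)) else 0)) at_top"
    proof eventually_elim
      case (elim n)
      then have "norm (b n) * real n powr (-1) \<le> (c * real n powr \<theta>) * real n powr (-1)"
          by (rule mult_right_mono) simp
      also have "\<dots> = c * real n powr (-(1 - \<theta>))" by (simp only: mult.assoc flip: powr_add) simp
      finally show ?case using b(2)[of n] by (auto simp: r_def)
    qed
    then show "(\<lambda>n. norm (r n) * real n powr (-1)) \<in> O(\<lambda>n. if primepow n \<and>
        \<not> prime n then real n powr (-(1 - \<theta>)) else 0)"
      by (rule bigoI)
  qed
  define M where "M = (\<Sum>n. norm (r n) * real n powr (-1))"
  show ?thesis
  proof (rule bigoI[where c = M], unfold eventually_at_filter, rule always_eventually, intro allI impI)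
    fix \<sigma> :: real assume "\<sigma> \<noteq> 1" "\<sigma> \<in> {1<..}"
    then have \<sigma>: "\<sigma> > 1" by simp
    have "b = (\<lambda>n. prime_part a n + r n)" using b(5) by (auto simp: prime_part_def r_def)
    moreover have "abs_conv (prime_part a) \<sigma>" by (intro abs_conv_prime_part ramanujan_abs_conv[OF
        selberg_classD(4)[OF a]] \<sigma>)
    moreover have "abs_conv r \<sigma>" using abs_conv_mono[OF r1] \<sigma> by simp
    ultimately have B: "dirichlet_series b (of_real \<sigma>) = dirichlet_series (prime_part a) (of_real \<sigma>) +
        dirichlet_series r (of_real \<sigma>)"
      using dirichlet_series_add[of "prime_part a" "of_real \<sigma>" r] by simp
    have "ln (norm (Dfun a (of_real \<sigma>))) = Re (dirichlet_series b (of_real \<sigma>))"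
      using b(4)[of "of_real \<sigma>"] \<sigma> Dfun_eq_dirichlet_series[OF selberg_classD(3)[OF a], of "of_real \<sigma>"]
      by (metis Re_complex_of_real ln_exp norm_exp_eq_Re)
    then have "ln (norm (Dfun a (of_real \<sigma>))) - Re (dirichlet_series (prime_part a) (of_real \<sigma>)) =
        Re (dirichlet_series r (of_real \<sigma>))"
      by (simp add: B)
    also have "\<bar>\<dots>\<bar> \<le> norm (dirichlet_series r (of_real \<sigma>))" by (rule abs_Re_le_cmod)
    also have "\<dots> \<le> M" unfolding M_def using norm_dirichlet_series_le[OF r1, of "of_real \<sigma>"] \<sigma> by simp
    finally show "norm (ln (norm (Dfun a (of_real \<sigma>))) - Re (dirichlet_series (prime_part a) (of_real \<sigma>))) \<le>
        M * norm (1::real)"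
      by simp
  qed
qed

text \<open>Near 1 one has F s = h s * (s - 1) powi n with h holomorphic and h 1 \<noteq> 0, so ln
  |h| stays bounded.\<close>

lemma ln_Dfun_zorder:
  assumes a: "a \<in> selberg_class"
  shows "(\<lambda>\<sigma>::real. ln (norm (Dfun a (of_real \<sigma>))) - of_int (zorder (Dfun a) 1) * ln (\<sigma> - 1)) \<in> O[at_right
      1](\<lambda>_. 1)"
proof -
  define n where "n = zorder (Dfun a) 1"
  obtain b \<theta> where "\<And>s. Re s > 1 \<Longrightarrow> exp (dirichlet_series b s) = dirichlet_series a s"
    by (rule euler_productE[OF selberg_classD(6,4)[OF a]]) blast
  then have nz: "Dfun a s \<noteq> 0" if "Re s > 1" for s
    using that Dfun_eq_dirichlet_series[OF selberg_classD(3)[OF a] that] by (metis exp_not_eq_zero)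
  have mero: "Dfun a meromorphic_on {1}"
    by (rule selberg_analyticE[OF selberg_classD(3)[OF a]])
       (auto simp: nicely_meromorphic_on_def intro: meromorphic_on_subset)
  have iso: "isolated_singularity_at (Dfun a) 1" "not_essential (Dfun a) 1"
    using mero by (auto simp: meromorphic_on_isolated_singularity meromorphic_on_not_essential)
  \<comment> \<open>\<open>zorder\<close> is meaningful only if F does not vanish identically near
    1; the Euler product excludes zeros in Re s > 1.\<close>
  have freq: "\<exists>\<^sub>F w in at 1. Dfun a w \<noteq> 0"
    unfolding frequently_at
  proof (intro allI impI)
    fix d :: real assume "d > 0"
    then show "\<exists>x\<in>UNIV. x \<noteq> 1 \<and> dist x 1 < d \<and> Dfun a x \<noteq> 0"
      by (intro bexI[of _ "of_real (1 + d / 2)"] conjI nz) (auto simp: dist_norm complex_eq_iff)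
  qed
  define h where "h = zor_poly (Dfun a) 1"
  obtain \<rho> where \<rho>: "h 1 \<noteq> 0" "\<rho> > 0" "h holomorphic_on cball 1 \<rho>"
    "\<And>w. w \<in> cball 1 \<rho> - {1} \<Longrightarrow> Dfun a w = h w * (w - 1) powi n \<and> h w \<noteq> 0"
    using zorder_exist[OF iso freq] unfolding h_def n_def by blast
  have "isCont h 1"
    using holomorphic_on_imp_continuous_on[OF \<rho>(3)] \<rho>(2)
    by (simp add: continuous_on_interior)
  then have "(h \<longlongrightarrow> h 1) (at 1)" by (simp add: isCont_def)
  moreover have "filterlim complex_of_real (at 1) (at_right 1)"
    unfolding filterlim_at using tendsto_of_real[OF tendsto_ident_at, of 1 "{1::real<..}"]
    by (auto simp: eventually_at_filter)
  ultimately have "((\<lambda>\<sigma>::real. h (of_real \<sigma>)) \<longlongrightarrow> h 1) (at_right 1)"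
    by (rule filterlim_compose)
  then have "((\<lambda>\<sigma>::real. ln (norm (h (of_real \<sigma>)))) \<longlongrightarrow> ln (norm (h 1))) (at_right 1)"
    using \<rho>(1) by (intro tendsto_intros) auto
  then have O: "(\<lambda>\<sigma>::real. ln (norm (h (of_real \<sigma>)))) \<in> O[at_right 1](\<lambda>_. 1)"
    by (intro bigoI_tendsto[where c = "ln (norm (h 1))"]) simp_all
  have "eventually (\<lambda>\<sigma>::real. \<sigma> \<in> {1<..<1 + \<rho>}) (at_right 1)"
    using \<rho>(2) by (intro eventually_at_right_real) simp
  then have "eventually (\<lambda>\<sigma>::real. ln (norm (Dfun a (of_real \<sigma>))) - of_int n * ln (\<sigma> - 1) =
      ln (norm (h (of_real \<sigma>)))) (at_right 1)"
  proof eventually_elim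
    case (elim \<sigma>)
    have "norm (1 - complex_of_real \<sigma>) = \<bar>1 - \<sigma>\<bar>" by (metis norm_of_real of_real_1 of_real_diff)
    then have "complex_of_real \<sigma> \<in> cball 1 \<rho> - {1}" using elim by (auto simp: dist_norm)
    from \<rho>(4)[OF this] have "norm (Dfun a (of_real \<sigma>)) = norm (h (of_real \<sigma>)) * (\<sigma> - 1) powi n" "h (of_real \<sigma>) \<noteq> 0"
    proof -
      have "norm (complex_of_real \<sigma> - 1) = \<sigma> - 1" using elim by (metis abs_of_pos diff_gt_0_iff_gt
          greaterThanLessThan_iff norm_of_real of_real_1 of_real_diff)
      then show "norm (Dfun a (of_real \<sigma>)) = norm (h (of_real \<sigma>)) * (\<sigma> - 1) powi n"
        using \<rho>(4)[OF \<open>complex_of_real \<sigma> \<in> cball 1 \<rho> - {1}\<close>] by (simp add: norm_mult norm_power_int)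
    qed auto
    moreover have "(\<sigma> - 1) powi n > 0" "ln ((\<sigma> - 1) powi n) = of_int n * ln (\<sigma> - 1)"
      using elim by (auto simp: powr_real_of_int'[symmetric] ln_powr)
    ultimately show ?case using elim ln_mult[of "norm (h (of_real \<sigma>))" "(\<sigma> - 1) powi n"] by auto
  qed
  from landau_o.big.in_cong[OF this] O show ?thesis unfolding n_def by simp
qed

lemma prime_part_zorder:
  assumes "a \<in> selberg_class"
  shows "(\<lambda>\<sigma>::real. Re (dirichlet_series (prime_part a) (of_real \<sigma>)) - of_int (zorder (Dfun a) 1) * ln (\<sigma> -
      1)) \<in> O[at_right 1](\<lambda>_. 1)"
  using sum_in_bigo(2)[OF ln_Dfun_zorder[OF assms] ln_Dfun_prime_part[OF assms]] by simp

lemma bigo_one_cmult: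
  fixes f :: "'a \<Rightarrow> 'b :: real_normed_field"
  shows "f \<in> O[F](\<lambda>_. 1) \<Longrightarrow> (\<lambda>x. c * f x) \<in> O[F](\<lambda>_. 1)"
  by (cases "c = 0") simp_all

lemma bigo_one_norm_le:
  fixes f :: "'a \<Rightarrow> 'b :: real_normed_field" and g :: "'a \<Rightarrow> 'c :: real_normed_field"
  assumes "f \<in> O[F](\<lambda>_. 1)" "\<And>x. norm (g x) \<le> norm (f x)"
  shows "g \<in> O[F](\<lambda>_. 1)"
proof -
  obtain c where "eventually (\<lambda>x. norm (f x) \<le> c) F"
    using assms(1) by (auto elim: landau_o.bigE)
  then have "eventually (\<lambda>x. norm (g x) \<le> c * norm (1 :: 'c)) F"
  proof eventually_elim
    case (elim x)
    then show ?case using assms(2)[of x] by simp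
  qed
  then show ?thesis by (rule bigoI)
qed

section \<open>From bounded prime sums to orders at 1\<close>

lemma ln_not_bigo_one:
  fixes c :: real
  assumes "(\<lambda>\<sigma>::real. c * ln (\<sigma> - 1)) \<in> O[at_right 1](\<lambda>_. 1)"
  shows "c = 0"
proof (rule ccontr)
  assume c: "c \<noteq> 0"
  with assms have "(\<lambda>\<sigma>::real. ln (\<sigma> - 1)) \<in> O[at_right 1](\<lambda>_. 1)" by simp
  moreover have "(\<lambda>_. 1) \<in> o[at_right 1](\<lambda>\<sigma>::real. ln (\<sigma> - 1))" by real_asymp
  ultimately have "(\<lambda>_. 1::real) \<in> o[at_right 1](\<lambda>_::real. 1::real)" by (meson landau_o.small_big_trans)
  then show False by (simp add: landau_o.small_refl_iff eventually_at_filter trivial_limit_def[symmetric])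
qed

text \<open>Summation by parts; the decrements of \<open>w\<close> are nonnegative and telescope, so
  only \<open>w 0\<close> survives.\<close>

lemma abel_sum_bound:
  fixes u :: "nat \<Rightarrow> complex" and w :: "nat \<Rightarrow> real"
  assumes M: "\<And>n. norm (\<Sum>k\<le>n. u k) \<le> M" and w: "\<And>n. w (Suc n) \<le> w n" "\<And>n. w n \<ge> 0"
  shows "norm (\<Sum>k\<le>n. u k * of_real (w k)) \<le> M * w 0"
proof -
  define S where "S n = (\<Sum>k\<le>n. u k)" for n
  have id: "(\<Sum>k\<le>n. u k * of_real (w k)) = S n * of_real (w n) + (\<Sum>k<n. S k * of_real (w k - w (Suc k)))"
    by (induction n) (simp_all add: S_def algebra_simps)
  have "norm (\<Sum>k\<le>n. u k * of_real (w k)) \<le> norm (S n * of_real (w n)) + (\<Sum>k<n. norm (S k * of_real (w k - w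
      (Suc k))))"
    unfolding id by (intro order.trans[OF norm_triangle_ineq] add_left_mono norm_sum)
  also have "\<dots> \<le> M * w n + (\<Sum>k<n. M * (w k - w (Suc k)))"
  proof (intro add_mono sum_mono)
    show "norm (S n * of_real (w n)) \<le> M * w n"
      using M[of n] w(2)[of n] by (simp add: norm_mult S_def mult_right_mono)
    show "norm (S k * of_real (w k - w (Suc k))) \<le> M * (w k - w (Suc k))" for k
      using M[of k] w(1)[of k] by (simp add: norm_mult S_def mult_right_mono del: of_real_diff)
  qed
  also have "(\<Sum>k<n. M * (w k - w (Suc k))) = M * (w 0 - w n)"
    by (simp add: sum_lessThan_telescope' flip: sum_distrib_left)
  finally show ?thesis by (simp add: algebra_simps)
qed

text \<open>p powr (-\<sigma>) is 1 / p times the weight p powr (1 - \<sigma>), which decreases in p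
  and is at most 1. Bounded partial sums of a p / p therefore bound the prime part uniformly in
  \<sigma> > 1.\<close>

lemma prime_part_bigo:
  assumes a: "\<And>\<sigma>. \<sigma> > 1 \<Longrightarrow> abs_conv a \<sigma>"
    and O: "(\<lambda>x::real. \<Sum>p | prime p \<and> real p \<le> x. a p / of_nat p) \<in> O[at_top](\<lambda>_. 1)"
  shows "(\<lambda>\<sigma>::real. dirichlet_series (prime_part a) (of_real \<sigma>)) \<in> O[at_right 1](\<lambda>_. 1)"
proof -
  define u where "u n = prime_part a (Suc n) / of_nat (Suc n)" for n
  define S where "S n = (\<Sum>k\<le>n. u k)" for n
  have S_eq: "S n = (\<Sum>p | prime p \<and> real p \<le> real (Suc n). a p / of_nat p)" for n
  proof -
    have "S n = (\<Sum>p\<in>Suc ` {..n}. prime_part a p / of_nat p)" unfolding S_def u_def by (simp add: sum.reindex)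
    also have "\<dots> = (\<Sum>p | prime p \<and> real p \<le> real (Suc n). a p / of_nat p)"
    proof (rule sum.mono_neutral_cong_right)
      show "{p. prime p \<and> real p \<le> real (Suc n)} \<subseteq> Suc ` {..n}"
      proof
        fix p assume "p \<in> {p. prime p \<and> real p \<le> real (Suc n)}"
        then have "p > 0" "p \<le> Suc n" by (auto simp: prime_gt_0_nat)
        then show "p \<in> Suc ` {..n}" by (intro image_eqI[of _ _ "p - 1"]) auto
      qed
    qed (auto simp: prime_part_def)
    finally show ?thesis .
  qed
  obtain c where "eventually (\<lambda>x::real. norm (\<Sum>p | prime p \<and> real p \<le> x. a p / of_nat p) \<le> c) at_top"
    using O by (auto elim!: landau_o.bigE)
  then have "eventually (\<lambda>n. norm (\<Sum>p | prime p \<and> real p \<le> real (Suc n). a p / of_nat p) \<le> c) sequentially"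
    by (rule eventually_compose_filterlim)
       (intro filterlim_compose[OF filterlim_real_sequentially] filterlim_Suc)
  then have "eventually (\<lambda>n. norm (S n) \<le> c) sequentially" by (simp only: S_eq)
  then have "Bseq S" by (rule BfunI)
  then obtain M where M: "\<And>n. norm (S n) \<le> M" by (auto simp: Bseq_def)
  have "norm (dirichlet_series (prime_part a) (of_real \<sigma>)) \<le> M" if \<sigma>: "\<sigma> > 1" for \<sigma>
  proof -
    have "(\<lambda>n. prime_part a n * of_nat n powr (- of_real \<sigma>)) sums dirichlet_series (prime_part a) (of_real \<sigma>)"
      by (rule abs_conv_sums[OF abs_conv_prime_part[OF a[OF \<sigma>]]]) simp
    then have "(\<lambda>n. prime_part a (Suc n) * of_nat (Suc n) powr (- of_real \<sigma>)) sums dirichlet_series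
        (prime_part a) (of_real \<sigma>)"
      by (subst sums_Suc_iff) (simp add: prime_part_def)
    moreover have "prime_part a (Suc n) * of_nat (Suc n) powr (- of_real \<sigma>) =
        u n * of_real (real (Suc n) powr (1 - \<sigma>))" for n
    proof -
      have "complex_of_real (real (Suc n)) powr of_real (-\<sigma>) = of_real (real (Suc n) powr (-\<sigma>))"
        by (rule powr_of_real) simp
      moreover have "real (Suc n) powr (1 - \<sigma>) = real (Suc n) * real (Suc n) powr (-\<sigma>)"
        using powr_add[of "real (Suc n)" 1 "-\<sigma>"] by simp
      moreover have "complex_of_nat (Suc n) \<noteq> 0" by (simp only: of_nat_eq_0_iff)
      ultimately show ?thesis
        unfolding u_def by (simp del: of_nat_Suc)
    qed
    ultimately have "(\<lambda>n. u n * of_real (real (Suc n) powr (1 - \<sigma>))) sums dirichlet_series (prime_part a)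
        (of_real \<sigma>)"
      by simp
    then have "(\<lambda>n. \<Sum>k\<le>n. u k * of_real (real (Suc k) powr (1 - \<sigma>))) \<longlonglongrightarrow> dirichlet_series (prime_part a) (of_real \<sigma>)"
      by (simp add: sums_def_le)
    moreover have "norm (\<Sum>k\<le>n. u k * of_real (real (Suc k) powr (1 - \<sigma>))) \<le> M" for n
    proof -
      have "norm (\<Sum>k\<le>n. u k * of_real (real (Suc k) powr (1 - \<sigma>))) \<le> M * real (Suc 0) powr (1 - \<sigma>)"
        using M \<sigma> unfolding S_def by (intro abel_sum_bound powr_mono2') auto
      then show ?thesis by simp
    qed
    ultimately show ?thesis
      by (intro Lim_bounded[OF tendsto_norm]) auto
  qed
  then show ?thesis
    by (intro bigoI[where c = M]) (auto simp: eventually_at_filter)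
qed

lemma zorder_zeta: "zorder (Dfun zeta_series) 1 = -1"
proof (rule zorder_eqI[of UNIV 1 zeta_g])
  show "zeta_g holomorphic_on UNIV" by (rule zeta_g_holomorphic)
  show "zeta_g 1 \<noteq> 0" by (simp add: zeta_g_1)
  show "Dfun zeta_series w = zeta_g w * (w - 1) powi (-1)" if "w \<in> UNIV" "w \<noteq> 1" for w
    using Dfun_zeta_eq[OF that(2)] by (simp add: power_int_minus field_simps)
qed auto

lemma zorder_bigo_eq:
  assumes a: "a \<in> selberg_class"
    and O: "(\<lambda>\<sigma>::real. Re (dirichlet_series (prime_part a) (of_real \<sigma>)) - c * ln (\<sigma> - 1)) \<in> O[at_right 1](\<lambda>_. 1)"
  shows "of_int (zorder (Dfun a) 1) = c"
proof -
  have "(\<lambda>\<sigma>::real. (c - of_int (zorder (Dfun a) 1)) * ln (\<sigma> - 1)) \<in> O[at_right 1](\<lambda>_. 1)"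
    using sum_in_bigo(2)[OF prime_part_zorder[OF a] O] by (simp add: algebra_simps)
  from ln_not_bigo_one[OF this] show ?thesis by simp
qed

lemma prime_part_dconv_list:
  assumes ps: "set ps \<subseteq> selberg_class" and s: "Re s > 1"
  shows "dirichlet_series (prime_part (dconv_list ps)) s = (\<Sum>a\<leftarrow>ps. dirichlet_series (prime_part a) s)"
  using ps
proof (induction ps)
  case Nil
  have "prime_part one_series = (\<lambda>_. 0)" by (auto simp: prime_part_def one_series_def)
  then show ?case by (simp add: dirichlet_series_def)
next
  case (Cons a ps)
  then have a: "a \<in> selberg_class" and d: "dconv_list ps \<in> selberg_class" using dconv_list_in_selberg by auto
  have "prime_part (dconv a (dconv_list ps)) = (\<lambda>n. prime_part a n + prime_part (dconv_list ps) n)"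
    using dconv_prime[of _ a "dconv_list ps"] selberg_classD(2)[OF a] selberg_classD(2)[OF d] by (auto simp:
        prime_part_def)
  moreover have "abs_conv (prime_part a) (Re s)" "abs_conv (prime_part (dconv_list ps)) (Re s)"
    using s a d selberg_classD(4) by (auto intro!: abs_conv_prime_part ramanujan_abs_conv)
  ultimately show ?case using Cons dirichlet_series_add by simp
qed

text \<open>Additivity is read off from the growth as \<sigma> tends to 1 from the right, where the
  prime parts of a convolution add up exactly.\<close>

lemma zorder_dconv_list:
  assumes ps: "set ps \<subseteq> selberg_class"
  shows "zorder (Dfun (dconv_list ps)) 1 = (\<Sum>a\<leftarrow>ps. zorder (Dfun a) 1)"
proof -
  have "(\<lambda>\<sigma>::real. (\<Sum>a\<leftarrow>ps. Re (dirichlet_series (prime_part a) (of_real \<sigma>))) - of_int (\<Sum>a\<leftarrow>ps. zorder (Dfun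
      a) 1) * ln (\<sigma> - 1)) \<in> O[at_right 1](\<lambda>_. 1)"
    using ps
  proof (induction ps)
    case (Cons a ps)
    then have IH: "(\<lambda>\<sigma>::real. (\<Sum>a\<leftarrow>ps. Re (dirichlet_series (prime_part a) (of_real \<sigma>))) - of_int (\<Sum>a\<leftarrow>ps.
        zorder (Dfun a) 1) * ln (\<sigma> - 1)) \<in> O[at_right 1](\<lambda>_. 1)"
      and a: "a \<in> selberg_class" by auto
    show ?case using sum_in_bigo(1)[OF prime_part_zorder[OF a] IH] by (simp add: algebra_simps)
  qed simp
  moreover have "eventually (\<lambda>\<sigma>::real. Re (dirichlet_series (prime_part (dconv_list ps)) (of_real \<sigma>)) -
      of_int (\<Sum>a\<leftarrow>ps. zorder (Dfun a) 1) * ln (\<sigma> - 1)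
      = (\<Sum>a\<leftarrow>ps. Re (dirichlet_series (prime_part a) (of_real \<sigma>))) - of_int (\<Sum>a\<leftarrow>ps. zorder (Dfun a) 1) * ln
          (\<sigma> - 1)) (at_right 1)"
  proof -
    have "Re (sum_list xs) = sum_list (map Re xs)" for xs by (induction xs) auto
    then show ?thesis using prime_part_dconv_list[OF ps] by (auto simp: eventually_at_filter o_def)
  qed
  ultimately have "(\<lambda>\<sigma>::real. Re (dirichlet_series (prime_part (dconv_list ps)) (of_real \<sigma>)) - of_int
      (\<Sum>a\<leftarrow>ps. zorder (Dfun a) 1) * ln (\<sigma> - 1)) \<in> O[at_right 1](\<lambda>_. 1)"
    by (subst landau_o.big.in_cong)
  from zorder_bigo_eq[OF dconv_list_in_selberg[OF ps] this] show ?thesis by (simp only: of_int_eq_iff)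
qed

text \<open>The bridge from the conjectures to orders. A bounded prime sum of c * a + d * \<zeta>
  leaves no multiple of ln (\<sigma> - 1); as \<zeta> has order -1, this reads c * order - d = 0.
  With suitable c and d a term ln (ln x) cancels before the passage to \<sigma>.\<close>

lemma prime_sum_zorder:
  fixes c d :: int
  assumes a: "a \<in> selberg_class"
    and O: "(\<lambda>x::real. \<Sum>p | prime p \<and> real p \<le> x. (of_int c * a p + of_int d * zeta_series p) / of_nat p) \<in>
        O[at_top](\<lambda>_. 1)"
  shows "c * zorder (Dfun a) 1 = d"
proof -
  let ?f = "\<lambda>n. of_int c * a n + of_int d * zeta_series n"
  have abs: "abs_conv a \<sigma>" "abs_conv zeta_series \<sigma>" if "\<sigma> > 1" for \<sigma>
    using that a zeta_in_selberg selberg_classD(4) ramanujan_abs_conv by blast+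
  have "(\<lambda>\<sigma>::real. dirichlet_series (prime_part ?f) (of_real \<sigma>)) \<in> O[at_right 1](\<lambda>_. 1)"
    using O by (intro prime_part_bigo abs_conv_add abs_conv_scale abs)
  then have 1: "(\<lambda>\<sigma>::real. Re (dirichlet_series (prime_part ?f) (of_real \<sigma>))) \<in> O[at_right 1](\<lambda>_. 1)"
    by (rule bigo_one_norm_le) (simp add: abs_Re_le_cmod)
  have "Re (dirichlet_series (prime_part ?f) (of_real \<sigma>)) =
      of_int c * Re (dirichlet_series (prime_part a) (of_real \<sigma>)) + of_int d * Re (dirichlet_series
          (prime_part zeta_series) (of_real \<sigma>))"
    if "\<sigma> > 1" for \<sigma>
  proof -
    have "prime_part ?f = (\<lambda>n. of_int c * prime_part a n + of_int d * prime_part zeta_series n)"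
      by (auto simp: prime_part_def)
    then have "dirichlet_series (prime_part ?f) (of_real \<sigma>) =
        of_int c * dirichlet_series (prime_part a) (of_real \<sigma>) + of_int d * dirichlet_series (prime_part
            zeta_series) (of_real \<sigma>)"
      using abs[OF that] by (simp add: dirichlet_series_add dirichlet_series_scale abs_conv_scale
          abs_conv_prime_part)
    then show ?thesis by simp
  qed
  then have "eventually (\<lambda>\<sigma>::real. Re (dirichlet_series (prime_part ?f) (of_real \<sigma>)) =
      of_int c * Re (dirichlet_series (prime_part a) (of_real \<sigma>)) + of_int d * Re (dirichlet_series
          (prime_part zeta_series) (of_real \<sigma>))) (at_right 1)"
    by (auto simp: eventually_at_filter)
  with 1 have 2: "(\<lambda>\<sigma>::real. of_int c * Re (dirichlet_series (prime_part a) (of_real \<sigma>)) + of_int d * Re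
      (dirichlet_series (prime_part zeta_series) (of_real \<sigma>))) \<in> O[at_right 1](\<lambda>_. 1)"
    by (simp add: landau_o.big.in_cong)
  have za: "(\<lambda>\<sigma>::real. of_int c * (Re (dirichlet_series (prime_part a) (of_real \<sigma>)) - of_int (zorder (Dfun
      a) 1) * ln (\<sigma> - 1))) \<in> O[at_right 1](\<lambda>_. 1)"
    by (intro bigo_one_cmult prime_part_zorder a)
  have zz: "(\<lambda>\<sigma>::real. of_int d * (Re (dirichlet_series (prime_part zeta_series) (of_real \<sigma>)) - of_int (-1)
      * ln (\<sigma> - 1))) \<in> O[at_right 1](\<lambda>_. 1)"
    using prime_part_zorder[OF zeta_in_selberg] unfolding zorder_zeta
    by (rule bigo_one_cmult)
  have "(\<lambda>\<sigma>::real. (of_int c * of_int (zorder (Dfun a) 1) - of_int d) * ln (\<sigma> - 1)) \<in> O[at_right 1](\<lambda>_. 1)"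
    using sum_in_bigo(2)[OF 2 sum_in_bigo(1)[OF za zz]] by (simp add: algebra_simps)
  from ln_not_bigo_one[OF this] have "(of_int (c * zorder (Dfun a) 1) :: real) = of_int d" by simp
  then show ?thesis by (simp only: of_int_eq_iff)
qed

section \<open>Consequences of the conjectures\<close>

text \<open>The coefficients of \<zeta> at primes are 1, so orthogonality to \<zeta> already bounds
  the sum of a p / p.\<close>

lemma primitive_orthogonal_zeta:
  assumes B: "selberg_conjecture_B" and "primitive_elem zeta_series" "primitive_elem a" "a \<noteq> zeta_series"
  shows "zorder (Dfun a) 1 = 0"
proof -
  have "(\<lambda>x::real. \<Sum>p | prime p \<and> real p \<le> x. a p * cnj (zeta_series p) / of_nat p) \<in> O[at_top](\<lambda>_. 1)"
    using assms unfolding selberg_conjecture_B_def by blast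
  moreover have "(\<Sum>p | prime p \<and> real p \<le> x. a p * cnj (zeta_series p) / of_nat p) =
      (\<Sum>p | prime p \<and> real p \<le> x. (of_int 1 * a p + of_int 0 * zeta_series p) / of_nat p)" for x
    by (intro sum.cong) (auto simp: zeta_series_def)
  ultimately show ?thesis
    using prime_sum_zorder[of a 1 0] assms(3) by (simp add: primitive_elem_def)
qed

text \<open>If \<open>\<zeta>\<close> had two different primitive factors, B would make \<open>a p / p\<close>, summed for a factor
  \<open>R\<close> of multiplicity \<open>e\<close>, grow like \<open>e * ln (ln x)\<close>. Comparison with the corresponding sum for
  \<open>\<zeta>\<close>, where A supplies \<open>N\<close>, gives \<open>N * zorder R = -e\<close>, so that all factors have a pole.\<close>

lemma zeta_primitive:
  assumes A: "selberg_conjecture_A" and B: "selberg_conjecture_B"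
  shows "primitive_elem zeta_series"
proof -
  obtain ps where ps: "\<And>p. p \<in> set ps \<Longrightarrow> primitive_elem p" "zeta_series = dconv_list ps"
    using primitive_factorization[OF zeta_in_selberg] by blast
  have sub: "set ps \<subseteq> selberg_class" using ps(1) by (auto simp: primitive_elem_def)
  have ord: "(\<Sum>a\<leftarrow>ps. zorder (Dfun a) 1) = -1" using zorder_dconv_list[OF sub] zorder_zeta ps(2) by simp
  have "ps \<noteq> []" using ord by auto
  have "set ps \<subseteq> {Q}" if Q: "Q \<in> set ps" for Q
  proof (rule ccontr)
    assume "\<not> set ps \<subseteq> {Q}"
    then obtain Q' where Q': "Q' \<in> set ps" "Q' \<noteq> Q" by blast
    obtain N where N: "selberg_number zeta_series N"
      using A zeta_in_selberg by (auto simp: selberg_conjecture_A_def)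
    let ?S = "\<lambda>f x. \<Sum>p | prime p \<and> real p \<le> x. f p / of_nat p :: complex"
    have num: "(\<lambda>x::real. ?S (\<lambda>p. a p * cnj (a p)) x - of_int n * of_real (ln (ln x))) \<in> O[at_top](\<lambda>_. 1)"
      if "selberg_number a n" for a n
    proof -
      have eq: "of_real ((\<Sum>p | prime p \<and> real p \<le> x. (norm (a p))\<^sup>2 / real p) - of_int n * ln (ln x)) =
          ?S (\<lambda>p. a p * cnj (a p)) x - of_int n * of_real (ln (ln x))" for x
        by (simp add: complex_norm_square[symmetric])
      have "norm (?S (\<lambda>p. a p * cnj (a p)) x - of_int n * of_real (ln (ln x))) \<le>
          norm ((\<Sum>p | prime p \<and> real p \<le> x. (norm (a p))\<^sup>2 / real p) - of_int n * ln (ln x))" for x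
        unfolding eq[symmetric] norm_of_real real_norm_def by (rule order.refl)
      with that[unfolded selberg_number_def] show ?thesis by (rule bigo_one_norm_le)
    qed
    have one: "N * zorder (Dfun R) 1 = - int (count_list ps R)" if R: "R \<in> set ps" for R
    proof -
      \<comment> \<open>B yields the Selberg number 1 of a primitive element through a different
        primitive partner; the two distinct factors provide one for every \<open>R\<close>.\<close>
      obtain R' where R': "R' \<in> set ps" "R' \<noteq> R" using Q Q' R by metis
      have sR: "selberg_number R 1"
        using B ps(1)[OF R] ps(1)[OF R'(1)] R'(2) unfolding selberg_conjecture_B_def by metis
      have part: "(\<lambda>x::real. (\<Sum>a\<leftarrow>qs. ?S (\<lambda>p. R p * cnj (a p)) x) - of_nat (count_list qs R) * of_real (ln
          (ln x))) \<in> O[at_top](\<lambda>_. 1)"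
        if "set qs \<subseteq> set ps" for qs
        using that
      proof (induction qs)
        case (Cons q qs)
        then have IH: "(\<lambda>x::real. (\<Sum>a\<leftarrow>qs. ?S (\<lambda>p. R p * cnj (a p)) x) - of_nat (count_list qs R) * of_real
            (ln (ln x))) \<in> O[at_top](\<lambda>_. 1)"
          and q: "q \<in> set ps" by auto
        show ?case
        proof (cases "q = R")
          case True
          show ?thesis using sum_in_bigo(1)[OF num[OF sR] IH] True by (simp add: algebra_simps)
        next
          case False
          then have "(\<lambda>x::real. ?S (\<lambda>p. R p * cnj (q p)) x) \<in> O[at_top](\<lambda>_. 1)"
            using B ps(1)[OF R] ps(1)[OF q] unfolding selberg_conjecture_B_def by blast
          from sum_in_bigo(1)[OF this IH] show ?thesis using False by (simp add: algebra_simps)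
        qed
      qed simp
      \<comment> \<open>At primes the coefficients of the factors add up to that of \<zeta>, which
        is 1.\<close>
      have S: "(\<Sum>a\<leftarrow>ps. ?S (\<lambda>p. R p * cnj (a p)) x) = ?S R x" for x
      proof -
        have "(\<Sum>a\<leftarrow>qs. ?S (\<lambda>p. R p * cnj (a p)) x) = ?S (\<lambda>p. R p * cnj (\<Sum>a\<leftarrow>qs. a p)) x" for qs
          by (induction qs) (simp_all add: distrib_left add_divide_distrib sum.distrib)
        moreover have "(\<Sum>a\<leftarrow>ps. a p) = 1" if "prime p" for p
          using dconv_list_prime[OF sub that] that unfolding ps(2)[symmetric] by (auto simp: zeta_series_def)
        ultimately show ?thesis by simp
      qed
      have z: "?S (\<lambda>p. zeta_series p * cnj (zeta_series p)) x = ?S zeta_series x" for x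
        by (intro sum.cong) (auto simp: zeta_series_def)
      have 1: "(\<lambda>x::real. of_int N * (?S R x - of_nat (count_list ps R) * of_real (ln (ln x)))) \<in> O[at_top](\<lambda>_. 1)"
        using part[OF order.refl] unfolding S by (rule bigo_one_cmult)
      have 2: "(\<lambda>x::real. of_nat (count_list ps R) * (?S zeta_series x - of_int N * of_real (ln (ln x)))) \<in>
          O[at_top](\<lambda>_. 1)"
        using num[OF N] unfolding z by (rule bigo_one_cmult)
      \<comment> \<open>Both brackets carry ln (ln x) with total coefficient N times the
        multiplicity of \<open>R\<close>, so it cancels in the difference.\<close>
      have "of_int N * (?S R x - of_nat (count_list ps R) * of_real (ln (ln x)))
          - of_nat (count_list ps R) * (?S zeta_series x - of_int N * of_real (ln (ln x))) =
          (\<Sum>p | prime p \<and> real p \<le> x. (of_int N * R p + of_int (- int (count_list ps R)) * zeta_series p) /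
              of_nat p)" for x
      proof -
        have "of_int N * ?S R x - of_nat (count_list ps R) * ?S zeta_series x =
          (\<Sum>p | prime p \<and> real p \<le> x. (of_int N * R p + of_int (- int (count_list ps R)) * zeta_series p) /
              of_nat p)"
          by (simp add: sum_distrib_left diff_divide_distrib flip: sum_subtractf)
        then show ?thesis by (simp add: algebra_simps)
      qed
      with sum_in_bigo(2)[OF 1 2] show ?thesis
        using sub R by (intro prime_sum_zorder) auto
    qed
    have cnt: "count_list ps R > 0" if "R \<in> set ps" for R
      using that by (metis count_list_0_iff gr0I)
    have "N * (\<Sum>a\<leftarrow>qs. zorder (Dfun a) 1) \<le> - int (length qs)" if "set qs \<subseteq> set ps" for qs
      using that
    proof (induction qs)
      case (Cons q qs)
      then have "N * zorder (Dfun q) 1 \<le> -1" using one[of q] cnt[of q] by auto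
      with Cons show ?case by (simp add: distrib_left)
    qed simp
    \<comment> \<open>The orders sum to -1, so the inequality reads -N \<le> - length ps <
      0.\<close>
    from this[OF order.refl] have "N > 0" using ord \<open>ps \<noteq> []\<close> by (cases ps) auto
    have "zorder (Dfun R) 1 \<le> -1" if "R \<in> set ps" for R
    proof -
      have "N * zorder (Dfun R) 1 < 0" using one[OF that] cnt[OF that] by simp
      then show ?thesis using \<open>N > 0\<close> by (simp add: mult_less_0_iff)
    qed
    then have "(\<Sum>a\<leftarrow>ps. zorder (Dfun a) 1) \<le> (\<Sum>a\<leftarrow>ps. -1)" by (intro sum_list_mono) auto
    also have "(\<Sum>a\<leftarrow>ps. -1 :: int) = - int (length ps)" by (simp add: sum_list_triv)
    finally have "length ps \<le> 1" using ord by simp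
    then have "ps = [hd ps]" using \<open>ps \<noteq> []\<close> by (cases ps) auto
    then have "set ps = {hd ps}" by (metis list.set(1) list.simps(15))
    then show False using Q Q' by auto
  qed
  then obtain Q where Q: "Q \<in> set ps" "set ps = {Q}" using \<open>ps \<noteq> []\<close> by (cases ps) auto
  \<comment> \<open>Now \<zeta> is a power of Q, and the exponent divides the order -1.\<close>
  have rep: "ps = replicate (length ps) Q" by (rule replicate_eqI) (use Q in auto)
  have "(\<Sum>a\<leftarrow>ps. zorder (Dfun a) 1) = int (length ps) * zorder (Dfun Q) 1"
    by (subst rep) (simp add: sum_list_replicate)
  then have "int (length ps) dvd 1" using ord by (metis dvd_minus_iff dvd_triv_left)
  then have "length ps = 1" by simp
  then have "ps = [Q]" using rep by (metis One_nat_def replicate_0 replicate_Suc)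
  moreover have "dconv Q one_series = Q"
  proof (rule ramanujan_unique)
    have "Q \<in> selberg_class" using Q sub by auto
    then show "ramanujan (dconv Q one_series)" "ramanujan Q" "dconv Q one_series 0 = Q 0"
      using selberg_classD(1,4) selberg_class_dconv one_series_in_selberg by metis+
    show "dirichlet_series (dconv Q one_series) s = dirichlet_series Q s" if "Re s > 1" for s
      using dirichlet_series_dconv[OF _ _ that] \<open>Q \<in> selberg_class\<close> selberg_classD(4) one_series_in_selberg
      by (simp add: dirichlet_series_one)
  qed
  ultimately show ?thesis using ps Q by simp
qed

theorem proposition4p3:
  fixes a :: "nat \<Rightarrow> complex" and m :: nat
  assumes "selberg_conjecture_A"
    and "selberg_conjecture_B"
    and "selberg_conjecture_C"
    and "a \<in> selberg_class"
    and "is_pole (Dfun a) 1"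
    and "zorder (Dfun a) 1 = - int m"
  shows "\<exists>b\<in>selberg_class. \<forall>s. s \<noteq> 1 \<longrightarrow> Dfun a s = zeta s ^ m * Dfun b s"
proof -
  have prim: "primitive_elem zeta_series" using assms(1,2) by (rule zeta_primitive)
  obtain ps where ps: "\<And>p. p \<in> set ps \<Longrightarrow> primitive_elem p" "a = dconv_list ps"
    using primitive_factorization[OF assms(4)] by blast
  have sub: "set ps \<subseteq> selberg_class" using ps(1) by (auto simp: primitive_elem_def)
  have "(\<Sum>a\<leftarrow>qs. zorder (Dfun a) 1) = - int (count_list qs zeta_series)" if "set qs \<subseteq> set ps" for qs
    using that
  proof (induction qs)
    case (Cons q qs)
    then show ?case
      using primitive_orthogonal_zeta[OF assms(2) prim, of q] ps(1)[of q] by (auto simp: zorder_zeta)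
  qed simp
  from this[OF order.refl] have m: "m = count_list ps zeta_series"
    using zorder_dconv_list[OF sub] assms(6) ps(2) by simp
  let ?qs = "filter (\<lambda>q. q \<noteq> zeta_series) ps"
  have subq: "set ?qs \<subseteq> selberg_class" using sub by auto
  show ?thesis
  proof (intro bexI allI impI)
    show "dconv_list ?qs \<in> selberg_class" by (rule dconv_list_in_selberg[OF subq])
    fix s :: complex assume s: "s \<noteq> 1"
    have split: "(\<Prod>p\<leftarrow>xs. Dfun p s) = zeta s ^ count_list xs zeta_series * (\<Prod>p\<leftarrow>filter (\<lambda>q. q \<noteq> zeta_series)
        xs. Dfun p s)" for xs
      by (induction xs) (auto simp: zeta_def)
    show "Dfun a s = zeta s ^ m * Dfun (dconv_list ?qs) s"
      unfolding Dfun_dconv_list[OF subq s] unfolding ps(2) Dfun_dconv_list[OF sub s] m by (rule split)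
  qed
qed

end
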